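(* Let $R$ be a commutative noetherian local ring satisfying one of the following assumptions: (i) $R$ is a 3-dimensional excellent normal local domain; (ii) $R$ is a 2-dimensional reduced excellent local ring. Then for every finitely generated $R$-module $M$ the set $\bigcup_{i\ge 0}\operatorname{Ass}_R(\operatorname{Ext}^i_R(M,R))$ is finite. *)

theory Defs
  imports "HOL-Algebra.Algebra" "HOL-Library.Extended_Nat"
begin

section \<open>Local rings, prime spectrum and Krull dimension\<close>

definition local_ring :: "('a, 'm) ring_scheme \<Rightarrow> bool"
  where "local_ring R \<longleftrightarrow> cring R \<and> (\<exists>!m. maximalideal m R)"

definition max_ideal :: "('a, 'm) ring_scheme \<Rightarrow> 'a set"
  where "max_ideal R = (THE m. maximalideal m R)"

definition Spec :: "('a, 'm) ring_scheme \<Rightarrow> 'a set set"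
  where "Spec R = {p. primeideal p R}"

definition zariski_open :: "('a, 'm) ring_scheme \<Rightarrow> 'a set set \<Rightarrow> bool"
  where "zariski_open R U \<longleftrightarrow> (\<exists>I. ideal I R \<and> U = {p \<in> Spec R. \<not> I \<subseteq> p})"

definition krull_dim :: "('a, 'm) ring_scheme \<Rightarrow> enat"
  where "krull_dim R =
    Sup {enat n | n. \<exists>P. (\<forall>i\<le>n. P i \<in> Spec R) \<and> (\<forall>i<n. P i \<subset> P (Suc i))}"

definition saturated_prime_chain ::
    "('a, 'm) ring_scheme \<Rightarrow> nat \<Rightarrow> (nat \<Rightarrow> 'a set) \<Rightarrow> 'a set \<Rightarrow> 'a set \<Rightarrow> bool"
  where "saturated_prime_chain R n P p q \<longleftrightarrow>
    P 0 = p \<and> P n = q \<and> (\<forall>i\<le>n. P i \<in> Spec R) \<and>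
    (\<forall>i<n. P i \<subset> P (Suc i) \<and> \<not> (\<exists>r\<in>Spec R. P i \<subset> r \<and> r \<subset> P (Suc i)))"

text \<open>Between any two comparable primes there is a saturated chain, and any two such
  chains have the same length.\<close>

definition catenary_ring :: "('a, 'm) ring_scheme \<Rightarrow> bool"
  where "catenary_ring R \<longleftrightarrow>
    (\<forall>p\<in>Spec R. \<forall>q\<in>Spec R. p \<subseteq> q \<longrightarrow> (\<exists>!n. \<exists>P. saturated_prime_chain R n P p q))"

definition reduced_ring :: "('a, 'm) ring_scheme \<Rightarrow> bool"
  where "reduced_ring R \<longleftrightarrow>
    (\<forall>x\<in>carrier R. \<forall>n::nat. x [^]\<^bsub>R\<^esub> n = \<zero>\<^bsub>R\<^esub> \<longrightarrow> x = \<zero>\<^bsub>R\<^esub>)"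


section \<open>Localization\<close>

definition loc_rel :: "('a, 'm) ring_scheme \<Rightarrow> 'a set \<Rightarrow> (('a \<times> 'a) \<times> ('a \<times> 'a)) set"
  where "loc_rel R S = {((a, s), (b, t)).
    a \<in> carrier R \<and> b \<in> carrier R \<and> s \<in> S \<and> t \<in> S \<and>
    (\<exists>u\<in>S. u \<otimes>\<^bsub>R\<^esub> (t \<otimes>\<^bsub>R\<^esub> a) = u \<otimes>\<^bsub>R\<^esub> (s \<otimes>\<^bsub>R\<^esub> b))}"

definition loc_frac :: "('a, 'm) ring_scheme \<Rightarrow> 'a set \<Rightarrow> 'a \<Rightarrow> 'a \<Rightarrow> ('a \<times> 'a) set"
  where "loc_frac R S a s = loc_rel R S `` {(a, s)}"

definition localization :: "('a, 'm) ring_scheme \<Rightarrow> 'a set \<Rightarrow> ('a \<times> 'a) set ring"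
  where "localization R S =
    \<lparr>carrier = (carrier R \<times> S) // loc_rel R S,
     monoid.mult = (\<lambda>U V. \<Union>x\<in>U. \<Union>y\<in>V.
       loc_frac R S (fst x \<otimes>\<^bsub>R\<^esub> fst y) (snd x \<otimes>\<^bsub>R\<^esub> snd y)),
     one = loc_frac R S \<one>\<^bsub>R\<^esub> \<one>\<^bsub>R\<^esub>,
     ring.zero = loc_frac R S \<zero>\<^bsub>R\<^esub> \<one>\<^bsub>R\<^esub>,
     ring.add = (\<lambda>U V. \<Union>x\<in>U. \<Union>y\<in>V.
       loc_frac R S ((snd y \<otimes>\<^bsub>R\<^esub> fst x) \<oplus>\<^bsub>R\<^esub> (snd x \<otimes>\<^bsub>R\<^esub> fst y)) (snd x \<otimes>\<^bsub>R\<^esub> snd y))\<rparr>"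

definition loc_at_prime :: "('a, 'm) ring_scheme \<Rightarrow> 'a set \<Rightarrow> ('a \<times> 'a) set ring"
  where "loc_at_prime R p = localization R (carrier R - p)"

definition fraction_field :: "('a, 'm) ring_scheme \<Rightarrow> ('a \<times> 'a) set ring"
  where "fraction_field R = localization R (carrier R - {\<zero>\<^bsub>R\<^esub>})"

definition to_fraction_field :: "('a, 'm) ring_scheme \<Rightarrow> 'a \<Rightarrow> ('a \<times> 'a) set"
  where "to_fraction_field R a = loc_frac R (carrier R - {\<zero>\<^bsub>R\<^esub>}) a \<one>\<^bsub>R\<^esub>"

definition residue_field :: "('a, 'm) ring_scheme \<Rightarrow> 'a set \<Rightarrow> ('a set \<times> 'a set) set ring"
  where "residue_field R p = fraction_field (R Quot p)"

definition to_residue_field ::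
    "('a, 'm) ring_scheme \<Rightarrow> 'a set \<Rightarrow> 'a \<Rightarrow> ('a set \<times> 'a set) set"
  where "to_residue_field R p a = to_fraction_field (R Quot p) (p +>\<^bsub>R\<^esub> a)"


section \<open>Normal domains\<close>

definition integral_elem ::
    "('a, 'm) ring_scheme \<Rightarrow> ('b, 'n) ring_scheme \<Rightarrow> ('a \<Rightarrow> 'b) \<Rightarrow> 'b \<Rightarrow> bool"
  where "integral_elem R A \<phi> x \<longleftrightarrow>
    (\<exists>n::nat. \<exists>c. n > 0 \<and> (\<forall>i<n. c i \<in> carrier R) \<and>
      (x [^]\<^bsub>A\<^esub> n) \<oplus>\<^bsub>A\<^esub> (\<Oplus>\<^bsub>A\<^esub>i\<in>{..<n}. \<phi> (c i) \<otimes>\<^bsub>A\<^esub> (x [^]\<^bsub>A\<^esub> i)) = \<zero>\<^bsub>A\<^esub>)"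

definition normal_domain :: "('a, 'm) ring_scheme \<Rightarrow> bool"
  where "normal_domain R \<longleftrightarrow> domain R \<and>
    (\<forall>x\<in>carrier (fraction_field R).
      integral_elem R (fraction_field R) (to_fraction_field R) x \<longrightarrow>
      x \<in> to_fraction_field R ` carrier R)"


section \<open>Regular rings\<close>

definition regular_local_ring :: "('a, 'm) ring_scheme \<Rightarrow> bool"
  where "regular_local_ring R \<longleftrightarrow> local_ring R \<and> noetherian_ring R \<and>
    (\<exists>S\<subseteq>carrier R. finite S \<and> enat (card S) = krull_dim R \<and> max_ideal R = Idl\<^bsub>R\<^esub> S)"

definition regular_locus :: "('a, 'm) ring_scheme \<Rightarrow> 'a set set"
  where "regular_locus R = {p \<in> Spec R. regular_local_ring (loc_at_prime R p)}"

definition regular_ring :: "('a, 'm) ring_scheme \<Rightarrow> bool"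
  where "regular_ring R \<longleftrightarrow> cring R \<and> noetherian_ring R \<and> regular_locus R = Spec R"


section \<open>Monoid rings, polynomial rings and tensor products of algebras\<close>

text \<open>The monoid ring consists of the finitely supported functions on the monoid; they are
  zero outside the carrier of the monoid.\<close>

definition monoid_ring ::
    "('a, 'm) ring_scheme \<Rightarrow> ('g, 'n) monoid_scheme \<Rightarrow> ('g \<Rightarrow> 'a) ring"
  where "monoid_ring R G =
    \<lparr>carrier = {f. range f \<subseteq> carrier R \<and> finite {x. f x \<noteq> \<zero>\<^bsub>R\<^esub>} \<and>
                   {x. f x \<noteq> \<zero>\<^bsub>R\<^esub>} \<subseteq> carrier G},
     monoid.mult = (\<lambda>f g x. \<Oplus>\<^bsub>R\<^esub>yz\<in>{(y, z). f y \<noteq> \<zero>\<^bsub>R\<^esub> \<and> g z \<noteq> \<zero>\<^bsub>R\<^esub> \<and> y \<otimes>\<^bsub>G\<^esub> z = x}.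
                       f (fst yz) \<otimes>\<^bsub>R\<^esub> g (snd yz)),
     one = (\<lambda>x. if x = \<one>\<^bsub>G\<^esub> then \<one>\<^bsub>R\<^esub> else \<zero>\<^bsub>R\<^esub>),
     ring.zero = (\<lambda>x. \<zero>\<^bsub>R\<^esub>),
     ring.add = (\<lambda>f g x. f x \<oplus>\<^bsub>R\<^esub> g x)\<rparr>"

definition monoid_ring_elem :: "('a, 'm) ring_scheme \<Rightarrow> 'g \<Rightarrow> 'g \<Rightarrow> 'a"
  where "monoid_ring_elem R g = (\<lambda>x. if x = g then \<one>\<^bsub>R\<^esub> else \<zero>\<^bsub>R\<^esub>)"

definition exponent_monoid :: "nat \<Rightarrow> (nat \<Rightarrow> nat) monoid"
  where "exponent_monoid n =
    \<lparr>carrier = {e. \<forall>i\<ge>n. e i = 0}, monoid.mult = (\<lambda>d e i. d i + e i), one = (\<lambda>i. 0)\<rparr>"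

definition mpoly_ring :: "('a, 'm) ring_scheme \<Rightarrow> nat \<Rightarrow> ((nat \<Rightarrow> nat) \<Rightarrow> 'a) ring"
  where "mpoly_ring R n = monoid_ring R (exponent_monoid n)"

text \<open>For ring homomorphisms \<open>\<phi> : K \<rightarrow> A\<close> and \<open>\<psi> : K \<rightarrow> B\<close>, the ring \<open>A \<otimes>\<^sub>K B\<close> is the quotient
  of the monoid ring \<open>\<int>[A \<times> B]\<close> over the multiplicative monoid \<open>A \<times> B\<close> by the bilinearity
  relations. As an abelian group \<open>\<int>[A \<times> B]\<close> is free on \<open>A \<times> B\<close>, and the subgroup generated by
  the relations is already an ideal, so this is the usual tensor product.\<close>

definition tensor_relations ::
    "('k, 'l) ring_scheme \<Rightarrow> ('a, 'm) ring_scheme \<Rightarrow> ('k \<Rightarrow> 'a) \<Rightarrow>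
     ('b, 'n) ring_scheme \<Rightarrow> ('k \<Rightarrow> 'b) \<Rightarrow> ('a \<times> 'b \<Rightarrow> int) set"
  where "tensor_relations K A \<phi> B \<psi> =
    (let Z = monoid_ring int_ring (A \<times>\<times> B);
         pure = (\<lambda>a b. monoid_ring_elem int_ring (a, b))
     in {pure (a \<oplus>\<^bsub>A\<^esub> a') b \<ominus>\<^bsub>Z\<^esub> (pure a b \<oplus>\<^bsub>Z\<^esub> pure a' b) | a a' b.
           a \<in> carrier A \<and> a' \<in> carrier A \<and> b \<in> carrier B} \<union>
        {pure a (b \<oplus>\<^bsub>B\<^esub> b') \<ominus>\<^bsub>Z\<^esub> (pure a b \<oplus>\<^bsub>Z\<^esub> pure a b') | a b b'.
           a \<in> carrier A \<and> b \<in> carrier B \<and> b' \<in> carrier B} \<union>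
        {pure (\<phi> c \<otimes>\<^bsub>A\<^esub> a) b \<ominus>\<^bsub>Z\<^esub> pure a (\<psi> c \<otimes>\<^bsub>B\<^esub> b) | a b c.
           a \<in> carrier A \<and> b \<in> carrier B \<and> c \<in> carrier K})"

definition tensor_ideal ::
    "('k, 'l) ring_scheme \<Rightarrow> ('a, 'm) ring_scheme \<Rightarrow> ('k \<Rightarrow> 'a) \<Rightarrow>
     ('b, 'n) ring_scheme \<Rightarrow> ('k \<Rightarrow> 'b) \<Rightarrow> ('a \<times> 'b \<Rightarrow> int) set"
  where "tensor_ideal K A \<phi> B \<psi> =
    Idl\<^bsub>monoid_ring int_ring (A \<times>\<times> B)\<^esub> (tensor_relations K A \<phi> B \<psi>)"

definition tensor_algebra ::
    "('k, 'l) ring_scheme \<Rightarrow> ('a, 'm) ring_scheme \<Rightarrow> ('k \<Rightarrow> 'a) \<Rightarrow>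
     ('b, 'n) ring_scheme \<Rightarrow> ('k \<Rightarrow> 'b) \<Rightarrow> ('a \<times> 'b \<Rightarrow> int) set ring"
  where "tensor_algebra K A \<phi> B \<psi> =
    monoid_ring int_ring (A \<times>\<times> B) Quot tensor_ideal K A \<phi> B \<psi>"

definition pure_tensor ::
    "('k, 'l) ring_scheme \<Rightarrow> ('a, 'm) ring_scheme \<Rightarrow> ('k \<Rightarrow> 'a) \<Rightarrow>
     ('b, 'n) ring_scheme \<Rightarrow> ('k \<Rightarrow> 'b) \<Rightarrow> 'a \<Rightarrow> 'b \<Rightarrow> ('a \<times> 'b \<Rightarrow> int) set"
  where "pure_tensor K A \<phi> B \<psi> a b =
    tensor_ideal K A \<phi> B \<psi> +>\<^bsub>monoid_ring int_ring (A \<times>\<times> B)\<^esub> monoid_ring_elem int_ring (a, b)"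


section \<open>Completion and formal fibres\<close>

primrec ideal_power :: "('a, 'm) ring_scheme \<Rightarrow> 'a set \<Rightarrow> nat \<Rightarrow> 'a set"
  where
    "ideal_power R I 0 = carrier R"
  | "ideal_power R I (Suc n) = ideal_prod R (ideal_power R I n) I"

text \<open>The inverse limit of the rings \<open>R / I\<^sup>n\<close>. A coset of \<open>I\<^sup>n\<^sup>+\<^sup>1\<close> is sent to a given coset of
  \<open>I\<^sup>n\<close> under the projection iff it is contained in it.\<close>

definition completion :: "('a, 'm) ring_scheme \<Rightarrow> 'a set \<Rightarrow> (nat \<Rightarrow> 'a set) ring"
  where "completion R I =
    \<lparr>carrier = {x. (\<forall>n. x n \<in> carrier (R Quot ideal_power R I n)) \<and> (\<forall>n. x (Suc n) \<subseteq> x n)},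
     monoid.mult = (\<lambda>x y n. x n \<otimes>\<^bsub>R Quot ideal_power R I n\<^esub> y n),
     one = (\<lambda>n. \<one>\<^bsub>R Quot ideal_power R I n\<^esub>),
     ring.zero = (\<lambda>n. \<zero>\<^bsub>R Quot ideal_power R I n\<^esub>),
     ring.add = (\<lambda>x y n. x n \<oplus>\<^bsub>R Quot ideal_power R I n\<^esub> y n)\<rparr>"

definition to_completion :: "('a, 'm) ring_scheme \<Rightarrow> 'a set \<Rightarrow> 'a \<Rightarrow> nat \<Rightarrow> 'a set"
  where "to_completion R I a = (\<lambda>n. ideal_power R I n +>\<^bsub>R\<^esub> a)"

text \<open>A finite field extension of \<open>K\<close> of degree \<open>d\<close> is in bijection with \<open>K\<^sup>d\<close>, hence isomorphic
  over \<open>K\<close> to one whose elements are lists over \<open>K\<close>. Quantifying over the extensions carried by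
  the type of lists therefore covers all finite extensions up to isomorphism.\<close>

definition geometrically_regular ::
    "('k, 'l) ring_scheme \<Rightarrow> ('a, 'm) ring_scheme \<Rightarrow> ('k \<Rightarrow> 'a) \<Rightarrow> bool"
  where "geometrically_regular K A \<phi> \<longleftrightarrow>
    (\<forall>(L :: 'k list ring) \<psi>.
      field L \<and> \<psi> \<in> ring_hom K L \<and>
      ring.finite_dimension L (\<psi> ` carrier K) (carrier L) \<longrightarrow>
      regular_ring (tensor_algebra K A \<phi> L \<psi>))"

text \<open>The fibre \<open>B \<otimes>\<^sub>A \<kappa>(q)\<close> of \<open>\<phi> : A \<rightarrow> B\<close> over \<open>q\<close>, together with the map from \<open>\<kappa>(q)\<close>.\<close>

definition geometrically_regular_fibre ::
    "('a, 'm) ring_scheme \<Rightarrow> ('b, 'n) ring_scheme \<Rightarrow> ('a \<Rightarrow> 'b) \<Rightarrow> 'a set \<Rightarrow> bool"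
  where "geometrically_regular_fibre A B \<phi> q \<longleftrightarrow>
    geometrically_regular (residue_field A q)
      (tensor_algebra A B \<phi> (residue_field A q) (to_residue_field A q))
      (pure_tensor A B \<phi> (residue_field A q) (to_residue_field A q) \<one>\<^bsub>B\<^esub>)"

text \<open>The flatness that is part of the regularity of \<open>A \<rightarrow> \<hat>A\<close> is automatic for noetherian local
  rings \<open>A\<close>, so only the condition on the formal fibres appears.\<close>

definition geometrically_regular_formal_fibres :: "('a, 'm) ring_scheme \<Rightarrow> bool"
  where "geometrically_regular_formal_fibres A \<longleftrightarrow>
    (\<forall>q\<in>Spec A. geometrically_regular_fibre A
      (completion A (max_ideal A)) (to_completion A (max_ideal A)) q)"


section \<open>Excellent rings\<close>

definition G_ring :: "('a, 'm) ring_scheme \<Rightarrow> bool"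
  where "G_ring R \<longleftrightarrow> cring R \<and> noetherian_ring R \<and>
    (\<forall>p\<in>Spec R. geometrically_regular_formal_fibres (loc_at_prime R p))"

text \<open>Every finitely generated \<open>R\<close>-algebra is isomorphic to a quotient of a polynomial ring in
  finitely many variables over \<open>R\<close>.\<close>

definition universally_catenary :: "('a, 'm) ring_scheme \<Rightarrow> bool"
  where "universally_catenary R \<longleftrightarrow> cring R \<and> noetherian_ring R \<and>
    (\<forall>n J. ideal J (mpoly_ring R n) \<longrightarrow> catenary_ring (mpoly_ring R n Quot J))"

definition J2_ring :: "('a, 'm) ring_scheme \<Rightarrow> bool"
  where "J2_ring R \<longleftrightarrow> cring R \<and> noetherian_ring R \<and>
    (\<forall>n J. ideal J (mpoly_ring R n) \<longrightarrow>
      zariski_open (mpoly_ring R n Quot J) (regular_locus (mpoly_ring R n Quot J)))"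

definition excellent_ring :: "('a, 'm) ring_scheme \<Rightarrow> bool"
  where "excellent_ring R \<longleftrightarrow> cring R \<and> noetherian_ring R \<and>
    universally_catenary R \<and> G_ring R \<and> J2_ring R"


section \<open>Modules and Ext\<close>

definition finitely_generated_module ::
    "('a, 'm) ring_scheme \<Rightarrow> ('a, 'b, 'n) module_scheme \<Rightarrow> bool"
  where "finitely_generated_module R M \<longleftrightarrow>
    (\<exists>S\<subseteq>carrier M. finite S \<and> (\<forall>N. submodule N R M \<and> S \<subseteq> N \<longrightarrow> N = carrier M))"

definition associated_primes ::
    "('a, 'm) ring_scheme \<Rightarrow> ('a, 'b, 'n) module_scheme \<Rightarrow> 'a set set"
  where "associated_primes R M =
    {p \<in> Spec R. \<exists>x\<in>carrier M. p = {r \<in> carrier R. r \<odot>\<^bsub>M\<^esub> x = \<zero>\<^bsub>M\<^esub>}}"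

text \<open>The fields \<^const>\<open>monoid.mult\<close> and \<^const>\<open>one\<close> of a module record play no role; they are left
  unspecified below.\<close>

definition ring_as_module :: "('a, 'm) ring_scheme \<Rightarrow> ('a, 'a) module"
  where "ring_as_module R =
    \<lparr>carrier = carrier R, monoid.mult = undefined, one = undefined, ring.zero = \<zero>\<^bsub>R\<^esub>,
     ring.add = (\<lambda>x y. x \<oplus>\<^bsub>R\<^esub> y), smult = (\<lambda>r x. r \<otimes>\<^bsub>R\<^esub> x)\<rparr>"

definition free_module :: "('a, 'm) ring_scheme \<Rightarrow> 'x set \<Rightarrow> ('a, 'x \<Rightarrow> 'a) module"
  where "free_module R B =
    \<lparr>carrier = {f. range f \<subseteq> carrier R \<and> finite {x. f x \<noteq> \<zero>\<^bsub>R\<^esub>} \<and> {x. f x \<noteq> \<zero>\<^bsub>R\<^esub>} \<subseteq> B},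
     monoid.mult = undefined, one = undefined, ring.zero = (\<lambda>x. \<zero>\<^bsub>R\<^esub>),
     ring.add = (\<lambda>f g x. f x \<oplus>\<^bsub>R\<^esub> g x), smult = (\<lambda>r f x. r \<otimes>\<^bsub>R\<^esub> f x)\<rparr>"

definition module_hom ::
    "('a, 'm) ring_scheme \<Rightarrow> ('a, 'b, 'n) module_scheme \<Rightarrow> ('a, 'c, 'o) module_scheme \<Rightarrow>
     ('b \<Rightarrow> 'c) set"
  where "module_hom R M N =
    {h \<in> carrier M \<rightarrow>\<^sub>E carrier N.
      (\<forall>x\<in>carrier M. \<forall>y\<in>carrier M. h (x \<oplus>\<^bsub>M\<^esub> y) = h x \<oplus>\<^bsub>N\<^esub> h y) \<and>
      (\<forall>r\<in>carrier R. \<forall>x\<in>carrier M. h (r \<odot>\<^bsub>M\<^esub> x) = r \<odot>\<^bsub>N\<^esub> h x)}"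

definition Hom_module ::
    "('a, 'm) ring_scheme \<Rightarrow> ('a, 'b, 'n) module_scheme \<Rightarrow> ('a, 'c, 'o) module_scheme \<Rightarrow>
     ('a, 'b \<Rightarrow> 'c) module"
  where "Hom_module R M N =
    \<lparr>carrier = module_hom R M N, monoid.mult = undefined, one = undefined,
     ring.zero = (\<lambda>x\<in>carrier M. \<zero>\<^bsub>N\<^esub>),
     ring.add = (\<lambda>g h. \<lambda>x\<in>carrier M. g x \<oplus>\<^bsub>N\<^esub> h x),
     smult = (\<lambda>r h. \<lambda>x\<in>carrier M. r \<odot>\<^bsub>N\<^esub> h x)\<rparr>"

definition quotient_module ::
    "('a, 'b, 'n) module_scheme \<Rightarrow> 'b set \<Rightarrow> ('a, 'b set) module"
  where "quotient_module M N =
    \<lparr>carrier = a_rcosets\<^bsub>M\<^esub> N, monoid.mult = undefined, one = undefined, ring.zero = N,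
     ring.add = set_add M, smult = (\<lambda>r U. \<Union>x\<in>U. N +>\<^bsub>M\<^esub> (r \<odot>\<^bsub>M\<^esub> x))\<rparr>"

text \<open>An exact sequence \<open>\<cdots> \<rightarrow> F\<^sub>1 \<rightarrow> F\<^sub>0 \<rightarrow> M \<rightarrow> 0\<close> in which \<open>F\<^sub>i\<close> is free on the set \<open>B i\<close>.\<close>

definition free_resolution ::
    "('a, 'm) ring_scheme \<Rightarrow> ('a, 'b, 'n) module_scheme \<Rightarrow> (nat \<Rightarrow> 'x set) \<Rightarrow>
     (nat \<Rightarrow> ('x \<Rightarrow> 'a) \<Rightarrow> ('x \<Rightarrow> 'a)) \<Rightarrow> (('x \<Rightarrow> 'a) \<Rightarrow> 'b) \<Rightarrow> bool"
  where "free_resolution R M B d \<epsilon> \<longleftrightarrow>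
    (let F = (\<lambda>i. free_module R (B i)) in
      \<epsilon> \<in> module_hom R (F 0) M \<and>
      (\<forall>i. d i \<in> module_hom R (F (Suc i)) (F i)) \<and>
      \<epsilon> ` carrier (F 0) = carrier M \<and>
      d 0 ` carrier (F 1) = {f \<in> carrier (F 0). \<epsilon> f = \<zero>\<^bsub>M\<^esub>} \<and>
      (\<forall>i. d (Suc i) ` carrier (F (Suc (Suc i))) =
           {f \<in> carrier (F (Suc i)). d i f = \<zero>\<^bsub>F i\<^esub>}))"

text \<open>The \<open>i\<close>-th cohomology of \<open>Hom\<^sub>R(F\<^sub>\<bullet>, N)\<close>.\<close>

definition Hom_cohomology ::
    "('a, 'm) ring_scheme \<Rightarrow> (nat \<Rightarrow> 'x set) \<Rightarrow> (nat \<Rightarrow> ('x \<Rightarrow> 'a) \<Rightarrow> ('x \<Rightarrow> 'a)) \<Rightarrow>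
     ('a, 'c, 'o) module_scheme \<Rightarrow> nat \<Rightarrow> ('a, (('x \<Rightarrow> 'a) \<Rightarrow> 'c) set) module"
  where "Hom_cohomology R B d N i =
    (let F = (\<lambda>i. free_module R (B i));
         C = (\<lambda>i. Hom_module R (F i) N);
         \<delta> = (\<lambda>i h. \<lambda>f\<in>carrier (F (Suc i)). h (d i f));
         Z = {h \<in> carrier (C i). \<delta> i h = \<zero>\<^bsub>C (Suc i)\<^esub>};
         D = (case i of 0 \<Rightarrow> {\<zero>\<^bsub>C 0\<^esub>} | Suc j \<Rightarrow> \<delta> j ` carrier (C j))
     in quotient_module ((C i)\<lparr>carrier := Z\<rparr>) D)"

text \<open>Every \<open>R\<close>-module \<open>M\<close> has a free resolution whose index sets lie in \<open>'a \<times> 'b \<times> nat\<close>: this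
  type is infinite and at least as large as \<open>R\<close> and \<open>M\<close>, hence at least as large as the free
  module on any of its subsets, so that each syzygy module can index generators of itself.\<close>

lemma free_module_simps:
  "carrier (free_module R B) =
     {f. range f \<subseteq> carrier R \<and> finite {x. f x \<noteq> \<zero>\<^bsub>R\<^esub>} \<and> {x. f x \<noteq> \<zero>\<^bsub>R\<^esub>} \<subseteq> B}"
  "\<zero>\<^bsub>free_module R B\<^esub> = (\<lambda>x. \<zero>\<^bsub>R\<^esub>)"
  "f \<oplus>\<^bsub>free_module R B\<^esub> g = (\<lambda>x. f x \<oplus>\<^bsub>R\<^esub> g x)"
  "r \<odot>\<^bsub>free_module R B\<^esub> f = (\<lambda>x. r \<otimes>\<^bsub>R\<^esub> f x)"
  by (simp_all add: free_module_def)

lemma free_module_is_module: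
  fixes R (structure)
  assumes "cring R"
  shows "module R (free_module R B)"
proof -
  interpret cring R by fact
  have add: "f \<oplus>\<^bsub>free_module R B\<^esub> g \<in> carrier (free_module R B)"
    if "f \<in> carrier (free_module R B)" "g \<in> carrier (free_module R B)" for f g
  proof -
    have "{x. f x \<oplus> g x \<noteq> \<zero>} \<subseteq> {x. f x \<noteq> \<zero>} \<union> {x. g x \<noteq> \<zero>}" by auto
    moreover have "finite ({x. f x \<noteq> \<zero>} \<union> {x. g x \<noteq> \<zero>})"
      using that by (auto simp: free_module_simps)
    ultimately have "finite {x. f x \<oplus> g x \<noteq> \<zero>}" "{x. f x \<oplus> g x \<noteq> \<zero>} \<subseteq> B"
      using that by (auto simp: free_module_simps intro: finite_subset)
    then show ?thesis using that by (auto simp: free_module_simps image_subset_iff)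
  qed
  have smult: "r \<odot>\<^bsub>free_module R B\<^esub> f \<in> carrier (free_module R B)"
    if "r \<in> carrier R" "f \<in> carrier (free_module R B)" for f r
  proof -
    have "{x. r \<otimes> f x \<noteq> \<zero>} \<subseteq> {x. f x \<noteq> \<zero>}" using that by auto
    moreover have "finite {x. f x \<noteq> \<zero>}" "{x. f x \<noteq> \<zero>} \<subseteq> B"
      using that by (auto simp: free_module_simps)
    ultimately have "finite {x. r \<otimes> f x \<noteq> \<zero>}" "{x. r \<otimes> f x \<noteq> \<zero>} \<subseteq> B"
      by (blast intro: finite_subset)+
    then show ?thesis using that by (auto simp: free_module_simps image_subset_iff)
  qed
  have ran: "f x \<in> carrier R" if "f \<in> carrier (free_module R B)" for f x
    using that by (auto simp: free_module_simps)
  show ?thesis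
  proof (intro moduleI abelian_groupI add smult)
    show "cring R" by fact
    show "\<zero>\<^bsub>free_module R B\<^esub> \<in> carrier (free_module R B)" by (auto simp: free_module_simps)
    fix f assume f: "f \<in> carrier (free_module R B)"
    have "(\<lambda>x. (\<ominus> \<one>) \<otimes> f x) \<in> carrier (free_module R B)"
      using smult[OF _ f, of "\<ominus> \<one>"] by (simp add: free_module_simps(4))
    moreover have "(\<lambda>x. (\<ominus> \<one>) \<otimes> f x) \<oplus>\<^bsub>free_module R B\<^esub> f = \<zero>\<^bsub>free_module R B\<^esub>"
      using ran[OF f] by (simp add: free_module_simps(2,3) l_minus l_neg)
    ultimately show "\<exists>g\<in>carrier (free_module R B). g \<oplus>\<^bsub>free_module R B\<^esub> f = \<zero>\<^bsub>free_module R B\<^esub>" by blast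
  qed (auto simp: free_module_simps(2-) ran a_ac l_distr r_distr m_assoc fun_eq_iff)
qed

lemma free_cover:
  fixes N :: "('a, 'c, 'n) module_scheme" and g :: "'c \<Rightarrow> 'x"
  assumes "module R N" and K: "submodule K R N" and g: "inj_on g K"
  shows "\<exists>(B :: 'x set) h. h \<in> module_hom R (free_module R B) N \<and> h ` carrier (free_module R B) = K"
proof -
  interpret N: module R N by fact
  interpret K: submodule K R N by fact
  have KN: "K \<subseteq> carrier N" using N.submoduleE(1)[OF K] .
  define B where "B = g ` K"
  define v where "v = inv_into K g"
  define F where "F = free_module R B"
  interpret F: module R F unfolding F_def by (rule free_module_is_module) (rule N.is_cring)
  have v: "v x \<in> K" if "x \<in> B" for x using that by (auto simp: B_def v_def inv_into_into)
  have vN: "v x \<in> carrier N" if "x \<in> B" for x using v[OF that] KN by auto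
  define s where "s f = {x. f x \<noteq> \<zero>\<^bsub>R\<^esub>}" for f :: "'x \<Rightarrow> 'a"
  define h where "h = (\<lambda>f\<in>carrier F. \<Oplus>\<^bsub>N\<^esub>x\<in>s f. f x \<odot>\<^bsub>N\<^esub> v x)"
  have s: "finite (s f)" "s f \<subseteq> B" "\<And>x. f x \<in> carrier R" if "f \<in> carrier F" for f
    using that by (auto simp: F_def free_module_simps s_def)
  have h_eq: "h f = (\<Oplus>\<^bsub>N\<^esub>x\<in>S. f x \<odot>\<^bsub>N\<^esub> v x)"
    if f: "f \<in> carrier F" and S: "finite S" "s f \<subseteq> S" "S \<subseteq> B" for f S
  proof -
    have "(\<Oplus>\<^bsub>N\<^esub>x\<in>s f. f x \<odot>\<^bsub>N\<^esub> v x) = (\<Oplus>\<^bsub>N\<^esub>x\<in>S. f x \<odot>\<^bsub>N\<^esub> v x)"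
    proof (rule N.add.finprod_mono_neutral_cong_left)
      show "f i \<odot>\<^bsub>N\<^esub> v i = \<zero>\<^bsub>N\<^esub>" if "i \<in> S - s f" for i
        using that S vN by (auto simp: s_def)
    qed (use S s[OF f] vN in auto)
    then show ?thesis using f by (simp add: h_def)
  qed
  have sum_K: "(\<Oplus>\<^bsub>N\<^esub>x\<in>S. w x) \<in> K" if "finite S" "\<And>x. x \<in> S \<Longrightarrow> w x \<in> K" for S and w :: "'x \<Rightarrow> 'c"
    using that
  proof (induction S rule: finite_induct)
    case empty then show ?case using K.one_closed by simp
  next
    case (insert a S)
    then show ?case using KN N.submoduleE(5)[OF K] by (subst N.finsum_insert) auto
  qed
  have hK: "h f \<in> K" if "f \<in> carrier F" for f
    using that s[OF that] v by (auto simp: h_def intro!: sum_K)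
  have "h \<in> module_hom R F N"
    unfolding module_hom_def
  proof (intro CollectI conjI ballI)
    show "h \<in> carrier F \<rightarrow>\<^sub>E carrier N" using hK KN by (auto simp: h_def)
  next
    fix f f' assume f: "f \<in> carrier F" and f': "f' \<in> carrier F"
    define S where "S = s f \<union> s f'"
    have S: "finite S" "S \<subseteq> B" using s f f' by (auto simp: S_def)
    have ff: "f \<oplus>\<^bsub>F\<^esub> f' \<in> carrier F" using f f' by blast
    have "s (f \<oplus>\<^bsub>F\<^esub> f') \<subseteq> S" by (auto simp: S_def s_def F_def free_module_simps)
    then have "h (f \<oplus>\<^bsub>F\<^esub> f') = (\<Oplus>\<^bsub>N\<^esub>x\<in>S. (f x \<oplus>\<^bsub>R\<^esub> f' x) \<odot>\<^bsub>N\<^esub> v x)"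
      using h_eq[OF ff S(1) _ S(2)] by (simp add: F_def free_module_simps)
    also have "\<dots> = (\<Oplus>\<^bsub>N\<^esub>x\<in>S. f x \<odot>\<^bsub>N\<^esub> v x \<oplus>\<^bsub>N\<^esub> f' x \<odot>\<^bsub>N\<^esub> v x)"
      using S s f f' vN by (intro N.finsum_cong) (auto simp: N.smult_l_distr subset_iff simp_implies_def)
    also have "\<dots> = (\<Oplus>\<^bsub>N\<^esub>x\<in>S. f x \<odot>\<^bsub>N\<^esub> v x) \<oplus>\<^bsub>N\<^esub> (\<Oplus>\<^bsub>N\<^esub>x\<in>S. f' x \<odot>\<^bsub>N\<^esub> v x)"
      using S s f f' vN by (intro N.finsum_addf) auto
    also have "\<dots> = h f \<oplus>\<^bsub>N\<^esub> h f'"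
      using h_eq[OF f S(1) _ S(2)] h_eq[OF f' S(1) _ S(2)] by (simp add: S_def)
    finally show "h (f \<oplus>\<^bsub>F\<^esub> f') = h f \<oplus>\<^bsub>N\<^esub> h f'" .
  next
    fix r f assume r: "r \<in> carrier R" and f: "f \<in> carrier F"
    have rf: "r \<odot>\<^bsub>F\<^esub> f \<in> carrier F" using r f by blast
    have "s (r \<odot>\<^bsub>F\<^esub> f) \<subseteq> s f" using r by (auto simp: s_def F_def free_module_simps)
    then have "h (r \<odot>\<^bsub>F\<^esub> f) = (\<Oplus>\<^bsub>N\<^esub>x\<in>s f. (r \<otimes>\<^bsub>R\<^esub> f x) \<odot>\<^bsub>N\<^esub> v x)"
      using h_eq[OF rf s(1)[OF f] _ s(2)[OF f]] by (simp add: F_def free_module_simps)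
    also have "\<dots> = (\<Oplus>\<^bsub>N\<^esub>x\<in>s f. r \<odot>\<^bsub>N\<^esub> (f x \<odot>\<^bsub>N\<^esub> v x))"
      using s[OF f] r vN by (intro N.finsum_cong) (auto simp: N.smult_assoc1 subset_iff simp_implies_def)
    also have "\<dots> = r \<odot>\<^bsub>N\<^esub> (\<Oplus>\<^bsub>N\<^esub>x\<in>s f. f x \<odot>\<^bsub>N\<^esub> v x)"
      using s[OF f] r vN by (intro N.finsum_smult_ldistr[symmetric]) auto
    finally show "h (r \<odot>\<^bsub>F\<^esub> f) = r \<odot>\<^bsub>N\<^esub> h f" using f by (simp add: h_def)
  qed
  moreover have "h ` carrier F = K"
  proof (intro equalityI subsetI)
    fix k assume k: "k \<in> K"
    define e where "e = (\<lambda>x. if x = g k then \<one>\<^bsub>R\<^esub> else \<zero>\<^bsub>R\<^esub>)"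
    have se: "s e \<subseteq> {g k}" by (auto simp: s_def e_def)
    have "finite {x. e x \<noteq> \<zero>\<^bsub>R\<^esub>}" using se unfolding s_def by (rule finite_subset) simp
    then have e: "e \<in> carrier F" using se k by (auto simp: F_def free_module_simps s_def B_def e_def)
    have "h e = (\<Oplus>\<^bsub>N\<^esub>x\<in>{g k}. e x \<odot>\<^bsub>N\<^esub> v x)" using k by (intro h_eq[OF e _ se]) (auto simp: B_def)
    also have "\<dots> = e (g k) \<odot>\<^bsub>N\<^esub> v (g k)"
      using vN[of "g k"] k by (subst N.finsum_insert) (auto simp: e_def B_def)
    also have "\<dots> = k" using k g KN by (auto simp: e_def v_def)
    finally show "k \<in> h ` carrier F" using e by blast
  qed (use hK in auto)
  ultimately show ?thesis unfolding F_def by blast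
qed

lemma module_hom_kernel:
  assumes "module R N" "module R N'" "h \<in> module_hom R N N'"
  shows "submodule {x \<in> carrier N. h x = \<zero>\<^bsub>N'\<^esub>} R N"
proof -
  interpret N: module R N by fact
  interpret N': module R N' by fact
  have h: "\<And>x. x \<in> carrier N \<Longrightarrow> h x \<in> carrier N'"
    "\<And>x y. x \<in> carrier N \<Longrightarrow> y \<in> carrier N \<Longrightarrow> h (x \<oplus>\<^bsub>N\<^esub> y) = h x \<oplus>\<^bsub>N'\<^esub> h y"
    "\<And>r x. r \<in> carrier R \<Longrightarrow> x \<in> carrier N \<Longrightarrow> h (r \<odot>\<^bsub>N\<^esub> x) = r \<odot>\<^bsub>N'\<^esub> h x"
    using assms(3) by (auto simp: module_hom_def)
  have z: "h \<zero>\<^bsub>N\<^esub> = \<zero>\<^bsub>N'\<^esub>"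
    using h(3)[of "\<zero>\<^bsub>R\<^esub>" "\<zero>\<^bsub>N\<^esub>"] h(1) by simp
  show ?thesis
  proof (rule N.submoduleI)
    fix a assume a: "a \<in> {x \<in> carrier N. h x = \<zero>\<^bsub>N'\<^esub>}"
    have "h (\<ominus>\<^bsub>N\<^esub> a) = h (\<ominus>\<^bsub>N\<^esub> a) \<oplus>\<^bsub>N'\<^esub> h a" using a h(1)[of "\<ominus>\<^bsub>N\<^esub> a"] by simp
    also have "\<dots> = h \<zero>\<^bsub>N\<^esub>" using a h(2)[of "\<ominus>\<^bsub>N\<^esub> a" a] by (simp add: N.M.l_neg)
    finally show "\<ominus>\<^bsub>N\<^esub> a \<in> {x \<in> carrier N. h x = \<zero>\<^bsub>N'\<^esub>}" using a z by simp
  qed (use h z in auto)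
qed

lemma free_module_embeds:
  fixes B :: "('a \<times> 'b \<times> nat) set" and R :: "('a, 'm) ring_scheme"
  shows "\<exists>g :: ('a \<times> 'b \<times> nat \<Rightarrow> 'a) \<Rightarrow> 'a \<times> 'b \<times> nat. inj_on g (carrier (free_module R B))"
proof -
  let ?J = "UNIV :: ('a \<times> 'b \<times> nat) set"
  let ?P = "UNIV :: (('a \<times> 'b \<times> nat) \<times> 'a) set"
  have inf: "infinite ?J" and infP: "infinite ?P" by (auto simp: finite_prod)
  have "inj (\<lambda>a. (a, undefined :: 'b, 0 :: nat))" by (auto simp: inj_on_def)
  then have "|UNIV :: 'a set| \<le>o |?J|" by (auto simp flip: card_of_ordLeq)
  then have "|?J \<times> (UNIV :: 'a set)| \<le>o |?J|"
    using inf card_of_Times_infinite_simps(1)[of ?J "UNIV :: 'a set"] ordIso_imp_ordLeq by blast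
  then have "|?P| \<le>o |?J|" by simp
  then have "|Fpow ?P| \<le>o |?J|"
    using card_of_Fpow_infinite[OF infP] ordIso_ordLeq_trans by blast
  then obtain c where c: "inj_on c (Fpow ?P)" and "c ` Fpow ?P \<subseteq> ?J"
    by (auto simp flip: card_of_ordLeq)
  define G where "G f = (\<lambda>x. (x, f x)) ` {x. f x \<noteq> \<zero>\<^bsub>R\<^esub>}" for f :: "'a \<times> 'b \<times> nat \<Rightarrow> 'a"
  have "inj_on G (carrier (free_module R B))"
  proof (rule inj_onI, rule ext)
    fix f f' x assume "G f = G f'"
    then have "(x, y) \<in> G f \<longleftrightarrow> (x, y) \<in> G f'" for y by simp
    then show "f x = f' x" unfolding G_def by (cases "f x = \<zero>\<^bsub>R\<^esub>"; cases "f' x = \<zero>\<^bsub>R\<^esub>") force+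
  qed
  moreover have "G ` carrier (free_module R B) \<subseteq> Fpow ?P"
    by (auto simp: G_def Fpow_def free_module_simps)
  ultimately have "inj_on (c \<circ> G) (carrier (free_module R B))"
    using c by (blast intro: comp_inj_on inj_on_subset)
  then show ?thesis by blast
qed

lemma free_resolution_exists:
  fixes R :: "('a, 'm) ring_scheme" and M :: "('a, 'b, 'n) module_scheme"
  assumes M: "module R M"
  shows "\<exists>(B :: nat \<Rightarrow> ('a \<times> 'b \<times> nat) set) d \<epsilon>. free_resolution R M B d \<epsilon>"
proof -
  interpret M: module R M by fact
  define F where "F = (\<lambda>B :: ('a \<times> 'b \<times> nat) set. free_module R B)"
  have F: "module R (F B)" for B unfolding F_def by (rule free_module_is_module) (rule M.is_cring)
  have "inj_on (\<lambda>m. (undefined :: 'a, m :: 'b, 0 :: nat)) (carrier M)" by (auto simp: inj_on_def)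
  then obtain B0 \<epsilon> where \<epsilon>: "\<epsilon> \<in> module_hom R (F B0) M" "\<epsilon> ` carrier (F B0) = carrier M"
    using free_cover[OF M M.carrier_is_submodule] unfolding F_def by blast
  define ok where "ok = (\<lambda>(B, K). submodule K R (F B))"
  define step where "step = (\<lambda>(B, K) (B', K') h. h \<in> module_hom R (F B') (F B) \<and>
     h ` carrier (F B') = K \<and> K' = {f \<in> carrier (F B'). h f = \<zero>\<^bsub>F B\<^esub>})"
  have "\<exists>q'. ok q' \<and> (\<exists>h. step q q' h)" if q: "ok q" for q
  proof -
    obtain B K where [simp]: "q = (B, K)" by (cases q)
    have K: "submodule K R (F B)" using q by (simp add: ok_def)
    have "K \<subseteq> carrier (F B)" using module.submoduleE(1)[OF F K] .
    then obtain g :: "_ \<Rightarrow> 'a \<times> 'b \<times> nat" where "inj_on g K"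
      using free_module_embeds[of R B] unfolding F_def by (blast intro: inj_on_subset)
    then obtain B' h where h: "h \<in> module_hom R (F B') (F B)" "h ` carrier (F B') = K"
      using free_cover[OF F K] unfolding F_def by blast
    show ?thesis
      using h module_hom_kernel[OF F F h(1)]
      by (intro exI[of _ "(B', {f \<in> carrier (F B'). h f = \<zero>\<^bsub>F B\<^esub>})"]) (auto simp: ok_def step_def)
  qed
  moreover have "ok (B0, {f \<in> carrier (F B0). \<epsilon> f = \<zero>\<^bsub>M\<^esub>})"
    using module_hom_kernel[OF F M \<epsilon>(1)] by (simp add: ok_def)
  ultimately have "\<exists>q. \<forall>n. (ok (q n) \<and> (n = 0 \<longrightarrow> q n = (B0, {f \<in> carrier (F B0). \<epsilon> f = \<zero>\<^bsub>M\<^esub>}))) \<and>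
      (\<exists>h. step (q n) (q (Suc n)) h)"
    by (intro dependent_nat_choice) auto
  then obtain q where q0: "q 0 = (B0, {f \<in> carrier (F B0). \<epsilon> f = \<zero>\<^bsub>M\<^esub>})"
    and q: "\<And>n. \<exists>h. step (q n) (q (Suc n)) h"
    by blast
  then obtain d where d: "\<And>n. step (q n) (q (Suc n)) (d n)" using choice[of "\<lambda>n h. step (q n) (q (Suc n)) h"] by blast
  have step: "d n \<in> module_hom R (F (fst (q (Suc n)))) (F (fst (q n)))"
    "d n ` carrier (F (fst (q (Suc n)))) = snd (q n)"
    "snd (q (Suc n)) = {f \<in> carrier (F (fst (q (Suc n)))). d n f = \<zero>\<^bsub>F (fst (q n))\<^esub>}" for n
    using d[of n] unfolding step_def by (auto simp: split_beta)
  have "free_resolution R M (\<lambda>n. fst (q n)) d \<epsilon>"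
    unfolding free_resolution_def Let_def
    using \<epsilon> step q0 by (auto simp: F_def)
  then show ?thesis by blast
qed

text \<open>Ext is computed from a chosen free resolution; up to isomorphism it does not depend on the
  choice.\<close>

definition chosen_resolution ::
    "('a, 'm) ring_scheme \<Rightarrow> ('a, 'b, 'n) module_scheme \<Rightarrow>
     (nat \<Rightarrow> ('a \<times> 'b \<times> nat) set) \<times>
     (nat \<Rightarrow> (('a \<times> 'b \<times> nat) \<Rightarrow> 'a) \<Rightarrow> (('a \<times> 'b \<times> nat) \<Rightarrow> 'a))"
  where "chosen_resolution R M = (SOME (B, d). \<exists>\<epsilon>. free_resolution R M B d \<epsilon>)"

lemma free_resolution_chosen:
  fixes R :: "('a, 'm) ring_scheme" and M :: "('a, 'b, 'n) module_scheme"
  assumes "module R M" and "chosen_resolution R M = (B, d)"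
  shows "\<exists>\<epsilon>. free_resolution R M B d \<epsilon>"
proof -
  let ?Q = "\<lambda>(B, d). \<exists>\<epsilon>. free_resolution R M B d \<epsilon>"
  from free_resolution_exists[OF assms(1)] obtain B' d' \<epsilon>' where
    "free_resolution R M (B' :: nat \<Rightarrow> ('a \<times> 'b \<times> nat) set) d' \<epsilon>'" by blast
  then have "?Q (B', d')" by auto
  then have "?Q (chosen_resolution R M)" unfolding chosen_resolution_def by (rule someI)
  then show ?thesis using assms(2) by simp
qed

definition Ext ::
    "nat \<Rightarrow> ('a, 'm) ring_scheme \<Rightarrow> ('a, 'b, 'n) module_scheme \<Rightarrow>
     ('a, 'c, 'o) module_scheme \<Rightarrow> ('a, ((('a \<times> 'b \<times> nat) \<Rightarrow> 'a) \<Rightarrow> 'c) set) module"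
  where "Ext i R M N = (case chosen_resolution R M of (B, d) \<Rightarrow> Hom_cohomology R B d N i)"

end

theory Submission
  imports Defs
begin

text \<open>The associated primes of each single \<open>Ext\<^sup>i(M, R)\<close> are finite in number, so it suffices to find a
  finite set of primes outside of which no prime is associated to \<open>Ext\<^sup>i(M, R)\<close> for any \<open>i \<ge> 3\<close>. If
  \<open>R\<^sub>p\<close> is regular of dimension at most two, then the second syzygies of \<open>M\<close> are free at \<open>p\<close>, hence
  \<open>Ext\<^sup>i(M, R)\<^sub>p = 0\<close> for \<open>i \<ge> 3\<close>. The singular locus is closed because \<open>R\<close> is excellent, and it
  contains no prime of height zero (\<open>R\<close> reduced), respectively of height at most one (\<open>R\<close> normal), so
  its non-maximal primes are minimal over its defining ideal; there are finitely many of them.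

  The localizations themselves enter only in the description of the regular locus; elsewhere, statements
  about \<open>R\<^sub>p\<close> are phrased in \<open>R\<close>, up to multiplication by elements outside \<open>p\<close>.\<close>

section \<open>Noetherian modules and localization at a prime\<close>

text \<open>\<open>Ext\<close> is computed from a chosen resolution whose free modules may have
  infinite rank, so no finiteness is visible there. Cocycles are therefore moved to a resolution of
  finite rank. An associated prime only records which \<open>r\<close> turn a given cocycle into a
  coboundary, and this condition is all that has to be compared. In degree 0 nothing but zero is a
  coboundary; there reducedness forces an associated prime to be a minimal prime of
  \<open>R\<close>. The bound 3 comes from the freeness argument. A class in degree \<open>i\<close>
  dies at \<open>p\<close> once the syzygy inside \<open>F_(i-2)\<close> is locally free. A regular
  pair is carried over to this syzygy because it is the kernel of a map between the free modules
  \<open>F_(i-2)\<close> and \<open>F_(i-3)\<close>, so degree \<open>i-3\<close> has to exist.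
  Regularity of \<open>R_p\<close> enters as a number of local generators of \<open>p\<close> that
  does not exceed the length of some chain of primes below \<open>p\<close>. That such generators
  form a regular sequence is then derived from the chain: its smallest member is shown to vanish
  locally. For a minimal prime there is no chain to exploit, which is why minimal primes are put
  into the exceptional set.\<close>

definition fg_sub :: "('a, 'm) ring_scheme \<Rightarrow> ('a, 'b, 'n) module_scheme \<Rightarrow> 'b set \<Rightarrow> bool"
  where "fg_sub R M N \<longleftrightarrow>
    (\<exists>S\<subseteq>N. finite S \<and> (\<forall>L. submodule L R M \<and> S \<subseteq> L \<longrightarrow> N \<subseteq> L))"

text \<open>Like \<open>fg_sub\<close>, this speaks only of submodules of one ambient
  \<open>M\<close>, so that a submodule never has to become a module record of its own. Over
  \<open>ring_as_module\<close> it is a condition on ideals.\<close>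

definition noetherian_module :: "('a, 'm) ring_scheme \<Rightarrow> ('a, 'b, 'n) module_scheme \<Rightarrow> bool"
  where "noetherian_module R M \<longleftrightarrow> (\<forall>N. submodule N R M \<longrightarrow> fg_sub R M N)"

text \<open>The elements of \<open>M\<close> whose image in the localization of \<open>M\<close> at the prime \<open>p\<close> lies in the
  localization of \<open>N\<close>.\<close>

definition sat :: "('a, 'm) ring_scheme \<Rightarrow> ('a, 'b, 'n) module_scheme \<Rightarrow> 'a set \<Rightarrow> 'b set \<Rightarrow> 'b set"
  where "sat R M p N = {x \<in> carrier M. \<exists>u\<in>carrier R - p. u \<odot>\<^bsub>M\<^esub> x \<in> N}"

text \<open>Generators are always added one at a time. For ideals this is the sum of
  \<open>L\<close> and a principal ideal, so it also provides ideals such as \<open>(x) + q0\<close>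
  and the ascending chain of the integrality argument.\<close>

definition adjoin :: "('a, 'm) ring_scheme \<Rightarrow> ('a, 'b, 'n) module_scheme \<Rightarrow> 'b \<Rightarrow> 'b set \<Rightarrow> 'b set"
  where "adjoin R M s L = {(r \<odot>\<^bsub>M\<^esub> s) \<oplus>\<^bsub>M\<^esub> l | r l. r \<in> carrier R \<and> l \<in> L}"

lemma primeideal_compl_mult:
  assumes "primeideal p R" "u \<in> carrier R - p" "v \<in> carrier R - p"
  shows "u \<otimes>\<^bsub>R\<^esub> v \<in> carrier R - p"
proof -
  interpret primeideal p R by fact
  show ?thesis using assms(2,3) I_prime by auto
qed

lemma primeideal_compl_one: "primeideal p R \<Longrightarrow> \<one>\<^bsub>R\<^esub> \<in> carrier R - p"
proof -
  assume "primeideal p R"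
  then interpret primeideal p R .
  show ?thesis using I_notcarr one_imp_carrier by auto
qed

lemma fg_subE:
  assumes "fg_sub R M N"
  obtains S where "S \<subseteq> N" "finite S" "\<And>L. submodule L R M \<Longrightarrow> S \<subseteq> L \<Longrightarrow> N \<subseteq> L"
  using assms unfolding fg_sub_def by blast

context module
begin

lemma add_minus_cancel_left: "a \<in> carrier M \<Longrightarrow> b \<in> carrier M \<Longrightarrow> a \<oplus>\<^bsub>M\<^esub> b \<oplus>\<^bsub>M\<^esub> \<ominus>\<^bsub>M\<^esub> a = b"
  by (metis M.a_inv_closed M.a_assoc M.a_comm M.l_neg M.r_zero)

lemma minus_eq_zeroD:
  assumes "a \<in> carrier M" "b \<in> carrier M" "a \<ominus>\<^bsub>M\<^esub> b = \<zero>\<^bsub>M\<^esub>"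
  shows "a = b"
  using M.minus_equality[of a "\<ominus>\<^bsub>M\<^esub> b"] assms by (simp add: a_minus_def)

lemma submodule_zero: "submodule N R M \<Longrightarrow> \<zero>\<^bsub>M\<^esub> \<in> N"
  using submoduleE(2,4)[of N] submoduleE(1)[of N] by (metis R.zero_closed ex_in_conv smult_l_null subset_iff)

lemmas submoduleD = submoduleE(1)[THEN subsetD] submoduleE(3-5) submodule_zero

lemma submodule_minus: "submodule N R M \<Longrightarrow> a \<in> N \<Longrightarrow> b \<in> N \<Longrightarrow> a \<ominus>\<^bsub>M\<^esub> b \<in> N"
  by (simp add: a_minus_def submoduleD)

lemma submodule_add_cancel:
  assumes "submodule N R M" "a \<oplus>\<^bsub>M\<^esub> b \<in> N" "a \<in> N" "b \<in> carrier M"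
  shows "b \<in> N"
proof -
  have a: "a \<in> carrier M" using assms submoduleD(1) by blast
  have "b = (a \<oplus>\<^bsub>M\<^esub> b) \<ominus>\<^bsub>M\<^esub> a" unfolding a_minus_def using add_minus_cancel_left[OF a assms(4)] by simp
  then show ?thesis using submodule_minus[OF assms(1,2,3)] by simp
qed

lemma submodule_Int: "submodule N R M \<Longrightarrow> submodule L R M \<Longrightarrow> submodule (N \<inter> L) R M"
  by (rule submoduleI) (auto simp: submoduleD)

lemma adjoin_submodule:
  assumes L: "submodule L R M" and s: "s \<in> carrier M"
  shows "submodule (adjoin R M s L) R M"
proof (rule submoduleI)
  note [simp] = submoduleD[OF L]
  show "adjoin R M s L \<subseteq> carrier M" using s by (auto simp: adjoin_def)
  show "\<zero>\<^bsub>M\<^esub> \<in> adjoin R M s L" using s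
    by (auto simp: adjoin_def intro!: exI[of _ \<zero>] exI[of _ "\<zero>\<^bsub>M\<^esub>"])
  fix a assume "a \<in> adjoin R M s L"
  then obtain r l where a: "a = r \<odot>\<^bsub>M\<^esub> s \<oplus>\<^bsub>M\<^esub> l" "r \<in> carrier R" "l \<in> L" by (auto simp: adjoin_def)
  have "\<ominus>\<^bsub>M\<^esub> a = (\<ominus> r) \<odot>\<^bsub>M\<^esub> s \<oplus>\<^bsub>M\<^esub> (\<ominus>\<^bsub>M\<^esub> l)"
    using a s by (simp add: smult_l_minus M.minus_add)
  then show "\<ominus>\<^bsub>M\<^esub> a \<in> adjoin R M s L"
    using a by (auto simp: adjoin_def intro!: exI[of _ "\<ominus> r"] exI[of _ "\<ominus>\<^bsub>M\<^esub> l"])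
  fix b assume "b \<in> adjoin R M s L"
  then obtain r' l' where b: "b = r' \<odot>\<^bsub>M\<^esub> s \<oplus>\<^bsub>M\<^esub> l'" "r' \<in> carrier R" "l' \<in> L" by (auto simp: adjoin_def)
  have "a \<oplus>\<^bsub>M\<^esub> b = (r \<oplus> r') \<odot>\<^bsub>M\<^esub> s \<oplus>\<^bsub>M\<^esub> (l \<oplus>\<^bsub>M\<^esub> l')"
    using a b s by (simp add: smult_l_distr M.a_ac)
  then show "a \<oplus>\<^bsub>M\<^esub> b \<in> adjoin R M s L"
    using a b by (auto simp: adjoin_def intro!: exI[of _ "r \<oplus> r'"] exI[of _ "l \<oplus>\<^bsub>M\<^esub> l'"])
next
  note [simp] = submoduleD[OF L]
  fix c a assume c: "c \<in> carrier R" and "a \<in> adjoin R M s L"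
  then obtain r l where a: "a = r \<odot>\<^bsub>M\<^esub> s \<oplus>\<^bsub>M\<^esub> l" "r \<in> carrier R" "l \<in> L" by (auto simp: adjoin_def)
  have "c \<odot>\<^bsub>M\<^esub> a = (c \<otimes> r) \<odot>\<^bsub>M\<^esub> s \<oplus>\<^bsub>M\<^esub> (c \<odot>\<^bsub>M\<^esub> l)"
    using a c s by (simp add: smult_r_distr smult_assoc1)
  then show "c \<odot>\<^bsub>M\<^esub> a \<in> adjoin R M s L"
    using a c by (auto simp: adjoin_def intro!: exI[of _ "c \<otimes> r"] exI[of _ "c \<odot>\<^bsub>M\<^esub> l"])
qed

lemma adjoin_superset:
  assumes L: "submodule L R M" and s: "s \<in> carrier M"
  shows "insert s L \<subseteq> adjoin R M s L"
proof
  note [simp] = submoduleD[OF L]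
  fix x assume "x \<in> insert s L"
  then show "x \<in> adjoin R M s L"
  proof
    assume "x = s"
    then show ?thesis using s by (auto simp: adjoin_def intro!: exI[of _ \<one>] exI[of _ "\<zero>\<^bsub>M\<^esub>"])
  next
    assume "x \<in> L"
    then show ?thesis using s by (auto simp: adjoin_def intro!: exI[of _ \<zero>] exI[of _ x])
  qed
qed

lemma zero_submodule: "submodule {\<zero>\<^bsub>M\<^esub>} R M"
  by (rule submoduleI) auto

lemma satI: "u \<in> carrier R - p \<Longrightarrow> x \<in> carrier M \<Longrightarrow> u \<odot>\<^bsub>M\<^esub> x \<in> N \<Longrightarrow> x \<in> sat R M p N"
  by (auto simp: sat_def)

lemma sat_superset:
  assumes "primeideal p R" "N \<subseteq> carrier M"
  shows "N \<subseteq> sat R M p N"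
  using assms primeideal_compl_one[OF assms(1)] by (auto intro!: satI[of \<one>])

lemma sat_submodule:
  assumes p: "primeideal p R" and N: "submodule N R M"
  shows "submodule (sat R M p N) R M"
proof (rule submoduleI)
  note [simp] = submoduleD[OF N]
  show "sat R M p N \<subseteq> carrier M" by (auto simp: sat_def)
  show "\<zero>\<^bsub>M\<^esub> \<in> sat R M p N" using sat_superset[OF p] N by (auto simp: subset_iff)
  fix a assume a: "a \<in> sat R M p N"
  then obtain u where u: "u \<in> carrier R - p" "u \<odot>\<^bsub>M\<^esub> a \<in> N" "a \<in> carrier M" by (auto simp: sat_def)
  then show "\<ominus>\<^bsub>M\<^esub> a \<in> sat R M p N" by (intro satI[of u]) (auto simp: smult_r_minus)
  fix b assume "b \<in> sat R M p N"
  then obtain v where v: "v \<in> carrier R - p" "v \<odot>\<^bsub>M\<^esub> b \<in> N" "b \<in> carrier M" by (auto simp: sat_def)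
  have "(u \<otimes> v) \<odot>\<^bsub>M\<^esub> (a \<oplus>\<^bsub>M\<^esub> b) = v \<odot>\<^bsub>M\<^esub> (u \<odot>\<^bsub>M\<^esub> a) \<oplus>\<^bsub>M\<^esub> u \<odot>\<^bsub>M\<^esub> (v \<odot>\<^bsub>M\<^esub> b)"
    using u v by (simp add: smult_r_distr flip: smult_assoc1) (simp add: R.m_comm)
  moreover have "\<dots> \<in> N" using u v by simp
  ultimately show "a \<oplus>\<^bsub>M\<^esub> b \<in> sat R M p N"
    using u v primeideal_compl_mult[OF p u(1) v(1)] by (intro satI[of "u \<otimes> v"]) simp_all
next
  fix c a assume "c \<in> carrier R" "a \<in> sat R M p N"
  then obtain u where u: "c \<in> carrier R" "u \<in> carrier R - p" "u \<odot>\<^bsub>M\<^esub> a \<in> N" "a \<in> carrier M" by (auto simp: sat_def)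
  have "u \<odot>\<^bsub>M\<^esub> (c \<odot>\<^bsub>M\<^esub> a) = c \<odot>\<^bsub>M\<^esub> (u \<odot>\<^bsub>M\<^esub> a)"
    using u by (simp add: R.m_comm flip: smult_assoc1)
  then show "c \<odot>\<^bsub>M\<^esub> a \<in> sat R M p N" using u by (intro satI[of u]) (auto simp: submoduleD[OF N])
qed

lemma sat_idem:
  assumes p: "primeideal p R"
  shows "sat R M p (sat R M p N) \<subseteq> sat R M p N"
proof
  fix a assume "a \<in> sat R M p (sat R M p N)"
  then obtain u v where "u \<in> carrier R - p" "v \<in> carrier R - p" "a \<in> carrier M" "v \<odot>\<^bsub>M\<^esub> (u \<odot>\<^bsub>M\<^esub> a) \<in> N"
    by (auto simp: sat_def)
  then show "a \<in> sat R M p N"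
    using primeideal_compl_mult[OF p, of v u] by (intro satI[of "v \<otimes> u"]) (auto simp: smult_assoc1)
qed

text \<open>The product of the denominators of finitely many generators is a common one, and it
  serves all of \<open>N\<close> because the elements that \<open>u\<close> sends into
  \<open>L\<close> form a submodule. An inclusion between localizations thereby becomes a single
  multiplication in \<open>M\<close>.\<close>

lemma sat_uniform:
  assumes p: "primeideal p R" and N: "fg_sub R M N" and L: "submodule L R M" and sub: "N \<subseteq> sat R M p L"
  shows "\<exists>u\<in>carrier R - p. \<forall>a\<in>N. u \<odot>\<^bsub>M\<^esub> a \<in> L"
proof -
  from N obtain S where S: "S \<subseteq> N" "finite S" "\<And>L. submodule L R M \<Longrightarrow> S \<subseteq> L \<Longrightarrow> N \<subseteq> L"
    using fg_subE by blast
  have "S \<subseteq> sat R M p L" using S(1) sub by blast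
  with S(2) have "\<exists>u\<in>carrier R - p. \<forall>a\<in>S. u \<odot>\<^bsub>M\<^esub> a \<in> L"
  proof (induction S rule: finite_induct)
    case empty
    then show ?case using primeideal_compl_one[OF p] by blast
  next
    case (insert s S)
    then obtain u where u: "u \<in> carrier R - p" "\<forall>a\<in>S. u \<odot>\<^bsub>M\<^esub> a \<in> L" by blast
    obtain v where v: "v \<in> carrier R - p" "v \<odot>\<^bsub>M\<^esub> s \<in> L" using insert by (auto simp: sat_def)
    have "(u \<otimes> v) \<odot>\<^bsub>M\<^esub> a \<in> L" if "a \<in> insert s S" for a
    proof -
      have a: "a \<in> carrier M" using that insert.prems by (auto simp: sat_def)
      have "(u \<otimes> v) \<odot>\<^bsub>M\<^esub> a = u \<odot>\<^bsub>M\<^esub> (v \<odot>\<^bsub>M\<^esub> a)" "(u \<otimes> v) \<odot>\<^bsub>M\<^esub> a = v \<odot>\<^bsub>M\<^esub> (u \<odot>\<^bsub>M\<^esub> a)"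
        using a u v by (auto simp: R.m_comm simp flip: smult_assoc1)
      then show ?thesis using that u v submoduleD(3)[OF L] by (metis DiffD1 insertE)
    qed
    then show ?case using primeideal_compl_mult[OF p u(1) v(1)] by blast
  qed
  then obtain u where u: "u \<in> carrier R - p" "\<forall>a\<in>S. u \<odot>\<^bsub>M\<^esub> a \<in> L" by blast
  have "submodule {a \<in> carrier M. u \<odot>\<^bsub>M\<^esub> a \<in> L} R M"
  proof (rule submoduleI)
    fix c x assume *: "c \<in> carrier R" "x \<in> {a \<in> carrier M. u \<odot>\<^bsub>M\<^esub> a \<in> L}"
    have "u \<odot>\<^bsub>M\<^esub> (c \<odot>\<^bsub>M\<^esub> x) = c \<odot>\<^bsub>M\<^esub> (u \<odot>\<^bsub>M\<^esub> x)"
      using u * by (simp add: R.m_comm flip: smult_assoc1)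
    then show "c \<odot>\<^bsub>M\<^esub> x \<in> {a \<in> carrier M. u \<odot>\<^bsub>M\<^esub> a \<in> L}" using * by (auto simp: submoduleD[OF L])
  qed (use u(1) in \<open>auto simp: submoduleD[OF L] smult_r_minus smult_r_distr\<close>)
  moreover have "S \<subseteq> {a \<in> carrier M. u \<odot>\<^bsub>M\<^esub> a \<in> L}" using u S(1) sub by (auto simp: sat_def)
  ultimately show ?thesis using S(3) u(1) by blast
qed

text \<open>Nakayama's lemma for the localizations at \<open>p\<close>: eliminate the generators of \<open>N\<close> one by one.\<close>

lemma nakayama:
  assumes p: "primeideal p R" and N: "submodule N R M" "fg_sub R M N"
    and N0: "submodule N0 R M"
    and xy: "x \<in> p" "y \<in> p"
    and dec: "\<And>a. a \<in> N \<Longrightarrow> \<exists>u\<in>carrier R - p. \<exists>b\<in>N. \<exists>c\<in>N. \<exists>e\<in>N0.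
        u \<odot>\<^bsub>M\<^esub> a = (x \<odot>\<^bsub>M\<^esub> b) \<oplus>\<^bsub>M\<^esub> (y \<odot>\<^bsub>M\<^esub> c) \<oplus>\<^bsub>M\<^esub> e"
  shows "N \<subseteq> sat R M p N0"
proof -
  interpret p: primeideal p R by fact
  have xyR: "x \<in> carrier R" "y \<in> carrier R" using xy by auto
  from N(2) obtain S where S: "S \<subseteq> N" "finite S" "\<And>L. submodule L R M \<Longrightarrow> S \<subseteq> L \<Longrightarrow> N \<subseteq> L"
    using fg_subE by blast
  \<comment> \<open>The induction eliminates generators from this statement: \<open>N\<close> is
    locally contained in every \<open>L\<close> that holds \<open>N0\<close> and the generators
    still in play. When none is left, \<open>L = N0\<close> is allowed.\<close>
  have "N \<subseteq> sat R M p L" if "submodule L R M" "S \<subseteq> L" "N0 \<subseteq> L" for L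
    using S(3)[OF that(1,2)] sat_superset[OF p submoduleE(1)[OF that(1)]] by blast
  with S(2,1) show ?thesis
  proof (induction S rule: finite_induct)
    case empty
    then show ?case using N0 by blast
  next
    case (insert s S)
    have s: "s \<in> N" "s \<in> carrier M" using insert.prems submoduleD(1)[OF N(1)] by auto
    show ?case
    proof (rule insert.IH)
      show "S \<subseteq> N" using insert.prems by auto
      fix L assume L: "submodule L R M" and SL: "S \<subseteq> L" "N0 \<subseteq> L"
      have "N \<subseteq> sat R M p (adjoin R M s L)"
        using adjoin_superset[OF L s(2)] SL by (intro insert.prems(2) adjoin_submodule L s) auto
      then have ad: "\<exists>v\<in>carrier R - p. \<exists>r\<in>carrier R. \<exists>l\<in>L. v \<odot>\<^bsub>M\<^esub> a = r \<odot>\<^bsub>M\<^esub> s \<oplus>\<^bsub>M\<^esub> l" if "a \<in> N" for a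
        using that unfolding sat_def adjoin_def by blast
      obtain u b c e where u: "u \<in> carrier R - p" "b \<in> N" "c \<in> N" "e \<in> N0"
        "u \<odot>\<^bsub>M\<^esub> s = (x \<odot>\<^bsub>M\<^esub> b) \<oplus>\<^bsub>M\<^esub> (y \<odot>\<^bsub>M\<^esub> c) \<oplus>\<^bsub>M\<^esub> e" using dec[OF s(1)] by blast
      obtain v r l where v: "v \<in> carrier R - p" "r \<in> carrier R" "l \<in> L" "v \<odot>\<^bsub>M\<^esub> b = r \<odot>\<^bsub>M\<^esub> s \<oplus>\<^bsub>M\<^esub> l"
        using ad[OF u(2)] by blast
      obtain w r' l' where w: "w \<in> carrier R - p" "r' \<in> carrier R" "l' \<in> L" "w \<odot>\<^bsub>M\<^esub> c = r' \<odot>\<^bsub>M\<^esub> s \<oplus>\<^bsub>M\<^esub> l'"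
        using ad[OF u(3)] by blast
      have R: "u \<in> carrier R" "v \<in> carrier R" "w \<in> carrier R" using u v w by auto
      have M: "b \<in> carrier M" "c \<in> carrier M" "e \<in> carrier M" "l \<in> carrier M" "l' \<in> carrier M"
        using u v w submoduleD(1)[OF N(1)] submoduleD(1)[OF N0] submoduleD(1)[OF L] by auto
      \<comment> \<open>Multiplying the decomposition of \<open>s\<close> by
        \<open>v \<otimes> w\<close> and inserting the expressions for \<open>b\<close> and
        \<open>c\<close> gives \<open>vwu s = q s + k\<close> with \<open>k \<in> L\<close>. Since
        \<open>q\<close> is a combination of \<open>x\<close> and \<open>y\<close> it lies in
        \<open>p\<close>, so \<open>?t = vwu - q\<close> is outside \<open>p\<close> and
        \<open>s\<close> is locally redundant.\<close>
      let ?q = "(x \<otimes> w \<otimes> r) \<oplus> (y \<otimes> v \<otimes> r')"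
      let ?k = "((x \<otimes> w) \<odot>\<^bsub>M\<^esub> l) \<oplus>\<^bsub>M\<^esub> ((y \<otimes> v) \<odot>\<^bsub>M\<^esub> l') \<oplus>\<^bsub>M\<^esub> ((v \<otimes> w) \<odot>\<^bsub>M\<^esub> e)"
      have "(v \<otimes> w \<otimes> u) \<odot>\<^bsub>M\<^esub> s = (v \<otimes> w) \<odot>\<^bsub>M\<^esub> (u \<odot>\<^bsub>M\<^esub> s)" using R s by (simp add: smult_assoc1)
      also have "\<dots> = (x \<otimes> w) \<odot>\<^bsub>M\<^esub> (v \<odot>\<^bsub>M\<^esub> b) \<oplus>\<^bsub>M\<^esub> (y \<otimes> v) \<odot>\<^bsub>M\<^esub> (w \<odot>\<^bsub>M\<^esub> c) \<oplus>\<^bsub>M\<^esub> (v \<otimes> w) \<odot>\<^bsub>M\<^esub> e"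
        using R M xyR by (simp add: u(5) smult_r_distr R.m_ac flip: smult_assoc1)
      also have "\<dots> = ?q \<odot>\<^bsub>M\<^esub> s \<oplus>\<^bsub>M\<^esub> ?k"
        using R M xyR v(2) w(2) s by (simp add: v(4) w(4) smult_r_distr smult_l_distr M.a_ac smult_assoc1)
      finally have eq: "(v \<otimes> w \<otimes> u) \<odot>\<^bsub>M\<^esub> s = ?q \<odot>\<^bsub>M\<^esub> s \<oplus>\<^bsub>M\<^esub> ?k" .
      have kL: "?k \<in> L" using R xyR u v w SL by (intro submoduleD[OF L] R.m_closed) auto
      have q: "?q \<in> p" using R xy v w by (auto intro!: p.a_closed p.I_r_closed)
      let ?t = "v \<otimes> w \<otimes> u \<ominus> ?q"
      have t: "?t \<in> carrier R - p"
      proof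
        show tR: "?t \<in> carrier R" using R xyR v w by simp
        show "?t \<notin> p"
        proof
          assume "?t \<in> p"
          then have "?t \<oplus> ?q \<in> p" using q by (rule p.a_closed)
          moreover have "?t \<oplus> ?q = v \<otimes> w \<otimes> u" using R xyR v w by (simp add: a_minus_def R.a_assoc R.l_neg)
          ultimately show False using primeideal_compl_mult[OF p primeideal_compl_mult[OF p v(1) w(1)] u(1)] by simp
        qed
      qed
      have "?t \<odot>\<^bsub>M\<^esub> s = (v \<otimes> w \<otimes> u) \<odot>\<^bsub>M\<^esub> s \<oplus>\<^bsub>M\<^esub> \<ominus>\<^bsub>M\<^esub> (?q \<odot>\<^bsub>M\<^esub> s)"
        using R xyR v w s by (simp add: a_minus_def smult_l_distr smult_l_minus)
      also have "\<dots> = ?k" unfolding eq using R M xyR v w s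
        by (intro add_minus_cancel_left) auto
      finally have ts: "?t \<odot>\<^bsub>M\<^esub> s \<in> L" using kL by simp
      show "N \<subseteq> sat R M p L"
      proof
        fix a assume a: "a \<in> N"
        then have aM: "a \<in> carrier M" using submoduleD(1)[OF N(1)] by blast
        obtain v' r'' l'' where v': "v' \<in> carrier R - p" "r'' \<in> carrier R" "l'' \<in> L"
          "v' \<odot>\<^bsub>M\<^esub> a = r'' \<odot>\<^bsub>M\<^esub> s \<oplus>\<^bsub>M\<^esub> l''" using ad[OF a] by blast
        have "(?t \<otimes> v') \<odot>\<^bsub>M\<^esub> a = ?t \<odot>\<^bsub>M\<^esub> (r'' \<odot>\<^bsub>M\<^esub> s \<oplus>\<^bsub>M\<^esub> l'')"
          using t v'(1) aM by (simp add: smult_assoc1 flip: v'(4))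
        also have "\<dots> = r'' \<odot>\<^bsub>M\<^esub> (?t \<odot>\<^bsub>M\<^esub> s) \<oplus>\<^bsub>M\<^esub> ?t \<odot>\<^bsub>M\<^esub> l''"
          using t v' s submoduleD(1)[OF L v'(3)] by (simp add: smult_r_distr R.m_comm flip: smult_assoc1)
        also have "\<dots> \<in> L" using t by (intro submoduleD(4)[OF L] submoduleD(3)[OF L v'(2) ts] submoduleD(3)[OF L _ v'(3)]) simp
        finally show "a \<in> sat R M p L"
          using primeideal_compl_mult[OF p t v'(1)] aM by (intro satI[of "?t \<otimes> v'"]) auto
      qed
    qed
  qed
qed

text \<open>The union of a strictly ascending chain would be finitely generated, with all generators
  already in one member. This is the form in which noetherian induction is used below: a
  counterexample is chosen maximal.\<close>

lemma noetherian_maximal: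
  assumes noeth: "noetherian_module R M"
    and F: "F \<noteq> {}" "\<And>N. N \<in> F \<Longrightarrow> submodule N R M"
  shows "\<exists>N\<in>F. \<forall>L\<in>F. N \<subseteq> L \<longrightarrow> L = N"
proof (rule ccontr)
  assume "\<not> ?thesis"
  then have step: "\<exists>L\<in>F. N \<subset> L" if "N \<in> F" for N using that by blast
  obtain N0 where "N0 \<in> F" using F by blast
  then have "\<exists>f. \<forall>n. f n \<in> F \<and> f n \<subset> f (Suc n)"
    using step by (intro dependent_nat_choice) auto
  then obtain f where f: "\<And>n. f n \<in> F" "\<And>n. f n \<subset> f (Suc n)" by blast
  have mono: "f m \<subseteq> f n" if "m \<le> n" for m n by (rule lift_Suc_mono_le[of f, OF psubset_imp_subset[OF f(2)] that])
  have sub: "submodule (f n) R M" for n using f F by blast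
  have "submodule (\<Union>n. f n) R M"
  proof (rule submoduleI)
    fix a b assume "a \<in> (\<Union>n. f n)" "b \<in> (\<Union>n. f n)"
    then obtain m n where "a \<in> f m" "b \<in> f n" by blast
    then have "a \<in> f (max m n)" "b \<in> f (max m n)" using mono[of m "max m n"] mono[of n "max m n"] by auto
    then show "a \<oplus>\<^bsub>M\<^esub> b \<in> (\<Union>n. f n)" using submoduleD(4)[OF sub] by (intro UN_I[of "max m n"]) auto
  next
    fix a assume "a \<in> (\<Union>n. f n)"
    then show "\<ominus>\<^bsub>M\<^esub> a \<in> (\<Union>n. f n)" using submoduleD(2)[OF sub] by (metis UN_iff)
  next
    fix c a assume "c \<in> carrier R" "a \<in> (\<Union>n. f n)"
    then show "c \<odot>\<^bsub>M\<^esub> a \<in> (\<Union>n. f n)" using submoduleD(3)[OF sub] by (metis UN_iff)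
  qed (use submoduleD(1,5)[OF sub] in auto)
  then have "fg_sub R M (\<Union>n. f n)" using noeth by (simp add: noetherian_module_def)
  then obtain S where S: "S \<subseteq> (\<Union>n. f n)" "finite S" "\<And>L. submodule L R M \<Longrightarrow> S \<subseteq> L \<Longrightarrow> (\<Union>n. f n) \<subseteq> L"
    using fg_subE by blast
  from S(2,1) have "\<exists>n. S \<subseteq> f n"
  proof (induction S rule: finite_induct)
    case (insert s S)
    then obtain m n where "s \<in> f m" "S \<subseteq> f n" by blast
    then have "insert s S \<subseteq> f (max m n)" using mono[of m "max m n"] mono[of n "max m n"] by auto
    then show ?case by blast
  qed auto
  then obtain n where "S \<subseteq> f n" by blast
  then have "f (Suc n) \<subseteq> f n" using S(3)[OF sub] by blast
  then show False using f(2)[of n] by blast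
qed

text \<open>Two cyclic submodules of a quotient with different prime annihilators intersect trivially,
  so adjoining a generator with prime annihilator adds at most one associated prime.\<close>

lemma finite_colon_primes:
  assumes noeth: "noetherian_module R M" and D: "submodule D R M"
  shows "finite {p. primeideal p R \<and> (\<exists>z\<in>carrier M. p = {r \<in> carrier R. r \<odot>\<^bsub>M\<^esub> z \<in> D})}"
proof (rule ccontr)
  let ?A = "\<lambda>D. {p. primeideal p R \<and> (\<exists>z\<in>carrier M. p = {r \<in> carrier R. r \<odot>\<^bsub>M\<^esub> z \<in> D})}"
  assume "infinite (?A D)"
  then have "{D. submodule D R M \<and> infinite (?A D)} \<noteq> {}" using D by auto
  from noetherian_maximal[OF noeth this] obtain D where D: "submodule D R M" "infinite (?A D)"
    and max: "\<And>L. submodule L R M \<Longrightarrow> infinite (?A L) \<Longrightarrow> D \<subseteq> L \<Longrightarrow> L = D"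
    unfolding mem_Collect_eq by blast
  obtain q where "q \<in> ?A D" using infinite_imp_nonempty[OF D(2)] by blast
  then obtain z where q: "primeideal q R" and z: "z \<in> carrier M" and qz: "q = {r \<in> carrier R. r \<odot>\<^bsub>M\<^esub> z \<in> D}" by auto
  have q_iff: "r \<in> q \<longleftrightarrow> r \<odot>\<^bsub>M\<^esub> z \<in> D" if "r \<in> carrier R" for r using that unfolding qz by blast
  interpret q: primeideal q R by fact
  define D' where "D' = adjoin R M z D"
  have D': "submodule D' R M" unfolding D'_def by (rule adjoin_submodule[OF D(1) z])
  have DD': "insert z D \<subseteq> D'" unfolding D'_def by (rule adjoin_superset[OF D(1) z])
  have "\<one> \<notin> q" using primeideal_compl_one[OF q] by blast
  then have "z \<notin> D" using q_iff[of \<one>] smult_one[OF z] by simp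
  then have "D' \<noteq> D" "D \<subseteq> D'" using DD' by blast+
  then have "finite (?A D')" using max[OF D'] by blast
  moreover have "?A D \<subseteq> insert q (?A D')"
  proof
    fix p assume "p \<in> ?A D"
    then obtain y where p: "primeideal p R" and y: "y \<in> carrier M" and py: "p = {r \<in> carrier R. r \<odot>\<^bsub>M\<^esub> y \<in> D}" by auto
    have p_iff: "r \<in> p \<longleftrightarrow> r \<odot>\<^bsub>M\<^esub> y \<in> D" if "r \<in> carrier R" for r using that unfolding py by blast
    interpret p: primeideal p R by fact
    show "p \<in> insert q (?A D')"
    proof (cases "\<forall>r\<in>carrier R. r \<odot>\<^bsub>M\<^esub> y \<in> D' \<longrightarrow> r \<odot>\<^bsub>M\<^esub> y \<in> D")
      case True
      then have "p = {r \<in> carrier R. r \<odot>\<^bsub>M\<^esub> y \<in> D'}" using DD' py by blast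
      then show ?thesis using p y by blast
    next
      case False
      then obtain r where r: "r \<in> carrier R" "r \<odot>\<^bsub>M\<^esub> y \<in> D'" "r \<odot>\<^bsub>M\<^esub> y \<notin> D" by blast
      then obtain s d where s: "s \<in> carrier R" "d \<in> D" "r \<odot>\<^bsub>M\<^esub> y = s \<odot>\<^bsub>M\<^esub> z \<oplus>\<^bsub>M\<^esub> d"
        by (auto simp: D'_def adjoin_def)
      have dM: "d \<in> carrier M" using submoduleD(1)[OF D(1)] s by blast
      have sz: "s \<odot>\<^bsub>M\<^esub> z \<notin> D" using r(3) s submoduleD(4)[OF D(1)] by auto
      have rp: "r \<notin> p" "s \<notin> q" using r s sz p_iff q_iff by blast+
      \<comment> \<open>Modulo \<open>D\<close> the elements \<open>r y\<close> and
        \<open>s z\<close> coincide. As \<open>r\<close> is outside \<open>p\<close> and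
        \<open>s\<close> outside \<open>q\<close>, passing from \<open>y\<close> to
        \<open>r y\<close> and from \<open>z\<close> to \<open>s z\<close> does not change the
        annihilators, so \<open>p = q\<close>.\<close>
      have eq: "t \<otimes> r \<in> p \<longleftrightarrow> t \<otimes> s \<in> q" if t: "t \<in> carrier R" for t
      proof -
        have "(t \<otimes> r) \<odot>\<^bsub>M\<^esub> y = (t \<otimes> s) \<odot>\<^bsub>M\<^esub> z \<oplus>\<^bsub>M\<^esub> t \<odot>\<^bsub>M\<^esub> d"
          using t r s y z dM by (simp add: smult_assoc1 smult_r_distr)
        moreover have "t \<odot>\<^bsub>M\<^esub> d \<in> D" using submoduleD(3)[OF D(1) t s(2)] .
        ultimately have "(t \<otimes> r) \<odot>\<^bsub>M\<^esub> y \<in> D \<longleftrightarrow> (t \<otimes> s) \<odot>\<^bsub>M\<^esub> z \<in> D"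
          using submodule_add_cancel[OF D(1), of "t \<odot>\<^bsub>M\<^esub> d" "(t \<otimes> s) \<odot>\<^bsub>M\<^esub> z"] submoduleD(4)[OF D(1)] t s r z dM
          by (metis M.add.m_comm R.m_closed smult_closed)
        then show ?thesis using p_iff[of "t \<otimes> r"] q_iff[of "t \<otimes> s"] t r s by simp
      qed
      have "t \<in> p \<longleftrightarrow> t \<in> q" if "t \<in> carrier R" for t
        using eq[OF that] that r(1) s(1) rp p.I_prime[OF that r(1)] q.I_prime[OF that s(1)]
          p.I_r_closed[of t r] q.I_r_closed[of t s] by blast
      then have "p = q" using p.Icarr q.Icarr by blast
      then show ?thesis by simp
    qed
  qed
  ultimately show False using D(2) by (meson finite.insertI finite_subset)
qed

end

section \<open>Homomorphisms and free modules\<close>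

lemma module_homD:
  assumes "h \<in> module_hom R N N'"
  shows "\<And>x. x \<in> carrier N \<Longrightarrow> h x \<in> carrier N'"
    and "\<And>x y. x \<in> carrier N \<Longrightarrow> y \<in> carrier N \<Longrightarrow> h (x \<oplus>\<^bsub>N\<^esub> y) = h x \<oplus>\<^bsub>N'\<^esub> h y"
    and "\<And>r x. r \<in> carrier R \<Longrightarrow> x \<in> carrier N \<Longrightarrow> h (r \<odot>\<^bsub>N\<^esub> x) = r \<odot>\<^bsub>N'\<^esub> h x"
  using assms by (auto simp: module_hom_def)

lemma module_homI:
  assumes "\<And>x. x \<in> carrier N \<Longrightarrow> h x \<in> carrier N'"
    and "\<And>x y. x \<in> carrier N \<Longrightarrow> y \<in> carrier N \<Longrightarrow> h (x \<oplus>\<^bsub>N\<^esub> y) = h x \<oplus>\<^bsub>N'\<^esub> h y"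
    and "\<And>r x. r \<in> carrier R \<Longrightarrow> x \<in> carrier N \<Longrightarrow> h (r \<odot>\<^bsub>N\<^esub> x) = r \<odot>\<^bsub>N'\<^esub> h x"
    and "module R N"
  shows "restrict h (carrier N) \<in> module_hom R N N'"
proof -
  interpret N: module R N by fact
  show ?thesis using assms(1-3) by (auto simp: module_hom_def)
qed

lemma module_hom_zero:
  assumes "module R N" "module R N'" "h \<in> module_hom R N N'"
  shows "h \<zero>\<^bsub>N\<^esub> = \<zero>\<^bsub>N'\<^esub>"
proof -
  interpret N: module R N by fact
  interpret N': module R N' by fact
  show ?thesis using module_homD(3)[OF assms(3), of "\<zero>\<^bsub>R\<^esub>" "\<zero>\<^bsub>N\<^esub>"] module_homD(1)[OF assms(3)] by simp
qed

lemma module_hom_minus: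
  assumes "module R N" "module R N'" "h \<in> module_hom R N N'" "x \<in> carrier N"
  shows "h (\<ominus>\<^bsub>N\<^esub> x) = \<ominus>\<^bsub>N'\<^esub> h x"
proof -
  interpret N: module R N by fact
  interpret N': module R N' by fact
  have "h ((\<ominus>\<^bsub>R\<^esub> \<one>\<^bsub>R\<^esub>) \<odot>\<^bsub>N\<^esub> x) = (\<ominus>\<^bsub>R\<^esub> \<one>\<^bsub>R\<^esub>) \<odot>\<^bsub>N'\<^esub> h x"
    using assms(4) by (intro module_homD(3)[OF assms(3)]) auto
  then show ?thesis
    using assms(4) module_homD(1)[OF assms(3,4)] by (simp add: N.smult_l_minus N'.smult_l_minus)
qed

lemma module_hom_diff:
  assumes "module R N" "module R N'" "h \<in> module_hom R N N'" "x \<in> carrier N" "y \<in> carrier N"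
  shows "h (x \<ominus>\<^bsub>N\<^esub> y) = h x \<ominus>\<^bsub>N'\<^esub> h y"
proof -
  interpret N: module R N by fact
  show ?thesis
    unfolding a_minus_def using module_homD(2)[OF assms(3), of x "\<ominus>\<^bsub>N\<^esub> y"] module_hom_minus[OF assms(1-3)] assms(4,5)
    by simp
qed

lemma module_hom_image:
  assumes "module R N" "module R N'" "h \<in> module_hom R N N'" "submodule K R N"
  shows "submodule (h ` K) R N'"
proof -
  interpret N: module R N by fact
  interpret N': module R N' by fact
  note h = module_homD[OF assms(3)] and K = N.submoduleD[OF assms(4)]
  show ?thesis
  proof (rule N'.submoduleI)
    show "\<zero>\<^bsub>N'\<^esub> \<in> h ` K" using module_hom_zero[OF assms(1-3)] K(5) by (metis image_eqI)
    fix a assume "a \<in> h ` K"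
    then obtain x where x: "x \<in> K" "a = h x" by blast
    then show "\<ominus>\<^bsub>N'\<^esub> a \<in> h ` K" using module_hom_minus[OF assms(1-3)] K(1,2) by (metis image_eqI)
    fix b assume "b \<in> h ` K"
    then obtain y where y: "y \<in> K" "b = h y" by blast
    then show "a \<oplus>\<^bsub>N'\<^esub> b \<in> h ` K" using x h(2) K(1,4) by (metis image_eqI)
  next
    fix c a assume c: "c \<in> carrier R" and "a \<in> h ` K"
    then obtain x where x: "x \<in> K" "a = h x" by blast
    then show "c \<odot>\<^bsub>N'\<^esub> a \<in> h ` K" using c h(3) K(1,3) by (metis image_eqI)
  qed (use h K in auto)
qed

lemma module_hom_preimage:
  assumes "module R N" "module R N'" "h \<in> module_hom R N N'" "submodule K R N'"
  shows "submodule {x \<in> carrier N. h x \<in> K} R N"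
proof -
  interpret N: module R N by fact
  interpret N': module R N' by fact
  note h = module_homD[OF assms(3)] and K = N'.submoduleD[OF assms(4)]
  show ?thesis
    by (rule N.submoduleI)
      (use h K module_hom_zero[OF assms(1-3)] module_hom_minus[OF assms(1-3)] in auto)
qed

lemma module_hom_compose:
  assumes "module R N" "h \<in> module_hom R N N'" "g \<in> module_hom R N' N''"
  shows "restrict (\<lambda>x. g (h x)) (carrier N) \<in> module_hom R N N''"
  by (rule module_homI) (use module_homD[OF assms(2)] module_homD[OF assms(3)] assms(1) in auto)

definition uvec :: "('a, 'm) ring_scheme \<Rightarrow> 'x \<Rightarrow> 'x \<Rightarrow> 'a"
  where "uvec R b = (\<lambda>x. if x = b then \<one>\<^bsub>R\<^esub> else \<zero>\<^bsub>R\<^esub>)"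

lemma ring_as_module_simps [simp]:
  "carrier (ring_as_module R) = carrier R"
  "\<zero>\<^bsub>ring_as_module R\<^esub> = \<zero>\<^bsub>R\<^esub>"
  "x \<oplus>\<^bsub>ring_as_module R\<^esub> y = x \<oplus>\<^bsub>R\<^esub> y"
  "r \<odot>\<^bsub>ring_as_module R\<^esub> x = r \<otimes>\<^bsub>R\<^esub> x"
  by (simp_all add: ring_as_module_def)

context cring
begin

lemma ring_as_module_is_module: "module R (ring_as_module R)"
proof (intro moduleI abelian_groupI)
  fix x assume "x \<in> carrier (ring_as_module R)"
  then show "\<exists>y\<in>carrier (ring_as_module R). y \<oplus>\<^bsub>ring_as_module R\<^esub> x = \<zero>\<^bsub>ring_as_module R\<^esub>"
    by (intro bexI[of _ "\<ominus> x"]) (auto simp: l_neg)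
qed (auto simp: is_cring a_ac l_distr r_distr m_assoc)

lemma ring_as_module_minus [simp]:
  assumes "x \<in> carrier R"
  shows "\<ominus>\<^bsub>ring_as_module R\<^esub> x = \<ominus> x"
proof -
  interpret M: module R "ring_as_module R" by (rule ring_as_module_is_module)
  have "x \<oplus> \<ominus>\<^bsub>ring_as_module R\<^esub> x = \<zero>" "\<ominus>\<^bsub>ring_as_module R\<^esub> x \<in> carrier R"
    using M.M.r_neg[of x] M.M.a_inv_closed[of x] assms by auto
  then show ?thesis using minus_equality[OF _ assms] assms a_comm by metis
qed

text \<open>This makes \<open>sat\<close>, \<open>nakayama\<close> and
  \<open>noetherian_maximal\<close> available for ideals, so that no separate ideal version of them
  is proved.\<close>

lemma submodule_iff_ideal: "submodule I R (ring_as_module R) \<longleftrightarrow> ideal I R"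
proof -
  interpret M: module R "ring_as_module R" by (rule ring_as_module_is_module)
  show ?thesis
  proof
    assume I: "submodule I R (ring_as_module R)"
    note D = M.submoduleD[OF I]
    show "ideal I R"
    proof (rule idealI[OF ring_axioms])
      show "subgroup I (add_monoid R)"
      proof
        fix x assume "x \<in> I"
        then have "\<ominus> x \<in> I" "x \<in> carrier R" using D(1,2) by (auto simp flip: ring_as_module_minus)
        then show "inv\<^bsub>add_monoid R\<^esub> x \<in> I" by (simp add: a_inv_def)
      qed (use D(1,4,5) in auto)
      fix a x assume "a \<in> I" "x \<in> carrier R"
      then show "x \<otimes> a \<in> I" "a \<otimes> x \<in> I" using D(1,3) m_comm[of a x] by auto
    qed
  next
    assume "ideal I R"
    then interpret I: ideal I R .
    show "submodule I R (ring_as_module R)"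
      by (rule M.submoduleI) (auto simp: I.I_l_closed)
  qed
qed

lemma free_module_module: "module R (free_module R B)"
  by (rule free_module_is_module) (rule is_cring)

lemma free_module_carrier:
  assumes "f \<in> carrier (free_module R B)"
  shows "f x \<in> carrier R" "x \<notin> B \<Longrightarrow> f x = \<zero>" "finite {x. f x \<noteq> \<zero>}"
  using assms by (auto simp: free_module_simps)

lemma free_module_finite_carrier:
  assumes "finite B"
  shows "f \<in> carrier (free_module R B) \<longleftrightarrow> (\<forall>x. f x \<in> carrier R) \<and> (\<forall>x. x \<notin> B \<longrightarrow> f x = \<zero>)"
proof -
  have "finite {x. f x \<noteq> \<zero>}" if "\<forall>x. x \<notin> B \<longrightarrow> f x = \<zero>"
    using that assms by (auto intro: finite_subset[of _ B])
  then show ?thesis by (auto simp: free_module_simps)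
qed

text \<open>An additive inverse is defined through the carrier and so depends formally on
  \<open>B\<close>. Multiplication by \<open>\<ominus> \<one>\<close> does not mention
  \<open>B\<close>, which allows comparing free modules on nested index sets.\<close>

lemma free_module_minus_smult:
  assumes "f \<in> carrier (free_module R B)"
  shows "\<ominus>\<^bsub>free_module R B\<^esub> f = (\<ominus> \<one>) \<odot>\<^bsub>free_module R B\<^esub> f"
proof -
  interpret F: module R "free_module R B" by (rule free_module_module)
  show ?thesis using assms F.smult_l_minus[OF one_closed assms] F.smult_one[OF assms] by simp
qed

lemma free_module_mono: "B' \<subseteq> B \<Longrightarrow> submodule (carrier (free_module R B')) R (free_module R B)"
proof -
  assume "B' \<subseteq> B"
  interpret F: module R "free_module R B" by (rule free_module_module)
  interpret F': module R "free_module R B'" by (rule free_module_module)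
  have eq: "\<ominus>\<^bsub>free_module R B\<^esub> f = (\<ominus> \<one>) \<odot>\<^bsub>free_module R B'\<^esub> f" if "f \<in> carrier (free_module R B)" for f
    using free_module_minus_smult[OF that] by (simp only: free_module_simps(4))
  show "submodule (carrier (free_module R B')) R (free_module R B)"
  proof (rule F.submoduleI)
    show sub: "carrier (free_module R B') \<subseteq> carrier (free_module R B)"
      using \<open>B' \<subseteq> B\<close> by (auto simp: free_module_simps)
    fix f g assume f: "f \<in> carrier (free_module R B')"
    then show "\<ominus>\<^bsub>free_module R B\<^esub> f \<in> carrier (free_module R B')" using eq[of f] sub by auto
    assume g: "g \<in> carrier (free_module R B')"
    show "f \<oplus>\<^bsub>free_module R B\<^esub> g \<in> carrier (free_module R B')"
      using F'.M.a_closed[OF f g] by (simp add: free_module_simps(3))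
  next
    fix c f assume "c \<in> carrier R" and "f \<in> carrier (free_module R B')"
    then show "c \<odot>\<^bsub>free_module R B\<^esub> f \<in> carrier (free_module R B')"
      using F'.smult_closed by (simp add: free_module_simps(4))
  qed (use F'.M.zero_closed in \<open>simp add: free_module_simps(2)\<close>)
qed

lemma free_module_minus:
  assumes "f \<in> carrier (free_module R B)"
  shows "\<ominus>\<^bsub>free_module R B\<^esub> f = (\<lambda>x. \<ominus> f x)"
  using free_module_carrier(1)[OF assms]
  by (simp add: free_module_minus_smult[OF assms] free_module_simps(4) l_minus)

lemma uvec_carrier: "b \<in> B \<Longrightarrow> uvec R b \<in> carrier (free_module R B)"
  by (auto simp: free_module_simps uvec_def intro: finite_subset[of _ "{b}"])

text \<open>Induction on the size of the support, since \<open>B\<close> may be infinite while every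
  vector has finite support: one coordinate is split off as a multiple of its unit vector.\<close>

lemma free_module_spanned:
  assumes L: "submodule L R (free_module R B)" and u: "\<And>b. b \<in> B \<Longrightarrow> uvec R b \<in> L"
  shows "carrier (free_module R B) \<subseteq> L"
proof
  interpret F: module R "free_module R B" by (rule free_module_module)
  note L' = F.submoduleD[OF L]
  fix f assume "f \<in> carrier (free_module R B)"
  then show "f \<in> L"
  proof (induction "card {x. f x \<noteq> \<zero>}" arbitrary: f rule: less_induct)
    case less
    note f = free_module_carrier[OF less.prems]
    show ?case
    proof (cases "{x. f x \<noteq> \<zero>} = {}")
      case True
      then have "f = \<zero>\<^bsub>free_module R B\<^esub>" by (auto simp: free_module_simps)
      then show ?thesis using L'(5) by simp
    next
      case False
      then obtain b where b: "f b \<noteq> \<zero>" "b \<in> B" using f(2) by blast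
      define g where "g = f(b := \<zero>)"
      have sub: "{x. g x \<noteq> \<zero>} \<subset> {x. f x \<noteq> \<zero>}" using b by (auto simp: g_def)
      have "finite {x. g x \<noteq> \<zero>}" using sub f(3) by (auto intro: finite_subset)
      then have g: "g \<in> carrier (free_module R B)" using less.prems by (auto simp: free_module_simps g_def)
      have "g \<in> L" using less.hyps[OF psubset_card_mono[OF f(3) sub] g] .
      moreover have "f = (f b \<odot>\<^bsub>free_module R B\<^esub> uvec R b) \<oplus>\<^bsub>free_module R B\<^esub> g"
        using f(1) by (auto simp: free_module_simps g_def uvec_def)
      ultimately show ?thesis using L'(3)[OF f(1) u[OF b(2)]] L'(4) by metis
    qed
  qed
qed

lemma free_module_hom_unique:
  assumes N: "module R N" and h: "h \<in> module_hom R (free_module R B) N" "h' \<in> module_hom R (free_module R B) N"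
    and eq: "\<And>b. b \<in> B \<Longrightarrow> h (uvec R b) = h' (uvec R b)" and f: "f \<in> carrier (free_module R B)"
  shows "h f = h' f"
proof -
  interpret F: module R "free_module R B" by (rule free_module_module)
  interpret N: module R N by fact
  have "submodule {f \<in> carrier (free_module R B). h f = h' f} R (free_module R B)"
    by (rule F.submoduleI)
      (use module_homD[OF h(1)] module_homD[OF h(2)] module_hom_zero[OF free_module_module N h(1)]
          module_hom_zero[OF free_module_module N h(2)] module_hom_minus[OF free_module_module N h(1)]
          module_hom_minus[OF free_module_module N h(2)] in auto)
  from free_module_spanned[OF this] show ?thesis using f eq by (auto simp: uvec_carrier)
qed

lemma free_module_hom_exists:
  fixes B :: "'x set"
  assumes N: "module R N" and v: "\<And>b. b \<in> B \<Longrightarrow> v b \<in> carrier N"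
  shows "\<exists>h\<in>module_hom R (free_module R B) N. \<forall>b\<in>B. h (uvec R b) = v b"
proof -
  interpret N: module R N by fact
  define F where "F = free_module R B"
  interpret F: module R F unfolding F_def by (rule free_module_module)
  define s where "s f = {x. f x \<noteq> \<zero>}" for f :: "'x \<Rightarrow> 'a"
  define h where "h = (\<lambda>f. \<Oplus>\<^bsub>N\<^esub>x\<in>s f. f x \<odot>\<^bsub>N\<^esub> v x)"
  have s: "finite (s f)" "s f \<subseteq> B" "\<And>x. f x \<in> carrier R" if "f \<in> carrier F" for f
    using that by (auto simp: F_def free_module_simps s_def)
  \<comment> \<open>Different vectors have different supports. Summing over a common finite superset
    makes additivity a termwise computation.\<close>
  have h_eq: "h f = (\<Oplus>\<^bsub>N\<^esub>x\<in>S. f x \<odot>\<^bsub>N\<^esub> v x)"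
    if f: "f \<in> carrier F" and S: "finite S" "s f \<subseteq> S" "S \<subseteq> B" for f S
    unfolding h_def
  proof (rule N.add.finprod_mono_neutral_cong_left)
    show "f i \<odot>\<^bsub>N\<^esub> v i = \<zero>\<^bsub>N\<^esub>" if "i \<in> S - s f" for i
      using that S v by (auto simp: s_def)
  qed (use S s[OF f] v in auto)
  have "restrict h (carrier F) \<in> module_hom R F N"
  proof (rule module_homI[OF _ _ _ F.module_axioms])
    show "h f \<in> carrier N" if "f \<in> carrier F" for f
      using s[OF that] v by (auto simp: h_def intro!: N.finsum_closed)
  next
    fix f f' assume f: "f \<in> carrier F" and f': "f' \<in> carrier F"
    define S where "S = s f \<union> s f'"
    have S: "finite S" "S \<subseteq> B" using s f f' by (auto simp: S_def)
    have ff: "f \<oplus>\<^bsub>F\<^esub> f' \<in> carrier F" using f f' by blast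
    have "s (f \<oplus>\<^bsub>F\<^esub> f') \<subseteq> S" by (auto simp: S_def s_def F_def free_module_simps)
    then have "h (f \<oplus>\<^bsub>F\<^esub> f') = (\<Oplus>\<^bsub>N\<^esub>x\<in>S. (f x \<oplus> f' x) \<odot>\<^bsub>N\<^esub> v x)"
      using h_eq[OF ff S(1) _ S(2)] by (simp add: F_def free_module_simps)
    also have "\<dots> = (\<Oplus>\<^bsub>N\<^esub>x\<in>S. f x \<odot>\<^bsub>N\<^esub> v x \<oplus>\<^bsub>N\<^esub> f' x \<odot>\<^bsub>N\<^esub> v x)"
      using S s f f' v by (intro N.finsum_cong) (auto simp: N.smult_l_distr subset_iff simp_implies_def)
    also have "\<dots> = (\<Oplus>\<^bsub>N\<^esub>x\<in>S. f x \<odot>\<^bsub>N\<^esub> v x) \<oplus>\<^bsub>N\<^esub> (\<Oplus>\<^bsub>N\<^esub>x\<in>S. f' x \<odot>\<^bsub>N\<^esub> v x)"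
      using S s f f' v by (intro N.finsum_addf) auto
    also have "\<dots> = h f \<oplus>\<^bsub>N\<^esub> h f'"
      using h_eq[OF f S(1) _ S(2)] h_eq[OF f' S(1) _ S(2)] by (simp add: S_def)
    finally show "h (f \<oplus>\<^bsub>F\<^esub> f') = h f \<oplus>\<^bsub>N\<^esub> h f'" .
  next
    fix r f assume r: "r \<in> carrier R" and f: "f \<in> carrier F"
    have rf: "r \<odot>\<^bsub>F\<^esub> f \<in> carrier F" using r f by blast
    have "s (r \<odot>\<^bsub>F\<^esub> f) \<subseteq> s f" using r by (auto simp: s_def F_def free_module_simps)
    then have "h (r \<odot>\<^bsub>F\<^esub> f) = (\<Oplus>\<^bsub>N\<^esub>x\<in>s f. (r \<otimes> f x) \<odot>\<^bsub>N\<^esub> v x)"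
      using h_eq[OF rf s(1)[OF f] _ s(2)[OF f]] by (simp add: F_def free_module_simps)
    also have "\<dots> = (\<Oplus>\<^bsub>N\<^esub>x\<in>s f. r \<odot>\<^bsub>N\<^esub> (f x \<odot>\<^bsub>N\<^esub> v x))"
      using s[OF f] r v by (intro N.finsum_cong) (auto simp: N.smult_assoc1 subset_iff simp_implies_def)
    also have "\<dots> = r \<odot>\<^bsub>N\<^esub> (\<Oplus>\<^bsub>N\<^esub>x\<in>s f. f x \<odot>\<^bsub>N\<^esub> v x)"
      using s[OF f] r v by (intro N.finsum_smult_ldistr[symmetric]) auto
    finally show "h (r \<odot>\<^bsub>F\<^esub> f) = r \<odot>\<^bsub>N\<^esub> h f" by (simp add: h_def)
  qed
  moreover have "h (uvec R b) = v b" if b: "b \<in> B" for b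
  proof -
    have "h (uvec R b) = (\<Oplus>\<^bsub>N\<^esub>x\<in>{b}. uvec R b x \<odot>\<^bsub>N\<^esub> v x)"
      using b uvec_carrier[OF b] by (intro h_eq) (auto simp: F_def s_def uvec_def)
    then show ?thesis using v[OF b] by (simp add: N.finsum_insert uvec_def)
  qed
  ultimately show ?thesis unfolding F_def
    by (intro bexI[of _ "restrict h (carrier (free_module R B))"]) (auto simp: uvec_carrier)
qed

text \<open>Projectivity of free modules: choose preimages of the images of the unit vectors and
  extend linearly. All chain maps, homotopies and local splittings below are obtained this
  way.\<close>

lemma free_module_lift:
  assumes N: "module R N" and P: "module R P"
    and \<phi>: "\<phi> \<in> module_hom R (free_module R B) N" and \<pi>: "\<pi> \<in> module_hom R P N"
    and sub: "\<And>b. b \<in> B \<Longrightarrow> \<phi> (uvec R b) \<in> \<pi> ` carrier P"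
  shows "\<exists>\<psi>\<in>module_hom R (free_module R B) P. \<forall>f\<in>carrier (free_module R B). \<pi> (\<psi> f) = \<phi> f"
proof -
  have "\<forall>b\<in>B. \<exists>y. y \<in> carrier P \<and> \<pi> y = \<phi> (uvec R b)" using sub by force
  then obtain v where v: "\<And>b. b \<in> B \<Longrightarrow> v b \<in> carrier P" "\<And>b. b \<in> B \<Longrightarrow> \<pi> (v b) = \<phi> (uvec R b)"
    using bchoice[of B "\<lambda>b y. y \<in> carrier P \<and> \<pi> y = \<phi> (uvec R b)"] by blast
  obtain \<psi> where \<psi>: "\<psi> \<in> module_hom R (free_module R B) P" "\<And>b. b \<in> B \<Longrightarrow> \<psi> (uvec R b) = v b"
    using free_module_hom_exists[OF P, of B v] v(1) by blast
  note c = module_hom_compose[OF free_module_module \<psi>(1) \<pi>]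
  have "restrict (\<lambda>f. \<pi> (\<psi> f)) (carrier (free_module R B)) f = \<phi> f" if "f \<in> carrier (free_module R B)" for f
    by (rule free_module_hom_unique[OF N c \<phi> _ that]) (simp add: \<psi>(2) v(2) uvec_carrier)
  then show ?thesis using \<psi>(1) by (intro bexI[of _ \<psi>]) auto
qed

end

section \<open>Noetherian free modules of finite rank\<close>

locale noetherian_cring = cring R + noetherian_ring R for R (structure)
begin

lemma noetherian_ring_as_module: "noetherian_module R (ring_as_module R)"
  unfolding noetherian_module_def fg_sub_def
proof (intro allI impI)
  fix I assume "submodule I R (ring_as_module R)"
  then have "ideal I R" by (simp add: submodule_iff_ideal)
  then obtain S where S: "S \<subseteq> carrier R" "finite S" "I = Idl S" using finetely_gen by blast
  show "\<exists>S\<subseteq>I. finite S \<and> (\<forall>L. submodule L R (ring_as_module R) \<and> S \<subseteq> L \<longrightarrow> I \<subseteq> L)"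
  proof (intro exI[of _ S] conjI allI impI)
    show "S \<subseteq> I" using genideal_self[OF S(1)] S(3) by simp
    fix L assume "submodule L R (ring_as_module R) \<and> S \<subseteq> L"
    then show "I \<subseteq> L" unfolding S(3) submodule_iff_ideal by (intro genideal_minimal) auto
  qed (rule S(2))
qed

text \<open>Induction along the coordinate projection \<open>ev\<close> at \<open>b\<close>, whose
  kernel is the free module on \<open>B\<close>. A submodule is generated by generators of its part
  in the kernel together with lifts of generators of its image under \<open>ev\<close>.\<close>

lemma noetherian_free_module:
  fixes B :: "'x set"
  assumes "finite B"
  shows "noetherian_module R (free_module R B)"
  using assms
proof (induction B rule: finite_induct)
  case empty
  interpret F: module R "free_module R ({} :: 'x set)" by (rule free_module_module)
  have c: "carrier (free_module R ({} :: 'x set)) = {\<zero>\<^bsub>free_module R ({} :: 'x set)\<^esub>}" by (auto simp: free_module_simps)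
  show ?case unfolding noetherian_module_def fg_sub_def
  proof (intro allI impI exI[of _ "{}"] conjI)
    fix N L :: "('x \<Rightarrow> 'a) set"
    assume "submodule N R (free_module R ({} :: 'x set))" "submodule L R (free_module R ({} :: 'x set)) \<and> {} \<subseteq> L"
    then show "N \<subseteq> L" using F.submoduleD(1)[of N] F.submodule_zero[of L] unfolding c by blast
  qed auto
next
  case (insert b B)
  interpret M: module R "ring_as_module R" by (rule ring_as_module_is_module)
  interpret F: module R "free_module R B" by (rule free_module_module)
  interpret G: module R "free_module R (insert b B)" by (rule free_module_module)
  define ev where "ev = (\<lambda>f\<in>carrier (free_module R (insert b B)). f b)"
  have ev: "ev \<in> module_hom R (free_module R (insert b B)) (ring_as_module R)"
    unfolding ev_def
    by (rule module_homI[OF _ _ _ G.module_axioms]) (auto simp: free_module_simps(3,4) free_module_carrier(1))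
  have sub: "submodule (carrier (free_module R B)) R (free_module R (insert b B))"
    by (rule free_module_mono) auto
  show ?case unfolding noetherian_module_def
  proof (intro allI impI)
    fix N assume N: "submodule N R (free_module R (insert b B))"
    note N' = G.submoduleD[OF N]
    have "fg_sub R (ring_as_module R) (ev ` N)"
      using noetherian_ring_as_module module_hom_image[OF G.module_axioms M.module_axioms ev N]
      by (simp add: noetherian_module_def)
    then obtain T where T: "T \<subseteq> ev ` N" "finite T"
      "\<And>L. submodule L R (ring_as_module R) \<Longrightarrow> T \<subseteq> L \<Longrightarrow> ev ` N \<subseteq> L" using fg_subE by blast
    obtain T' where T': "T' \<subseteq> N" "finite T'" "T = ev ` T'" using finite_subset_image[OF T(2,1)] by blast
    define K where "K = N \<inter> carrier (free_module R B)"
    have K: "submodule K R (free_module R B)"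
    proof (rule F.submoduleI)
      fix f assume f: "f \<in> K"
      \<comment> \<open>The two inverses are sought in different carriers, but both are the
        pointwise inverse.\<close>
      then have "\<ominus>\<^bsub>free_module R (insert b B)\<^esub> f = \<ominus>\<^bsub>free_module R B\<^esub> f"
        using free_module_minus[of f B] free_module_minus[of f "insert b B"] N'(1)[of f] by (simp add: K_def)
      then show "\<ominus>\<^bsub>free_module R B\<^esub> f \<in> K" using f N'(2)[of f] by (auto simp: K_def)
      fix g assume "g \<in> K"
      then show "f \<oplus>\<^bsub>free_module R B\<^esub> g \<in> K" using f N'(4) F.M.a_closed by (auto simp: K_def free_module_simps(3))
    next
      fix c f assume "c \<in> carrier R" "f \<in> K"
      then show "c \<odot>\<^bsub>free_module R B\<^esub> f \<in> K" using N'(3) F.smult_closed by (auto simp: K_def free_module_simps(4))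
    next
      show "\<zero>\<^bsub>free_module R B\<^esub> \<in> K" using N'(5) F.M.zero_closed by (auto simp: K_def free_module_simps(2))
    qed (auto simp: K_def)
    then have "fg_sub R (free_module R B) K" using insert.IH by (simp add: noetherian_module_def)
    then obtain S where S: "S \<subseteq> K" "finite S"
      "\<And>L. submodule L R (free_module R B) \<Longrightarrow> S \<subseteq> L \<Longrightarrow> K \<subseteq> L" using fg_subE by blast
    have "N \<subseteq> L" if L: "submodule L R (free_module R (insert b B))" "S \<union> T' \<subseteq> L" for L
    proof
      fix f assume f: "f \<in> N"
      \<comment> \<open>Working with \<open>L \<inter> N\<close> instead of \<open>L\<close> yields
        a preimage \<open>g\<close> that also lies in \<open>N\<close>, so that the difference of
        \<open>f\<close> and \<open>g\<close> falls into \<open>K\<close>.\<close>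
      have LN: "submodule (L \<inter> N) R (free_module R (insert b B))" by (rule G.submodule_Int[OF L(1) N])
      have "T \<subseteq> ev ` (L \<inter> N)" using T' L(2) by auto
      then have "ev ` N \<subseteq> ev ` (L \<inter> N)"
        by (intro T(3) module_hom_image[OF G.module_axioms M.module_axioms ev LN])
      then obtain g where g: "g \<in> L" "g \<in> N" "ev f = ev g" using f by blast
      have car: "f \<in> carrier (free_module R (insert b B))" "g \<in> carrier (free_module R (insert b B))"
        using f g N'(1) by auto
      let ?d = "f \<ominus>\<^bsub>free_module R (insert b B)\<^esub> g"
      have d: "?d = (\<lambda>x. f x \<ominus> g x)" using car by (simp add: a_minus_def free_module_minus free_module_simps(3))
      have "?d \<in> N" using G.submodule_minus[OF N f g(2)] .
      moreover have "?d \<in> carrier (free_module R B)"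
        unfolding d free_module_finite_carrier[OF insert.hyps(1)]
      proof (intro conjI allI impI)
        fix x
        note fg = free_module_carrier[OF car(1)] free_module_carrier[OF car(2)]
        show "f x \<ominus> g x \<in> carrier R" using fg by simp
        assume "x \<notin> B"
        then have "f x = g x" using g(3) car fg by (cases "x = b") (auto simp: ev_def)
        then show "f x \<ominus> g x = \<zero>" using fg by (simp add: r_right_minus_eq)
      qed
      ultimately have "?d \<in> K" by (simp add: K_def)
      moreover have "submodule (L \<inter> K) R (free_module R B)"
      proof (rule F.submoduleI)
        note L' = G.submoduleD[OF L(1)] and K' = F.submoduleD[OF K]
        fix f assume f: "f \<in> L \<inter> K"
        then have "\<ominus>\<^bsub>free_module R (insert b B)\<^esub> f = \<ominus>\<^bsub>free_module R B\<^esub> f"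
          using free_module_minus[of f B] free_module_minus[of f "insert b B"] L'(1)[of f] K'(1)[of f] by simp
        then show "\<ominus>\<^bsub>free_module R B\<^esub> f \<in> L \<inter> K" using f L'(2)[of f] K'(2)[of f] by auto
        fix g assume "g \<in> L \<inter> K"
        then show "f \<oplus>\<^bsub>free_module R B\<^esub> g \<in> L \<inter> K"
          using f L'(4)[of f g] K'(4)[of f g] by (auto simp: free_module_simps(3))
      next
        fix c f assume "c \<in> carrier R" "f \<in> L \<inter> K"
        then show "c \<odot>\<^bsub>free_module R B\<^esub> f \<in> L \<inter> K"
          using G.submoduleD(3)[OF L(1), of c f] F.submoduleD(3)[OF K, of c f] by (auto simp: free_module_simps(4))
      next
        show "\<zero>\<^bsub>free_module R B\<^esub> \<in> L \<inter> K"
          using G.submodule_zero[OF L(1)] F.submodule_zero[OF K] by (auto simp: free_module_simps(2))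
      qed (use F.submoduleD(1)[OF K] in auto)
      then have "K \<subseteq> L" using S(1) L(2) S(3)[of "L \<inter> K"] by blast
      ultimately have "?d \<in> L" by blast
      then have "g \<oplus>\<^bsub>free_module R (insert b B)\<^esub> ?d \<in> L" using G.submoduleD(4)[OF L(1) g(1)] by blast
      moreover have "g \<oplus>\<^bsub>free_module R (insert b B)\<^esub> ?d = f"
        using free_module_carrier(1)[OF car(1)] free_module_carrier(1)[OF car(2)]
        unfolding d free_module_simps(3) by (auto simp: a_minus_def a_lcomm[of "g _" "f _"] r_neg intro!: ext)
      ultimately show "f \<in> L" by simp
    qed
    then show "fg_sub R (free_module R (insert b B)) N"
      unfolding fg_sub_def using S T' by (intro exI[of _ "S \<union> T'"]) (auto simp: K_def)
  qed
qed

end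

text \<open>Numbering the generators makes an initial segment of the naturals the index set, so that
  all modules of a resolution built from such covers share one index type.\<close>

lemma fg_cover:
  fixes R (structure)
  assumes "cring R" and N: "module R N" and K: "submodule K R N" "fg_sub R N K"
  shows "\<exists>(n :: nat) h. h \<in> module_hom R (free_module R {..<n}) N \<and> h ` carrier (free_module R {..<n}) = K"
proof -
  interpret cring R by fact
  interpret N: module R N by fact
  obtain S where S: "S \<subseteq> K" "finite S" "\<And>L. submodule L R N \<Longrightarrow> S \<subseteq> L \<Longrightarrow> K \<subseteq> L"
    using K(2) fg_subE by blast
  obtain s where s: "bij_betw s {..<card S} S"
    using ex_bij_betw_nat_finite[OF S(2)] by (auto simp: atLeast0LessThan)
  let ?F = "free_module R {..<card S}"
  note F = free_module_module[of "{..<card S}"]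
  have sK: "s i \<in> K" if "i < card S" for i using s that S(1) by (auto simp: bij_betw_def)
  obtain h where h: "h \<in> module_hom R ?F N" "\<And>i. i < card S \<Longrightarrow> h (uvec R i) = s i"
    using free_module_hom_exists[OF N, of "{..<card S}" s] sK N.submoduleD(1)[OF K(1)] by auto
  have "h ` carrier ?F \<subseteq> K"
    using free_module_spanned[OF module_hom_preimage[OF F N h(1) K(1)]] h(2) sK uvec_carrier[of _ "{..<card S}"]
    by auto
  moreover have "K \<subseteq> h ` carrier ?F"
  proof (rule S(3))
    show "submodule (h ` carrier ?F) R N"
      using module_hom_image[OF F N h(1)] module.carrier_is_submodule[OF F] by blast
    have "s i \<in> h ` carrier ?F" if "i < card S" for i
      using h(2)[OF that] uvec_carrier[of i "{..<card S}"] that by (metis image_eqI lessThan_iff)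
    then have "s ` {..<card S} \<subseteq> h ` carrier ?F" by auto
    then show "S \<subseteq> h ` carrier ?F" using s by (simp add: bij_betw_def)
  qed
  ultimately show ?thesis using h(1) by blast
qed

section \<open>Comparison of free resolutions\<close>

text \<open>Since \<open>d i\<close> goes from degree \<open>i + 1\<close> to degree
  \<open>i\<close>, in degree 0 the augmentation \<open>\<epsilon>\<close> takes the place of the
  outgoing differential. With this convention exactness reads the same in every degree.\<close>

definition cycles ::
    "('a, 'm) ring_scheme \<Rightarrow> ('a, 'b, 'n) module_scheme \<Rightarrow> (nat \<Rightarrow> 'x set) \<Rightarrow>
     (nat \<Rightarrow> ('x \<Rightarrow> 'a) \<Rightarrow> ('x \<Rightarrow> 'a)) \<Rightarrow> (('x \<Rightarrow> 'a) \<Rightarrow> 'b) \<Rightarrow> nat \<Rightarrow> ('x \<Rightarrow> 'a) set"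
  where "cycles R M B d \<epsilon> i = {f \<in> carrier (free_module R (B i)).
    (case i of 0 \<Rightarrow> \<epsilon> f = \<zero>\<^bsub>M\<^esub> | Suc j \<Rightarrow> d j f = \<zero>\<^bsub>free_module R (B j)\<^esub>)}"

lemma free_resolutionD:
  assumes "free_resolution R M B d \<epsilon>"
  shows "\<epsilon> \<in> module_hom R (free_module R (B 0)) M"
    and "\<epsilon> ` carrier (free_module R (B 0)) = carrier M"
    and "d i \<in> module_hom R (free_module R (B (Suc i))) (free_module R (B i))"
    and "d i ` carrier (free_module R (B (Suc i))) = cycles R M B d \<epsilon> i"
proof -
  show "d i ` carrier (free_module R (B (Suc i))) = cycles R M B d \<epsilon> i"
    using assms by (cases i) (simp_all add: free_resolution_def Let_def cycles_def)
qed (use assms in \<open>simp_all add: free_resolution_def Let_def\<close>)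

lemma cycles_Suc:
  "f \<in> cycles R M B d \<epsilon> (Suc j) \<longleftrightarrow>
     f \<in> carrier (free_module R (B (Suc j))) \<and> d j f = \<zero>\<^bsub>free_module R (B j)\<^esub>"
  by (simp add: cycles_def)

lemma cycles_0:
  "f \<in> cycles R M B d \<epsilon> 0 \<longleftrightarrow> f \<in> carrier (free_module R (B 0)) \<and> \<epsilon> f = \<zero>\<^bsub>M\<^esub>"
  by (simp add: cycles_def)

lemma finite_free_resolution_exists:
  fixes R :: "('a, 'm) ring_scheme" and M :: "('a, 'b, 'n) module_scheme"
  assumes R: "noetherian_cring R" and M: "module R M" "finitely_generated_module R M"
  shows "\<exists>(B :: nat \<Rightarrow> nat set) d \<epsilon>. free_resolution R M B d \<epsilon> \<and> (\<forall>i. finite (B i))"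
proof -
  interpret noetherian_cring R by fact
  interpret M: module R M by fact
  define F where "F = (\<lambda>n. free_module R {..<n :: nat})"
  have F: "module R (F n)" for n unfolding F_def by (rule free_module_module)
  have "fg_sub R M (carrier M)"
    using M(2) unfolding finitely_generated_module_def fg_sub_def by blast
  then obtain n0 \<epsilon> where \<epsilon>: "\<epsilon> \<in> module_hom R (F n0) M" "\<epsilon> ` carrier (F n0) = carrier M"
    using fg_cover[OF is_cring M(1) M.carrier_is_submodule] unfolding F_def by blast
  \<comment> \<open>A state of the recursion is a rank together with the kernel that the next
    differential has to cover. That kernel is finitely generated because a free module of finite
    rank is noetherian.\<close>
  define ok where "ok = (\<lambda>(n, K). submodule K R (F n))"
  define step where "step = (\<lambda>(n, K) (n', K') h. h \<in> module_hom R (F n') (F n) \<and>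
     h ` carrier (F n') = K \<and> K' = {f \<in> carrier (F n'). h f = \<zero>\<^bsub>F n\<^esub>})"
  have "\<exists>q'. ok q' \<and> (\<exists>h. step q q' h)" if q: "ok q" for q
  proof -
    obtain n K where [simp]: "q = (n, K)" by (cases q)
    have K: "submodule K R (F n)" using q by (simp add: ok_def)
    have "fg_sub R (F n) K"
      using noetherian_free_module[of "{..<n}"] K by (simp add: noetherian_module_def F_def)
    then obtain n' h where h: "h \<in> module_hom R (F n') (F n)" "h ` carrier (F n') = K"
      using fg_cover[OF is_cring F K] unfolding F_def by blast
    show ?thesis
      using h module_hom_kernel[OF F F h(1)]
      by (intro exI[of _ "(n', {f \<in> carrier (F n'). h f = \<zero>\<^bsub>F n\<^esub>})"]) (auto simp: ok_def step_def)
  qed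
  moreover have "ok (n0, {f \<in> carrier (F n0). \<epsilon> f = \<zero>\<^bsub>M\<^esub>})"
    using module_hom_kernel[OF F M(1) \<epsilon>(1)] by (simp add: ok_def)
  ultimately have "\<exists>q. \<forall>n. (ok (q n) \<and> (n = 0 \<longrightarrow> q n = (n0, {f \<in> carrier (F n0). \<epsilon> f = \<zero>\<^bsub>M\<^esub>}))) \<and>
      (\<exists>h. step (q n) (q (Suc n)) h)"
    by (intro dependent_nat_choice) auto
  then obtain q where q0: "q 0 = (n0, {f \<in> carrier (F n0). \<epsilon> f = \<zero>\<^bsub>M\<^esub>})"
    and q: "\<And>n. \<exists>h. step (q n) (q (Suc n)) h"
    by blast
  then obtain d where d: "\<And>n. step (q n) (q (Suc n)) (d n)"
    using choice[of "\<lambda>n h. step (q n) (q (Suc n)) h"] by blast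
  have step: "d n \<in> module_hom R (F (fst (q (Suc n)))) (F (fst (q n)))"
    "d n ` carrier (F (fst (q (Suc n)))) = snd (q n)"
    "snd (q (Suc n)) = {f \<in> carrier (F (fst (q (Suc n)))). d n f = \<zero>\<^bsub>F (fst (q n))\<^esub>}" for n
    using d[of n] unfolding step_def by (auto simp: split_beta)
  have "free_resolution R M (\<lambda>n. {..<fst (q n)}) d \<epsilon>"
    unfolding free_resolution_def Let_def
    using \<epsilon> step q0 by (auto simp: F_def)
  then show ?thesis by blast
qed

context
  fixes R :: "('a, 'm) ring_scheme" (structure) and M :: "('a, 'b, 'n) module_scheme"
  assumes R: "cring R" and M: "module R M"
begin

interpretation cring R by (rule R)

lemma resolution_map_exists:
  fixes B :: "nat \<Rightarrow> 'x set" and C :: "nat \<Rightarrow> 'y set"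
  assumes F: "free_resolution R M B d \<epsilon>" and G: "free_resolution R M C d' \<eta>"
  shows "\<exists>g. (\<forall>i. g i \<in> module_hom R (free_module R (C i)) (free_module R (B i))) \<and>
    (\<forall>x\<in>carrier (free_module R (C 0)). \<epsilon> (g 0 x) = \<eta> x) \<and>
    (\<forall>i. \<forall>x\<in>carrier (free_module R (C (Suc i))). d i (g (Suc i) x) = g i (d' i x))"
proof -
  note F = free_resolutionD[OF F] and G = free_resolutionD[OF G]
  let ?F = "\<lambda>i. free_module R (B i)" and ?G = "\<lambda>i. free_module R (C i)"
  \<comment> \<open>The recursion must remember that \<open>g\<close> respects cycles: the cycles of
    the target are boundaries, and this is what permits the lift in the next degree.\<close>
  define P where "P i g \<longleftrightarrow> g \<in> module_hom R (?G i) (?F i) \<and>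
      g ` cycles R M C d' \<eta> i \<subseteq> cycles R M B d \<epsilon> i \<and>
      (i = 0 \<longrightarrow> (\<forall>x\<in>carrier (?G 0). \<epsilon> (g x) = \<eta> x))" for i g
  have base: "\<exists>g. P 0 g"
  proof -
    have "\<exists>g\<in>module_hom R (?G 0) (?F 0). \<forall>x\<in>carrier (?G 0). \<epsilon> (g x) = \<eta> x"
      using module_homD(1)[OF G(1)] uvec_carrier[of _ "C 0"] unfolding F(2)[symmetric]
      by (intro free_module_lift[OF M free_module_module G(1) F(1)]) auto
    then obtain g where g: "g \<in> module_hom R (?G 0) (?F 0)" "\<forall>x\<in>carrier (?G 0). \<epsilon> (g x) = \<eta> x" by blast
    then show ?thesis using module_homD(1)[OF g(1)] by (auto simp: P_def cycles_0)
  qed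
  have step: "\<exists>g'. P (Suc i) g' \<and> (\<forall>x\<in>carrier (?G (Suc i)). d i (g' x) = g (d' i x))" if "P i g" for i g
  proof -
    have g: "g \<in> module_hom R (?G i) (?F i)" "g ` cycles R M C d' \<eta> i \<subseteq> cycles R M B d \<epsilon> i"
      using that by (auto simp: P_def)
    have "\<exists>g'\<in>module_hom R (?G (Suc i)) (?F (Suc i)). \<forall>x\<in>carrier (?G (Suc i)).
        d i (g' x) = restrict (\<lambda>x. g (d' i x)) (carrier (?G (Suc i))) x"
    proof (rule free_module_lift[OF free_module_module free_module_module
          module_hom_compose[OF free_module_module G(3) g(1)] F(3)])
      fix b assume b: "b \<in> C (Suc i)"
      have "d' i (uvec R b) \<in> cycles R M C d' \<eta> i" using G(4)[of i] uvec_carrier[OF b] by blast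
      then show "restrict (\<lambda>x. g (d' i x)) (carrier (?G (Suc i))) (uvec R b) \<in> d i ` carrier (?F (Suc i))"
        using g(2) uvec_carrier[OF b] unfolding F(4) by auto
    qed
    then obtain g' where g': "g' \<in> module_hom R (?G (Suc i)) (?F (Suc i))"
      "\<And>x. x \<in> carrier (?G (Suc i)) \<Longrightarrow> d i (g' x) = g (d' i x)" by auto
    have "P (Suc i) g'"
      unfolding P_def
      using g' module_homD(1)[OF g'(1)] module_hom_zero[OF free_module_module free_module_module g(1)]
      by (auto simp: cycles_Suc)
    then show ?thesis using g'(2) by blast
  qed
  have "\<exists>g. \<forall>i. P i (g i) \<and> (\<forall>x\<in>carrier (?G (Suc i)). d i (g (Suc i) x) = g i (d' i x))"
    using base step by (intro dependent_nat_choice) auto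
  then obtain g where "\<And>i. P i (g i)" "\<And>i x. x \<in> carrier (?G (Suc i)) \<Longrightarrow> d i (g (Suc i) x) = g i (d' i x)"
    by blast
  then show ?thesis by (intro exI[of _ g]) (auto simp: P_def)
qed

text \<open>This is the homotopy between \<open>\<phi>\<close> and the identity, recorded on cycles
  only: there the second homotopy term, which passes through the differential, vanishes.\<close>

lemma resolution_homotopy:
  fixes B :: "nat \<Rightarrow> 'x set"
  assumes F: "free_resolution R M B d \<epsilon>"
    and \<phi>: "\<And>i. \<phi> i \<in> module_hom R (free_module R (B i)) (free_module R (B i))"
      "\<And>x. x \<in> carrier (free_module R (B 0)) \<Longrightarrow> \<epsilon> (\<phi> 0 x) = \<epsilon> x"
      "\<And>i x. x \<in> carrier (free_module R (B (Suc i))) \<Longrightarrow> d i (\<phi> (Suc i) x) = \<phi> i (d i x)"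
  shows "\<exists>s\<in>module_hom R (free_module R (B i)) (free_module R (B (Suc i))).
    \<forall>z\<in>cycles R M B d \<epsilon> i. d i (s z) = z \<ominus>\<^bsub>free_module R (B i)\<^esub> \<phi> i z"
proof -
  note F = free_resolutionD[OF F]
  let ?F = "\<lambda>i. free_module R (B i)"
  interpret F: module R "?F n" for n by (rule free_module_module)
  interpret M: module R M by (rule M)
  note d = module_homD[OF F(3)] and p = module_homD[OF \<phi>(1)]
  show ?thesis
  proof (induction i)
    case 0
    let ?t = "restrict (\<lambda>x. x \<ominus>\<^bsub>?F 0\<^esub> \<phi> 0 x) (carrier (?F 0))"
    have t: "?t \<in> module_hom R (?F 0) (?F 0)"
      using module_homD[OF \<phi>(1)[of 0]] by (intro module_homI)
        (auto simp: a_minus_def F.M.minus_add F.M.a_ac F.smult_r_distr F.smult_r_minus F.module_axioms)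
    have "\<exists>s\<in>module_hom R (?F 0) (?F (Suc 0)). \<forall>x\<in>carrier (?F 0). d 0 (s x) = ?t x"
    proof (rule free_module_lift[OF free_module_module free_module_module t F(3)])
      fix b assume b: "b \<in> B 0"
      note u = uvec_carrier[OF b]
      have "\<epsilon> (uvec R b \<ominus>\<^bsub>?F 0\<^esub> \<phi> 0 (uvec R b)) = \<zero>\<^bsub>M\<^esub>"
        using module_hom_diff[OF F.module_axioms M F(1) u p(1)[OF u]] \<phi>(2)[OF u] module_homD(1)[OF F(1) u]
        by (simp add: a_minus_def M.M.r_neg)
      then show "?t (uvec R b) \<in> d 0 ` carrier (?F (Suc 0))"
        unfolding F(4) using u p(1)[OF u] by (simp add: cycles_0)
    qed
    then obtain s where "s \<in> module_hom R (?F 0) (?F (Suc 0))" "\<And>x. x \<in> carrier (?F 0) \<Longrightarrow> d 0 (s x) = ?t x" by blast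
    then show ?case by (intro bexI[of _ s]) (auto simp: cycles_0)
  next
    case (Suc i)
    then obtain s where s: "s \<in> module_hom R (?F i) (?F (Suc i))"
      "\<And>z. z \<in> cycles R M B d \<epsilon> i \<Longrightarrow> d i (s z) = z \<ominus>\<^bsub>?F i\<^esub> \<phi> i z" by blast
    note s' = module_homD[OF s(1)]
    \<comment> \<open>By the induction hypothesis for the cycle \<open>d i x\<close>, the element
      \<open>x - \<phi> x - s (d x)\<close> is again a cycle. It is hence a boundary, and lifting it
      gives the next \<open>s\<close>.\<close>
    let ?t = "restrict (\<lambda>x. x \<ominus>\<^bsub>?F (Suc i)\<^esub> \<phi> (Suc i) x \<ominus>\<^bsub>?F (Suc i)\<^esub> s (d i x)) (carrier (?F (Suc i)))"
    have t: "?t \<in> module_hom R (?F (Suc i)) (?F (Suc i))"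
      using module_homD[OF \<phi>(1)[of "Suc i"]] s' module_homD[OF F(3)[of i]] by (intro module_homI)
        (auto simp: a_minus_def F.M.minus_add F.M.a_ac F.smult_r_distr F.smult_r_minus F.module_axioms)
    have "\<exists>s\<in>module_hom R (?F (Suc i)) (?F (Suc (Suc i))). \<forall>x\<in>carrier (?F (Suc i)). d (Suc i) (s x) = ?t x"
    proof (rule free_module_lift[OF free_module_module free_module_module t F(3)])
      fix b assume b: "b \<in> B (Suc i)"
      define u where "u = uvec R b"
      have u: "u \<in> carrier (?F (Suc i))" using uvec_carrier[OF b] by (simp add: u_def)
      have du: "d i u \<in> cycles R M B d \<epsilon> i" using F(4)[of i] u by blast
      have "d i (u \<ominus>\<^bsub>?F (Suc i)\<^esub> \<phi> (Suc i) u \<ominus>\<^bsub>?F (Suc i)\<^esub> s (d i u)) =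
          (d i u \<ominus>\<^bsub>?F i\<^esub> d i (\<phi> (Suc i) u)) \<ominus>\<^bsub>?F i\<^esub> d i (s (d i u))"
        using u p(1)[OF u] s'(1)[OF d(1)[OF u]]
        by (simp add: module_hom_diff[OF F.module_axioms F.module_axioms F(3)])
      also have "\<dots> = \<zero>\<^bsub>?F i\<^esub>"
        using u d(1)[OF u] p(1)[OF d(1)[OF u]] by (simp add: s(2)[OF du] \<phi>(3)[OF u] a_minus_def F.M.r_neg)
      finally show "?t (uvec R b) \<in> d (Suc i) ` carrier (?F (Suc (Suc i)))"
        unfolding F(4) using u p(1)[OF u] s'(1)[OF d(1)[OF u]] by (simp add: cycles_Suc flip: u_def)
    qed
    then obtain s'' where s'': "s'' \<in> module_hom R (?F (Suc i)) (?F (Suc (Suc i)))"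
       "\<And>x. x \<in> carrier (?F (Suc i)) \<Longrightarrow> d (Suc i) (s'' x) = ?t x" by blast
    have "d (Suc i) (s'' z) = z \<ominus>\<^bsub>?F (Suc i)\<^esub> \<phi> (Suc i) z" if z: "z \<in> cycles R M B d \<epsilon> (Suc i)" for z
      using z s''(2)[of z] module_hom_zero[OF F.module_axioms F.module_axioms s(1)] p(1)[of z "Suc i"]
      by (simp add: cycles_Suc a_minus_def)
    then show ?case using s''(1) by blast
  qed
qed

text \<open>The map on cohomology induced by a comparison of resolutions is injective.\<close>

lemma coboundary_transfer:
  fixes B :: "nat \<Rightarrow> 'x set" and C :: "nat \<Rightarrow> 'y set"
  assumes F: "free_resolution R M B d \<epsilon>" and G: "free_resolution R M C d' \<eta>"
    and N: "module R N"
    and h: "h \<in> module_hom R (free_module R (B (Suc i))) N"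
    and coc: "\<And>x. x \<in> carrier (free_module R (B (Suc (Suc i)))) \<Longrightarrow> h (d (Suc i) x) = \<zero>\<^bsub>N\<^esub>"
  shows "\<exists>h'\<in>module_hom R (free_module R (C (Suc i))) N.
    (\<forall>x\<in>carrier (free_module R (C (Suc (Suc i)))). h' (d' (Suc i) x) = \<zero>\<^bsub>N\<^esub>) \<and>
    (\<forall>r\<in>carrier R.
      (\<exists>k\<in>module_hom R (free_module R (B i)) N.
        \<forall>x\<in>carrier (free_module R (B (Suc i))). r \<odot>\<^bsub>N\<^esub> h x = k (d i x)) \<longleftrightarrow>
      (\<exists>k\<in>module_hom R (free_module R (C i)) N.
        \<forall>x\<in>carrier (free_module R (C (Suc i))). r \<odot>\<^bsub>N\<^esub> h' x = k (d' i x)))"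
proof -
  let ?F = "\<lambda>i. free_module R (B i)" and ?G = "\<lambda>i. free_module R (C i)"
  interpret F: module R "?F n" for n by (rule free_module_module)
  interpret G: module R "?G n" for n by (rule free_module_module)
  interpret N: module R N by (rule N)
  note F' = free_resolutionD[OF F] and G' = free_resolutionD[OF G]
  obtain g where g: "\<And>i. g i \<in> module_hom R (?G i) (?F i)" "\<And>x. x \<in> carrier (?G 0) \<Longrightarrow> \<epsilon> (g 0 x) = \<eta> x"
    "\<And>i x. x \<in> carrier (?G (Suc i)) \<Longrightarrow> d i (g (Suc i) x) = g i (d' i x)"
    using resolution_map_exists[OF F G] by blast
  obtain f where f: "\<And>i. f i \<in> module_hom R (?F i) (?G i)" "\<And>x. x \<in> carrier (?F 0) \<Longrightarrow> \<eta> (f 0 x) = \<epsilon> x"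
    "\<And>i x. x \<in> carrier (?F (Suc i)) \<Longrightarrow> d' i (f (Suc i) x) = f i (d i x)"
    using resolution_map_exists[OF G F] by blast
  note D = module_homD[OF F'(3)] and D' = module_homD[OF G'(3)]
    and gD = module_homD[OF g(1)] and fD = module_homD[OF f(1)] and hD = module_homD[OF h]
  define \<phi> where "\<phi> i = restrict (\<lambda>x. g i (f i x)) (carrier (?F i))" for i
  have \<phi>: "\<phi> i \<in> module_hom R (?F i) (?F i)" for i
    unfolding \<phi>_def by (rule module_hom_compose[OF F.module_axioms f(1) g(1)])
  have eps: "\<epsilon> (\<phi> 0 x) = \<epsilon> x" if "x \<in> carrier (?F 0)" for x
    using that f(2) g(2) fD by (simp add: \<phi>_def)
  have comm: "d i (\<phi> (Suc i) x) = \<phi> i (d i x)" if "x \<in> carrier (?F (Suc i))" for i x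
    using that f(3) g(3) fD(1) D(1) by (simp add: \<phi>_def)
  have "\<exists>s\<in>module_hom R (?F i) (?F (Suc i)). \<forall>z\<in>cycles R M B d \<epsilon> i. d i (s z) = z \<ominus>\<^bsub>?F i\<^esub> \<phi> i z"
    by (rule resolution_homotopy[OF F \<phi> eps comm])
  then obtain s where s: "s \<in> module_hom R (?F i) (?F (Suc i))"
    "\<And>z. z \<in> cycles R M B d \<epsilon> i \<Longrightarrow> d i (s z) = z \<ominus>\<^bsub>?F i\<^esub> \<phi> i z" by blast
  note sD = module_homD[OF s(1)]
  define h' where "h' = restrict (\<lambda>x. h (g (Suc i) x)) (carrier (?G (Suc i)))"
  have h': "h' \<in> module_hom R (?G (Suc i)) N"
    unfolding h'_def by (rule module_hom_compose[OF G.module_axioms g(1)[of "Suc i"] h])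
  have coc': "h' (d' (Suc i) x) = \<zero>\<^bsub>N\<^esub>" if x: "x \<in> carrier (?G (Suc (Suc i)))" for x
    using g(3)[OF x] coc[OF gD(1)[OF x]] D'(1)[OF x] by (simp add: h'_def)
  \<comment> \<open>With \<open>\<phi> = g \<circ> f\<close> the element \<open>?w\<close> is a
    cycle, hence a boundary, and the cocycle \<open>h\<close> kills it. So \<open>h\<close> and
    \<open>h' \<circ> f\<close> differ by the coboundary of \<open>h \<circ> s\<close>.\<close>
  have decomp: "h x = h' (f (Suc i) x) \<oplus>\<^bsub>N\<^esub> h (s (d i x))" if x: "x \<in> carrier (?F (Suc i))" for x
  proof -
    let ?w = "x \<ominus>\<^bsub>?F (Suc i)\<^esub> \<phi> (Suc i) x \<ominus>\<^bsub>?F (Suc i)\<^esub> s (d i x)"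
    have dx: "d i x \<in> cycles R M B d \<epsilon> i" using F'(4)[of i] x by blast
    have car: "\<phi> (Suc i) x \<in> carrier (?F (Suc i))" "s (d i x) \<in> carrier (?F (Suc i))"
      "\<phi> i (d i x) \<in> carrier (?F i)"
      using module_homD(1)[OF \<phi>] x sD(1) D(1) by blast+
    have "d i ?w = (d i x \<ominus>\<^bsub>?F i\<^esub> \<phi> i (d i x)) \<ominus>\<^bsub>?F i\<^esub> d i (s (d i x))"
      using x car by (simp add: module_hom_diff[OF F.module_axioms F.module_axioms F'(3)] comm)
    also have "\<dots> = \<zero>\<^bsub>?F i\<^esub>" using car D(1)[OF x] by (simp add: s(2)[OF dx] a_minus_def F.M.r_neg)
    finally have "?w \<in> cycles R M B d \<epsilon> (Suc i)" using x car by (simp add: cycles_Suc)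
    then obtain y where "y \<in> carrier (?F (Suc (Suc i)))" "?w = d (Suc i) y"
      unfolding F'(4)[symmetric] by blast
    then have "h ?w = \<zero>\<^bsub>N\<^esub>" using coc by simp
    then have "h x \<ominus>\<^bsub>N\<^esub> h (\<phi> (Suc i) x) \<ominus>\<^bsub>N\<^esub> h (s (d i x)) = \<zero>\<^bsub>N\<^esub>"
      using x car by (simp add: module_hom_diff[OF F.module_axioms N h])
    from this have "h x \<ominus>\<^bsub>N\<^esub> h (\<phi> (Suc i) x) = h (s (d i x))"
      by (rule N.minus_eq_zeroD[rotated 2]) (use hD(1)[OF x] hD(1)[OF car(1)] hD(1)[OF car(2)] in simp_all)
    then have "h x = h (\<phi> (Suc i) x) \<oplus>\<^bsub>N\<^esub> h (s (d i x))"
      using hD(1)[OF x] hD(1)[OF car(1)] hD(1)[OF car(2)]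
      by (metis N.M.a_comm N.M.add.inv_closed N.M.add.inv_solve_right a_minus_def)
    then show ?thesis using x fD(1)[OF x] by (simp add: \<phi>_def h'_def)
  qed
  have "(\<exists>k\<in>module_hom R (?F i) N. \<forall>x\<in>carrier (?F (Suc i)). r \<odot>\<^bsub>N\<^esub> h x = k (d i x)) \<longleftrightarrow>
      (\<exists>k\<in>module_hom R (?G i) N. \<forall>x\<in>carrier (?G (Suc i)). r \<odot>\<^bsub>N\<^esub> h' x = k (d' i x))"
    (is "?L \<longleftrightarrow> ?R") if r: "r \<in> carrier R" for r
  proof
    assume ?L
    then obtain k where k: "k \<in> module_hom R (?F i) N" "\<And>x. x \<in> carrier (?F (Suc i)) \<Longrightarrow> r \<odot>\<^bsub>N\<^esub> h x = k (d i x)"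
      by blast
    let ?k = "restrict (\<lambda>x. k (g i x)) (carrier (?G i))"
    have "?k \<in> module_hom R (?G i) N" by (rule module_hom_compose[OF G.module_axioms g(1) k(1)])
    moreover have "r \<odot>\<^bsub>N\<^esub> h' x = ?k (d' i x)" if x: "x \<in> carrier (?G (Suc i))" for x
      using x k(2)[OF gD(1)[OF x]] g(3)[OF x] D'(1)[OF x] by (simp add: h'_def)
    ultimately show ?R by blast
  next
    assume ?R
    then obtain k where k: "k \<in> module_hom R (?G i) N" "\<And>x. x \<in> carrier (?G (Suc i)) \<Longrightarrow> r \<odot>\<^bsub>N\<^esub> h' x = k (d' i x)"
      by blast
    note kD = module_homD[OF k(1)]
    \<comment> \<open>By \<open>decomp\<close>, \<open>r h\<close> is the sum of
      \<open>r (h' \<circ> f)\<close>, a coboundary through \<open>k \<circ> f\<close>, and the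
      coboundary of \<open>r (h \<circ> s)\<close>.\<close>
    let ?k = "restrict (\<lambda>x. k (f i x) \<oplus>\<^bsub>N\<^esub> r \<odot>\<^bsub>N\<^esub> h (s x)) (carrier (?F i))"
    have "?k \<in> module_hom R (?F i) N"
    proof (rule module_homI[OF _ _ _ F.module_axioms])
      fix x assume x: "x \<in> carrier (?F i)"
      note c = kD(1)[OF fD(1)[OF x]] hD(1)[OF sD(1)[OF x]]
      show "k (f i x) \<oplus>\<^bsub>N\<^esub> r \<odot>\<^bsub>N\<^esub> h (s x) \<in> carrier N" using c r by simp
      {
        fix t assume t: "t \<in> carrier R"
        show "k (f i (t \<odot>\<^bsub>?F i\<^esub> x)) \<oplus>\<^bsub>N\<^esub> r \<odot>\<^bsub>N\<^esub> h (s (t \<odot>\<^bsub>?F i\<^esub> x)) =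
          t \<odot>\<^bsub>N\<^esub> (k (f i x) \<oplus>\<^bsub>N\<^esub> r \<odot>\<^bsub>N\<^esub> h (s x))"
          using t x c r fD(1)[OF x] sD(1)[OF x]
          by (simp add: fD(3) sD(3) kD(3) hD(3) N.smult_r_distr m_comm flip: N.smult_assoc1)
      }
      fix y assume y: "y \<in> carrier (?F i)"
      note c' = kD(1)[OF fD(1)[OF y]] hD(1)[OF sD(1)[OF y]]
      show "k (f i (x \<oplus>\<^bsub>?F i\<^esub> y)) \<oplus>\<^bsub>N\<^esub> r \<odot>\<^bsub>N\<^esub> h (s (x \<oplus>\<^bsub>?F i\<^esub> y)) =
          k (f i x) \<oplus>\<^bsub>N\<^esub> r \<odot>\<^bsub>N\<^esub> h (s x) \<oplus>\<^bsub>N\<^esub> (k (f i y) \<oplus>\<^bsub>N\<^esub> r \<odot>\<^bsub>N\<^esub> h (s y))"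
        using x y c c' r fD(1)[OF x] sD(1)[OF x] fD(1)[OF y] sD(1)[OF y]
        by (simp add: fD(2) sD(2) kD(2) hD(2) N.smult_r_distr N.M.a_ac)
    qed
    moreover have "r \<odot>\<^bsub>N\<^esub> h x = ?k (d i x)" if x: "x \<in> carrier (?F (Suc i))" for x
      using x r decomp[OF x] k(2)[OF fD(1)[OF x]] f(3)[OF x] D(1)[OF x]
        module_homD(1)[OF h' fD(1)[OF x]] hD(1)[OF sD(1)[OF D(1)[OF x]]]
      by (simp add: N.smult_r_distr)
    ultimately show ?L by blast
  qed
  then show ?thesis using h' coc' by blast
qed

end

section \<open>Associated primes of Ext modules\<close>

text \<open>Scalar multiplication on \<open>quotient_module\<close> is a union of cosets over all
  representatives, and this union is \<open>D\<close> exactly when the scalar moves one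
  representative into \<open>D\<close>. Associated primes thus become colons inside
  \<open>C\<close>, where cosets no longer occur.\<close>

lemma associated_primes_quotient:
  assumes Z: "submodule Z R C" and D: "submodule D R C" and C: "module R C"
    and p: "p \<in> associated_primes R (quotient_module (C\<lparr>carrier := Z\<rparr>) D)"
  shows "primeideal p R \<and> (\<exists>z\<in>Z. p = {r \<in> carrier R. r \<odot>\<^bsub>C\<^esub> z \<in> D})"
proof -
  interpret C: module R C by fact
  note ZD = C.submoduleD[OF Z] and DD = C.submoduleD[OF D]
  have self: "x \<in> D +>\<^bsub>C\<lparr>carrier := Z\<rparr>\<^esub> x" if "x \<in> carrier C" for x
    using DD(5) that by (auto simp: a_r_coset_def r_coset_def intro!: bexI[of _ "\<zero>\<^bsub>C\<^esub>"])
  obtain U where p': "primeideal p R" and U: "U \<in> carrier (quotient_module (C\<lparr>carrier := Z\<rparr>) D)"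
    and pU: "p = {r \<in> carrier R. r \<odot>\<^bsub>quotient_module (C\<lparr>carrier := Z\<rparr>) D\<^esub> U = \<zero>\<^bsub>quotient_module (C\<lparr>carrier := Z\<rparr>) D\<^esub>}"
    using p by (auto simp: associated_primes_def Spec_def)
  obtain z where z: "z \<in> Z" "U = D +>\<^bsub>C\<lparr>carrier := Z\<rparr>\<^esub> z"
    using U by (auto simp: quotient_module_def A_RCOSETS_def RCOSETS_def a_r_coset_def)
  have zC: "z \<in> carrier C" using z ZD(1) by blast
  have cos: "D +>\<^bsub>C\<lparr>carrier := Z\<rparr>\<^esub> y = {w \<oplus>\<^bsub>C\<^esub> y | w. w \<in> D}" for y
    by (auto simp: a_r_coset_def r_coset_def)
  have "(\<Union>x\<in>U. D +>\<^bsub>C\<lparr>carrier := Z\<rparr>\<^esub> (r \<odot>\<^bsub>C\<^esub> x)) = D \<longleftrightarrow> r \<odot>\<^bsub>C\<^esub> z \<in> D" if r: "r \<in> carrier R" for r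
  proof
    assume eq: "(\<Union>x\<in>U. D +>\<^bsub>C\<lparr>carrier := Z\<rparr>\<^esub> (r \<odot>\<^bsub>C\<^esub> x)) = D"
    have "z \<in> U" using self[OF zC] z by simp
    then show "r \<odot>\<^bsub>C\<^esub> z \<in> D" using eq self[of "r \<odot>\<^bsub>C\<^esub> z"] r zC by auto
  next
    assume rz: "r \<odot>\<^bsub>C\<^esub> z \<in> D"
    have rx: "r \<odot>\<^bsub>C\<^esub> x \<in> D" if "x \<in> U" for x
    proof -
      have "x \<in> {w \<oplus>\<^bsub>C\<^esub> z | w. w \<in> D}" using that unfolding z(2) cos .
      then obtain w where w: "w \<in> D" "x = w \<oplus>\<^bsub>C\<^esub> z" by blast
      then show ?thesis using rz r zC DD by (simp add: C.smult_r_distr)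
    qed
    have "D +>\<^bsub>C\<lparr>carrier := Z\<rparr>\<^esub> (r \<odot>\<^bsub>C\<^esub> x) = D" if "x \<in> U" for x
    proof
      show "D +>\<^bsub>C\<lparr>carrier := Z\<rparr>\<^esub> (r \<odot>\<^bsub>C\<^esub> x) \<subseteq> D" using rx[OF that] DD(4) by (auto simp: cos)
      show "D \<subseteq> D +>\<^bsub>C\<lparr>carrier := Z\<rparr>\<^esub> (r \<odot>\<^bsub>C\<^esub> x)"
      proof
        fix y assume y: "y \<in> D"
        have "y = (y \<ominus>\<^bsub>C\<^esub> r \<odot>\<^bsub>C\<^esub> x) \<oplus>\<^bsub>C\<^esub> (r \<odot>\<^bsub>C\<^esub> x)"
          using DD(1)[OF y] DD(1)[OF rx[OF that]] by (simp add: a_minus_def C.M.a_assoc C.M.l_neg)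
        then show "y \<in> D +>\<^bsub>C\<lparr>carrier := Z\<rparr>\<^esub> (r \<odot>\<^bsub>C\<^esub> x)"
          unfolding cos using C.submodule_minus[OF D y rx[OF that]] by blast
      qed
    qed
    moreover have "z \<in> U" using self[OF zC] z by simp
    ultimately show "(\<Union>x\<in>U. D +>\<^bsub>C\<lparr>carrier := Z\<rparr>\<^esub> (r \<odot>\<^bsub>C\<^esub> x)) = D" by blast
  qed
  then have "p = {r \<in> carrier R. r \<odot>\<^bsub>C\<^esub> z \<in> D}"
    unfolding pU by (auto simp: quotient_module_def)
  then show ?thesis using p' z by blast
qed

section \<open>Hom modules and their cohomology in terms of cocycles\<close>

lemma Hom_module_simps [simp]:
  "carrier (Hom_module R M N) = module_hom R M N"
  "\<zero>\<^bsub>Hom_module R M N\<^esub> = (\<lambda>x\<in>carrier M. \<zero>\<^bsub>N\<^esub>)"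
  "g \<oplus>\<^bsub>Hom_module R M N\<^esub> h = (\<lambda>x\<in>carrier M. g x \<oplus>\<^bsub>N\<^esub> h x)"
  "r \<odot>\<^bsub>Hom_module R M N\<^esub> h = (\<lambda>x\<in>carrier M. r \<odot>\<^bsub>N\<^esub> h x)"
  by (simp_all add: Hom_module_def)

lemma module_hom_extensional: "h \<in> module_hom R M N \<Longrightarrow> x \<notin> carrier M \<Longrightarrow> h x = undefined"
  by (auto simp: module_hom_def)

lemma module_hom_eqI:
  assumes "h \<in> module_hom R M N" "h' \<in> module_hom R M N" "\<And>x. x \<in> carrier M \<Longrightarrow> h x = h' x"
  shows "h = h'"
proof
  show "h x = h' x" for x
    using assms(3)[of x] module_hom_extensional[OF assms(1), of x] module_hom_extensional[OF assms(2), of x]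
    by (cases "x \<in> carrier M") auto
qed

lemma module_hom_smult:
  assumes "module R M" "module R N" "h \<in> module_hom R M N" "r \<in> carrier R"
  shows "(\<lambda>x\<in>carrier M. r \<odot>\<^bsub>N\<^esub> h x) \<in> module_hom R M N"
proof -
  interpret M: module R M by fact
  interpret N: module R N by fact
  note h = module_homD[OF assms(3)]
  show ?thesis
    by (rule module_homI[OF _ _ _ assms(1)])
      (use assms(4) h in \<open>simp_all add: N.smult_r_distr M.m_comm flip: N.smult_assoc1\<close>)
qed

lemma Hom_module_is_module:
  assumes "module R M" "module R N"
  shows "module R (Hom_module R M N)"
proof -
  interpret M: module R M by fact
  interpret N: module R N by fact
  have add: "(\<lambda>x\<in>carrier M. g x \<oplus>\<^bsub>N\<^esub> h x) \<in> module_hom R M N"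
    if "g \<in> module_hom R M N" "h \<in> module_hom R M N" for g h
    by (rule module_homI[OF _ _ _ assms(1)])
      (use module_homD[OF that(1)] module_homD[OF that(2)] in \<open>simp_all add: N.smult_r_distr N.M.a_ac\<close>)
  have smult: "(\<lambda>x\<in>carrier M. r \<odot>\<^bsub>N\<^esub> h x) \<in> module_hom R M N"
    if "r \<in> carrier R" "h \<in> module_hom R M N" for r h
    using module_hom_smult[OF assms that(2,1)] .
  have zero: "(\<lambda>x\<in>carrier M. \<zero>\<^bsub>N\<^esub>) \<in> module_hom R M N"
    by (rule module_homI[OF _ _ _ assms(1)]) auto
  show ?thesis
  proof (intro moduleI abelian_groupI)
    fix h assume h: "h \<in> carrier (Hom_module R M N)"
    then have h': "h \<in> module_hom R M N" by simp
    have "(\<lambda>x\<in>carrier M. (\<ominus>\<^bsub>R\<^esub> \<one>\<^bsub>R\<^esub>) \<odot>\<^bsub>N\<^esub> h x) \<in> module_hom R M N" by (rule smult) (use h' in auto)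
    then show "\<exists>g\<in>carrier (Hom_module R M N). g \<oplus>\<^bsub>Hom_module R M N\<^esub> h = \<zero>\<^bsub>Hom_module R M N\<^esub>"
      using module_homD(1)[OF h']
      by (intro bexI[of _ "\<lambda>x\<in>carrier M. (\<ominus>\<^bsub>R\<^esub> \<one>\<^bsub>R\<^esub>) \<odot>\<^bsub>N\<^esub> h x"])
        (auto simp: N.smult_l_minus N.M.l_neg intro!: restrict_ext)
    show "\<zero>\<^bsub>Hom_module R M N\<^esub> \<oplus>\<^bsub>Hom_module R M N\<^esub> h = h"
      "\<one>\<^bsub>R\<^esub> \<odot>\<^bsub>Hom_module R M N\<^esub> h = h"
      using module_homD(1)[OF h'] module_hom_extensional[OF h'] by (auto simp: fun_eq_iff restrict_def)
  next
    fix a b h assume a: "a \<in> carrier R" "b \<in> carrier R" and "h \<in> carrier (Hom_module R M N)"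
    then have h: "\<And>x. x \<in> carrier M \<Longrightarrow> h x \<in> carrier N" by (auto dest: module_homD)
    show "(a \<oplus>\<^bsub>R\<^esub> b) \<odot>\<^bsub>Hom_module R M N\<^esub> h =
        a \<odot>\<^bsub>Hom_module R M N\<^esub> h \<oplus>\<^bsub>Hom_module R M N\<^esub> b \<odot>\<^bsub>Hom_module R M N\<^esub> h"
      "a \<otimes>\<^bsub>R\<^esub> b \<odot>\<^bsub>Hom_module R M N\<^esub> h = a \<odot>\<^bsub>Hom_module R M N\<^esub> (b \<odot>\<^bsub>Hom_module R M N\<^esub> h)"
      using a h by (auto simp: N.smult_l_distr N.smult_assoc1 intro!: restrict_ext)
  next
    fix g h assume "g \<in> carrier (Hom_module R M N)" "h \<in> carrier (Hom_module R M N)"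
    then have gh: "\<And>x. x \<in> carrier M \<Longrightarrow> g x \<in> carrier N" "\<And>x. x \<in> carrier M \<Longrightarrow> h x \<in> carrier N"
      by (auto dest: module_homD)
    show "g \<oplus>\<^bsub>Hom_module R M N\<^esub> h = h \<oplus>\<^bsub>Hom_module R M N\<^esub> g"
      using gh by (auto simp: N.M.a_comm intro!: restrict_ext)
    {
      fix a assume "a \<in> carrier R"
      then show "a \<odot>\<^bsub>Hom_module R M N\<^esub> (g \<oplus>\<^bsub>Hom_module R M N\<^esub> h) =
          a \<odot>\<^bsub>Hom_module R M N\<^esub> g \<oplus>\<^bsub>Hom_module R M N\<^esub> a \<odot>\<^bsub>Hom_module R M N\<^esub> h"
        using gh by (auto simp: N.smult_r_distr intro!: restrict_ext)
    }
    fix k assume "k \<in> carrier (Hom_module R M N)"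
    then show "g \<oplus>\<^bsub>Hom_module R M N\<^esub> h \<oplus>\<^bsub>Hom_module R M N\<^esub> k =
        g \<oplus>\<^bsub>Hom_module R M N\<^esub> (h \<oplus>\<^bsub>Hom_module R M N\<^esub> k)"
      using gh by (auto simp: N.M.a_assoc dest: module_homD intro!: restrict_ext)
  qed (use add smult zero M.is_cring in auto)
qed

lemma module_hom_dual:
  assumes P: "module R P" and Q: "module R Q" and N: "module R N" and \<phi>: "\<phi> \<in> module_hom R P Q"
  shows "(\<lambda>h\<in>module_hom R Q N. \<lambda>x\<in>carrier P. h (\<phi> x)) \<in> module_hom R (Hom_module R Q N) (Hom_module R P N)"
proof -
  interpret P: module R P by fact
  have "restrict (\<lambda>h. \<lambda>x\<in>carrier P. h (\<phi> x)) (carrier (Hom_module R Q N)) \<in>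
      module_hom R (Hom_module R Q N) (Hom_module R P N)"
  proof (rule module_homI[OF _ _ _ Hom_module_is_module[OF Q N]])
    fix h assume "h \<in> carrier (Hom_module R Q N)"
    then show "(\<lambda>x\<in>carrier P. h (\<phi> x)) \<in> carrier (Hom_module R P N)"
      using module_hom_compose[OF P \<phi>] by simp
  qed (use module_homD(1)[OF \<phi>] in \<open>auto intro!: restrict_ext\<close>)
  then show ?thesis by simp
qed

lemma associated_primes_Hom_cohomology:
  fixes N :: "('a, 'c, 'o) module_scheme" and B :: "nat \<Rightarrow> 'x set"
  assumes R: "cring R" and N: "module R N"
    and d: "\<And>i. d i \<in> module_hom R (free_module R (B (Suc i))) (free_module R (B i))"
    and dd: "\<And>i x. x \<in> carrier (free_module R (B (Suc (Suc i)))) \<Longrightarrow> d i (d (Suc i) x) = \<zero>\<^bsub>free_module R (B i)\<^esub>"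
    and p: "p \<in> associated_primes R (Hom_cohomology R B d N i)"
  shows "primeideal p R \<and> (\<exists>h\<in>module_hom R (free_module R (B i)) N.
    (\<forall>x\<in>carrier (free_module R (B (Suc i))). h (d i x) = \<zero>\<^bsub>N\<^esub>) \<and>
    p = {r \<in> carrier R. case i of
        0 \<Rightarrow> \<forall>x\<in>carrier (free_module R (B 0)). r \<odot>\<^bsub>N\<^esub> h x = \<zero>\<^bsub>N\<^esub>
      | Suc j \<Rightarrow> \<exists>k\<in>module_hom R (free_module R (B j)) N.
          \<forall>x\<in>carrier (free_module R (B i)). r \<odot>\<^bsub>N\<^esub> h x = k (d j x)})"
proof -
  interpret cring R by fact
  interpret N: module R N by fact
  define C where "C = (\<lambda>i. Hom_module R (free_module R (B i)) N)"
  have C: "module R (C n)" for n unfolding C_def by (rule Hom_module_is_module[OF free_module_module N])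
  define \<delta> where "\<delta> = (\<lambda>i (h :: ('x \<Rightarrow> 'a) \<Rightarrow> 'c). \<lambda>x\<in>carrier (free_module R (B (Suc i))). h (d i x))"
  define Z where "Z = {h \<in> carrier (C i). \<delta> i h = \<zero>\<^bsub>C (Suc i)\<^esub>}"
  define D where "D = (case i of 0 \<Rightarrow> {\<zero>\<^bsub>C 0\<^esub>} | Suc j \<Rightarrow> \<delta> j ` carrier (C j))"
  have \<delta>: "(\<lambda>h\<in>carrier (C n). \<delta> n h) \<in> module_hom R (C n) (C (Suc n))" for n
    using module_hom_dual[OF free_module_module free_module_module N d[of n]]
    by (simp add: C_def \<delta>_def)
  have coh: "Hom_cohomology R B d N i = quotient_module ((C i)\<lparr>carrier := Z\<rparr>) D"
    unfolding Hom_cohomology_def Let_def Z_def D_def \<delta>_def C_def by (rule refl)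
  have "Z = {h \<in> carrier (C i). (\<lambda>h\<in>carrier (C i). \<delta> i h) h = \<zero>\<^bsub>C (Suc i)\<^esub>}"
    by (auto simp: Z_def)
  then have Z: "submodule Z R (C i)" using module_hom_kernel[OF C C \<delta>] by simp
  have D: "submodule D R (C i)"
  proof (cases i)
    case 0
    then show ?thesis using module.zero_submodule[OF C] by (simp add: D_def)
  next
    case (Suc j)
    have "D = (\<lambda>h\<in>carrier (C j). \<delta> j h) ` carrier (C j)" using Suc by (simp add: D_def)
    then show ?thesis
      using module_hom_image[OF C C \<delta> module.carrier_is_submodule[OF C]] Suc by simp
  qed
  obtain h where p': "primeideal p R" and h: "h \<in> Z" "p = {r \<in> carrier R. r \<odot>\<^bsub>C i\<^esub> h \<in> D}"
    using associated_primes_quotient[OF Z D C p[unfolded coh]] by blast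
  have hom: "h \<in> module_hom R (free_module R (B i)) N" using h by (simp add: Z_def C_def)
  have rh: "(\<lambda>x\<in>carrier (free_module R (B i)). r \<odot>\<^bsub>N\<^esub> h x) \<in> module_hom R (free_module R (B i)) N"
    if "r \<in> carrier R" for r by (rule module_hom_smult[OF free_module_module N hom that])
  have coc: "h (d i x) = \<zero>\<^bsub>N\<^esub>" if "x \<in> carrier (free_module R (B (Suc i)))" for x
    using h(1) that by (auto simp: Z_def C_def \<delta>_def fun_eq_iff restrict_def split: if_splits)
  have "r \<odot>\<^bsub>C i\<^esub> h \<in> D \<longleftrightarrow> (case i of
        0 \<Rightarrow> \<forall>x\<in>carrier (free_module R (B 0)). r \<odot>\<^bsub>N\<^esub> h x = \<zero>\<^bsub>N\<^esub>
      | Suc j \<Rightarrow> \<exists>k\<in>module_hom R (free_module R (B j)) N.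
          \<forall>x\<in>carrier (free_module R (B i)). r \<odot>\<^bsub>N\<^esub> h x = k (d j x))" if r: "r \<in> carrier R" for r
  proof (cases i)
    case 0
    then show ?thesis by (auto simp: D_def C_def fun_eq_iff restrict_def split: if_splits)
  next
    case (Suc j)
    have "r \<odot>\<^bsub>C i\<^esub> h \<in> D \<longleftrightarrow> (\<exists>k\<in>module_hom R (free_module R (B j)) N. r \<odot>\<^bsub>C i\<^esub> h = \<delta> j k)"
      using Suc by (auto simp: D_def C_def)
    also have "\<dots> \<longleftrightarrow> (\<exists>k\<in>module_hom R (free_module R (B j)) N.
          \<forall>x\<in>carrier (free_module R (B i)). r \<odot>\<^bsub>N\<^esub> h x = k (d j x))"
      using Suc by (auto simp: C_def \<delta>_def fun_eq_iff restrict_def)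
    finally show ?thesis using Suc by simp
  qed
  then show ?thesis using p' hom coc h(2) by (intro conjI bexI[of _ h]) auto
qed

context noetherian_cring
begin

text \<open>A homomorphism to \<open>R\<close> is recorded by its values on the finite basis, a
  vector \<open>v h\<close> in a noetherian free module. The coboundaries become the submodule
  \<open>?D\<close>, the image of \<open>\<Psi>\<close>, and \<open>r h\<close> is a coboundary iff
  \<open>r\<close> multiplies \<open>v h\<close> into \<open>?D\<close>; so these are colon primes
  of one submodule.\<close>

lemma finite_coboundary_primes:
  fixes C :: "'x set" and C' :: "'y set"
  assumes C: "finite C" and d: "d \<in> module_hom R (free_module R C) (free_module R C')"
  shows "finite {p. primeideal p R \<and> (\<exists>h\<in>module_hom R (free_module R C) (ring_as_module R).
    p = {r \<in> carrier R. \<exists>k\<in>module_hom R (free_module R C') (ring_as_module R).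
          \<forall>x\<in>carrier (free_module R C). r \<otimes> h x = k (d x)})}"
proof -
  let ?N = "ring_as_module R" and ?F = "free_module R C" and ?G = "free_module R C'"
  interpret F: module R ?F by (rule free_module_module)
  interpret N: module R ?N by (rule ring_as_module_is_module)
  note H = Hom_module_is_module[OF free_module_module N.module_axioms, of C']
  define v where "v h = (\<lambda>b. if b \<in> C then h (uvec R b) else \<zero>)" for h :: "('x \<Rightarrow> 'a) \<Rightarrow> 'a"
  define kd where "kd k = (\<lambda>x\<in>carrier ?F. k (d x))" for k :: "('y \<Rightarrow> 'a) \<Rightarrow> 'a"
  have kd: "kd k \<in> module_hom R ?F ?N" if "k \<in> module_hom R ?G ?N" for k
    unfolding kd_def by (rule module_hom_compose[OF F.module_axioms d that])
  have v: "v h \<in> carrier ?F" if "h \<in> module_hom R ?F ?N" for h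
    using module_homD(1)[OF that] uvec_carrier[of _ C] by (auto simp: free_module_finite_carrier[OF C] v_def)
  have v_inj: "h = h'" if "h \<in> module_hom R ?F ?N" "h' \<in> module_hom R ?F ?N" "v h = v h'" for h h'
  proof (rule module_hom_eqI[OF that(1,2)])
    fix x assume x: "x \<in> carrier ?F"
    show "h x = h' x"
    proof (rule free_module_hom_unique[OF N.module_axioms that(1,2) _ x])
      fix b assume "b \<in> C"
      then show "h (uvec R b) = h' (uvec R b)" using fun_cong[OF that(3), of b] by (simp add: v_def)
    qed
  qed
  define \<Psi> where "\<Psi> = (\<lambda>k\<in>carrier (Hom_module R ?G ?N). v (kd k))"
  have "\<Psi> \<in> module_hom R (Hom_module R ?G ?N) ?F"
    unfolding \<Psi>_def
  proof (rule module_homI[OF _ _ _ H])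
    fix k assume "k \<in> carrier (Hom_module R ?G ?N)"
    then show "v (kd k) \<in> carrier ?F" using v kd by simp
  qed (use module_homD(1)[OF d] uvec_carrier[of _ C] in \<open>auto simp: v_def kd_def free_module_simps(3,4)\<close>)
  from module_hom_image[OF H F.module_axioms this module.carrier_is_submodule[OF H]]
  have D: "submodule (\<Psi> ` carrier (Hom_module R ?G ?N)) R ?F" (is "submodule ?D R ?F") .
  have "{p. primeideal p R \<and> (\<exists>h\<in>module_hom R ?F ?N. p = {r \<in> carrier R.
          \<exists>k\<in>module_hom R ?G ?N. \<forall>x\<in>carrier ?F. r \<otimes> h x = k (d x)})}
     \<subseteq> {p. primeideal p R \<and> (\<exists>z\<in>carrier ?F. p = {r \<in> carrier R. r \<odot>\<^bsub>?F\<^esub> z \<in> ?D})}"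
  proof
    fix p assume "p \<in> {p. primeideal p R \<and> (\<exists>h\<in>module_hom R ?F ?N. p = {r \<in> carrier R.
          \<exists>k\<in>module_hom R ?G ?N. \<forall>x\<in>carrier ?F. r \<otimes> h x = k (d x)})}"
    then obtain h where p: "primeideal p R" and h: "h \<in> module_hom R ?F ?N"
      and ph: "p = {r \<in> carrier R. \<exists>k\<in>module_hom R ?G ?N. \<forall>x\<in>carrier ?F. r \<otimes> h x = k (d x)}" by blast
    have "(\<exists>k\<in>module_hom R ?G ?N. \<forall>x\<in>carrier ?F. r \<otimes> h x = k (d x)) \<longleftrightarrow> r \<odot>\<^bsub>?F\<^esub> v h \<in> ?D"
      if r: "r \<in> carrier R" for r
    proof -
      have rh: "(\<lambda>x\<in>carrier ?F. r \<odot>\<^bsub>?N\<^esub> h x) \<in> module_hom R ?F ?N"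
        by (rule module_hom_smult[OF F.module_axioms N.module_axioms h r])
      have "r \<odot>\<^bsub>?F\<^esub> v h = v (\<lambda>x\<in>carrier ?F. r \<odot>\<^bsub>?N\<^esub> h x)"
        using r uvec_carrier[of _ C] by (auto simp: v_def free_module_simps(4))
      then have "r \<odot>\<^bsub>?F\<^esub> v h \<in> ?D \<longleftrightarrow> (\<exists>k\<in>module_hom R ?G ?N. v (\<lambda>x\<in>carrier ?F. r \<odot>\<^bsub>?N\<^esub> h x) = v (kd k))"
        by (auto simp: \<Psi>_def)
      also have "\<dots> \<longleftrightarrow> (\<exists>k\<in>module_hom R ?G ?N. (\<lambda>x\<in>carrier ?F. r \<odot>\<^bsub>?N\<^esub> h x) = kd k)"
        using v_inj[OF rh kd] by (intro bex_cong refl) metis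
      also have "\<dots> \<longleftrightarrow> (\<exists>k\<in>module_hom R ?G ?N. \<forall>x\<in>carrier ?F. r \<otimes> h x = k (d x))"
        by (auto simp: kd_def fun_eq_iff restrict_def)
      finally show ?thesis by simp
    qed
    then have "p = {r \<in> carrier R. r \<odot>\<^bsub>?F\<^esub> v h \<in> ?D}" unfolding ph by (intro Collect_cong conj_cong refl) auto
    then show "p \<in> {p. primeideal p R \<and> (\<exists>z\<in>carrier ?F. p = {r \<in> carrier R. r \<odot>\<^bsub>?F\<^esub> z \<in> ?D})}"
      using p v[OF h] by blast
  qed
  then show ?thesis
    using F.finite_colon_primes[OF noetherian_free_module[OF C] D] by (rule finite_subset)
qed

end

section \<open>Locally free syzygies\<close>

text \<open>Denominator-free form of: the maximal ideal of \<open>R_p\<close> is generated by one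
  nonzerodivisor. If \<open>R_p\<close> is a field this fails, because then every \<open>x\<close>
  in \<open>p\<close> becomes zero there.\<close>

definition locally_principal_regular :: "('a, 'm) ring_scheme \<Rightarrow> 'a set \<Rightarrow> bool"
  where "locally_principal_regular R p \<longleftrightarrow> (\<exists>x\<in>p.
    (\<forall>z\<in>p. \<exists>u\<in>carrier R - p. \<exists>r\<in>carrier R. u \<otimes>\<^bsub>R\<^esub> z = x \<otimes>\<^bsub>R\<^esub> r) \<and>
    (\<forall>r\<in>carrier R. x \<otimes>\<^bsub>R\<^esub> r = \<zero>\<^bsub>R\<^esub> \<longrightarrow> (\<exists>u\<in>carrier R - p. u \<otimes>\<^bsub>R\<^esub> r = \<zero>\<^bsub>R\<^esub>)))"

text \<open>Denominator-free form of: the maximal ideal of \<open>R_p\<close> is generated by a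
  regular sequence \<open>x, y\<close>. The last clause says that \<open>y\<close> is a
  nonzerodivisor modulo \<open>x\<close>.\<close>

definition locally_regular_pair :: "('a, 'm) ring_scheme \<Rightarrow> 'a set \<Rightarrow> bool"
  where "locally_regular_pair R p \<longleftrightarrow> (\<exists>x\<in>p. \<exists>y\<in>p.
    (\<forall>z\<in>p. \<exists>u\<in>carrier R - p. \<exists>r\<in>carrier R. \<exists>s\<in>carrier R. u \<otimes>\<^bsub>R\<^esub> z = x \<otimes>\<^bsub>R\<^esub> r \<oplus>\<^bsub>R\<^esub> y \<otimes>\<^bsub>R\<^esub> s) \<and>
    (\<forall>r\<in>carrier R. x \<otimes>\<^bsub>R\<^esub> r = \<zero>\<^bsub>R\<^esub> \<longrightarrow> (\<exists>u\<in>carrier R - p. u \<otimes>\<^bsub>R\<^esub> r = \<zero>\<^bsub>R\<^esub>)) \<and>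
    (\<forall>r\<in>carrier R. \<forall>s\<in>carrier R. x \<otimes>\<^bsub>R\<^esub> r = y \<otimes>\<^bsub>R\<^esub> s \<longrightarrow>
      (\<exists>u\<in>carrier R - p. \<exists>t\<in>carrier R. u \<otimes>\<^bsub>R\<^esub> s = x \<otimes>\<^bsub>R\<^esub> t)))"

lemma locally_regular_pairE:
  assumes "locally_regular_pair R p"
  obtains x y where "x \<in> p" "y \<in> p"
    "\<And>z. z \<in> p \<Longrightarrow> \<exists>u\<in>carrier R - p. \<exists>r\<in>carrier R. \<exists>s\<in>carrier R. u \<otimes>\<^bsub>R\<^esub> z = x \<otimes>\<^bsub>R\<^esub> r \<oplus>\<^bsub>R\<^esub> y \<otimes>\<^bsub>R\<^esub> s"
    "\<And>r. r \<in> carrier R \<Longrightarrow> x \<otimes>\<^bsub>R\<^esub> r = \<zero>\<^bsub>R\<^esub> \<Longrightarrow> \<exists>u\<in>carrier R - p. u \<otimes>\<^bsub>R\<^esub> r = \<zero>\<^bsub>R\<^esub>"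
    "\<And>r s. r \<in> carrier R \<Longrightarrow> s \<in> carrier R \<Longrightarrow> x \<otimes>\<^bsub>R\<^esub> r = y \<otimes>\<^bsub>R\<^esub> s \<Longrightarrow>
      \<exists>u\<in>carrier R - p. \<exists>t\<in>carrier R. u \<otimes>\<^bsub>R\<^esub> s = x \<otimes>\<^bsub>R\<^esub> t"
  using assms unfolding locally_regular_pair_def
  by (elim bexE conjE) (rule that, assumption+, simp_all)

context cring
begin

text \<open>Coordinatewise divisibility with varying denominators becomes divisibility of the whole
  vector, as there are finitely many coordinates. One generator is the case
  \<open>y = \<zero>\<close>, and vanishing of the vector is the case
  \<open>x = y = \<zero>\<close>.\<close>

lemma free_module_common_denominator:
  assumes p: "primeideal p R" and B: "finite B" and xy: "x \<in> carrier R" "y \<in> carrier R"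
    and a: "a \<in> carrier (free_module R B)"
    and loc: "\<And>b. b \<in> B \<Longrightarrow> \<exists>u\<in>carrier R - p. \<exists>r\<in>carrier R. \<exists>s\<in>carrier R. u \<otimes> a b = x \<otimes> r \<oplus> y \<otimes> s"
  shows "\<exists>u\<in>carrier R - p. \<exists>f\<in>carrier (free_module R B). \<exists>g\<in>carrier (free_module R B).
    u \<odot>\<^bsub>free_module R B\<^esub> a = x \<odot>\<^bsub>free_module R B\<^esub> f \<oplus>\<^bsub>free_module R B\<^esub> y \<odot>\<^bsub>free_module R B\<^esub> g"
proof -
  have aR: "a b \<in> carrier R" for b using free_module_carrier(1)[OF a] .
  have "\<exists>u\<in>carrier R - p. \<forall>b\<in>S. \<exists>r\<in>carrier R. \<exists>s\<in>carrier R. u \<otimes> a b = x \<otimes> r \<oplus> y \<otimes> s"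
    if "S \<subseteq> B" for S
    using finite_subset[OF that B] that
  proof (induction S rule: finite_induct)
    case empty
    then show ?case using primeideal_compl_one[OF p] by blast
  next
    case (insert b S)
    obtain u where u: "u \<in> carrier R - p"
      "\<forall>b\<in>S. \<exists>r\<in>carrier R. \<exists>s\<in>carrier R. u \<otimes> a b = x \<otimes> r \<oplus> y \<otimes> s" using insert by auto
    obtain v where v: "v \<in> carrier R - p" "\<exists>r\<in>carrier R. \<exists>s\<in>carrier R. v \<otimes> a b = x \<otimes> r \<oplus> y \<otimes> s"
      using loc[of b] insert.prems by auto
    have mult: "\<exists>r\<in>carrier R. \<exists>s\<in>carrier R. (t \<otimes> w) \<otimes> a c = x \<otimes> r \<oplus> y \<otimes> s"
      if tw: "t \<in> carrier R" "w \<in> carrier R" and ex: "\<exists>r\<in>carrier R. \<exists>s\<in>carrier R. w \<otimes> a c = x \<otimes> r \<oplus> y \<otimes> s" for t w c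
    proof -
      obtain r s where rs: "r \<in> carrier R" "s \<in> carrier R" "w \<otimes> a c = x \<otimes> r \<oplus> y \<otimes> s" using ex by blast
      have "(t \<otimes> w) \<otimes> a c = t \<otimes> (w \<otimes> a c)" using tw aR by (simp add: m_assoc)
      also have "\<dots> = x \<otimes> (t \<otimes> r) \<oplus> y \<otimes> (t \<otimes> s)" unfolding rs(3) using rs(1,2) tw xy by algebra
      finally show ?thesis using rs tw by blast
    qed
    have "\<exists>r\<in>carrier R. \<exists>s\<in>carrier R. (v \<otimes> u) \<otimes> a c = x \<otimes> r \<oplus> y \<otimes> s" if c: "c \<in> insert b S" for c
    proof (cases "c = b")
      case True
      then show ?thesis using mult[of u v b] u v by (simp add: m_comm)
    next
      case False
      then show ?thesis using mult[of v u c] u v c by simp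
    qed
    then show ?case using primeideal_compl_mult[OF p v(1) u(1)] by blast
  qed
  from this[of B] obtain u where u: "u \<in> carrier R - p"
    "\<forall>b\<in>B. \<exists>r\<in>carrier R. \<exists>s\<in>carrier R. u \<otimes> a b = x \<otimes> r \<oplus> y \<otimes> s" by blast
  then obtain r s where rs: "\<And>b. b \<in> B \<Longrightarrow> r b \<in> carrier R" "\<And>b. b \<in> B \<Longrightarrow> s b \<in> carrier R"
    "\<And>b. b \<in> B \<Longrightarrow> u \<otimes> a b = x \<otimes> r b \<oplus> y \<otimes> s b"
    by metis
  let ?f = "\<lambda>b. if b \<in> B then r b else \<zero>" and ?g = "\<lambda>b. if b \<in> B then s b else \<zero>"
  have "u \<odot>\<^bsub>free_module R B\<^esub> a = x \<odot>\<^bsub>free_module R B\<^esub> ?f \<oplus>\<^bsub>free_module R B\<^esub> y \<odot>\<^bsub>free_module R B\<^esub> ?g"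
    using rs xy u free_module_carrier(2)[OF a] by (auto simp: free_module_simps fun_eq_iff)
  moreover have "?f \<in> carrier (free_module R B)" "?g \<in> carrier (free_module R B)"
    using rs by (auto simp: free_module_finite_carrier[OF B])
  ultimately show ?thesis using u(1) by blast
qed

lemma free_module_local_nzd:
  assumes p: "primeideal p R" and B: "finite B" and x: "x \<in> carrier R"
    and nzd: "\<And>r. r \<in> carrier R \<Longrightarrow> x \<otimes> r = \<zero> \<Longrightarrow> \<exists>u\<in>carrier R - p. u \<otimes> r = \<zero>"
    and a: "a \<in> carrier (free_module R B)" "x \<odot>\<^bsub>free_module R B\<^esub> a = \<zero>\<^bsub>free_module R B\<^esub>"
  shows "\<exists>u\<in>carrier R - p. u \<odot>\<^bsub>free_module R B\<^esub> a = \<zero>\<^bsub>free_module R B\<^esub>"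
proof -
  interpret F: module R "free_module R B" by (rule free_module_module)
  \<comment> \<open>With both generators zero, the common denominator of the preceding lemma
    annihilates \<open>a\<close>.\<close>
  have "\<exists>u\<in>carrier R - p. \<exists>r\<in>carrier R. \<exists>s\<in>carrier R. u \<otimes> a b = \<zero> \<otimes> r \<oplus> \<zero> \<otimes> s" for b
    using nzd[of "a b"] fun_cong[OF a(2), of b] free_module_carrier(1)[OF a(1)] by (auto simp: free_module_simps)
  from free_module_common_denominator[OF p B zero_closed zero_closed a(1) this]
  show ?thesis by auto
qed

end

context noetherian_cring
begin

text \<open>The syzygy module \<open>ker \<delta>\<close> is locally free: take a minimal set of local generators. A relation
  between them has all its coefficients in \<open>p\<close>, and regularity shows that the module of relations
  is contained in its multiple by \<open>p\<close>, so it vanishes by Nakayama's lemma. Hence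
  the surjection onto this syzygy module splits locally.\<close>

lemma syzygy_splits_locally:
  fixes B :: "'x set" and C :: "'y set" and D :: "'z set"
  assumes p: "primeideal p R" and reg: "locally_principal_regular R p \<or> locally_regular_pair R p"
    and A: "module R A" and fin: "finite B" "finite C" "finite D"
    and \<beta>: "\<beta> \<in> module_hom R A (free_module R B)"
    and \<gamma>: "\<gamma> \<in> module_hom R (free_module R B) (free_module R C)"
    and \<delta>: "\<delta> \<in> module_hom R (free_module R C) (free_module R D)"
    and ex1: "\<beta> ` carrier A = {z \<in> carrier (free_module R B). \<gamma> z = \<zero>\<^bsub>free_module R C\<^esub>}"
    and ex2: "\<gamma> ` carrier (free_module R B) = {z \<in> carrier (free_module R C). \<delta> z = \<zero>\<^bsub>free_module R D\<^esub>}"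
  shows "\<exists>t\<in>carrier R - p. \<exists>\<psi>\<in>module_hom R (free_module R B) A.
    \<forall>z\<in>\<beta> ` carrier A. \<beta> (\<psi> z) = t \<odot>\<^bsub>free_module R B\<^esub> z"
proof -
  let ?B = "free_module R B" and ?C = "free_module R C" and ?D = "free_module R D"
  interpret p: primeideal p R by fact
  interpret A: module R A by fact
  interpret B: module R ?B by (rule free_module_module)
  interpret C: module R ?C by (rule free_module_module)
  interpret D: module R ?D by (rule free_module_module)
  note gD = module_homD[OF \<gamma>] and dD = module_homD[OF \<delta>] and bD = module_homD[OF \<beta>]
  \<comment> \<open>\<open>Q B'\<close> says that the images of the unit vectors in
    \<open>B'\<close> generate the image of \<open>\<gamma>\<close> at \<open>p\<close>, with one
    denominator for all elements. A smallest such \<open>B'\<close> plays the part of a minimal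
    system of generators over \<open>R_p\<close>.\<close>
  define Q where "Q B' \<longleftrightarrow> B' \<subseteq> B \<and> (\<exists>u\<in>carrier R - p. \<forall>z\<in>carrier ?B.
      \<exists>f\<in>carrier (free_module R B'). u \<odot>\<^bsub>?C\<^esub> \<gamma> z = \<gamma> f)" for B'
  have "Q B" unfolding Q_def
    using primeideal_compl_one[OF p] gD(1) by (intro conjI bexI[of _ \<one>] ballI) (auto simp del: C.smult_one simp: C.smult_one)
  then obtain B' where B': "Q B'" and least: "\<And>B''. Q B'' \<Longrightarrow> card B' \<le> card B''"
    using ex_has_least_nat[of Q B card] by blast
  let ?B' = "free_module R B'"
  interpret B': module R ?B' by (rule free_module_module)
  have BB: "B' \<subseteq> B" and finB': "finite B'" using B' fin(1) by (auto simp: Q_def intro: finite_subset)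
  have sub: "submodule (carrier ?B') R ?B" by (rule free_module_mono[OF BB])
  note subD = B.submoduleD[OF sub]
  have ops [simp]: "f \<oplus>\<^bsub>?B'\<^esub> g = f \<oplus>\<^bsub>?B\<^esub> g" "r \<odot>\<^bsub>?B'\<^esub> f = r \<odot>\<^bsub>?B\<^esub> f" "\<zero>\<^bsub>?B'\<^esub> = \<zero>\<^bsub>?B\<^esub>" for f g r
    by (simp_all add: free_module_simps)
  obtain u0 where u0: "u0 \<in> carrier R - p"
    "\<And>z. z \<in> carrier ?B \<Longrightarrow> \<exists>f\<in>carrier ?B'. u0 \<odot>\<^bsub>?C\<^esub> \<gamma> z = \<gamma> f" using B' unfolding Q_def by blast
  define Rel where "Rel = {f \<in> carrier ?B'. \<gamma> f = \<zero>\<^bsub>?C\<^esub>}"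
  have \<gamma>': "restrict \<gamma> (carrier ?B') \<in> module_hom R ?B' ?C"
    by (rule module_homI[OF _ _ _ B'.module_axioms]) (use gD subD(1) in simp_all)
  have Rel_eq: "Rel = {f \<in> carrier ?B'. restrict \<gamma> (carrier ?B') f = \<zero>\<^bsub>?C\<^esub>}" by (auto simp: Rel_def)
  have Rel: "submodule Rel R ?B'"
    unfolding Rel_eq by (rule module_hom_kernel[OF B'.module_axioms C.module_axioms \<gamma>'])
  have Rel_fg: "fg_sub R ?B' Rel"
    using noetherian_free_module[OF finB'] Rel by (simp add: noetherian_module_def)
  have coeff: "a b \<in> p" if a: "a \<in> Rel" and b: "b \<in> B'" for a b
  proof (rule ccontr)
    assume "a b \<notin> p"
    have a': "a \<in> carrier ?B'" "\<gamma> a = \<zero>\<^bsub>?C\<^esub>" using a by (auto simp: Rel_def)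
    have ab: "a b \<in> carrier R - p" using \<open>a b \<notin> p\<close> free_module_carrier(1)[OF a'(1)] by auto
    have "Q (B' - {b})"
      unfolding Q_def
    proof (intro conjI bexI[of _ "a b \<otimes> u0"] ballI)
      show "B' - {b} \<subseteq> B" using BB by auto
      show "a b \<otimes> u0 \<in> carrier R - p" by (rule primeideal_compl_mult[OF p ab u0(1)])
      fix z assume z: "z \<in> carrier ?B"
      obtain f where f: "f \<in> carrier ?B'" "u0 \<odot>\<^bsub>?C\<^esub> \<gamma> z = \<gamma> f" using u0(2)[OF z] by blast
      have fb: "f b \<in> carrier R" using free_module_carrier(1)[OF f(1)] .
      \<comment> \<open>A relation whose coefficient at \<open>b\<close> is a local unit can be
        solved for the generator \<open>b\<close>: subtracting a multiple of it cancels the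
        coordinate of \<open>f\<close> at \<open>b\<close> without changing the image up to the
        factor \<open>a b\<close>. Then \<open>b\<close> could be dropped, against the choice of
        \<open>B'\<close>.\<close>
      let ?g = "a b \<odot>\<^bsub>?B\<^esub> f \<oplus>\<^bsub>?B\<^esub> (\<ominus> f b) \<odot>\<^bsub>?B\<^esub> a"
      have "?g x = \<zero>" if "x \<notin> B' - {b}" for x
        using that free_module_carrier[OF f(1)] free_module_carrier[OF a'(1)]
        by (cases "x = b") (simp_all add: free_module_simps l_minus r_minus r_neg m_comm)
      moreover have "?g x \<in> carrier R" for x
        using free_module_carrier(1)[OF f(1)] free_module_carrier(1)[OF a'(1)] by (simp add: free_module_simps)
      ultimately have g: "?g \<in> carrier (free_module R (B' - {b}))"
        using finB' by (subst free_module_finite_carrier) auto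
      have "\<gamma> ?g = a b \<odot>\<^bsub>?C\<^esub> \<gamma> f"
        using f(1) a' ab fb subD(1) gD(1) by (simp add: gD(2,3))
      also have "\<dots> = (a b \<otimes> u0) \<odot>\<^bsub>?C\<^esub> \<gamma> z"
        using ab u0(1) gD(1)[OF z] by (simp add: C.smult_assoc1 flip: f(2))
      finally show "\<exists>f\<in>carrier (free_module R (B' - {b})). (a b \<otimes> u0) \<odot>\<^bsub>?C\<^esub> \<gamma> z = \<gamma> f"
        using g by (metis (no_types))
    qed
    then have "card B' \<le> card (B' - {b})" by (rule least)
    then show False using b finB' by (metis card_Diff1_less leD)
  qed
  \<comment> \<open>Nakayama applies once every relation is locally \<open>x\<close> times a
    relation plus \<open>y\<close> times a relation. So far \<open>coeff\<close> only gives this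
    with vectors of \<open>?B'\<close> in place of relations.\<close>
  have "Rel \<subseteq> sat R ?B' p {\<zero>\<^bsub>?B'\<^esub>}"
    using reg
  proof
    assume "locally_principal_regular R p"
    then obtain x where x: "x \<in> p" "\<And>z. z \<in> p \<Longrightarrow> \<exists>u\<in>carrier R - p. \<exists>r\<in>carrier R. u \<otimes> z = x \<otimes> r"
      "\<And>r. r \<in> carrier R \<Longrightarrow> x \<otimes> r = \<zero> \<Longrightarrow> \<exists>u\<in>carrier R - p. u \<otimes> r = \<zero>"
      unfolding locally_principal_regular_def by blast
    have xR: "x \<in> carrier R" using x by auto
    show ?thesis
    proof (rule B'.nakayama[OF p Rel Rel_fg B'.zero_submodule x(1) x(1)])
      fix a assume a: "a \<in> Rel"
      then have a': "a \<in> carrier ?B'" "\<gamma> a = \<zero>\<^bsub>?C\<^esub>" by (auto simp: Rel_def)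
      have "\<exists>u\<in>carrier R - p. \<exists>r\<in>carrier R. \<exists>s\<in>carrier R. u \<otimes> a b = x \<otimes> r \<oplus> \<zero> \<otimes> s" if b: "b \<in> B'" for b
      proof -
        obtain u r where "u \<in> carrier R - p" "r \<in> carrier R" "u \<otimes> a b = x \<otimes> r"
          using x(2)[OF coeff[OF a b]] by blast
        then show ?thesis using xR by (intro bexI[of _ u] bexI[of _ r] bexI[of _ \<zero>]) auto
      qed
      from free_module_common_denominator[OF p finB' xR zero_closed a'(1) this]
      obtain u f g where u: "u \<in> carrier R - p" "f \<in> carrier ?B'" "g \<in> carrier ?B'"
        "u \<odot>\<^bsub>?B\<^esub> a = x \<odot>\<^bsub>?B\<^esub> f \<oplus>\<^bsub>?B\<^esub> \<zero> \<odot>\<^bsub>?B\<^esub> g" by auto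
      have ua: "u \<odot>\<^bsub>?B\<^esub> a = x \<odot>\<^bsub>?B\<^esub> f" using u xR subD(1) by simp
      \<comment> \<open>Since \<open>x\<close> is locally a nonzerodivisor on the coordinates,
        \<open>x \<gamma> f = 0\<close> forces \<open>\<gamma> f\<close> to vanish locally, so
        \<open>f\<close> is a relation up to a denominator.\<close>
      have "x \<odot>\<^bsub>?C\<^esub> \<gamma> f = \<gamma> (u \<odot>\<^bsub>?B\<^esub> a)" unfolding ua using u(2) xR subD(1) by (simp add: gD(3))
      also have "\<dots> = \<zero>\<^bsub>?C\<^esub>" using u(1) a' subD(1) by (simp add: gD(3))
      finally obtain v where v: "v \<in> carrier R - p" "v \<odot>\<^bsub>?C\<^esub> \<gamma> f = \<zero>\<^bsub>?C\<^esub>"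
        using free_module_local_nzd[OF p fin(2) xR x(3) gD(1)[OF subD(1)[OF u(2)]]] by blast
      have vf: "v \<odot>\<^bsub>?B\<^esub> f \<in> Rel" using v u(2) subD(1,3) by (simp add: Rel_def gD(3))
      have "(v \<otimes> u) \<odot>\<^bsub>?B\<^esub> a = x \<odot>\<^bsub>?B\<^esub> (v \<odot>\<^bsub>?B\<^esub> f)"
        using v(1) u(1,2) xR a'(1) subD(1) by (simp add: B.smult_assoc1 ua) (simp add: m_comm flip: B.smult_assoc1)
      moreover have "\<dots> \<in> carrier ?B" using vf xR subD(1) by (auto simp: Rel_def)
      ultimately show "\<exists>u\<in>carrier R - p. \<exists>b\<in>Rel. \<exists>c\<in>Rel. \<exists>e\<in>{\<zero>\<^bsub>?B'\<^esub>}.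
          u \<odot>\<^bsub>?B'\<^esub> a = x \<odot>\<^bsub>?B'\<^esub> b \<oplus>\<^bsub>?B'\<^esub> x \<odot>\<^bsub>?B'\<^esub> c \<oplus>\<^bsub>?B'\<^esub> e"
        using primeideal_compl_mult[OF p v(1) u(1)] vf B'.submodule_zero[OF Rel] xR
        by (intro bexI[of _ "v \<otimes> u"] bexI[of _ "v \<odot>\<^bsub>?B\<^esub> f"] bexI[of _ "\<zero>\<^bsub>?B\<^esub>"]) auto
    qed
  next
    assume "locally_regular_pair R p"
    then show ?thesis
    proof (rule locally_regular_pairE)
      fix x y assume x: "x \<in> p" "y \<in> p"
        "\<And>z. z \<in> p \<Longrightarrow> \<exists>u\<in>carrier R - p. \<exists>r\<in>carrier R. \<exists>s\<in>carrier R. u \<otimes> z = x \<otimes> r \<oplus> y \<otimes> s"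
        "\<And>r. r \<in> carrier R \<Longrightarrow> x \<otimes> r = \<zero> \<Longrightarrow> \<exists>u\<in>carrier R - p. u \<otimes> r = \<zero>"
        "\<And>r s. r \<in> carrier R \<Longrightarrow> s \<in> carrier R \<Longrightarrow> x \<otimes> r = y \<otimes> s \<Longrightarrow> \<exists>u\<in>carrier R - p. \<exists>t\<in>carrier R. u \<otimes> s = x \<otimes> t"
      have xR: "x \<in> carrier R" "y \<in> carrier R" using x by auto
      show ?thesis
      proof (rule B'.nakayama[OF p Rel Rel_fg B'.zero_submodule x(1,2)])
        fix a assume a: "a \<in> Rel"
        then have a': "a \<in> carrier ?B'" "\<gamma> a = \<zero>\<^bsub>?C\<^esub>" by (auto simp: Rel_def)
        from free_module_common_denominator[OF p finB' xR a'(1) x(3)[OF coeff[OF a]]]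
        obtain u f g where u: "u \<in> carrier R - p" "f \<in> carrier ?B'" "g \<in> carrier ?B'"
          "u \<odot>\<^bsub>?B\<^esub> a = x \<odot>\<^bsub>?B\<^esub> f \<oplus>\<^bsub>?B\<^esub> y \<odot>\<^bsub>?B\<^esub> g" by auto
        note fgB = subD(1)[OF u(2)] subD(1)[OF u(3)]
        have "x \<odot>\<^bsub>?C\<^esub> \<gamma> f \<oplus>\<^bsub>?C\<^esub> y \<odot>\<^bsub>?C\<^esub> \<gamma> g = \<gamma> (u \<odot>\<^bsub>?B\<^esub> a)"
          unfolding u(4) using fgB xR by (simp add: gD(2,3))
        also have "\<dots> = \<zero>\<^bsub>?C\<^esub>" using u(1) a' subD(1) by (simp add: gD(3))
        finally have rel: "x \<odot>\<^bsub>?C\<^esub> \<gamma> f \<oplus>\<^bsub>?C\<^esub> y \<odot>\<^bsub>?C\<^esub> \<gamma> g = \<zero>\<^bsub>?C\<^esub>" .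
        note fC = free_module_carrier(1)[OF gD(1)[OF fgB(1)]] and gC = free_module_carrier(1)[OF gD(1)[OF fgB(2)]]
        \<comment> \<open>Regularity of the pair, applied in each coordinate to
          \<open>x \<gamma> f = - y \<gamma> g\<close>, shows that \<open>\<gamma> g\<close> is
          locally divisible by \<open>x\<close>.\<close>
        have "\<exists>u\<in>carrier R - p. \<exists>r\<in>carrier R. \<exists>s\<in>carrier R. u \<otimes> \<gamma> g c = x \<otimes> r \<oplus> \<zero> \<otimes> s" for c
        proof -
          have "x \<otimes> \<gamma> f c \<oplus> y \<otimes> \<gamma> g c = \<zero>" using fun_cong[OF rel, of c] by (simp add: free_module_simps)
          then have "x \<otimes> (\<ominus> \<gamma> f c) = y \<otimes> \<gamma> g c"
            using xR fC gC minus_equality[of "y \<otimes> \<gamma> g c" "x \<otimes> \<gamma> f c"] by (simp add: r_minus a_comm)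
          then obtain w t where "w \<in> carrier R - p" "t \<in> carrier R" "w \<otimes> \<gamma> g c = x \<otimes> t"
            using x(5)[of "\<ominus> \<gamma> f c" "\<gamma> g c"] fC gC by blast
          then show ?thesis using xR by (intro bexI[of _ w] bexI[of _ t] bexI[of _ \<zero>]) auto
        qed
        from free_module_common_denominator[OF p fin(2) xR(1) zero_closed gD(1)[OF fgB(2)] this]
        obtain u1 t t' where u1: "u1 \<in> carrier R - p" "t \<in> carrier ?C" "t' \<in> carrier ?C"
          "u1 \<odot>\<^bsub>?C\<^esub> \<gamma> g = x \<odot>\<^bsub>?C\<^esub> t \<oplus>\<^bsub>?C\<^esub> \<zero> \<odot>\<^bsub>?C\<^esub> t'" by auto
        have u1g: "u1 \<odot>\<^bsub>?C\<^esub> \<gamma> g = x \<odot>\<^bsub>?C\<^esub> t" using u1 xR by simp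
        have dg: "\<delta> (\<gamma> z) = \<zero>\<^bsub>?D\<^esub>" if "z \<in> carrier ?B" for z using that ex2 by blast
        \<comment> \<open>The quotient \<open>t\<close> need not lie in the image of
          \<open>\<gamma>\<close>. But \<open>x \<delta> t = 0\<close> in a free module, so
          \<open>\<delta> t\<close> vanishes locally and \<open>t\<close> is, up to a denominator,
          in the kernel of \<open>\<delta>\<close>, which is that image. This is where the second
          free module \<open>?D\<close> below the syzygy is used.\<close>
        have "x \<odot>\<^bsub>?D\<^esub> \<delta> t = \<delta> (u1 \<odot>\<^bsub>?C\<^esub> \<gamma> g)" unfolding u1g using u1(2) xR by (simp add: dD(3))
        also have "\<dots> = \<zero>\<^bsub>?D\<^esub>" using u1(1) gD(1)[OF fgB(2)] dg[OF fgB(2)] by (simp add: dD(3))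
        finally obtain u2 where u2: "u2 \<in> carrier R - p" "u2 \<odot>\<^bsub>?D\<^esub> \<delta> t = \<zero>\<^bsub>?D\<^esub>"
          using free_module_local_nzd[OF p fin(3) xR(1) x(4) dD(1)[OF u1(2)]] by blast
        have "u2 \<odot>\<^bsub>?C\<^esub> t \<in> \<gamma> ` carrier ?B" unfolding ex2 using u2 u1(2) by (simp add: dD(3))
        then obtain e where e: "e \<in> carrier ?B" "u2 \<odot>\<^bsub>?C\<^esub> t = \<gamma> e" by blast
        obtain e' where e': "e' \<in> carrier ?B'" "u0 \<odot>\<^bsub>?C\<^esub> \<gamma> e = \<gamma> e'" using u0(2)[OF e(1)] by blast
        note eB = subD(1)[OF e'(1)]
        define U where "U = u0 \<otimes> (u2 \<otimes> u1)"
        have U: "U \<in> carrier R - p"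
          unfolding U_def by (intro primeideal_compl_mult[OF p] u0 u1 u2)
        have uR: "u0 \<in> carrier R" "u1 \<in> carrier R" "u2 \<in> carrier R" "U \<in> carrier R" "u \<in> carrier R" using u0 u1 u2 u U by auto
        have "U \<odot>\<^bsub>?C\<^esub> \<gamma> g = u0 \<odot>\<^bsub>?C\<^esub> (u2 \<odot>\<^bsub>?C\<^esub> (u1 \<odot>\<^bsub>?C\<^esub> \<gamma> g))"
          using uR gD(1)[OF fgB(2)] by (simp add: U_def C.smult_assoc1)
        also have "\<dots> = u0 \<odot>\<^bsub>?C\<^esub> (x \<odot>\<^bsub>?C\<^esub> (u2 \<odot>\<^bsub>?C\<^esub> t))"
          unfolding u1g using uR xR u1(2) by (simp add: m_comm flip: C.smult_assoc1)
        also have "\<dots> = x \<odot>\<^bsub>?C\<^esub> \<gamma> e'"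
          unfolding e(2) e'(2)[symmetric] using uR xR gD(1)[OF e(1)] by (simp add: m_comm flip: C.smult_assoc1)
        finally have Ug: "U \<odot>\<^bsub>?C\<^esub> \<gamma> g = x \<odot>\<^bsub>?C\<^esub> \<gamma> e'" .
        \<comment> \<open>Koszul correction: replacing the pair \<open>(U f, U g)\<close> by
          \<open>(U f + y e', U g - x e')\<close> leaves \<open>x f + y g\<close> unchanged up to
          the factor \<open>U\<close>. Now \<open>c1\<close> is a relation by \<open>Ug\<close>, and
          \<open>k\<close> is one locally because \<open>x\<close> is a nonzerodivisor.\<close>
        define c1 where "c1 = U \<odot>\<^bsub>?B\<^esub> g \<oplus>\<^bsub>?B\<^esub> (\<ominus> x) \<odot>\<^bsub>?B\<^esub> e'"
        have c1: "c1 \<in> Rel"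
          using Ug uR xR e' u fgB eB subD(3,4) gD(1)[OF eB]
          by (simp add: Rel_def c1_def gD(2,3) C.smult_l_minus C.M.r_neg)
        define k where "k = U \<odot>\<^bsub>?B\<^esub> f \<oplus>\<^bsub>?B\<^esub> y \<odot>\<^bsub>?B\<^esub> e'"
        have k: "k \<in> carrier ?B'" using uR xR u e' subD(3,4) by (simp add: k_def)
        have "x \<odot>\<^bsub>?C\<^esub> \<gamma> k = U \<odot>\<^bsub>?C\<^esub> (x \<odot>\<^bsub>?C\<^esub> \<gamma> f) \<oplus>\<^bsub>?C\<^esub> y \<odot>\<^bsub>?C\<^esub> (x \<odot>\<^bsub>?C\<^esub> \<gamma> e')"
          using uR xR fgB eB gD(1)[OF fgB(1)] gD(1)[OF eB]
          by (simp add: k_def gD(2,3) C.smult_r_distr m_comm flip: C.smult_assoc1)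
        also have "\<dots> = U \<odot>\<^bsub>?C\<^esub> (x \<odot>\<^bsub>?C\<^esub> \<gamma> f \<oplus>\<^bsub>?C\<^esub> y \<odot>\<^bsub>?C\<^esub> \<gamma> g)"
          unfolding Ug[symmetric] using uR xR gD(1)[OF fgB(1)] gD(1)[OF fgB(2)]
          by (simp add: C.smult_r_distr m_comm flip: C.smult_assoc1)
        also have "\<dots> = \<zero>\<^bsub>?C\<^esub>" unfolding rel using uR by simp
        finally obtain u3 where u3: "u3 \<in> carrier R - p" "u3 \<odot>\<^bsub>?C\<^esub> \<gamma> k = \<zero>\<^bsub>?C\<^esub>"
          using free_module_local_nzd[OF p fin(2) xR(1) x(4) gD(1)[OF subD(1)[OF k]]] by blast
        have b1: "u3 \<odot>\<^bsub>?B\<^esub> k \<in> Rel" using u3 k subD(1,3) by (simp add: Rel_def gD(3))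
        have c2: "u3 \<odot>\<^bsub>?B\<^esub> c1 \<in> Rel" using B'.submoduleD(3)[OF Rel _ c1, of u3] u3(1) by simp
        have u3R: "u3 \<in> carrier R" using u3 by simp
        have "(u3 \<otimes> (U \<otimes> u)) \<odot>\<^bsub>?B\<^esub> a = (u3 \<otimes> U) \<odot>\<^bsub>?B\<^esub> (u \<odot>\<^bsub>?B\<^esub> a)"
          using uR u3R subD(1)[OF a'(1)] by (simp add: B.smult_assoc1)
        also have "\<dots> = x \<odot>\<^bsub>?B\<^esub> (u3 \<odot>\<^bsub>?B\<^esub> k) \<oplus>\<^bsub>?B\<^esub> y \<odot>\<^bsub>?B\<^esub> (u3 \<odot>\<^bsub>?B\<^esub> c1)"
          unfolding u(4)
        proof (rule ext)
          fix i
          have i: "f i \<in> carrier R" "g i \<in> carrier R" "e' i \<in> carrier R"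
            using free_module_carrier(1)[OF fgB(1)] free_module_carrier(1)[OF fgB(2)] free_module_carrier(1)[OF eB] by auto
          have "u3 \<otimes> U \<otimes> (x \<otimes> f i \<oplus> y \<otimes> g i) =
              x \<otimes> (u3 \<otimes> (U \<otimes> f i \<oplus> y \<otimes> e' i)) \<oplus> y \<otimes> (u3 \<otimes> (U \<otimes> g i \<oplus> \<ominus> x \<otimes> e' i))"
            using i uR u3R xR by algebra
          then show "((u3 \<otimes> U) \<odot>\<^bsub>?B\<^esub> (x \<odot>\<^bsub>?B\<^esub> f \<oplus>\<^bsub>?B\<^esub> y \<odot>\<^bsub>?B\<^esub> g)) i =
              (x \<odot>\<^bsub>?B\<^esub> (u3 \<odot>\<^bsub>?B\<^esub> k) \<oplus>\<^bsub>?B\<^esub> y \<odot>\<^bsub>?B\<^esub> (u3 \<odot>\<^bsub>?B\<^esub> c1)) i"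
            by (simp add: free_module_simps k_def c1_def)
        qed
        finally have eq: "(u3 \<otimes> (U \<otimes> u)) \<odot>\<^bsub>?B\<^esub> a = x \<odot>\<^bsub>?B\<^esub> (u3 \<odot>\<^bsub>?B\<^esub> k) \<oplus>\<^bsub>?B\<^esub> y \<odot>\<^bsub>?B\<^esub> (u3 \<odot>\<^bsub>?B\<^esub> c1)" .
        have "x \<odot>\<^bsub>?B\<^esub> (u3 \<odot>\<^bsub>?B\<^esub> k) \<oplus>\<^bsub>?B\<^esub> y \<odot>\<^bsub>?B\<^esub> (u3 \<odot>\<^bsub>?B\<^esub> c1) \<in> carrier ?B"
          using b1 c2 xR subD(1) by (simp add: Rel_def)
        then show "\<exists>u\<in>carrier R - p. \<exists>b\<in>Rel. \<exists>c\<in>Rel. \<exists>e\<in>{\<zero>\<^bsub>?B'\<^esub>}.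
            u \<odot>\<^bsub>?B'\<^esub> a = x \<odot>\<^bsub>?B'\<^esub> b \<oplus>\<^bsub>?B'\<^esub> y \<odot>\<^bsub>?B'\<^esub> c \<oplus>\<^bsub>?B'\<^esub> e"
          using primeideal_compl_mult[OF p u3(1) primeideal_compl_mult[OF p U u(1)]] b1 c2 eq
          by (intro bexI[of _ "u3 \<otimes> (U \<otimes> u)"] bexI[of _ "u3 \<odot>\<^bsub>?B\<^esub> k"] bexI[of _ "u3 \<odot>\<^bsub>?B\<^esub> c1"] bexI[of _ "\<zero>\<^bsub>?B\<^esub>"]) auto
      qed
    qed
  qed
  then obtain w where w: "w \<in> carrier R - p" "\<And>a. a \<in> Rel \<Longrightarrow> w \<odot>\<^bsub>?B\<^esub> a = \<zero>\<^bsub>?B\<^esub>"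
    using B'.sat_uniform[OF p Rel_fg B'.zero_submodule] by auto
  have uw: "u0 \<in> carrier R" "w \<in> carrier R" using u0 w by auto
  \<comment> \<open>Up to the denominator \<open>u0\<close>, each \<open>\<gamma> z\<close> is a
    combination of the chosen generators. The lift \<open>c\<close> selects the coefficients
    linearly in \<open>z\<close>, so it splits off the generators from \<open>?B\<close>.\<close>
  have "restrict (\<lambda>z. u0 \<odot>\<^bsub>?C\<^esub> \<gamma> z) (carrier ?B) \<in> module_hom R ?B ?C"
    by (rule module_hom_smult[OF B.module_axioms C.module_axioms \<gamma> uw(1)])
  then have "\<exists>c\<in>module_hom R ?B ?B'. \<forall>z\<in>carrier ?B.
      restrict \<gamma> (carrier ?B') (c z) = restrict (\<lambda>z. u0 \<odot>\<^bsub>?C\<^esub> \<gamma> z) (carrier ?B) z"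
  proof (rule free_module_lift[OF C.module_axioms B'.module_axioms _ \<gamma>'])
    fix b assume "b \<in> B"
    then have b: "uvec R b \<in> carrier ?B" by (rule uvec_carrier)
    then show "restrict (\<lambda>z. u0 \<odot>\<^bsub>?C\<^esub> \<gamma> z) (carrier ?B) (uvec R b) \<in> restrict \<gamma> (carrier ?B') ` carrier ?B'"
      using u0(2)[OF b] by auto
  qed
  then obtain c where c: "c \<in> module_hom R ?B ?B'"
    and "\<And>z. z \<in> carrier ?B \<Longrightarrow> restrict \<gamma> (carrier ?B') (c z) = u0 \<odot>\<^bsub>?C\<^esub> \<gamma> z" by auto
  note cD = module_homD[OF c]
  have gc: "\<gamma> (c z) = u0 \<odot>\<^bsub>?C\<^esub> \<gamma> z" if "z \<in> carrier ?B" for z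
    using \<open>\<And>z. z \<in> carrier ?B \<Longrightarrow> restrict \<gamma> (carrier ?B') (c z) = u0 \<odot>\<^bsub>?C\<^esub> \<gamma> z\<close>[OF that] cD(1)[OF that] by simp
  have cB: "c z \<in> carrier ?B" if "z \<in> carrier ?B" for z using cD(1)[OF that] subD(1) by blast
  \<comment> \<open>\<open>u0 z - c z\<close> lies in the kernel of \<open>\<gamma>\<close>, so
    \<open>?\<theta>\<close> lifts through \<open>\<beta>\<close>. On that kernel \<open>c z\<close>
    is a relation and \<open>w\<close> kills it, so there \<open>?\<theta>\<close> is multiplication
    by \<open>w u0\<close>.\<close>
  let ?\<theta> = "\<lambda>z. w \<odot>\<^bsub>?B\<^esub> (u0 \<odot>\<^bsub>?B\<^esub> z \<oplus>\<^bsub>?B\<^esub> (\<ominus> \<one>) \<odot>\<^bsub>?B\<^esub> c z)"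
  have \<theta>: "restrict ?\<theta> (carrier ?B) \<in> module_hom R ?B ?B"
  proof (rule module_homI[OF _ _ _ B.module_axioms])
    fix z assume z: "z \<in> carrier ?B"
    note car = free_module_carrier(1)[OF z] free_module_carrier(1)[OF cB[OF z]]
    show "?\<theta> z \<in> carrier ?B" using z cB uw by simp
    {
      fix r assume r: "r \<in> carrier R"
      have "w \<otimes> (u0 \<otimes> (r \<otimes> z i) \<oplus> \<ominus> \<one> \<otimes> (r \<otimes> c z i)) = r \<otimes> (w \<otimes> (u0 \<otimes> z i \<oplus> \<ominus> \<one> \<otimes> c z i))" for i
        using car[of i] r uw by algebra
      then show "?\<theta> (r \<odot>\<^bsub>?B\<^esub> z) = r \<odot>\<^bsub>?B\<^esub> ?\<theta> z"
        using cD(3)[OF r z] by (simp add: free_module_simps fun_eq_iff)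
    }
    fix y assume y: "y \<in> carrier ?B"
    note car' = free_module_carrier(1)[OF y] free_module_carrier(1)[OF cB[OF y]]
    have "w \<otimes> (u0 \<otimes> (z i \<oplus> y i) \<oplus> \<ominus> \<one> \<otimes> (c z i \<oplus> c y i)) =
        w \<otimes> (u0 \<otimes> z i \<oplus> \<ominus> \<one> \<otimes> c z i) \<oplus> w \<otimes> (u0 \<otimes> y i \<oplus> \<ominus> \<one> \<otimes> c y i)" for i
      using car[of i] car'[of i] uw by algebra
    then show "?\<theta> (z \<oplus>\<^bsub>?B\<^esub> y) = ?\<theta> z \<oplus>\<^bsub>?B\<^esub> ?\<theta> y"
      using cD(2)[OF z y] by (simp add: free_module_simps fun_eq_iff)
  qed
  have "\<exists>\<psi>\<in>module_hom R ?B A. \<forall>z\<in>carrier ?B. \<beta> (\<psi> z) = restrict ?\<theta> (carrier ?B) z"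
  proof (rule free_module_lift[OF B.module_axioms A \<theta> \<beta>])
    fix b assume "b \<in> B"
    then have b: "uvec R b \<in> carrier ?B" by (rule uvec_carrier)
    have "\<gamma> (?\<theta> (uvec R b)) = \<zero>\<^bsub>?C\<^esub>"
      using b cB[OF b] uw gD(1)[OF b] by (simp add: gD(2,3) gc C.smult_l_minus C.M.r_neg)
    then show "restrict ?\<theta> (carrier ?B) (uvec R b) \<in> \<beta> ` carrier A"
      unfolding ex1 using b cB[OF b] uw by simp
  qed
  then obtain \<psi> where \<psi>: "\<psi> \<in> module_hom R ?B A" "\<And>z. z \<in> carrier ?B \<Longrightarrow> \<beta> (\<psi> z) = ?\<theta> z" by auto
  have "\<beta> (\<psi> z) = (w \<otimes> u0) \<odot>\<^bsub>?B\<^esub> z" if "z \<in> \<beta> ` carrier A" for z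
  proof -
    have z: "z \<in> carrier ?B" "\<gamma> z = \<zero>\<^bsub>?C\<^esub>" using that unfolding ex1 by auto
    have "c z \<in> Rel" using cD(1)[OF z(1)] gc[OF z(1)] z(2) uw by (simp add: Rel_def)
    then have wc: "w \<odot>\<^bsub>?B\<^esub> c z = \<zero>\<^bsub>?B\<^esub>" by (rule w(2))
    have "?\<theta> z = w \<odot>\<^bsub>?B\<^esub> (u0 \<odot>\<^bsub>?B\<^esub> z) \<oplus>\<^bsub>?B\<^esub> (\<ominus> \<one>) \<odot>\<^bsub>?B\<^esub> (w \<odot>\<^bsub>?B\<^esub> c z)"
      using z cB[OF z(1)] uw by (simp add: B.smult_r_distr B.smult_r_minus B.smult_l_minus)
    then show ?thesis using \<psi>(2)[OF z(1)] z uw by (simp add: wc B.smult_assoc1)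
  qed
  then show ?thesis using primeideal_compl_mult[OF p w(1) u0(1)] \<psi>(1) by blast
qed

end

section \<open>Cocycles at regular primes\<close>

lemma free_resolution_exact:
  assumes "free_resolution R M B d \<epsilon>"
  shows "d (Suc i) ` carrier (free_module R (B (Suc (Suc i)))) =
    {z \<in> carrier (free_module R (B (Suc i))). d i z = \<zero>\<^bsub>free_module R (B i)\<^esub>}"
  using free_resolutionD(4)[OF assms, of "Suc i"] by (simp add: cycles_def)

context noetherian_cring
begin

text \<open>Let \<open>\<psi>\<close> be the local splitting. Then \<open>\<psi> (d x) - t x\<close>
  is a cycle, hence a boundary, and \<open>h\<close> kills it; so \<open>t h\<close> is the
  coboundary of \<open>h \<circ> \<psi>\<close>.\<close>

lemma regular_prime_kills_cocycle:
  fixes B :: "nat \<Rightarrow> 'x set"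
  assumes F: "free_resolution R M B d \<epsilon>" and fin: "\<And>i. finite (B i)"
    and p: "primeideal p R" and reg: "locally_principal_regular R p \<or> locally_regular_pair R p"
    and N: "module R N"
    and h: "h \<in> module_hom R (free_module R (B (Suc (Suc (Suc n))))) N"
    and coc: "\<And>x. x \<in> carrier (free_module R (B (Suc (Suc (Suc (Suc n)))))) \<Longrightarrow> h (d (Suc (Suc (Suc n))) x) = \<zero>\<^bsub>N\<^esub>"
  shows "\<exists>t\<in>carrier R - p. \<exists>k\<in>module_hom R (free_module R (B (Suc (Suc n)))) N.
    \<forall>x\<in>carrier (free_module R (B (Suc (Suc (Suc n))))). t \<odot>\<^bsub>N\<^esub> h x = k (d (Suc (Suc n)) x)"
proof -
  \<comment> \<open>The splitting is needed for the boundaries in degree \<open>j\<close>, and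
    \<open>syzygy_splits_locally\<close> requires two more free modules below that degree; hence
    \<open>j = n + 2\<close>.\<close>
  define j where "j = Suc (Suc n)"
  interpret F: module R "free_module R (B m)" for m by (rule free_module_module)
  interpret N: module R N by fact
  note d = free_resolutionD(3)[OF F] and ex = free_resolution_exact[OF F]
  obtain t \<psi> where t: "t \<in> carrier R - p" and \<psi>: "\<psi> \<in> module_hom R (free_module R (B j)) (free_module R (B (Suc j)))"
    and eq: "\<forall>z\<in>d j ` carrier (free_module R (B (Suc j))). d j (\<psi> z) = t \<odot>\<^bsub>free_module R (B j)\<^esub> z"
    using syzygy_splits_locally[OF p reg F.module_axioms fin fin fin d d d ex ex, of n] unfolding j_def by blast
  note hD = module_homD[OF h[folded j_def]] and dD = module_homD[OF d] and \<psi>D = module_homD[OF \<psi>]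
  have "t \<odot>\<^bsub>N\<^esub> h x = h (\<psi> (d j x))" if x: "x \<in> carrier (free_module R (B (Suc j)))" for x
  proof -
    let ?F = "free_module R (B (Suc j))"
    let ?w = "\<psi> (d j x) \<ominus>\<^bsub>?F\<^esub> t \<odot>\<^bsub>?F\<^esub> x"
    have car: "\<psi> (d j x) \<in> carrier ?F" "t \<odot>\<^bsub>?F\<^esub> x \<in> carrier ?F" using x t \<psi>D(1) dD(1) by auto
    have "d j ?w = d j (\<psi> (d j x)) \<ominus>\<^bsub>free_module R (B j)\<^esub> t \<odot>\<^bsub>free_module R (B j)\<^esub> d j x"
      using car x t by (simp add: module_hom_diff[OF F.module_axioms F.module_axioms d] dD(3))
    also have "\<dots> = \<zero>\<^bsub>free_module R (B j)\<^esub>"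
      using eq x t dD(1)[OF x] by (simp add: a_minus_def F.M.r_neg)
    finally have "?w \<in> d (Suc j) ` carrier (free_module R (B (Suc (Suc j))))"
      unfolding ex using car by simp
    then obtain y where "?w = d (Suc j) y" "y \<in> carrier (free_module R (B (Suc (Suc j))))" by (rule imageE)
    then have "h ?w = \<zero>\<^bsub>N\<^esub>" using coc[folded j_def, of y] by simp
    then have "h (\<psi> (d j x)) \<ominus>\<^bsub>N\<^esub> t \<odot>\<^bsub>N\<^esub> h x = \<zero>\<^bsub>N\<^esub>"
      using car x t hD(3) by (simp add: module_hom_diff[OF F.module_axioms N h[folded j_def]])
    then show ?thesis
      using N.minus_eq_zeroD[of "h (\<psi> (d j x))" "t \<odot>\<^bsub>N\<^esub> h x"] hD(1)[OF car(1)] hD(1)[OF x] t by simp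
  qed
  moreover have "restrict (\<lambda>z. h (\<psi> z)) (carrier (free_module R (B j))) \<in> module_hom R (free_module R (B j)) N"
    by (rule module_hom_compose[OF F.module_axioms \<psi> h[folded j_def]])
  ultimately show ?thesis
    unfolding j_def[symmetric] using t dD(1)
    by (intro bexI[of _ t] bexI[of _ "restrict (\<lambda>z. h (\<psi> z)) (carrier (free_module R (B j)))"]) auto
qed

section \<open>Associated primes of Ext through a resolution of finite rank\<close>

lemma associated_primes_Ext:
  fixes M :: "('a, 'c, 'n) module_scheme"
  assumes M: "module R M"
    and p: "p \<in> associated_primes R (Ext i R M (ring_as_module R))"
  shows "\<exists>(B :: nat \<Rightarrow> ('a \<times> 'c \<times> nat) set) d \<epsilon>. free_resolution R M B d \<epsilon> \<and> primeideal p R \<and>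
    (\<exists>h\<in>module_hom R (free_module R (B i)) (ring_as_module R).
      (\<forall>x\<in>carrier (free_module R (B (Suc i))). h (d i x) = \<zero>) \<and>
      p = {r \<in> carrier R. case i of
          0 \<Rightarrow> \<forall>x\<in>carrier (free_module R (B 0)). r \<otimes> h x = \<zero>
        | Suc j \<Rightarrow> \<exists>k\<in>module_hom R (free_module R (B j)) (ring_as_module R).
            \<forall>x\<in>carrier (free_module R (B i)). r \<otimes> h x = k (d j x)})"
proof -
  obtain B d where Bd: "chosen_resolution R M = (B, d)" by force
  then obtain \<epsilon> where F: "free_resolution R M B d \<epsilon>" using free_resolution_chosen[OF M] by blast
  have "d i (d (Suc i) x) = \<zero>\<^bsub>free_module R (B i)\<^esub>" if "x \<in> carrier (free_module R (B (Suc (Suc i))))" for i x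
    using free_resolution_exact[OF F, of i] that by blast
  note ass = associated_primes_Hom_cohomology[where d = d and B = B and i = i and p = p,
      OF is_cring ring_as_module_is_module free_resolutionD(3)[OF F] this]
  have "primeideal p R \<and> (\<exists>h\<in>module_hom R (free_module R (B i)) (ring_as_module R).
      (\<forall>x\<in>carrier (free_module R (B (Suc i))). h (d i x) = \<zero>) \<and>
      p = {r \<in> carrier R. case i of
          0 \<Rightarrow> \<forall>x\<in>carrier (free_module R (B 0)). r \<otimes> h x = \<zero>
        | Suc j \<Rightarrow> \<exists>k\<in>module_hom R (free_module R (B j)) (ring_as_module R).
            \<forall>x\<in>carrier (free_module R (B i)). r \<otimes> h x = k (d j x)})"
    using ass p unfolding Ext_def Bd prod.case ring_as_module_simps by (rule mp[OF impI])
  then show ?thesis using F by blast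
qed

text \<open>If some \<open>z\<close> in \<open>p\<close> were outside \<open>q\<close>, then
  \<open>z \<otimes> h x = \<zero>\<close> would put every value \<open>h x\<close> into
  \<open>q \<subseteq> p\<close>, which annihilates \<open>h\<close>. Hence \<open>h x\<close>
  squares to zero and vanishes by reducedness, and \<open>p\<close> would contain
  \<open>\<one>\<close>.\<close>

lemma associated_primes_Ext_0:
  fixes M :: "('a, 'c, 'n) module_scheme"
  assumes red: "reduced_ring R" and M: "module R M"
    and p: "p \<in> associated_primes R (Ext 0 R M (ring_as_module R))"
    and q: "primeideal q R" "q \<subseteq> p"
  shows "q = p"
proof (rule ccontr)
  assume "q \<noteq> p"
  then obtain z where z: "z \<in> p" "z \<notin> q" using q(2) by blast
  obtain S :: "('a \<times> 'c \<times> nat) set" and h where pp: "primeideal p R" and h: "h \<in> module_hom R (free_module R (S)) (ring_as_module R)"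
    and ph: "p = {r \<in> carrier R. \<forall>x\<in>carrier (free_module R (S)). r \<otimes> h x = \<zero>}"
    using associated_primes_Ext[OF M p] unfolding nat.case by blast
  interpret q: primeideal q R by fact
  have "h x = \<zero>" if x: "x \<in> carrier (free_module R S)" for x
  proof -
    have hx: "h x \<in> carrier R" using module_homD(1)[OF h x] by simp
    have "z \<otimes> h x = \<zero>" "z \<in> carrier R" using z(1) x unfolding ph by auto
    then have "h x \<in> q" using q.I_prime[of z "h x"] hx z(2) by auto
    then have "h x \<otimes> h x = \<zero>" using q(2) x unfolding ph by blast
    then have "h x [^] (2::nat) = \<zero>" using hx by (simp add: numeral_2_eq_2)
    then show ?thesis using red hx unfolding reduced_ring_def by blast
  qed
  then have "\<one> \<in> p" unfolding ph by simp
  then show False using primeideal_compl_one[OF pp] by blast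
qed

context
  fixes M :: "('a, 'c, 'n) module_scheme"
  assumes M: "module R M" "finitely_generated_module R M"
begin

text \<open>The resolution behind \<open>Ext\<close> is exchanged for one of finite rank by
  \<open>coboundary_transfer\<close>. A single finite resolution serves all degrees, and the cocycle
  condition is carried along for the vanishing argument at regular primes.\<close>

lemma associated_primes_Ext_Suc:
  "\<exists>(C :: nat \<Rightarrow> nat set) d \<epsilon>. free_resolution R M C d \<epsilon> \<and> (\<forall>i. finite (C i)) \<and>
    (\<forall>j. \<forall>p\<in>associated_primes R (Ext (Suc j) R M (ring_as_module R)). primeideal p R \<and>
      (\<exists>h\<in>module_hom R (free_module R (C (Suc j))) (ring_as_module R).
        (\<forall>x\<in>carrier (free_module R (C (Suc (Suc j)))). h (d (Suc j) x) = \<zero>) \<and>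
        p = {r \<in> carrier R. \<exists>k\<in>module_hom R (free_module R (C j)) (ring_as_module R).
              \<forall>x\<in>carrier (free_module R (C (Suc j))). r \<otimes> h x = k (d j x)}))"
proof -
  have "noetherian_cring R" by unfold_locales
  from finite_free_resolution_exists[OF this M]
  obtain C d \<eta> where G: "free_resolution R M (C :: nat \<Rightarrow> nat set) d \<eta>" "\<forall>i. finite (C i)" by blast
  have "primeideal p R \<and> (\<exists>h\<in>module_hom R (free_module R (C (Suc j))) (ring_as_module R).
        (\<forall>x\<in>carrier (free_module R (C (Suc (Suc j)))). h (d (Suc j) x) = \<zero>) \<and>
        p = {r \<in> carrier R. \<exists>k\<in>module_hom R (free_module R (C j)) (ring_as_module R).
              \<forall>x\<in>carrier (free_module R (C (Suc j))). r \<otimes> h x = k (d j x)})"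
    if p: "p \<in> associated_primes R (Ext (Suc j) R M (ring_as_module R))" for p j
  proof -
    obtain B d' \<epsilon> h where F: "free_resolution R M (B :: nat \<Rightarrow> ('a \<times> 'c \<times> nat) set) d' \<epsilon>" and pp: "primeideal p R"
      and h: "h \<in> module_hom R (free_module R (B (Suc j))) (ring_as_module R)"
      and coc: "\<And>x. x \<in> carrier (free_module R (B (Suc (Suc j)))) \<Longrightarrow> h (d' (Suc j) x) = \<zero>"
      and ph: "p = {r \<in> carrier R. \<exists>k\<in>module_hom R (free_module R (B j)) (ring_as_module R).
            \<forall>x\<in>carrier (free_module R (B (Suc j))). r \<otimes> h x = k (d' j x)}"
      using associated_primes_Ext[OF M(1) p] by auto
    obtain h' where h': "h' \<in> module_hom R (free_module R (C (Suc j))) (ring_as_module R)"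
      "\<forall>x\<in>carrier (free_module R (C (Suc (Suc j)))). h' (d (Suc j) x) = \<zero>"
      "\<forall>r\<in>carrier R.
      (\<exists>k\<in>module_hom R (free_module R (B j)) (ring_as_module R).
        \<forall>x\<in>carrier (free_module R (B (Suc j))). r \<otimes> h x = k (d' j x)) \<longleftrightarrow>
      (\<exists>k\<in>module_hom R (free_module R (C j)) (ring_as_module R).
        \<forall>x\<in>carrier (free_module R (C (Suc j))). r \<otimes> h' x = k (d j x))"
      using coboundary_transfer[OF is_cring M(1) F G(1) ring_as_module_is_module h] coc by auto
    have "p = {r \<in> carrier R. \<exists>k\<in>module_hom R (free_module R (C j)) (ring_as_module R).
              \<forall>x\<in>carrier (free_module R (C (Suc j))). r \<otimes> h' x = k (d j x)}"
      unfolding ph using h'(3) by (intro Collect_cong conj_cong refl) (rule bspec)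
    then show ?thesis using pp h'(1,2) by blast
  qed
  then show ?thesis using G by blast
qed

lemma finite_associated_primes_Ext_Suc:
  "finite (associated_primes R (Ext (Suc j) R M (ring_as_module R)))"
proof -
  obtain C d \<epsilon> where G: "free_resolution R M (C :: nat \<Rightarrow> nat set) d \<epsilon>" "\<forall>i. finite (C i)"
    and P: "\<forall>j. \<forall>p\<in>associated_primes R (Ext (Suc j) R M (ring_as_module R)). primeideal p R \<and>
      (\<exists>h\<in>module_hom R (free_module R (C (Suc j))) (ring_as_module R).
        (\<forall>x\<in>carrier (free_module R (C (Suc (Suc j)))). h (d (Suc j) x) = \<zero>) \<and>
        p = {r \<in> carrier R. \<exists>k\<in>module_hom R (free_module R (C j)) (ring_as_module R).
              \<forall>x\<in>carrier (free_module R (C (Suc j))). r \<otimes> h x = k (d j x)})"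
    using associated_primes_Ext_Suc by (elim exE conjE)
  have "associated_primes R (Ext (Suc j) R M (ring_as_module R)) \<subseteq>
    {p. primeideal p R \<and> (\<exists>h\<in>module_hom R (free_module R (C (Suc j))) (ring_as_module R).
      p = {r \<in> carrier R. \<exists>k\<in>module_hom R (free_module R (C j)) (ring_as_module R).
          \<forall>x\<in>carrier (free_module R (C (Suc j))). r \<otimes> h x = k (d j x)})}"
    using P by blast
  then show ?thesis
    using finite_coboundary_primes[OF G(2)[rule_format] free_resolutionD(3)[OF G(1)]] by (rule finite_subset)
qed

lemma associated_prime_Ext_not_regular:
  assumes "i \<ge> 3" and p: "p \<in> associated_primes R (Ext i R M (ring_as_module R))"
  shows "\<not> locally_principal_regular R p" "\<not> locally_regular_pair R p"
proof -
  obtain n where i: "i = Suc (Suc (Suc n))"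
    using \<open>i \<ge> 3\<close> by (auto simp: numeral_3_eq_3 le_iff_add)
  obtain C d \<epsilon> where G: "free_resolution R M (C :: nat \<Rightarrow> nat set) d \<epsilon>" "\<forall>i. finite (C i)"
    and P: "\<forall>j. \<forall>p\<in>associated_primes R (Ext (Suc j) R M (ring_as_module R)). primeideal p R \<and>
      (\<exists>h\<in>module_hom R (free_module R (C (Suc j))) (ring_as_module R).
        (\<forall>x\<in>carrier (free_module R (C (Suc (Suc j)))). h (d (Suc j) x) = \<zero>) \<and>
        p = {r \<in> carrier R. \<exists>k\<in>module_hom R (free_module R (C j)) (ring_as_module R).
              \<forall>x\<in>carrier (free_module R (C (Suc j))). r \<otimes> h x = k (d j x)})"
    using associated_primes_Ext_Suc by (elim exE conjE)
  obtain h where pp: "primeideal p R" and h: "h \<in> module_hom R (free_module R (C (Suc (Suc (Suc n))))) (ring_as_module R)"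
    and coc: "\<forall>x\<in>carrier (free_module R (C (Suc (Suc (Suc (Suc n)))))). h (d (Suc (Suc (Suc n))) x) = \<zero>"
    and ph: "p = {r \<in> carrier R. \<exists>k\<in>module_hom R (free_module R (C (Suc (Suc n)))) (ring_as_module R).
              \<forall>x\<in>carrier (free_module R (C (Suc (Suc (Suc n))))). r \<otimes> h x = k (d (Suc (Suc n)) x)}"
    using P[rule_format, OF p[unfolded i]] by blast
  have "\<not> (locally_principal_regular R p \<or> locally_regular_pair R p)"
  proof
    assume "locally_principal_regular R p \<or> locally_regular_pair R p"
    from regular_prime_kills_cocycle[OF G(1) G(2)[rule_format] pp this ring_as_module_is_module h]
    obtain t where "t \<in> carrier R - p"
      "\<exists>k\<in>module_hom R (free_module R (C (Suc (Suc n)))) (ring_as_module R).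
        \<forall>x\<in>carrier (free_module R (C (Suc (Suc (Suc n))))). t \<otimes> h x = k (d (Suc (Suc n)) x)"
      using coc by auto
    then have "t \<in> p" "t \<notin> p" unfolding ph by auto
    then show False by simp
  qed
  then show "\<not> locally_principal_regular R p" "\<not> locally_regular_pair R p" by auto
qed

end

end

section \<open>Regular primes of height one and two\<close>

context noetherian_cring
begin

interpretation M: module R "ring_as_module R" by (rule ring_as_module_is_module)

lemma ideal_fg: "ideal I R \<Longrightarrow> fg_sub R (ring_as_module R) I"
  using noetherian_ring_as_module by (simp add: noetherian_module_def submodule_iff_ideal)

lemma sat_primeideal:
  assumes "primeideal q R" "q \<subseteq> p"
  shows "sat R (ring_as_module R) p q \<subseteq> q"
proof
  interpret q: primeideal q R by fact
  fix a assume "a \<in> sat R (ring_as_module R) p q"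
  then obtain u where "u \<in> carrier R - p" "a \<in> carrier R" "u \<otimes> a \<in> q" by (auto simp: sat_def)
  then show "a \<in> q" using q.I_prime[of u a] assms(2) by blast
qed

text \<open>The smaller prime \<open>q\<close> ensures that \<open>x\<close> is not a local
  zerodivisor. From \<open>x \<notin> q\<close> one gets that \<open>q\<close> is locally
  \<open>x\<close> times itself, so it vanishes at \<open>p\<close> by Nakayama; but everything
  annihilated by \<open>x\<close> lies in \<open>q\<close>.\<close>

lemma locally_principal_regularI:
  assumes p: "primeideal p R" and q: "primeideal q R" "q \<subset> p"
    and x: "x \<in> p" "\<And>z. z \<in> p \<Longrightarrow> \<exists>u\<in>carrier R - p. \<exists>r\<in>carrier R. u \<otimes> z = x \<otimes> r"
  shows "locally_principal_regular R p"
proof -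
  interpret p: primeideal p R by fact
  interpret q: primeideal q R by (rule q(1))
  have xR: "x \<in> carrier R" using x by auto
  have xq: "x \<notin> q"
  proof
    assume xq: "x \<in> q"
    have "p \<subseteq> q"
    proof
      fix z assume z: "z \<in> p"
      obtain u r where u: "u \<in> carrier R - p" "r \<in> carrier R" "u \<otimes> z = x \<otimes> r" using x(2)[OF z] by blast
      then have "u \<otimes> z \<in> q" using xq by (simp add: q.I_r_closed)
      then show "z \<in> q" using q.I_prime[of u z] u q(2) z by auto
    qed
    then show False using q(2) by blast
  qed
  have "q \<subseteq> sat R (ring_as_module R) p {\<zero>\<^bsub>ring_as_module R\<^esub>}"
  proof (rule M.nakayama[OF p _ ideal_fg[OF q.is_ideal] M.zero_submodule x(1) x(1)])
    show "submodule q R (ring_as_module R)" by (simp add: submodule_iff_ideal q.is_ideal)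
    fix a assume a: "a \<in> q"
    obtain u r where u: "u \<in> carrier R - p" "r \<in> carrier R" "u \<otimes> a = x \<otimes> r" using x(2)[of a] a q(2) by blast
    then have "x \<otimes> r \<in> q" using a by (metis DiffD1 q.I_l_closed)
    then have "r \<in> q" using q.I_prime[OF xR u(2)] xq by blast
    then show "\<exists>u\<in>carrier R - p. \<exists>b\<in>q. \<exists>c\<in>q. \<exists>e\<in>{\<zero>\<^bsub>ring_as_module R\<^esub>}.
       u \<odot>\<^bsub>ring_as_module R\<^esub> a = x \<odot>\<^bsub>ring_as_module R\<^esub> b \<oplus>\<^bsub>ring_as_module R\<^esub> x \<odot>\<^bsub>ring_as_module R\<^esub> c \<oplus>\<^bsub>ring_as_module R\<^esub> e"
      using u xR by (intro bexI[of _ u] bexI[of _ r] bexI[of _ \<zero>]) auto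
  qed
  then have "\<exists>u\<in>carrier R - p. u \<otimes> r = \<zero>" if "r \<in> carrier R" "x \<otimes> r = \<zero>" for r
    using q.I_prime[OF xR that(1)] that xq by (auto simp: sat_def)
  then show ?thesis unfolding locally_principal_regular_def using x by blast
qed

text \<open>As long as the coefficient of the power of \<open>y\<close> lies in \<open>p\<close>, it
  can be rewritten by \<open>gen\<close> as a combination of \<open>x\<close> and \<open>y\<close>,
  which raises the exponent. The process stops early at a coefficient outside \<open>p\<close>; the
  exponent reached is an order in \<open>y\<close> modulo \<open>x\<close>.\<close>

lemma locally_generated_powers:
  fixes n :: nat
  assumes p: "primeideal p R" and x: "x \<in> p" "y \<in> p"
    and gen: "\<And>z. z \<in> p \<Longrightarrow> \<exists>u\<in>carrier R - p. \<exists>r\<in>carrier R. \<exists>s\<in>carrier R. u \<otimes> z = x \<otimes> r \<oplus> y \<otimes> s"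
    and w: "w \<in> carrier R"
  shows "(\<exists>u\<in>carrier R - p. \<exists>b\<in>carrier R. \<exists>c\<in>carrier R. u \<otimes> w = x \<otimes> b \<oplus> c \<otimes> y [^] n) \<or>
    (\<exists>j<n. \<exists>u\<in>carrier R - p. \<exists>b\<in>carrier R. \<exists>c\<in>carrier R - p. u \<otimes> w = x \<otimes> b \<oplus> c \<otimes> y [^] j)"
proof (induction n)
  case 0
  interpret p: primeideal p R by fact
  have "\<one> \<otimes> w = x \<otimes> \<zero> \<oplus> w \<otimes> y [^] (0::nat)" using w x by simp
  then show ?case using primeideal_compl_one[OF p] w by blast
next
  case (Suc n)
  interpret p: primeideal p R by fact
  have xR: "x \<in> carrier R" "y \<in> carrier R" "y [^] n \<in> carrier R" using x by auto
  show ?case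
  proof (cases "\<exists>j<n. \<exists>u\<in>carrier R - p. \<exists>b\<in>carrier R. \<exists>c\<in>carrier R - p. u \<otimes> w = x \<otimes> b \<oplus> c \<otimes> y [^] j")
    case True
    then show ?thesis using less_SucI by blast
  next
    case False
    then obtain u b c where u: "u \<in> carrier R - p" "b \<in> carrier R" "c \<in> carrier R"
      "u \<otimes> w = x \<otimes> b \<oplus> c \<otimes> y [^] n" using Suc by blast
    show ?thesis
    proof (cases "c \<in> p")
      case False
      then show ?thesis using u by blast
    next
      case True
      then obtain v r s where v: "v \<in> carrier R - p" "r \<in> carrier R" "s \<in> carrier R" "v \<otimes> c = x \<otimes> r \<oplus> y \<otimes> s"
        using gen by blast
      have R: "u \<in> carrier R" "v \<in> carrier R" using u v by auto
      have "(v \<otimes> u) \<otimes> w = v \<otimes> (x \<otimes> b \<oplus> c \<otimes> y [^] n)" using R w by (simp add: m_assoc flip: u(4))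
      also have "\<dots> = x \<otimes> (v \<otimes> b) \<oplus> (v \<otimes> c) \<otimes> y [^] n" using R u(2,3) xR by algebra
      also have "\<dots> = x \<otimes> (v \<otimes> b \<oplus> r \<otimes> y [^] n) \<oplus> s \<otimes> y [^] Suc n"
        unfolding v(4) nat_pow_Suc using R u(2) v(2,3) xR by algebra
      finally show ?thesis
        using primeideal_compl_mult[OF p v(1) u(1)] R u v xR by (intro disjI1) blast
    qed
  qed
qed

section \<open>Two local generators at the top of a chain of three primes\<close>

context
  fixes p q0 q x y
  assumes p: "primeideal p R" and q0: "primeideal q0 R" and q: "primeideal q R"
    and q0q: "q0 \<subset> q" and qp: "q \<subset> p" and xp: "x \<in> p" and yp: "y \<in> p"
    and gen: "\<And>z. z \<in> p \<Longrightarrow> \<exists>u\<in>carrier R - p. \<exists>r\<in>carrier R. \<exists>s\<in>carrier R. u \<otimes> z = x \<otimes> r \<oplus> y \<otimes> s"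
begin

interpretation p: primeideal p R by (rule p)
interpretation q0: primeideal q0 R by (rule q0)
interpretation q: primeideal q R by (rule q)

lemma pair_carrier: "x \<in> carrier R" "y \<in> carrier R"
  using xp yp by auto

text \<open>The contraction to \<open>R\<close> of the ideal \<open>(x) + q0\<close> of
  \<open>R_p\<close>. It is local at \<open>p\<close> by construction, so elements outside
  \<open>p\<close> can be cancelled.\<close>

definition pair_ideal where "pair_ideal = {a \<in> carrier R. \<exists>u\<in>carrier R - p. \<exists>r\<in>carrier R. \<exists>e\<in>q0. u \<otimes> a = x \<otimes> r \<oplus> e}"

lemma pair_ideal_eq: "pair_ideal = sat R (ring_as_module R) p (adjoin R (ring_as_module R) x q0)"
  unfolding pair_ideal_def sat_def adjoin_def using pair_carrier by (auto simp: m_comm)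

lemma pair_ideal_submodule: "submodule pair_ideal R (ring_as_module R)"
  unfolding pair_ideal_eq using pair_carrier
  by (intro M.sat_submodule p M.adjoin_submodule) (simp_all add: submodule_iff_ideal q0.is_ideal)

lemma pair_ideal_ideal: "ideal pair_ideal R"
  using pair_ideal_submodule by (simp add: submodule_iff_ideal)

interpretation PI: ideal pair_ideal R by (rule pair_ideal_ideal)

lemma pair_ideal_I:
  assumes "u \<in> carrier R - p" "a \<in> carrier R" "u \<otimes> a \<in> pair_ideal"
  shows "a \<in> pair_ideal"
proof -
  have "a \<in> sat R (ring_as_module R) p pair_ideal" by (rule M.satI[OF assms(1)]) (simp_all add: assms)
  then show ?thesis using M.sat_idem[OF p] unfolding pair_ideal_eq by blast
qed

lemma pair_ideal_D: "a \<in> pair_ideal \<Longrightarrow> \<exists>u\<in>carrier R - p. \<exists>r\<in>carrier R. \<exists>e\<in>q0. u \<otimes> a = x \<otimes> r \<oplus> e"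
  unfolding pair_ideal_def by blast

lemma pair_ideal_contains: "r \<in> carrier R \<Longrightarrow> e \<in> q0 \<Longrightarrow> x \<otimes> r \<oplus> e \<in> pair_ideal"
  using primeideal_compl_one[OF p] pair_carrier unfolding pair_ideal_def
  by (intro CollectI conjI bexI[of _ \<one>] bexI[of _ r] bexI[of _ e]) auto

lemma x_in_pair_ideal: "x \<in> pair_ideal"
  using pair_ideal_contains[of \<one> \<zero>] pair_carrier by simp

lemma pair_x_notin: "x \<in> q \<Longrightarrow> y \<notin> q"
proof
  assume xy: "x \<in> q" "y \<in> q"
  have "p \<subseteq> q"
  proof
    fix z assume z: "z \<in> p"
    obtain u r s where u: "u \<in> carrier R - p" "r \<in> carrier R" "s \<in> carrier R" "u \<otimes> z = x \<otimes> r \<oplus> y \<otimes> s"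
      using gen[OF z] by blast
    have "u \<otimes> z \<in> q" unfolding u(4) using u xy by (intro q.a_closed q.I_r_closed)
    then show "z \<in> q" using q.I_prime[of u z] u qp z by auto
  qed
  then show False using qp by blast
qed

text \<open>This is the case of Krull's principal ideal theorem that is needed here. If \<open>y\<^sup>k\<close> lay
  in \<open>(x) + q0\<close>, an element \<open>z\<close> of \<open>q\<close> of minimal order in \<open>y\<close> would generate \<open>q\<close> modulo \<open>q0\<close>. Some
  power of \<open>z\<close> is in \<open>(x) + q0\<close>, and dividing by \<open>z\<close>, which is prime to \<open>x\<close>, lowers the exponent.\<close>

lemma power_notin_pair_ideal: "y [^] (k::nat) \<notin> pair_ideal"
proof
  assume yk: "y [^] k \<in> pair_ideal"
  note xyR = pair_carrier
  \<comment> \<open>In \<open>u a = x r + e\<close> with \<open>a\<close> and \<open>e\<close> in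
    \<open>q\<close>, primality and \<open>x \<notin> q\<close> give \<open>r \<in> q\<close>. So
    locally \<open>q = x q + N\<close>, and Nakayama removes the first summand.\<close>
  have q_le: "q \<subseteq> sat R (ring_as_module R) p N"
    if N: "submodule N R (ring_as_module R)" and dec: "\<And>a. a \<in> q \<Longrightarrow> \<exists>u\<in>carrier R - p. \<exists>r\<in>carrier R. \<exists>e\<in>N. u \<otimes> a = x \<otimes> r \<oplus> e"
      and Nq: "N \<subseteq> q" and xq: "x \<notin> q" for N
  proof (rule M.nakayama[OF p _ ideal_fg[OF q.is_ideal] N xp xp])
    show "submodule q R (ring_as_module R)" by (simp add: submodule_iff_ideal q.is_ideal)
    fix a assume a: "a \<in> q"
    obtain u r e where u: "u \<in> carrier R - p" "r \<in> carrier R" "e \<in> N" "u \<otimes> a = x \<otimes> r \<oplus> e"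
      using dec[OF a] by blast
    have e: "e \<in> q" "e \<in> carrier R" using u(3) Nq by auto
    have "x \<otimes> r = u \<otimes> a \<ominus> e" unfolding u(4) using xyR u(2) e by algebra
    also have "\<dots> \<in> q" using a u(1) e by (simp add: a_minus_def q.I_l_closed)
    finally have "r \<in> q" using q.I_prime[OF xyR(1) u(2)] xq by blast
    then show "\<exists>u\<in>carrier R - p. \<exists>b\<in>q. \<exists>c\<in>q. \<exists>e\<in>N.
       u \<odot>\<^bsub>ring_as_module R\<^esub> a = x \<odot>\<^bsub>ring_as_module R\<^esub> b \<oplus>\<^bsub>ring_as_module R\<^esub> x \<odot>\<^bsub>ring_as_module R\<^esub> c \<oplus>\<^bsub>ring_as_module R\<^esub> e"
      using u xyR by (intro bexI[of _ u] bexI[of _ r] bexI[of _ \<zero>] bexI[of _ e]) auto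
  qed
  have xq: "x \<notin> q"
  proof
    assume xq: "x \<in> q"
    have "pair_ideal \<subseteq> sat R (ring_as_module R) p q"
    proof
      fix a assume a: "a \<in> pair_ideal"
      then have aR: "a \<in> carrier R" by simp
      obtain u r e where u: "u \<in> carrier R - p" "r \<in> carrier R" "e \<in> q0" "u \<otimes> a = x \<otimes> r \<oplus> e"
        using pair_ideal_D[OF a] by blast
      have "u \<otimes> a \<in> q" unfolding u(4) using u xq q0q by (intro q.a_closed q.I_r_closed) auto
      then show "a \<in> sat R (ring_as_module R) p q" using aR by (intro M.satI[OF u(1)]) simp_all
    qed
    then have "y [^] k \<in> q" using yk sat_primeideal[OF q] qp by blast
    moreover have "y [^] n \<notin> q" for n :: nat
    proof (induction n)
      case 0 then show ?case using primeideal_compl_one[OF q] by simp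
    next
      case (Suc n)
      then show ?case using q.I_prime[of "y [^] n" y] xyR pair_x_notin[OF xq] by auto
    qed
    ultimately show False by blast
  qed
  have alt: "w \<in> pair_ideal \<or> (\<exists>j::nat. \<exists>u\<in>carrier R - p. \<exists>b\<in>carrier R. \<exists>c\<in>carrier R - p. u \<otimes> w = x \<otimes> b \<oplus> c \<otimes> y [^] j)"
    if w: "w \<in> carrier R" for w
    using locally_generated_powers[OF p xp yp gen w, of k]
  proof
    assume "\<exists>u\<in>carrier R - p. \<exists>b\<in>carrier R. \<exists>c\<in>carrier R. u \<otimes> w = x \<otimes> b \<oplus> c \<otimes> y [^] k"
    then obtain u b c where u: "u \<in> carrier R - p" "b \<in> carrier R" "c \<in> carrier R"
      "u \<otimes> w = x \<otimes> b \<oplus> c \<otimes> y [^] k" by blast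
    have "u \<otimes> w \<in> pair_ideal" unfolding u(4) using u yk x_in_pair_ideal by (intro PI.a_closed PI.I_r_closed PI.I_l_closed)
    then show ?thesis using pair_ideal_I[OF u(1) w] by blast
  next
    assume "\<exists>j<k. \<exists>u\<in>carrier R - p. \<exists>b\<in>carrier R. \<exists>c\<in>carrier R - p. u \<otimes> w = x \<otimes> b \<oplus> c \<otimes> y [^] j"
    then obtain j :: nat where "\<exists>u\<in>carrier R - p. \<exists>b\<in>carrier R. \<exists>c\<in>carrier R - p. u \<otimes> w = x \<otimes> b \<oplus> c \<otimes> y [^] j"
      by (elim exE conjE)
    then show ?thesis by (intro disjI2 exI[of _ j])
  qed
  \<comment> \<open>The orders in \<open>y\<close>, modulo \<open>x\<close>, that occur for elements
    of \<open>q\<close>. If there were none, all of \<open>q\<close> would lie in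
    \<open>pair_ideal\<close>, and \<open>q_le\<close> would give
    \<open>q \<subseteq> q0\<close>.\<close>
  define S where "S = {j. \<exists>z\<in>q. \<exists>u\<in>carrier R - p. \<exists>b\<in>carrier R. \<exists>c\<in>carrier R - p. u \<otimes> z = x \<otimes> b \<oplus> c \<otimes> y [^] (j::nat)}"
  have "S \<noteq> {}"
  proof
    assume "S = {}"
    have qJ: "q \<subseteq> pair_ideal"
    proof
      fix w assume w: "w \<in> q"
      then have "w \<in> carrier R" by simp
      from alt[OF this] show "w \<in> pair_ideal"
      proof
        assume "\<exists>j::nat. \<exists>u\<in>carrier R - p. \<exists>b\<in>carrier R. \<exists>c\<in>carrier R - p. u \<otimes> w = x \<otimes> b \<oplus> c \<otimes> y [^] j"
        then obtain j where "j \<in> S" unfolding S_def using w by (elim exE) blast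
        then show ?thesis using \<open>S = {}\<close> by blast
      qed
    qed
    have "q \<subseteq> sat R (ring_as_module R) p q0"
    proof (rule q_le[OF _ _ _ xq])
      fix a assume "a \<in> q"
      then show "\<exists>u\<in>carrier R - p. \<exists>r\<in>carrier R. \<exists>e\<in>q0. u \<otimes> a = x \<otimes> r \<oplus> e" using qJ pair_ideal_D by blast
    qed (use q0q q0.is_ideal in \<open>auto simp: submodule_iff_ideal\<close>)
    then show False using sat_primeideal[OF q0, of p] q0q qp by blast
  qed
  define j where "j = (LEAST j. j \<in> S)"
  have j: "j \<in> S" and j_le: "\<And>i. i \<in> S \<Longrightarrow> j \<le> i"
    unfolding j_def using \<open>S \<noteq> {}\<close> by (auto intro: LeastI Least_le)
  obtain z u b c where z: "z \<in> q" and u: "u \<in> carrier R - p" "b \<in> carrier R" "c \<in> carrier R - p"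
    "u \<otimes> z = x \<otimes> b \<oplus> c \<otimes> y [^] j" using j unfolding S_def by blast
  have zR: "z \<in> carrier R" using z by simp
  define N0 where "N0 = adjoin R (ring_as_module R) z q0"
  have N0: "submodule N0 R (ring_as_module R)" unfolding N0_def using zR
    by (intro M.adjoin_submodule) (auto simp: submodule_iff_ideal q0.is_ideal)
  have N0I: "t \<otimes> z \<oplus> e \<in> N0" if "t \<in> carrier R" "e \<in> q0" for t e
    using that by (auto simp: N0_def adjoin_def)
  have N0q: "N0 \<subseteq> q" using z q0q by (auto simp: N0_def adjoin_def q.I_l_closed)
  have "q \<subseteq> sat R (ring_as_module R) p N0"
  proof (rule q_le[OF N0 _ N0q xq])
    fix w assume w: "w \<in> q"
    then have wR: "w \<in> carrier R" by simp
    show "\<exists>u\<in>carrier R - p. \<exists>r\<in>carrier R. \<exists>e\<in>N0. u \<otimes> w = x \<otimes> r \<oplus> e"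
    proof (cases "w \<in> pair_ideal")
      case True
      then obtain v r e where v: "v \<in> carrier R - p" "r \<in> carrier R" "e \<in> q0" "v \<otimes> w = x \<otimes> r \<oplus> e"
        using pair_ideal_D by blast
      have "e \<in> N0" using N0I[OF zero_closed v(3)] v(3) zR by simp
      then show ?thesis using v by blast
    next
      case False
      then obtain i v b' c' where v: "v \<in> carrier R - p" "b' \<in> carrier R" "c' \<in> carrier R - p"
        "v \<otimes> w = x \<otimes> b' \<oplus> c' \<otimes> y [^] (i::nat)" using alt[OF wR] by blast
      have "i \<in> S" unfolding S_def using v w by blast
      then have ji: "j \<le> i" by (rule j_le)
      define Y where "Y = y [^] (i - j)"
      have yi: "y [^] i = Y \<otimes> y [^] j" using ji xyR by (simp add: Y_def nat_pow_mult)
      define Z where "Z = y [^] j"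
      have R: "u \<in> carrier R" "c \<in> carrier R" "v \<in> carrier R" "c' \<in> carrier R" "Y \<in> carrier R" "Z \<in> carrier R"
        using u v xyR by (auto simp: Y_def Z_def)
      \<comment> \<open>Up to the local unit \<open>c\<close>, \<open>y [^] j\<close> equals
        \<open>u z\<close> modulo \<open>x\<close>. An element of \<open>q\<close> of order
        \<open>i \<ge> j\<close> is therefore a multiple of \<open>z\<close> modulo
        \<open>x\<close>, which is the form that \<open>q_le\<close> needs.\<close>
      have uz: "c \<otimes> Z = u \<otimes> z \<ominus> x \<otimes> b" unfolding u(4)[folded Z_def] using R u(2) xyR by algebra
      have "(c \<otimes> v) \<otimes> w = c \<otimes> (v \<otimes> w)" using R wR by (simp add: m_assoc)
      also have "\<dots> = x \<otimes> (c \<otimes> b') \<oplus> c' \<otimes> Y \<otimes> (c \<otimes> Z)"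
        unfolding v(4) yi Z_def[symmetric] using R v(2) xyR by algebra
      also have "\<dots> = x \<otimes> (c \<otimes> b' \<ominus> c' \<otimes> Y \<otimes> b) \<oplus> ((c' \<otimes> Y \<otimes> u) \<otimes> z)"
        unfolding uz using R v(2) u(2) xyR zR by algebra
      finally have eq: "(c \<otimes> v) \<otimes> w = x \<otimes> (c \<otimes> b' \<ominus> c' \<otimes> Y \<otimes> b) \<oplus> ((c' \<otimes> Y \<otimes> u) \<otimes> z)" .
      have "(c' \<otimes> Y \<otimes> u) \<otimes> z \<oplus> \<zero> \<in> N0" by (rule N0I) (use R in auto)
      then have "(c' \<otimes> Y \<otimes> u) \<otimes> z \<in> N0" using R zR by simp
      then show ?thesis using eq primeideal_compl_mult[OF p u(3) v(1)] R u(2) v(2)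
        by (intro bexI[of _ "c \<otimes> v"] bexI[of _ "c \<otimes> b' \<ominus> c' \<otimes> Y \<otimes> b"] bexI[of _ "(c' \<otimes> Y \<otimes> u) \<otimes> z"]) auto
    qed
  qed
  then have sub: "q \<subseteq> sat R (ring_as_module R) p N0" .
  have q_N0: "\<exists>v\<in>carrier R - p. \<exists>t\<in>carrier R. \<exists>e\<in>q0. v \<otimes> a = t \<otimes> z \<oplus> e" if a: "a \<in> q" for a
  proof -
    obtain v where v: "v \<in> carrier R - p" "v \<otimes> a \<in> N0" using subsetD[OF sub a] by (auto simp: sat_def)
    from v(2) have "\<exists>t\<in>carrier R. \<exists>e\<in>q0. v \<otimes> a = t \<otimes> z \<oplus> e" unfolding N0_def adjoin_def by auto
    then show ?thesis using v(1) by blast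
  qed
  have zq0: "z \<notin> q0"
  proof
    assume zq0: "z \<in> q0"
    have "q \<subseteq> sat R (ring_as_module R) p q0"
    proof
      fix a assume a: "a \<in> q"
      obtain v t e where v: "v \<in> carrier R - p" "t \<in> carrier R" "e \<in> q0" "v \<otimes> a = t \<otimes> z \<oplus> e"
        using q_N0[OF a] by blast
      have "v \<otimes> a \<in> q0" unfolding v(4) using v zq0 by (intro q0.a_closed q0.I_l_closed)
      then show "a \<in> sat R (ring_as_module R) p q0" using a by (intro M.satI[OF v(1)]) simp_all
    qed
    then show False using sat_primeideal[OF q0, of p] q0q qp by blast
  qed
  have "\<exists>n. z [^] (n::nat) \<in> pair_ideal"
  proof -
    obtain v r s where v: "v \<in> carrier R - p" "r \<in> carrier R" "s \<in> carrier R" "v \<otimes> z = x \<otimes> r \<oplus> y \<otimes> s"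
      using gen[OF psubsetD[OF qp z]] by blast
    \<comment> \<open>Modulo \<open>pair_ideal\<close> the element \<open>v z\<close> is
      \<open>y s\<close>, so its \<open>k\<close>-th power is divisible by \<open>y [^] k\<close>,
      which was assumed to lie in \<open>pair_ideal\<close>.\<close>
    have "\<exists>e\<in>pair_ideal. (v \<otimes> z) [^] n = s [^] n \<otimes> y [^] n \<oplus> e" for n :: nat
    proof (induction n)
      case 0
      then show ?case by (intro bexI[of _ \<zero>]) auto
    next
      case (Suc n)
      then obtain e where e: "e \<in> pair_ideal" "(v \<otimes> z) [^] n = s [^] n \<otimes> y [^] n \<oplus> e" by blast
      have R: "s [^] n \<in> carrier R" "y [^] n \<in> carrier R" "e \<in> carrier R" using v xyR e(1) by auto
      have "(v \<otimes> z) [^] Suc n = (s [^] n \<otimes> y [^] n \<oplus> e) \<otimes> (x \<otimes> r \<oplus> y \<otimes> s)"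
        unfolding nat_pow_Suc e(2) by (simp only: v(4))
      also have "\<dots> = s [^] Suc n \<otimes> y [^] Suc n \<oplus> (x \<otimes> (s [^] n \<otimes> y [^] n \<otimes> r) \<oplus> e \<otimes> (x \<otimes> r \<oplus> y \<otimes> s))"
        unfolding nat_pow_Suc using R v(2,3) xyR by algebra
      finally show ?case
        using R v(2,3) xyR e(1) x_in_pair_ideal
        by (intro bexI[of _ "x \<otimes> (s [^] n \<otimes> y [^] n \<otimes> r) \<oplus> e \<otimes> (x \<otimes> r \<oplus> y \<otimes> s)"] PI.a_closed PI.I_r_closed) auto
    qed
    then obtain e where e: "e \<in> pair_ideal" "(v \<otimes> z) [^] k = s [^] k \<otimes> y [^] k \<oplus> e" by blast
    have "(v \<otimes> z) [^] k \<in> pair_ideal" unfolding e(2) using e(1) yk v by (intro PI.a_closed PI.I_l_closed) auto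
    then have "v [^] k \<otimes> z [^] k \<in> pair_ideal" using v(1) zR by (simp add: nat_pow_distrib)
    moreover have "v [^] n \<in> carrier R - p" for n :: nat
    proof (induction n)
      case 0 then show ?case using primeideal_compl_one[OF p] by simp
    next
      case (Suc n) then show ?case using primeideal_compl_mult[OF p Suc v(1)] by simp
    qed
    ultimately show ?thesis using pair_ideal_I zR by blast
  qed
  define n where "n = (LEAST n. z [^] (n::nat) \<in> pair_ideal)"
  have n: "z [^] n \<in> pair_ideal" and n_le: "\<And>m. z [^] m \<in> pair_ideal \<Longrightarrow> n \<le> m"
    unfolding n_def using \<open>\<exists>n. z [^] n \<in> pair_ideal\<close> by (auto intro: LeastI Least_le)
  obtain v r e where v: "v \<in> carrier R - p" "r \<in> carrier R" "e \<in> q0" "v \<otimes> z [^] n = x \<otimes> r \<oplus> e"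
    using pair_ideal_D[OF n] by blast
  have R: "v \<in> carrier R" "e \<in> carrier R" using v by auto
  show False
  proof (cases n)
    case 0
    have "v \<otimes> z [^] n \<in> p" unfolding v(4) using v xp q0q qp by (intro p.a_closed p.I_r_closed) auto
    then show False using 0 v by simp
  next
    case (Suc m)
    have zm: "z [^] m \<in> carrier R" using zR by simp
    have eq: "v \<otimes> (z [^] m \<otimes> z) = x \<otimes> r \<oplus> e" using v(4) Suc by simp
    have "x \<otimes> r = v \<otimes> (z [^] m \<otimes> z) \<ominus> e" unfolding eq using xyR v(2) R by algebra
    also have "\<dots> \<in> q" using R zm z v(3) q0q by (auto simp: a_minus_def intro!: q.a_closed q.I_l_closed)
    finally have "r \<in> q" using q.I_prime[OF xyR(1) v(2)] xq by blast
    then obtain v' t e' where v': "v' \<in> carrier R - p" "t \<in> carrier R" "e' \<in> q0" "v' \<otimes> r = t \<otimes> z \<oplus> e'"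
      using q_N0 by blast
    have R': "v' \<in> carrier R" "e' \<in> carrier R" using v' by auto
    \<comment> \<open>In \<open>v z^(m+1) = x r + e\<close> the coefficient \<open>r\<close> lies in
      \<open>q\<close>, so it is a multiple of \<open>z\<close> modulo \<open>q0\<close> up to
      \<open>v'\<close>. Then \<open>z\<close> can be divided out modulo the prime
      \<open>q0\<close>, which puts \<open>z [^] m\<close> into \<open>pair_ideal\<close> and
      contradicts the minimality of \<open>n\<close>.\<close>
    have "z \<otimes> (v' \<otimes> v \<otimes> z [^] m \<ominus> x \<otimes> t) = v' \<otimes> (v \<otimes> (z [^] m \<otimes> z)) \<ominus> x \<otimes> (t \<otimes> z)"
      using zR zm R R' v'(2) xyR by algebra
    also have "\<dots> = x \<otimes> (v' \<otimes> r) \<oplus> v' \<otimes> e \<ominus> x \<otimes> (t \<otimes> z)"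
      unfolding eq using R R' v(2) v'(2) xyR zR by algebra
    also have "\<dots> = x \<otimes> e' \<oplus> v' \<otimes> e"
      unfolding v'(4) using R R' v(2) v'(2) xyR zR by algebra
    also have "\<dots> \<in> q0" using R' xyR v(3) v'(3) by (intro q0.a_closed q0.I_l_closed)
    finally have "v' \<otimes> v \<otimes> z [^] m \<ominus> x \<otimes> t \<in> q0" (is "?e \<in> q0")
      using q0.I_prime[OF zR, of ?e] zq0 R R' zm xyR v'(2) by auto
    then have "x \<otimes> t \<oplus> ?e \<in> pair_ideal" by (rule pair_ideal_contains[OF v'(2)])
    moreover have "x \<otimes> t \<oplus> ?e = (v' \<otimes> v) \<otimes> z [^] m" using R R' zm xyR v'(2) by algebra
    ultimately have "z [^] m \<in> pair_ideal" using pair_ideal_I[OF primeideal_compl_mult[OF p v'(1) v(1)] zm] by simp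
    then show False using n_le[of m] Suc by simp
  qed
qed

text \<open>Everything killed by some power of \<open>y\<close> modulo \<open>pair_ideal\<close> is
  collected in \<open>T\<close>. Since no power of \<open>y\<close> is in \<open>pair_ideal\<close>,
  \<open>T\<close> lies in \<open>p\<close>; it then turns out to equal
  \<open>y T + (x) + q0\<close> locally, and Nakayama puts it into \<open>pair_ideal\<close>.
  Passing to all powers of \<open>y\<close> is what makes \<open>T\<close> stable under division by
  \<open>y\<close>.\<close>

lemma mult_in_pair_ideal:
  assumes s: "s \<in> carrier R" "y \<otimes> s \<in> pair_ideal"
  shows "s \<in> pair_ideal"
proof -
  note xyR = pair_carrier
  define T where "T = {s \<in> carrier R. \<exists>k::nat. y [^] k \<otimes> s \<in> pair_ideal}"
  have mono: "y [^] m \<otimes> a \<in> pair_ideal" if "y [^] k \<otimes> a \<in> pair_ideal" "k \<le> m" "a \<in> carrier R" for k m :: nat and a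
  proof -
    have "y [^] m \<otimes> a = y [^] (m - k) \<otimes> (y [^] k \<otimes> a)"
      using that xyR by (simp add: m_assoc[symmetric] nat_pow_mult)
    then show ?thesis using that xyR by (simp add: PI.I_l_closed)
  qed
  have T: "submodule T R (ring_as_module R)"
  proof (rule M.submoduleI)
    show "\<zero>\<^bsub>ring_as_module R\<^esub> \<in> T" using xyR by (auto simp: T_def)
    fix a assume a: "a \<in> T"
    then obtain k where k: "a \<in> carrier R" "y [^] (k::nat) \<otimes> a \<in> pair_ideal" by (auto simp: T_def)
    then show "\<ominus>\<^bsub>ring_as_module R\<^esub> a \<in> T" using xyR by (auto simp: T_def r_minus intro!: exI[of _ k])
    fix b assume "b \<in> T"
    then obtain m where m: "b \<in> carrier R" "y [^] (m::nat) \<otimes> b \<in> pair_ideal" by (auto simp: T_def)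
    have "y [^] (max k m) \<otimes> (a \<oplus> b) \<in> pair_ideal"
      using mono[OF k(2) _ k(1), of "max k m"] mono[OF m(2) _ m(1), of "max k m"] k m xyR by (simp add: r_distr)
    then show "a \<oplus>\<^bsub>ring_as_module R\<^esub> b \<in> T" using k m by (auto simp: T_def)
  next
    fix r a assume r: "r \<in> carrier R" and "a \<in> T"
    then obtain k where k: "a \<in> carrier R" "y [^] (k::nat) \<otimes> a \<in> pair_ideal" by (auto simp: T_def)
    have "y [^] k \<otimes> (r \<otimes> a) = r \<otimes> (y [^] k \<otimes> a)" using r k xyR by (simp add: m_lcomm)
    then show "r \<odot>\<^bsub>ring_as_module R\<^esub> a \<in> T" using r k by (auto simp: T_def PI.I_l_closed intro!: exI[of _ k])
  qed (auto simp: T_def)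
  define N0 where "N0 = adjoin R (ring_as_module R) x q0"
  have N0: "submodule N0 R (ring_as_module R)" unfolding N0_def using xyR
    by (intro M.adjoin_submodule) (auto simp: submodule_iff_ideal q0.is_ideal)
  have "T \<subseteq> sat R (ring_as_module R) p N0"
  proof (rule M.nakayama[OF p T _ N0 yp yp])
    show "fg_sub R (ring_as_module R) T" using T by (intro ideal_fg) (simp add: submodule_iff_ideal)
    fix a assume "a \<in> T"
    then obtain k where k: "a \<in> carrier R" "y [^] (k::nat) \<otimes> a \<in> pair_ideal" by (auto simp: T_def)
    have "a \<in> p"
    proof (rule ccontr)
      assume "a \<notin> p"
      then have "y [^] k \<in> pair_ideal" using k xyR pair_ideal_I[of a "y [^] k"] by (simp add: m_comm)
      then show False using power_notin_pair_ideal by blast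
    qed
    then obtain u r c where u: "u \<in> carrier R - p" "r \<in> carrier R" "c \<in> carrier R" "u \<otimes> a = x \<otimes> r \<oplus> y \<otimes> c"
      using gen by blast
    define Y where "Y = y [^] k"
    have R: "Y \<in> carrier R" "u \<in> carrier R" using xyR u by (auto simp: Y_def)
    \<comment> \<open>The cofactor \<open>c\<close> is in \<open>T\<close> again, with exponent one
      larger: \<open>y [^] Suc k \<otimes> c\<close> is \<open>u y^k a\<close> minus a multiple of
      \<open>x\<close>, and both lie in \<open>pair_ideal\<close>.\<close>
    have "y [^] Suc k \<otimes> c = Y \<otimes> (y \<otimes> c)" using xyR u(3) by (simp add: Y_def m_assoc)
    also have "y \<otimes> c = u \<otimes> a \<ominus> x \<otimes> r" unfolding u(4) using xyR u(2,3) by algebra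
    also have "Y \<otimes> (u \<otimes> a \<ominus> x \<otimes> r) = u \<otimes> (Y \<otimes> a) \<oplus> x \<otimes> (\<ominus> (Y \<otimes> r))"
      using R xyR u(2) k(1) by algebra
    also have "\<dots> \<in> pair_ideal" using R k(2) u(2)
      by (intro PI.a_closed[OF PI.I_l_closed PI.I_r_closed[OF x_in_pair_ideal]]) (simp_all add: Y_def)
    finally have "c \<in> T" using u(3) unfolding T_def by blast
    moreover have "x \<otimes> r \<in> N0" unfolding N0_def adjoin_def using u(2) xyR
      by (intro CollectI exI[of _ r] exI[of _ \<zero>]) (simp add: m_comm)
    moreover have "u \<otimes> a = y \<otimes> c \<oplus> y \<otimes> \<zero> \<oplus> x \<otimes> r" unfolding u(4) using xyR u(2,3) by algebra
    moreover have "\<zero> \<in> T" using M.submodule_zero[OF T] by simp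
    ultimately show "\<exists>u\<in>carrier R - p. \<exists>b\<in>T. \<exists>c\<in>T. \<exists>e\<in>N0.
       u \<odot>\<^bsub>ring_as_module R\<^esub> a = y \<odot>\<^bsub>ring_as_module R\<^esub> b \<oplus>\<^bsub>ring_as_module R\<^esub> y \<odot>\<^bsub>ring_as_module R\<^esub> c \<oplus>\<^bsub>ring_as_module R\<^esub> e"
      using u(1) unfolding ring_as_module_simps by blast
  qed
  moreover have "s \<in> T" using s xyR by (auto simp: T_def intro!: exI[of _ "1::nat"])
  ultimately show ?thesis unfolding pair_ideal_eq N0_def by blast
qed

text \<open>The smallest prime \<open>q0\<close> vanishes at \<open>p\<close>, being locally
  \<open>x q0 + y q0\<close>. After that \<open>pair_ideal\<close> is locally just
  \<open>(x)\<close>, so \<open>mult_in_pair_ideal\<close> says that \<open>y\<close> is regular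
  modulo \<open>x\<close>, while \<open>x \<notin> q0\<close> makes \<open>x\<close> itself
  regular.\<close>

lemma locally_regular_pair_aux:
  assumes xq0: "x \<notin> q0"
  shows "locally_regular_pair R p"
proof -
  note xyR = pair_carrier
  have zero: "q0 \<subseteq> sat R (ring_as_module R) p {\<zero>\<^bsub>ring_as_module R\<^esub>}"
  proof (rule M.nakayama[OF p _ ideal_fg[OF q0.is_ideal] M.zero_submodule xp yp])
    show "submodule q0 R (ring_as_module R)" by (simp add: submodule_iff_ideal q0.is_ideal)
    fix a assume a: "a \<in> q0"
    then have "a \<in> p" using q0q qp by blast
    then obtain u b c where u: "u \<in> carrier R - p" "b \<in> carrier R" "c \<in> carrier R" "u \<otimes> a = x \<otimes> b \<oplus> y \<otimes> c"
      using gen by blast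
    have R: "a \<in> carrier R" "u \<in> carrier R" using a u by auto
    \<comment> \<open>From \<open>a = x b + y c\<close> in \<open>q0\<close> one gets
      \<open>y c\<close>, hence also \<open>c\<close>, in \<open>pair_ideal\<close>. Writing
      \<open>c = x d + e\<close> turns \<open>a\<close> into \<open>x (b + y d) + y e\<close>, and
      \<open>x \<notin> q0\<close> forces the first cofactor into \<open>q0\<close> as well.\<close>
    have "y \<otimes> c = x \<otimes> (\<ominus> b) \<oplus> u \<otimes> a" unfolding u(4) using xyR u(2,3) by algebra
    also have "\<dots> \<in> pair_ideal" using u(1,2) by (intro pair_ideal_contains q0.I_l_closed[OF a]) auto
    finally have "c \<in> pair_ideal" by (rule mult_in_pair_ideal[OF u(3)])
    then obtain v d e where v: "v \<in> carrier R - p" "d \<in> carrier R" "e \<in> q0" "v \<otimes> c = x \<otimes> d \<oplus> e"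
      using pair_ideal_D by blast
    have R': "v \<in> carrier R" "e \<in> carrier R" using v by auto
    have "(v \<otimes> u) \<otimes> a = v \<otimes> (u \<otimes> a)" using R R' by (simp add: m_assoc)
    also have "\<dots> = x \<otimes> (v \<otimes> b) \<oplus> y \<otimes> (v \<otimes> c)" unfolding u(4) using R' xyR u(2,3) by algebra
    also have "\<dots> = x \<otimes> (v \<otimes> b \<oplus> y \<otimes> d) \<oplus> y \<otimes> e" unfolding v(4) using R' xyR u(2,3) v(2) by algebra
    finally have eq: "(v \<otimes> u) \<otimes> a = x \<otimes> (v \<otimes> b \<oplus> y \<otimes> d) \<oplus> y \<otimes> e" .
    have "x \<otimes> (v \<otimes> b \<oplus> y \<otimes> d) = (v \<otimes> u) \<otimes> a \<oplus> y \<otimes> (\<ominus> e)"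
      unfolding eq using R' xyR u(2) v(2) by algebra
    also have "\<dots> \<in> q0" using a R R' xyR v(3) by (intro q0.a_closed q0.I_l_closed) auto
    finally have "v \<otimes> b \<oplus> y \<otimes> d \<in> q0"
      using q0.I_prime[OF xyR(1), of "v \<otimes> b \<oplus> y \<otimes> d"] xq0 R' xyR u(2) v(2) by auto
    moreover have "(v \<otimes> u) \<otimes> a = x \<otimes> (v \<otimes> b \<oplus> y \<otimes> d) \<oplus> y \<otimes> e \<oplus> \<zero>"
      using eq R' xyR u(2) v(2) by simp
    ultimately show "\<exists>u\<in>carrier R - p. \<exists>b\<in>q0. \<exists>c\<in>q0. \<exists>e\<in>{\<zero>\<^bsub>ring_as_module R\<^esub>}.
       u \<odot>\<^bsub>ring_as_module R\<^esub> a = x \<odot>\<^bsub>ring_as_module R\<^esub> b \<oplus>\<^bsub>ring_as_module R\<^esub> y \<odot>\<^bsub>ring_as_module R\<^esub> c \<oplus>\<^bsub>ring_as_module R\<^esub> e"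
      using v(3) primeideal_compl_mult[OF p v(1) u(1)] unfolding ring_as_module_simps by blast
  qed
  then have zero': "\<exists>u\<in>carrier R - p. u \<otimes> e = \<zero>" if "e \<in> q0" for e
    using that by (auto simp: sat_def)
  have "\<exists>u\<in>carrier R - p. u \<otimes> r = \<zero>" if "r \<in> carrier R" "x \<otimes> r = \<zero>" for r
    using q0.I_prime[OF xyR(1) that(1)] that xq0 zero' by auto
  moreover have "\<exists>u\<in>carrier R - p. \<exists>t\<in>carrier R. u \<otimes> s = x \<otimes> t"
    if r: "r \<in> carrier R" "s \<in> carrier R" "x \<otimes> r = y \<otimes> s" for r s
  proof -
    have "y \<otimes> s \<in> pair_ideal" using x_in_pair_ideal r by (simp add: PI.I_r_closed flip: r(3))
    then have "s \<in> pair_ideal" by (rule mult_in_pair_ideal[OF r(2)])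
    then obtain v t e where v: "v \<in> carrier R - p" "t \<in> carrier R" "e \<in> q0" "v \<otimes> s = x \<otimes> t \<oplus> e"
      using pair_ideal_D by blast
    obtain w where w: "w \<in> carrier R - p" "w \<otimes> e = \<zero>" using zero'[OF v(3)] by blast
    have R: "v \<in> carrier R" "e \<in> carrier R" "w \<in> carrier R" using v w by auto
    have "(w \<otimes> v) \<otimes> s = w \<otimes> (v \<otimes> s)" using R r by (simp add: m_assoc)
    also have "\<dots> = x \<otimes> (w \<otimes> t) \<oplus> w \<otimes> e" unfolding v(4) using R v(2) xyR by algebra
    also have "\<dots> = x \<otimes> (w \<otimes> t)" using w(2) R v(2) xyR by simp
    finally show ?thesis using primeideal_compl_mult[OF p w(1) v(1)] R v(2) by blast
  qed
  ultimately show ?thesis unfolding locally_regular_pair_def using xp yp gen by blast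
qed

end

end

section \<open>Localization at a prime\<close>

locale mult_subset = cring R for R (structure) +
  fixes S
  assumes S_sub: "S \<subseteq> carrier R" and S_one: "\<one> \<in> S" and S_mult: "\<And>s t. s \<in> S \<Longrightarrow> t \<in> S \<Longrightarrow> s \<otimes> t \<in> S"
begin

lemma S_carrier [simp]: "s \<in> S \<Longrightarrow> s \<in> carrier R"
  using S_sub by blast

lemma loc_equiv: "equiv (carrier R \<times> S) (loc_rel R S)"
proof (rule equivI)
  show "loc_rel R S \<subseteq> (carrier R \<times> S) \<times> (carrier R \<times> S)" by (auto simp: loc_rel_def)
  show "refl_on (carrier R \<times> S) (loc_rel R S)"
    using S_one by (auto simp: refl_on_def loc_rel_def)
  show "sym (loc_rel R S)" unfolding sym_def loc_rel_def by (auto, metis)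
  show "trans (loc_rel R S)"
  proof (rule transI)
    fix P Q T assume PQ: "(P, Q) \<in> loc_rel R S" and QT: "(Q, T) \<in> loc_rel R S"
    obtain a s b t c r where e: "P = (a, s)" "Q = (b, t)" "T = (c, r)" by (metis surj_pair)
    obtain u v where u: "a \<in> carrier R" "b \<in> carrier R" "c \<in> carrier R" "s \<in> S" "t \<in> S" "r \<in> S" "u \<in> S" "v \<in> S"
      "u \<otimes> (t \<otimes> a) = u \<otimes> (s \<otimes> b)" "v \<otimes> (r \<otimes> b) = v \<otimes> (t \<otimes> c)"
      using PQ QT by (auto simp: e loc_rel_def)
    note c = u(1-3) u(4-8)[THEN S_carrier]
    have "(t \<otimes> (u \<otimes> v)) \<otimes> (r \<otimes> a) = (r \<otimes> v) \<otimes> (u \<otimes> (t \<otimes> a))" using c by algebra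
    also have "\<dots> = (u \<otimes> s) \<otimes> (v \<otimes> (r \<otimes> b))" unfolding u(9) using c by algebra
    also have "\<dots> = (t \<otimes> (u \<otimes> v)) \<otimes> (s \<otimes> c)" unfolding u(10) using c by algebra
    finally show "(P, T) \<in> loc_rel R S" using u S_mult by (auto simp: e loc_rel_def)
  qed
qed

lemma loc_frac_eq:
  assumes "a \<in> carrier R" "b \<in> carrier R" "s \<in> S" "t \<in> S"
  shows "loc_frac R S a s = loc_frac R S b t \<longleftrightarrow> (\<exists>u\<in>S. u \<otimes> (t \<otimes> a) = u \<otimes> (s \<otimes> b))"
  unfolding loc_frac_def using eq_equiv_class_iff[OF loc_equiv, of "(a, s)" "(b, t)"] assms
  by (auto simp: loc_rel_def)

lemma loc_frac_eqI:
  assumes "a \<in> carrier R" "b \<in> carrier R" "s \<in> S" "t \<in> S" "t \<otimes> a = s \<otimes> b"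
  shows "loc_frac R S a s = loc_frac R S b t"
  using loc_frac_eq[OF assms(1-4)] assms(5) S_one by auto

lemma loc_carrier: "x \<in> carrier (localization R S) \<longleftrightarrow> (\<exists>a\<in>carrier R. \<exists>s\<in>S. x = loc_frac R S a s)"
  by (auto simp: localization_def quotient_def loc_frac_def)

lemma loc_frac_carrier: "a \<in> carrier R \<Longrightarrow> s \<in> S \<Longrightarrow> loc_frac R S a s \<in> carrier (localization R S)"
  using loc_carrier by blast

lemma loc_mult:
  assumes "a \<in> carrier R" "b \<in> carrier R" "s \<in> S" "t \<in> S"
  shows "loc_frac R S a s \<otimes>\<^bsub>localization R S\<^esub> loc_frac R S b t = loc_frac R S (a \<otimes> b) (s \<otimes> t)"
proof -
  have "congruent2 (loc_rel R S) (loc_rel R S) (\<lambda>x y. loc_frac R S (fst x \<otimes> fst y) (snd x \<otimes> snd y))"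
  proof (rule congruent2I')
    fix P P' Q Q' assume *: "(P, P') \<in> loc_rel R S" "(Q, Q') \<in> loc_rel R S"
    obtain a s a' s' b t b' t' where e: "P = (a, s)" "P' = (a', s')" "Q = (b, t)" "Q' = (b', t')" by (metis surj_pair)
    obtain u v where u: "a \<in> carrier R" "a' \<in> carrier R" "b \<in> carrier R" "b' \<in> carrier R"
      "s \<in> S" "s' \<in> S" "t \<in> S" "t' \<in> S" "u \<in> S" "v \<in> S"
      "u \<otimes> (s' \<otimes> a) = u \<otimes> (s \<otimes> a')" "v \<otimes> (t' \<otimes> b) = v \<otimes> (t \<otimes> b')"
      using * by (auto simp: e loc_rel_def)
    note c = u(1-4) u(5-10)[THEN S_carrier]
    have "(u \<otimes> v) \<otimes> ((s' \<otimes> t') \<otimes> (a \<otimes> b)) = (u \<otimes> (s' \<otimes> a)) \<otimes> (v \<otimes> (t' \<otimes> b))" using c by algebra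
    also have "\<dots> = (u \<otimes> v) \<otimes> ((s \<otimes> t) \<otimes> (a' \<otimes> b'))" unfolding u(11,12) using c by algebra
    finally show "loc_frac R S (fst P \<otimes> fst Q) (snd P \<otimes> snd Q) = loc_frac R S (fst P' \<otimes> fst Q') (snd P' \<otimes> snd Q')"
      using u S_mult by (subst loc_frac_eq) (auto simp: e)
  qed
  from UN_equiv_class2[OF loc_equiv loc_equiv this, of "(a, s)" "(b, t)"] show ?thesis
    using assms by (simp add: localization_def loc_frac_def)
qed

lemma loc_add:
  assumes "a \<in> carrier R" "b \<in> carrier R" "s \<in> S" "t \<in> S"
  shows "loc_frac R S a s \<oplus>\<^bsub>localization R S\<^esub> loc_frac R S b t = loc_frac R S (t \<otimes> a \<oplus> s \<otimes> b) (s \<otimes> t)"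
proof -
  have "congruent2 (loc_rel R S) (loc_rel R S)
    (\<lambda>x y. loc_frac R S (snd y \<otimes> fst x \<oplus> snd x \<otimes> fst y) (snd x \<otimes> snd y))"
  proof (rule congruent2I')
    fix P P' Q Q' assume *: "(P, P') \<in> loc_rel R S" "(Q, Q') \<in> loc_rel R S"
    obtain a s a' s' b t b' t' where e: "P = (a, s)" "P' = (a', s')" "Q = (b, t)" "Q' = (b', t')" by (metis surj_pair)
    obtain u v where u: "a \<in> carrier R" "a' \<in> carrier R" "b \<in> carrier R" "b' \<in> carrier R"
      "s \<in> S" "s' \<in> S" "t \<in> S" "t' \<in> S" "u \<in> S" "v \<in> S"
      "u \<otimes> (s' \<otimes> a) = u \<otimes> (s \<otimes> a')" "v \<otimes> (t' \<otimes> b) = v \<otimes> (t \<otimes> b')"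
      using * by (auto simp: e loc_rel_def)
    note c = u(1-4) u(5-10)[THEN S_carrier]
    have "(u \<otimes> v) \<otimes> ((s' \<otimes> t') \<otimes> (t \<otimes> a \<oplus> s \<otimes> b)) =
        (u \<otimes> (s' \<otimes> a)) \<otimes> (v \<otimes> t' \<otimes> t) \<oplus> (v \<otimes> (t' \<otimes> b)) \<otimes> (u \<otimes> s' \<otimes> s)" using c by algebra
    also have "\<dots> = (u \<otimes> v) \<otimes> ((s \<otimes> t) \<otimes> (t' \<otimes> a' \<oplus> s' \<otimes> b'))" unfolding u(11,12) using c by algebra
    finally show "loc_frac R S (snd Q \<otimes> fst P \<oplus> snd P \<otimes> fst Q) (snd P \<otimes> snd Q) =
        loc_frac R S (snd Q' \<otimes> fst P' \<oplus> snd P' \<otimes> fst Q') (snd P' \<otimes> snd Q')"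
      using u S_mult by (subst loc_frac_eq) (auto simp: e)
  qed
  from UN_equiv_class2[OF loc_equiv loc_equiv this, of "(a, s)" "(b, t)"] show ?thesis
    using assms by (simp add: localization_def loc_frac_def)
qed

lemma loc_zero: "\<zero>\<^bsub>localization R S\<^esub> = loc_frac R S \<zero> \<one>"
  and loc_one: "\<one>\<^bsub>localization R S\<^esub> = loc_frac R S \<one> \<one>"
  by (simp_all add: localization_def)

lemma loc_cring: "cring (localization R S)"
proof -
  note simps = loc_add loc_mult loc_zero loc_one S_one S_mult
  have ag: "abelian_group (localization R S)"
  proof (rule abelian_groupI)
    fix x y assume "x \<in> carrier (localization R S)" "y \<in> carrier (localization R S)"
    then obtain a s b t where x: "x = loc_frac R S a s" "a \<in> carrier R" "s \<in> S"
      and y: "y = loc_frac R S b t" "b \<in> carrier R" "t \<in> S" by (auto simp: loc_carrier)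
    note c = x(2) y(2) x(3)[THEN S_carrier] y(3)[THEN S_carrier]
    show "x \<oplus>\<^bsub>localization R S\<^esub> y \<in> carrier (localization R S)"
      using x y by (auto simp: simps intro!: loc_frac_carrier)
    show "x \<oplus>\<^bsub>localization R S\<^esub> y = y \<oplus>\<^bsub>localization R S\<^esub> x"
      using x y c by (simp add: simps a_comm m_comm)
    fix z assume "z \<in> carrier (localization R S)"
    then obtain d r where z: "z = loc_frac R S d r" "d \<in> carrier R" "r \<in> S" by (auto simp: loc_carrier)
    note c = c z(2) z(3)[THEN S_carrier]
    have "r \<otimes> (t \<otimes> a \<oplus> s \<otimes> b) \<oplus> (s \<otimes> t) \<otimes> d = (t \<otimes> r) \<otimes> a \<oplus> s \<otimes> (r \<otimes> b \<oplus> t \<otimes> d)"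
      using c by algebra
    then show "x \<oplus>\<^bsub>localization R S\<^esub> y \<oplus>\<^bsub>localization R S\<^esub> z = x \<oplus>\<^bsub>localization R S\<^esub> (y \<oplus>\<^bsub>localization R S\<^esub> z)"
      using x y z c by (simp add: simps m_assoc)
  next
    show "\<zero>\<^bsub>localization R S\<^esub> \<in> carrier (localization R S)" by (auto simp: simps intro!: loc_frac_carrier)
    fix x assume "x \<in> carrier (localization R S)"
    then obtain a s where x: "x = loc_frac R S a s" "a \<in> carrier R" "s \<in> S" by (auto simp: loc_carrier)
    show "\<zero>\<^bsub>localization R S\<^esub> \<oplus>\<^bsub>localization R S\<^esub> x = x" using x by (simp add: simps)
    have eq: "loc_frac R S (\<ominus> a) s \<oplus>\<^bsub>localization R S\<^esub> x = \<zero>\<^bsub>localization R S\<^esub>"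
      using x by (simp add: simps) (intro loc_frac_eqI, auto simp: S_one S_mult r_minus l_neg)
    show "\<exists>y\<in>carrier (localization R S). y \<oplus>\<^bsub>localization R S\<^esub> x = \<zero>\<^bsub>localization R S\<^esub>"
      using eq x by (intro bexI[of _ "loc_frac R S (\<ominus> a) s"]) (auto intro!: loc_frac_carrier)
  qed
  have cm: "comm_monoid (localization R S)"
  proof (rule comm_monoidI)
    fix x y assume "x \<in> carrier (localization R S)" "y \<in> carrier (localization R S)"
    then obtain a s b t where x: "x = loc_frac R S a s" "a \<in> carrier R" "s \<in> S"
      and y: "y = loc_frac R S b t" "b \<in> carrier R" "t \<in> S" by (auto simp: loc_carrier)
    show "x \<otimes>\<^bsub>localization R S\<^esub> y \<in> carrier (localization R S)"
      using x y by (auto simp: simps intro!: loc_frac_carrier)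
    show "x \<otimes>\<^bsub>localization R S\<^esub> y = y \<otimes>\<^bsub>localization R S\<^esub> x"
      using x y by (simp add: simps m_comm)
    fix z assume "z \<in> carrier (localization R S)"
    then obtain d r where z: "z = loc_frac R S d r" "d \<in> carrier R" "r \<in> S" by (auto simp: loc_carrier)
    show "x \<otimes>\<^bsub>localization R S\<^esub> y \<otimes>\<^bsub>localization R S\<^esub> z = x \<otimes>\<^bsub>localization R S\<^esub> (y \<otimes>\<^bsub>localization R S\<^esub> z)"
      using x y z by (simp add: simps m_assoc)
  next
    show "\<one>\<^bsub>localization R S\<^esub> \<in> carrier (localization R S)" by (auto simp: simps intro!: loc_frac_carrier)
    fix x assume "x \<in> carrier (localization R S)"
    then show "\<one>\<^bsub>localization R S\<^esub> \<otimes>\<^bsub>localization R S\<^esub> x = x" by (auto simp: simps loc_carrier)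
  qed
  show ?thesis
  proof (rule cringI[OF ag cm])
    fix x y z assume "x \<in> carrier (localization R S)" "y \<in> carrier (localization R S)" "z \<in> carrier (localization R S)"
    then obtain a s b t d r where x: "x = loc_frac R S a s" "a \<in> carrier R" "s \<in> S"
      and y: "y = loc_frac R S b t" "b \<in> carrier R" "t \<in> S"
      and z: "z = loc_frac R S d r" "d \<in> carrier R" "r \<in> S" by (auto simp: loc_carrier)
    note c = x(2) y(2) z(2) x(3)[THEN S_carrier] y(3)[THEN S_carrier] z(3)[THEN S_carrier]
    have "loc_frac R S ((t \<otimes> a \<oplus> s \<otimes> b) \<otimes> d) ((s \<otimes> t) \<otimes> r) =
        loc_frac R S ((t \<otimes> r) \<otimes> (a \<otimes> d) \<oplus> (s \<otimes> r) \<otimes> (b \<otimes> d)) ((s \<otimes> r) \<otimes> (t \<otimes> r))"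
    proof (rule loc_frac_eqI)
      show "((s \<otimes> r) \<otimes> (t \<otimes> r)) \<otimes> ((t \<otimes> a \<oplus> s \<otimes> b) \<otimes> d) =
        ((s \<otimes> t) \<otimes> r) \<otimes> ((t \<otimes> r) \<otimes> (a \<otimes> d) \<oplus> (s \<otimes> r) \<otimes> (b \<otimes> d))" using c by algebra
    qed (use x y z c S_mult in auto)
    then show "(x \<oplus>\<^bsub>localization R S\<^esub> y) \<otimes>\<^bsub>localization R S\<^esub> z =
        x \<otimes>\<^bsub>localization R S\<^esub> z \<oplus>\<^bsub>localization R S\<^esub> y \<otimes>\<^bsub>localization R S\<^esub> z"
      using x y z c by (simp add: simps)
  qed
qed

lemma loc_frac_eq_zero:
  assumes "a \<in> carrier R" "loc_frac R S a \<one> = \<zero>\<^bsub>localization R S\<^esub>"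
  shows "\<exists>s\<in>S. s \<otimes> a = \<zero>"
  using assms loc_frac_eq[of a \<zero> \<one> \<one>] by (auto simp: loc_zero S_one)

lemma loc_frac_hom: "(\<lambda>a. loc_frac R S a \<one>) \<in> ring_hom R (localization R S)"
  by (rule ring_hom_memI) (auto simp: loc_mult loc_add loc_one S_one intro!: loc_frac_carrier)

lemma loc_frac_unit:
  assumes s: "s \<in> S"
  shows "loc_frac R S s \<one> \<in> Units (localization R S)"
proof -
  interpret L: cring "localization R S" by (rule loc_cring)
  have "loc_frac R S s \<one> \<otimes>\<^bsub>localization R S\<^esub> loc_frac R S \<one> s = \<one>\<^bsub>localization R S\<^esub>"
    using s by (simp add: loc_mult loc_one S_one) (intro loc_frac_eqI, auto simp: S_one)
  moreover have "loc_frac R S \<one> s \<otimes>\<^bsub>localization R S\<^esub> loc_frac R S s \<one> = \<one>\<^bsub>localization R S\<^esub>"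
    using s by (simp add: loc_mult loc_one S_one) (intro loc_frac_eqI, auto simp: S_one)
  ultimately show ?thesis
    using loc_frac_carrier[of s \<one>] loc_frac_carrier[of \<one> s] s S_one unfolding Units_def
    by (intro CollectI conjI bexI[of _ "loc_frac R S \<one> s"]) simp_all
qed

lemma loc_numerator:
  assumes "x \<in> carrier (localization R S)"
  shows "\<exists>r\<in>carrier R. \<exists>s\<in>S. loc_frac R S s \<one> \<otimes>\<^bsub>localization R S\<^esub> x = loc_frac R S r \<one>"
proof -
  obtain a s where x: "x = loc_frac R S a s" "a \<in> carrier R" "s \<in> S" using assms by (auto simp: loc_carrier)
  then have "loc_frac R S s \<one> \<otimes>\<^bsub>localization R S\<^esub> x = loc_frac R S a \<one>"
    by (simp add: loc_mult S_one) (intro loc_frac_eqI, auto simp: S_one)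
  then show ?thesis using x by blast
qed

end

text \<open>These properties determine \<open>A\<close> as \<open>R_p\<close>. Keeping
  \<open>A\<close> abstract admits localizations of a ring that is merely isomorphic to
  \<open>R\<close>, which is how regularity is supplied by \<open>J2_ring\<close>.\<close>

locale prime_localization =
  R: cring R + A: cring A for R :: "('a, 'm) ring_scheme" (structure) and A :: "('c, 'k) ring_scheme" +
  fixes p :: "'a set" and \<phi> :: "'a \<Rightarrow> 'c"
  assumes prime: "primeideal p R" and hom: "\<phi> \<in> ring_hom R A"
    and unit: "\<And>s. s \<in> carrier R - p \<Longrightarrow> \<phi> s \<in> Units A"
    and numerator: "\<And>x. x \<in> carrier A \<Longrightarrow> \<exists>r\<in>carrier R. \<exists>s\<in>carrier R - p. \<phi> s \<otimes>\<^bsub>A\<^esub> x = \<phi> r"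
    and kernel: "\<And>r. r \<in> carrier R \<Longrightarrow> \<phi> r = \<zero>\<^bsub>A\<^esub> \<Longrightarrow> \<exists>s\<in>carrier R - p. s \<otimes> r = \<zero>"

lemma mult_subset_compl:
  assumes "cring R" "primeideal p R"
  shows "mult_subset R (carrier R - p)"
proof -
  interpret cring R by fact
  show ?thesis
    using primeideal_compl_one[OF assms(2)] primeideal_compl_mult[OF assms(2)] by unfold_locales auto
qed

lemma prime_localization_loc_at_prime:
  assumes "cring R" "primeideal p R"
  shows "prime_localization R (loc_at_prime R p) p (\<lambda>a. loc_frac R (carrier R - p) a \<one>\<^bsub>R\<^esub>)"
proof -
  interpret mult_subset R "carrier R - p" by (rule mult_subset_compl[OF assms])
  show ?thesis
    unfolding loc_at_prime_def prime_localization_def prime_localization_axioms_def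
    using assms loc_cring loc_frac_hom loc_frac_unit loc_numerator loc_frac_eq_zero by blast
qed

text \<open>Composition with the isomorphism \<open>h\<close> presents a localization of the copy
  \<open>R'\<close> as one of \<open>R\<close>, so that the results can be stated for primes of
  \<open>R\<close>.\<close>

lemma prime_localization_iso:
  fixes R :: "('a, 'm) ring_scheme" and R' :: "('b, 'n) ring_scheme"
  assumes R: "cring R" and h: "h \<in> ring_hom R R'" "bij_betw h (carrier R) (carrier R')"
    and L: "prime_localization R' A p' \<phi>" and p: "primeideal {r \<in> carrier R. h r \<in> p'} R"
  shows "prime_localization R A {r \<in> carrier R. h r \<in> p'} (\<lambda>r. \<phi> (h r))"
proof -
  interpret R: cring R by fact
  interpret L: prime_localization R' A p' \<phi> by fact
  have hc: "h r \<in> carrier R'" if "r \<in> carrier R" for r using ring_hom_closed[OF h(1) that] .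
  have surj: "\<exists>r\<in>carrier R. h r = y" if y: "y \<in> carrier R'" for y
  proof -
    have "y \<in> h ` carrier R" using bij_betw_imp_surj_on[OF h(2)] y by simp
    then show ?thesis by (rule imageE) (intro bexI, simp_all)
  qed
  have inj: "h r = h s \<Longrightarrow> r \<in> carrier R \<Longrightarrow> s \<in> carrier R \<Longrightarrow> r = s" for r s
    using h(2) by (auto simp: bij_betw_def inj_on_def)
  have h0: "h \<zero>\<^bsub>R\<^esub> = \<zero>\<^bsub>R'\<^esub>" by (rule ring_hom_zero[OF h(1)]) unfold_locales
  show ?thesis
  proof (intro prime_localization.intro prime_localization_axioms.intro)
    show "cring R" by fact
    show "cring A" by unfold_locales
    show "primeideal {r \<in> carrier R. h r \<in> p'} R" by (rule p)
    show "(\<lambda>r. \<phi> (h r)) \<in> ring_hom R A"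
      using ring_hom_trans[OF h(1) L.hom] by (simp add: comp_def)
    show "\<phi> (h s) \<in> Units A" if "s \<in> carrier R - {r \<in> carrier R. h r \<in> p'}" for s
      using that hc by (intro L.unit) auto
    show "\<exists>r\<in>carrier R. \<exists>s\<in>carrier R - {r \<in> carrier R. h r \<in> p'}. \<phi> (h s) \<otimes>\<^bsub>A\<^esub> x = \<phi> (h r)"
      if x: "x \<in> carrier A" for x
    proof -
      obtain r' s' where rs': "r' \<in> carrier R'" "s' \<in> carrier R' - p'" "\<phi> s' \<otimes>\<^bsub>A\<^esub> x = \<phi> r'"
        using L.numerator[OF x] by blast
      obtain r where "r \<in> carrier R" "h r = r'" using surj[OF rs'(1)] by blast
      moreover obtain s where "s \<in> carrier R" "h s = s'" using surj rs'(2) by blast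
      ultimately show ?thesis using rs' by (intro bexI[of _ r] bexI[of _ s]) auto
    qed
    show "\<exists>s\<in>carrier R - {r \<in> carrier R. h r \<in> p'}. s \<otimes>\<^bsub>R\<^esub> r = \<zero>\<^bsub>R\<^esub>"
      if r: "r \<in> carrier R" "\<phi> (h r) = \<zero>\<^bsub>A\<^esub>" for r
    proof -
      obtain s' where s': "s' \<in> carrier R' - p'" "s' \<otimes>\<^bsub>R'\<^esub> h r = \<zero>\<^bsub>R'\<^esub>" using L.kernel[OF hc r(2)] r(1) by blast
      then obtain s where s: "s \<in> carrier R" "h s = s'" using surj by blast
      have "h (s \<otimes>\<^bsub>R\<^esub> r) = h \<zero>\<^bsub>R\<^esub>" using s s' r by (simp add: ring_hom_mult[OF h(1)] h0)
      then have "s \<otimes>\<^bsub>R\<^esub> r = \<zero>\<^bsub>R\<^esub>" using s r by (intro inj) auto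
      then show ?thesis using s s' by (intro bexI[of _ s]) auto
    qed
  qed
qed

text \<open>Existence of such a chain says that the height of \<open>q\<close> is at least
  \<open>n\<close>. The top member need only be contained in \<open>q\<close>, so truncated and
  contracted chains are again of this form.\<close>

definition prime_chain :: "('a, 'm) ring_scheme \<Rightarrow> nat \<Rightarrow> (nat \<Rightarrow> 'a set) \<Rightarrow> 'a set \<Rightarrow> bool"
  where "prime_chain R n P q \<longleftrightarrow>
    (\<forall>i\<le>n. primeideal (P i) R) \<and> (\<forall>i<n. P i \<subset> P (Suc i)) \<and> P n \<subseteq> q"

lemma prime_chain_take:
  assumes "prime_chain R n P q" "m \<le> n"
  shows "prime_chain R m P q"
proof -
  have "P m \<subseteq> P n"
    using assms(2)
  proof (induction rule: inc_induct)
    case (step k)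
    then show ?case using assms(1) by (auto simp: prime_chain_def)
  qed simp
  then show ?thesis using assms by (auto simp: prime_chain_def)
qed

section \<open>Extension and contraction of ideals; regularity read off in the base ring\<close>

context prime_localization
begin

interpretation p: primeideal p R by (rule prime)
interpretation h: ring_hom_cring R A \<phi>
  by (intro ring_hom_cringI hom) unfold_locales
interpretation MA: module A "ring_as_module A" by (rule A.ring_as_module_is_module)

lemma unit_cancel:
  assumes "ideal I A" "s \<in> carrier R - p" "x \<in> carrier A" "\<phi> s \<otimes>\<^bsub>A\<^esub> x \<in> I"
  shows "x \<in> I"
proof -
  interpret I: ideal I A by fact
  note u = unit[OF assms(2)]
  have "inv\<^bsub>A\<^esub> \<phi> s \<otimes>\<^bsub>A\<^esub> (\<phi> s \<otimes>\<^bsub>A\<^esub> x) = x"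
    using u assms(3) A.Units_closed[OF u] by (simp add: A.m_assoc[symmetric])
  then show ?thesis using I.I_l_closed[OF assms(4) A.Units_inv_closed[OF u]] by simp
qed

text \<open>The extension of \<open>I\<close> to \<open>R_p\<close>. One fraction with numerator in
  \<open>I\<close> suffices per element because sums of such fractions have a common
  denominator.\<close>

definition loc_ext :: "'a set \<Rightarrow> 'c set"
  where "loc_ext I = {x \<in> carrier A. \<exists>r\<in>I. \<exists>s\<in>carrier R - p. \<phi> s \<otimes>\<^bsub>A\<^esub> x = \<phi> r}"

definition loc_contr :: "'c set \<Rightarrow> 'a set"
  where "loc_contr I = {r \<in> carrier R. \<phi> r \<in> I}"

lemma loc_ext_ideal:
  assumes I: "ideal I R"
  shows "ideal (loc_ext I) A"
proof -
  interpret I: ideal I R by fact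
  have "submodule (loc_ext I) A (ring_as_module A)"
  proof (rule MA.submoduleI)
    show "\<zero>\<^bsub>ring_as_module A\<^esub> \<in> loc_ext I"
      using primeideal_compl_one[OF prime] I.zero_closed unfolding loc_ext_def
      by (intro CollectI conjI bexI[of _ \<zero>] bexI[of _ \<one>]) auto
    fix x assume "x \<in> loc_ext I"
    then obtain r s where x: "x \<in> carrier A" "r \<in> I" "s \<in> carrier R - p" "\<phi> s \<otimes>\<^bsub>A\<^esub> x = \<phi> r"
      by (auto simp: loc_ext_def)
    then show "\<ominus>\<^bsub>ring_as_module A\<^esub> x \<in> loc_ext I"
      unfolding loc_ext_def by (intro CollectI conjI bexI[of _ "\<ominus> r"] bexI[of _ s]) (auto simp: A.r_minus)
    fix y assume "y \<in> loc_ext I"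
    then obtain q t where y: "y \<in> carrier A" "q \<in> I" "t \<in> carrier R - p" "\<phi> t \<otimes>\<^bsub>A\<^esub> y = \<phi> q"
      by (auto simp: loc_ext_def)
    have c: "\<phi> s \<in> carrier A" "\<phi> t \<in> carrier A" using x y by auto
    have "\<phi> (s \<otimes> t) \<otimes>\<^bsub>A\<^esub> (x \<oplus>\<^bsub>A\<^esub> y) = \<phi> t \<otimes>\<^bsub>A\<^esub> (\<phi> s \<otimes>\<^bsub>A\<^esub> x) \<oplus>\<^bsub>A\<^esub> \<phi> s \<otimes>\<^bsub>A\<^esub> (\<phi> t \<otimes>\<^bsub>A\<^esub> y)"
      using c x(1,3) y(1,3) by (simp add: A.r_distr A.m_ac)
    also have "\<dots> = \<phi> (t \<otimes> r \<oplus> s \<otimes> q)" using x y by simp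
    finally have "\<phi> (s \<otimes> t) \<otimes>\<^bsub>A\<^esub> (x \<oplus>\<^bsub>A\<^esub> y) = \<phi> (t \<otimes> r \<oplus> s \<otimes> q)" .
    moreover have "t \<otimes> r \<oplus> s \<otimes> q \<in> I" using x y by (intro I.a_closed I.I_l_closed) auto
    ultimately show "x \<oplus>\<^bsub>ring_as_module A\<^esub> y \<in> loc_ext I"
      using x(1) y(1) primeideal_compl_mult[OF prime x(3) y(3)] unfolding loc_ext_def
      by (intro CollectI conjI bexI[of _ "t \<otimes> r \<oplus> s \<otimes> q"] bexI[of _ "s \<otimes> t"]) auto
  next
    fix a x assume a: "a \<in> carrier A" and "x \<in> loc_ext I"
    then obtain r s where x: "x \<in> carrier A" "r \<in> I" "s \<in> carrier R - p" "\<phi> s \<otimes>\<^bsub>A\<^esub> x = \<phi> r"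
      by (auto simp: loc_ext_def)
    obtain q t where t: "q \<in> carrier R" "t \<in> carrier R - p" "\<phi> t \<otimes>\<^bsub>A\<^esub> a = \<phi> q" using numerator[OF a] by blast
    have c: "\<phi> s \<in> carrier A" "\<phi> t \<in> carrier A" using x t by auto
    have "\<phi> (t \<otimes> s) \<otimes>\<^bsub>A\<^esub> (a \<otimes>\<^bsub>A\<^esub> x) = (\<phi> t \<otimes>\<^bsub>A\<^esub> a) \<otimes>\<^bsub>A\<^esub> (\<phi> s \<otimes>\<^bsub>A\<^esub> x)"
      using c x(1,3) t(2) a by (simp add: A.m_ac)
    also have "\<dots> = \<phi> (q \<otimes> r)" using x t by simp
    finally show "a \<odot>\<^bsub>ring_as_module A\<^esub> x \<in> loc_ext I"
      using x(1,2) a t(1) primeideal_compl_mult[OF prime t(2) x(3)] unfolding loc_ext_def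
      by (intro CollectI conjI bexI[of _ "q \<otimes> r"] bexI[of _ "t \<otimes> s"]) (auto intro: I.I_l_closed)
  qed (auto simp: loc_ext_def)
  then show ?thesis by (simp add: A.submodule_iff_ideal)
qed

lemma loc_contr_ideal:
  assumes "ideal I A"
  shows "ideal (loc_contr I) R"
proof -
  interpret I: ideal I A by fact
  interpret MR: module R "ring_as_module R" by (rule R.ring_as_module_is_module)
  have "submodule (loc_contr I) R (ring_as_module R)"
    by (rule MR.submoduleI) (auto simp: loc_contr_def I.I_l_closed)
  then show ?thesis by (simp add: R.submodule_iff_ideal)
qed

lemma loc_contr_subset:
  assumes "ideal I A" "I \<noteq> carrier A"
  shows "loc_contr I \<subseteq> p"
proof
  interpret I: ideal I A by fact
  fix r assume r: "r \<in> loc_contr I"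
  show "r \<in> p"
  proof (rule ccontr)
    assume "r \<notin> p"
    then have r': "r \<in> carrier R - p" using r by (auto simp: loc_contr_def)
    have "\<phi> r \<otimes>\<^bsub>A\<^esub> \<one>\<^bsub>A\<^esub> \<in> I" using r r' by (simp add: loc_contr_def)
    then have "\<one>\<^bsub>A\<^esub> \<in> I" using unit_cancel[OF assms(1) r'] by simp
    then show False using I.one_imp_carrier assms(2) by blast
  qed
qed

lemma loc_contr_mono_strict:
  assumes "ideal I A" "ideal I' A" "I \<subset> I'"
  shows "loc_contr I \<subset> loc_contr I'"
proof -
  interpret I: ideal I A by fact
  interpret I': ideal I' A by fact
  obtain x where x: "x \<in> I'" "x \<notin> I" using assms(3) by blast
  obtain r s where rs: "r \<in> carrier R" "s \<in> carrier R - p" "\<phi> s \<otimes>\<^bsub>A\<^esub> x = \<phi> r"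
    using numerator[of x] x(1) by auto
  have "\<phi> s \<otimes>\<^bsub>A\<^esub> x \<in> I'" using x(1) rs(2) by (intro I'.I_l_closed) auto
  then have "r \<in> loc_contr I'" using rs by (simp add: loc_contr_def)
  moreover have "r \<notin> loc_contr I"
  proof
    assume "r \<in> loc_contr I"
    then have "\<phi> s \<otimes>\<^bsub>A\<^esub> x \<in> I" using rs by (simp add: loc_contr_def)
    then show False using unit_cancel[OF assms(1) rs(2)] x by auto
  qed
  ultimately show ?thesis using assms(3) by (auto simp: loc_contr_def)
qed

lemma loc_contr_prime:
  assumes "primeideal P A"
  shows "primeideal (loc_contr P) R"
proof -
  interpret P: primeideal P A by fact
  show ?thesis
  proof (rule primeidealI[OF loc_contr_ideal[OF P.is_ideal]])
    have "\<one>\<^bsub>A\<^esub> \<notin> P" using primeideal_compl_one[OF assms] by blast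
    then have "\<one> \<notin> loc_contr P" by (simp add: loc_contr_def)
    then show "carrier R \<noteq> loc_contr P" by auto
    fix a b assume "a \<in> carrier R" "b \<in> carrier R" "a \<otimes> b \<in> loc_contr P"
    then show "a \<in> loc_contr P \<or> b \<in> loc_contr P"
      using P.I_prime[of "\<phi> a" "\<phi> b"] by (auto simp: loc_contr_def)
  qed unfold_locales
qed

text \<open>Two fractions for \<open>x\<close> become equal after multiplication by some
  \<open>t\<close> outside \<open>p\<close>. All denominators are outside \<open>q\<close>, so
  primality of \<open>q\<close> cancels them and any numerator decides membership.\<close>

lemma loc_ext_mem:
  assumes q: "primeideal q R" "q \<subseteq> p"
    and x: "x \<in> carrier A" "r \<in> carrier R" "s \<in> carrier R - p" "\<phi> s \<otimes>\<^bsub>A\<^esub> x = \<phi> r"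
  shows "x \<in> loc_ext q \<longleftrightarrow> r \<in> q"
proof
  assume "r \<in> q"
  then show "x \<in> loc_ext q" using x by (auto simp: loc_ext_def)
next
  interpret q: primeideal q R by fact
  assume "x \<in> loc_ext q"
  then obtain r' s' where r': "r' \<in> q" "s' \<in> carrier R - p" "\<phi> s' \<otimes>\<^bsub>A\<^esub> x = \<phi> r'" by (auto simp: loc_ext_def)
  have c: "\<phi> s \<in> carrier A" "\<phi> s' \<in> carrier A" "r' \<in> carrier R" using x r' by auto
  have "\<phi> (s' \<otimes> r) = \<phi> s' \<otimes>\<^bsub>A\<^esub> (\<phi> s \<otimes>\<^bsub>A\<^esub> x)" using x r' by simp
  also have "\<dots> = \<phi> s \<otimes>\<^bsub>A\<^esub> (\<phi> s' \<otimes>\<^bsub>A\<^esub> x)" using c x(1) by (simp add: A.m_lcomm)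
  also have "\<dots> = \<phi> (s \<otimes> r')" using x r' c by simp
  finally have "\<phi> (s' \<otimes> r \<ominus> s \<otimes> r') = \<zero>\<^bsub>A\<^esub>"
    using x(2,3) r'(2) c by (simp add: a_minus_def A.r_neg del: h.hom_mult)
  then obtain t where t: "t \<in> carrier R - p" "t \<otimes> (s' \<otimes> r \<ominus> s \<otimes> r') = \<zero>"
    using kernel[of "s' \<otimes> r \<ominus> s \<otimes> r'"] x(2,3) r'(2) c by auto
  have R: "t \<in> carrier R" "s' \<in> carrier R" "s \<in> carrier R" using t r' x by auto
  have "(t \<otimes> s') \<otimes> r = t \<otimes> (s' \<otimes> r \<ominus> s \<otimes> r') \<oplus> (t \<otimes> s) \<otimes> r'"
    using R x(2) c(3) by algebra
  also have "\<dots> = (t \<otimes> s) \<otimes> r'" using R c(3) by (simp add: t(2))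
  also have "\<dots> \<in> q" using r'(1) R by (intro q.I_l_closed) auto
  finally have "r \<in> q \<or> t \<otimes> s' \<in> q" using q.I_prime[of "t \<otimes> s'" r] R x(2) by auto
  then show "r \<in> q" using primeideal_compl_mult[OF prime t(1) r'(2)] q(2) by blast
qed

lemma loc_ext_hom:
  assumes "primeideal q R" "q \<subseteq> p" "r \<in> carrier R"
  shows "\<phi> r \<in> loc_ext q \<longleftrightarrow> r \<in> q"
  using assms primeideal_compl_one[OF prime] by (intro loc_ext_mem[where s = \<one>]) auto

lemma loc_ext_prime:
  assumes q: "primeideal q R" "q \<subseteq> p"
  shows "primeideal (loc_ext q) A"
proof -
  interpret q: primeideal q R by fact
  show ?thesis
  proof (rule primeidealI[OF loc_ext_ideal[OF q.is_ideal]])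
    have "\<phi> \<one> \<notin> loc_ext q" using primeideal_compl_one[OF q(1)] by (subst loc_ext_hom[OF q]) auto
    then show "carrier A \<noteq> loc_ext q" by auto
    fix x y assume x: "x \<in> carrier A" and y: "y \<in> carrier A" and xy: "x \<otimes>\<^bsub>A\<^esub> y \<in> loc_ext q"
    obtain r s where rs: "r \<in> carrier R" "s \<in> carrier R - p" "\<phi> s \<otimes>\<^bsub>A\<^esub> x = \<phi> r" using numerator[OF x] by blast
    obtain r' s' where rs': "r' \<in> carrier R" "s' \<in> carrier R - p" "\<phi> s' \<otimes>\<^bsub>A\<^esub> y = \<phi> r'" using numerator[OF y] by blast
    have "\<phi> (s \<otimes> s') \<otimes>\<^bsub>A\<^esub> (x \<otimes>\<^bsub>A\<^esub> y) = (\<phi> s \<otimes>\<^bsub>A\<^esub> x) \<otimes>\<^bsub>A\<^esub> (\<phi> s' \<otimes>\<^bsub>A\<^esub> y)"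
      using x y rs(2) rs'(2) by (simp add: A.m_ac)
    also have "\<dots> = \<phi> (r \<otimes> r')" using rs rs' by simp
    finally have "r \<otimes> r' \<in> q"
      using loc_ext_mem[OF q, of "x \<otimes>\<^bsub>A\<^esub> y" "r \<otimes> r'" "s \<otimes> s'"] xy x y rs(1) rs'(1)
        primeideal_compl_mult[OF prime rs(2) rs'(2)] by auto
    then have "r \<in> q \<or> r' \<in> q" using q.I_prime rs(1) rs'(1) by blast
    then show "x \<in> loc_ext q \<or> y \<in> loc_ext q"
      using loc_ext_mem[OF q x rs] loc_ext_mem[OF q y rs'] by blast
  qed unfold_locales
qed

lemma loc_ext_mono_strict:
  assumes "primeideal q R" "primeideal q' R" "q \<subset> q'" "q' \<subseteq> p"
  shows "loc_ext q \<subset> loc_ext q'"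
proof -
  interpret q': primeideal q' R by fact
  obtain r where r: "r \<in> q'" "r \<notin> q" using assms(3) by blast
  have "\<phi> r \<in> loc_ext q'" "\<phi> r \<notin> loc_ext q"
    using r assms loc_ext_hom[of q r] loc_ext_hom[of q' r] by auto
  moreover have "loc_ext q \<subseteq> loc_ext q'" using assms(3) by (auto simp: loc_ext_def)
  ultimately show ?thesis by blast
qed

lemma not_in_loc_ext_unit:
  assumes "x \<in> carrier A" "x \<notin> loc_ext p"
  shows "x \<in> Units A"
proof -
  obtain r s where rs: "r \<in> carrier R" "s \<in> carrier R - p" "\<phi> s \<otimes>\<^bsub>A\<^esub> x = \<phi> r" using numerator[OF assms(1)] by blast
  then have "r \<in> carrier R - p" using assms by (auto simp: loc_ext_def)
  then have u: "\<phi> r \<in> Units A" by (rule unit)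
  have "x \<otimes>\<^bsub>A\<^esub> (\<phi> s \<otimes>\<^bsub>A\<^esub> inv\<^bsub>A\<^esub> \<phi> r) = (\<phi> s \<otimes>\<^bsub>A\<^esub> x) \<otimes>\<^bsub>A\<^esub> inv\<^bsub>A\<^esub> \<phi> r"
    using assms(1) rs(2) A.Units_inv_closed[OF u] by (simp add: A.m_ac)
  also have "\<dots> = \<one>\<^bsub>A\<^esub>" unfolding rs(3) using u by (rule A.Units_r_inv)
  finally have "x \<otimes>\<^bsub>A\<^esub> (\<phi> s \<otimes>\<^bsub>A\<^esub> inv\<^bsub>A\<^esub> \<phi> r) = \<one>\<^bsub>A\<^esub>" .
  moreover have c: "\<phi> s \<otimes>\<^bsub>A\<^esub> inv\<^bsub>A\<^esub> \<phi> r \<in> carrier A" using rs(2) A.Units_inv_closed[OF u] by simp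
  ultimately show ?thesis using assms(1) A.m_comm[OF assms(1) c] unfolding Units_def by (intro CollectI conjI bexI[OF _ c]) auto
qed

lemma proper_ideal_subset:
  assumes "ideal I A" "I \<noteq> carrier A"
  shows "I \<subseteq> loc_ext p"
proof
  interpret I: ideal I A by fact
  fix x assume x: "x \<in> I"
  show "x \<in> loc_ext p"
  proof (rule ccontr)
    assume "x \<notin> loc_ext p"
    then have u: "x \<in> Units A" using x by (intro not_in_loc_ext_unit) auto
    then have "inv\<^bsub>A\<^esub> x \<otimes>\<^bsub>A\<^esub> x \<in> I" using x by (intro I.I_l_closed) auto
    then show False using u I.one_imp_carrier assms(2) by simp
  qed
qed

lemma loc_ext_p_proper: "loc_ext p \<noteq> carrier A"
  using loc_ext_prime[OF prime] primeideal.I_notcarr by blast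

lemma loc_ext_p_maximal: "maximalideal (loc_ext p) A"
proof (rule maximalidealI[OF loc_ext_ideal[OF p.is_ideal] loc_ext_p_proper[symmetric]])
  fix J assume J: "ideal J A" "loc_ext p \<subseteq> J" "J \<subseteq> carrier A"
  then show "J = loc_ext p \<or> J = carrier A" using proper_ideal_subset[OF J(1)] by blast
qed

lemma maximalideal_unique: "maximalideal m A \<Longrightarrow> m = loc_ext p"
proof -
  assume "maximalideal m A"
  then interpret m: maximalideal m A .
  have "m \<subseteq> loc_ext p" using proper_ideal_subset[OF m.is_ideal] m.I_notcarr by blast
  moreover have "loc_ext p \<subseteq> carrier A" by (auto simp: loc_ext_def)
  ultimately show ?thesis
    using m.I_maximal[OF loc_ext_ideal[OF p.is_ideal]] loc_ext_p_proper by blast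
qed

lemma loc_local_ring: "local_ring A"
  unfolding local_ring_def
  by (intro conjI ex1I[of _ "loc_ext p"] A.is_cring loc_ext_p_maximal) (rule maximalideal_unique)

lemma loc_max_ideal: "max_ideal A = loc_ext p"
  unfolding max_ideal_def using loc_ext_p_maximal maximalideal_unique by (rule the_equality)

lemma loc_chain_to:
  assumes "\<forall>i\<le>n. P i \<in> Spec A" "\<forall>i<n. P i \<subset> P (Suc i)"
  shows "prime_chain R n (\<lambda>i. loc_contr (P i)) p"
proof -
  have P: "primeideal (P i) A" if "i \<le> n" for i using assms(1) that by (simp add: Spec_def)
  have id: "ideal (P i) A" "P i \<noteq> carrier A" if "i \<le> n" for i
    using P[OF that] primeideal.axioms(1) primeideal.I_notcarr by blast+
  show ?thesis
    unfolding prime_chain_def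
  proof (intro conjI allI impI)
    show "loc_contr (P i) \<subset> loc_contr (P (Suc i))" if "i < n" for i
      using id[of i] id[of "Suc i"] assms(2) that by (intro loc_contr_mono_strict) auto
    show "loc_contr (P n) \<subseteq> p" by (rule loc_contr_subset[OF id]) auto
  qed (rule loc_contr_prime[OF P])
qed

lemma loc_chain_from:
  assumes "prime_chain R n P p"
  shows "(\<forall>i\<le>n. loc_ext (P i) \<in> Spec A) \<and> (\<forall>i<n. loc_ext (P i) \<subset> loc_ext (P (Suc i)))"
proof -
  have P: "primeideal (P i) R" "P i \<subseteq> p" if "i \<le> n" for i
    using assms prime_chain_take[OF assms that] that by (auto simp: prime_chain_def)
  show ?thesis
  proof (intro conjI allI impI)
    show "loc_ext (P i) \<in> Spec A" if "i \<le> n" for i using loc_ext_prime[OF P[OF that]] by (simp add: Spec_def)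
    show "loc_ext (P i) \<subset> loc_ext (P (Suc i))" if "i < n" for i
      using P[of i] P[of "Suc i"] that assms by (intro loc_ext_mono_strict) (auto simp: prime_chain_def)
  qed
qed

text \<open>Generators of the maximal ideal are replaced by numerators, and a chain of primes of
  \<open>A\<close> is contracted. Numerators of different generators may coincide and the chain may
  be longer than \<open>card T\<close>, hence \<open>card S \<le> n\<close> instead of an
  equality.\<close>

lemma regular_local_generators:
  assumes "regular_local_ring A"
  shows "\<exists>n S P. finite S \<and> S \<subseteq> p \<and> card S \<le> n \<and> prime_chain R n P p \<and>
    (\<forall>z\<in>p. \<exists>u\<in>carrier R - p. u \<otimes> z \<in> Idl\<^bsub>R\<^esub> S)"
proof -
  obtain T where T: "T \<subseteq> carrier A" "finite T" "enat (card T) = krull_dim A" "max_ideal A = Idl\<^bsub>A\<^esub> T"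
    using assms unfolding regular_local_ring_def by blast
  define chain where "chain n P \<longleftrightarrow> (\<forall>i\<le>n. P i \<in> Spec A) \<and> (\<forall>i<n. P i \<subset> P (Suc i))" for n and P :: "nat \<Rightarrow> 'c set"
  have dim: "krull_dim A = Sup {enat n | n. \<exists>P. chain n P}"
    unfolding krull_dim_def chain_def ..
  \<comment> \<open>The dimension is a supremum in \<open>enat\<close>. If all chains had length at
    most \<open>k\<close>, the supremum would be at most \<open>k\<close>, which is less than
    \<open>card T\<close>. With no generators the maximal ideal alone is a chain.\<close>
  have "\<exists>n P. chain n P \<and> card T \<le> n"
  proof (cases "card T")
    case 0
    have "chain 0 (\<lambda>_. loc_ext p)" using loc_ext_prime[OF prime] by (simp add: chain_def Spec_def)
    then show ?thesis using 0 by auto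
  next
    case (Suc k)
    show ?thesis
    proof (rule ccontr)
      assume "\<not> ?thesis"
      then have "n \<le> k" if "chain n P" for n P
        using that Suc by (cases "n \<le> k") (auto simp: not_le Suc_le_eq)
      then have "krull_dim A \<le> enat k" unfolding dim by (intro Sup_least) force
      then show False using T(3) Suc by (metis enat_ord_simps(1) not_less_eq_eq order_refl)
    qed
  qed
  then obtain n P where n: "chain n P" "card T \<le> n" by blast
  have "\<forall>x\<in>T. \<exists>r. r \<in> carrier R \<and> (\<exists>s\<in>carrier R - p. \<phi> s \<otimes>\<^bsub>A\<^esub> x = \<phi> r)"
    using numerator T(1) by blast
  then obtain num where num: "\<forall>x\<in>T. num x \<in> carrier R \<and> (\<exists>s\<in>carrier R - p. \<phi> s \<otimes>\<^bsub>A\<^esub> x = \<phi> (num x))"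
    by (rule bchoice[THEN exE])
  let ?S = "num ` T"
  have TI: "T \<subseteq> loc_ext p" using A.genideal_self[OF T(1)] T(4) loc_max_ideal by simp
  have S: "?S \<subseteq> p"
  proof
    fix r assume "r \<in> ?S"
    then obtain x s where "x \<in> T" "r \<in> carrier R" "s \<in> carrier R - p" "\<phi> s \<otimes>\<^bsub>A\<^esub> x = \<phi> r" using num by blast
    then show "r \<in> p" using loc_ext_mem[OF prime order_refl, of x r s] TI T(1) by blast
  qed
  have SR: "?S \<subseteq> carrier R" using S by auto
  have "\<exists>u\<in>carrier R - p. u \<otimes> z \<in> Idl\<^bsub>R\<^esub> ?S" if z: "z \<in> p" for z
  proof -
    interpret I: ideal "Idl\<^bsub>R\<^esub> ?S" R by (rule R.genideal_ideal[OF SR])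
    have "T \<subseteq> loc_ext (Idl\<^bsub>R\<^esub> ?S)"
    proof
      fix x assume x: "x \<in> T"
      then obtain s where "s \<in> carrier R - p" "\<phi> s \<otimes>\<^bsub>A\<^esub> x = \<phi> (num x)" using num by blast
      moreover have "num x \<in> Idl\<^bsub>R\<^esub> ?S" using R.genideal_self[OF SR] x by blast
      ultimately show "x \<in> loc_ext (Idl\<^bsub>R\<^esub> ?S)" using x T(1) by (auto simp: loc_ext_def)
    qed
    then have "loc_ext p \<subseteq> loc_ext (Idl\<^bsub>R\<^esub> ?S)"
      using A.genideal_minimal[OF loc_ext_ideal[OF I.is_ideal]] T(4) loc_max_ideal by simp
    moreover have zR: "z \<in> carrier R" using z by simp
    moreover have "\<phi> z \<in> loc_ext p" using z zR loc_ext_hom[OF prime order_refl zR] by simp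
    ultimately have "\<phi> z \<in> loc_ext (Idl\<^bsub>R\<^esub> ?S)" by blast
    then obtain r s where r: "r \<in> Idl\<^bsub>R\<^esub> ?S" "s \<in> carrier R - p" "\<phi> s \<otimes>\<^bsub>A\<^esub> \<phi> z = \<phi> r"
      by (auto simp: loc_ext_def)
    have R: "s \<in> carrier R" "r \<in> carrier R" using r by auto
    have "\<phi> (s \<otimes> z \<ominus> r) = \<zero>\<^bsub>A\<^esub>" using r(3) R zR by (simp add: a_minus_def A.r_neg)
    then obtain t where t: "t \<in> carrier R - p" "t \<otimes> (s \<otimes> z \<ominus> r) = \<zero>"
      using kernel[of "s \<otimes> z \<ominus> r"] R zR by auto
    have tR: "t \<in> carrier R" using t by simp
    have "(t \<otimes> s) \<otimes> z = t \<otimes> (s \<otimes> z \<ominus> r) \<oplus> t \<otimes> r" using R zR tR by algebra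
    also have "\<dots> = t \<otimes> r" using R tR by (simp add: t(2))
    also have "\<dots> \<in> Idl\<^bsub>R\<^esub> ?S" using r(1) tR by (rule I.I_l_closed)
    finally show ?thesis using primeideal_compl_mult[OF prime t(1) r(2)] by blast
  qed
  moreover have "card ?S \<le> n" using card_image_le[OF T(2), of num] n(2) by simp
  ultimately show ?thesis
    using S T(2) loc_chain_to[of n P] n(1) unfolding chain_def
    by (intro exI[of _ n] exI[of _ ?S] exI[of _ "\<lambda>i. loc_contr (P i)"]) auto
qed

lemma loc_noetherian:
  assumes "noetherian_ring R"
  shows "noetherian_ring A"
proof (rule A.noetherian_ringI)
  fix I assume I: "ideal I A"
  obtain S where S: "S \<subseteq> carrier R" "finite S" "loc_contr I = Idl\<^bsub>R\<^esub> S"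
    using noetherian_ring.finetely_gen[OF assms loc_contr_ideal[OF I]] by blast
  have SA: "\<phi> ` S \<subseteq> carrier A" using S(1) by auto
  interpret I: ideal I A by fact
  interpret K: ideal "Idl\<^bsub>A\<^esub> (\<phi> ` S)" A by (rule A.genideal_ideal[OF SA])
  have "I = Idl\<^bsub>A\<^esub> (\<phi> ` S)"
  proof
    have "S \<subseteq> loc_contr (Idl\<^bsub>A\<^esub> (\<phi> ` S))" using A.genideal_self[OF SA] S(1) by (auto simp: loc_contr_def)
    then have sub: "loc_contr I \<subseteq> loc_contr (Idl\<^bsub>A\<^esub> (\<phi> ` S))"
      unfolding S(3) by (intro R.genideal_minimal loc_contr_ideal K.is_ideal)
    show "I \<subseteq> Idl\<^bsub>A\<^esub> (\<phi> ` S)"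
    proof
      fix x assume x: "x \<in> I"
      then have xA: "x \<in> carrier A" by simp
      obtain r s where rs: "r \<in> carrier R" "s \<in> carrier R - p" "\<phi> s \<otimes>\<^bsub>A\<^esub> x = \<phi> r" using numerator[OF xA] by blast
      have "\<phi> s \<otimes>\<^bsub>A\<^esub> x \<in> I" using x rs(2) by (intro I.I_l_closed) auto
      then have "r \<in> loc_contr (Idl\<^bsub>A\<^esub> (\<phi> ` S))" using rs sub by (auto simp: loc_contr_def)
      then show "x \<in> Idl\<^bsub>A\<^esub> (\<phi> ` S)" using rs by (intro unit_cancel[OF K.is_ideal rs(2) xA]) (simp add: loc_contr_def)
    qed
    have "S \<subseteq> loc_contr I" using R.genideal_self[OF S(1)] S(3) by simp
    then show "Idl\<^bsub>A\<^esub> (\<phi> ` S) \<subseteq> I" by (intro A.genideal_minimal I) (auto simp: loc_contr_def)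
  qed
  then show "\<exists>T\<subseteq>carrier A. finite T \<and> I = Idl\<^bsub>A\<^esub> T" using SA S(2) by blast
qed

text \<open>A set with at most one element keeps its cardinality under \<open>\<phi>\<close>, so the
  number of generators can be matched with the dimension. Primes of height at most one are the only
  ones to which this is applied.\<close>

lemma regular_local_ringI:
  assumes noeth: "noetherian_ring R"
    and S: "S \<subseteq> p" "finite S" "card S \<le> 1" "\<And>z. z \<in> p \<Longrightarrow> \<exists>u\<in>carrier R - p. u \<otimes> z \<in> Idl\<^bsub>R\<^esub> S"
    and chain: "prime_chain R (card S) P p" and max: "\<And>P. \<not> prime_chain R (Suc (card S)) P p"
  shows "regular_local_ring A"
proof -
  have SR: "S \<subseteq> carrier R" using S(1) by auto
  have SA: "\<phi> ` S \<subseteq> carrier A" using SR by auto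
  have card: "card (\<phi> ` S) = card S"
    using S(2,3) by (cases "card S") (auto simp: card_Suc_eq)
  have "krull_dim A = enat (card S)"
    unfolding krull_dim_def
  proof (rule antisym)
    show "Sup {enat n |n. \<exists>P. (\<forall>i\<le>n. P i \<in> Spec A) \<and> (\<forall>i<n. P i \<subset> P (Suc i))} \<le> enat (card S)"
    proof (rule Sup_least)
      fix e assume "e \<in> {enat n |n. \<exists>P. (\<forall>i\<le>n. P i \<in> Spec A) \<and> (\<forall>i<n. P i \<subset> P (Suc i))}"
      then obtain n P where n: "e = enat n" "\<forall>i\<le>n. P i \<in> Spec A" "\<forall>i<n. P i \<subset> P (Suc i)" by blast
      have "n \<le> card S"
      proof (rule ccontr)
        assume "\<not> n \<le> card S"
        then show False using prime_chain_take[OF loc_chain_to[OF n(2,3)], of "Suc (card S)"] max by auto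
      qed
      then show "e \<le> enat (card S)" using n(1) by simp
    qed
    show "enat (card S) \<le> Sup {enat n |n. \<exists>P. (\<forall>i\<le>n. P i \<in> Spec A) \<and> (\<forall>i<n. P i \<subset> P (Suc i))}"
      using loc_chain_from[OF chain, THEN conjunct1] loc_chain_from[OF chain, THEN conjunct2]
      by (intro Sup_upper CollectI exI[of _ "card S"] conjI refl exI[of _ "\<lambda>i. loc_ext (P i)"])
  qed
  moreover have "loc_ext p = Idl\<^bsub>A\<^esub> (\<phi> ` S)"
  proof
    interpret K: ideal "Idl\<^bsub>A\<^esub> (\<phi> ` S)" A by (rule A.genideal_ideal[OF SA])
    have "S \<subseteq> loc_contr (Idl\<^bsub>A\<^esub> (\<phi> ` S))" using A.genideal_self[OF SA] SR by (auto simp: loc_contr_def)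
    then have sub: "Idl\<^bsub>R\<^esub> S \<subseteq> loc_contr (Idl\<^bsub>A\<^esub> (\<phi> ` S))"
      by (intro R.genideal_minimal loc_contr_ideal K.is_ideal)
    show "loc_ext p \<subseteq> Idl\<^bsub>A\<^esub> (\<phi> ` S)"
    proof
      fix x assume "x \<in> loc_ext p"
      then obtain r s where x: "x \<in> carrier A" "r \<in> p" "s \<in> carrier R - p" "\<phi> s \<otimes>\<^bsub>A\<^esub> x = \<phi> r" by (auto simp: loc_ext_def)
      obtain u where u: "u \<in> carrier R - p" "u \<otimes> r \<in> Idl\<^bsub>R\<^esub> S" using S(4)[OF x(2)] by blast
      have "\<phi> u \<otimes>\<^bsub>A\<^esub> (\<phi> s \<otimes>\<^bsub>A\<^esub> x) \<in> Idl\<^bsub>A\<^esub> (\<phi> ` S)" using u sub x(2) by (auto simp: loc_contr_def x(4))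
      then show "x \<in> Idl\<^bsub>A\<^esub> (\<phi> ` S)"
        using unit_cancel[OF K.is_ideal u(1), of "\<phi> s \<otimes>\<^bsub>A\<^esub> x"] unit_cancel[OF K.is_ideal x(3,1)] x by auto
    qed
    have "\<phi> ` S \<subseteq> loc_ext p" using loc_ext_hom[OF prime order_refl] S(1) by auto
    then show "Idl\<^bsub>A\<^esub> (\<phi> ` S) \<subseteq> loc_ext p" by (intro A.genideal_minimal loc_ext_ideal p.is_ideal)
  qed
  ultimately show ?thesis
    unfolding regular_local_ring_def loc_max_ideal
    using loc_local_ring loc_noetherian[OF noeth] SA S(2) card by (intro conjI exI[of _ "\<phi> ` S"]) auto
qed

end

context noetherian_cring
begin

interpretation M: module R "ring_as_module R" by (rule ring_as_module_is_module)

text \<open>At most one of \<open>x\<close> and \<open>y\<close> lies in \<open>q0\<close>, since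
  both together would force \<open>p \<subseteq> q\<close>. The roles of the two are exchanged when
  it is \<open>x\<close>.\<close>

lemma locally_regular_pairI:
  assumes p: "primeideal p R" and q0: "primeideal q0 R" and q: "primeideal q R"
    and qs: "q0 \<subset> q" "q \<subset> p" and xy: "x \<in> p" "y \<in> p"
    and gen: "\<And>z. z \<in> p \<Longrightarrow> \<exists>u\<in>carrier R - p. \<exists>r\<in>carrier R. \<exists>s\<in>carrier R. u \<otimes> z = x \<otimes> r \<oplus> y \<otimes> s"
  shows "locally_regular_pair R p"
proof (cases "x \<in> q0")
  case False
  then show ?thesis using locally_regular_pair_aux[OF p q0 q qs xy gen] by blast
next
  case True
  interpret p: primeideal p R by fact
  have "\<exists>u\<in>carrier R - p. \<exists>r\<in>carrier R. \<exists>s\<in>carrier R. u \<otimes> z = y \<otimes> r \<oplus> x \<otimes> s" if z: "z \<in> p" for z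
  proof -
    obtain u r s where "u \<in> carrier R - p" "r \<in> carrier R" "s \<in> carrier R" "u \<otimes> z = x \<otimes> r \<oplus> y \<otimes> s"
      using gen[OF z] by blast
    then show ?thesis using xy by (intro bexI[of _ u] bexI[of _ s] bexI[of _ r]) (auto simp: a_comm)
  qed
  moreover have "y \<notin> q0" using pair_x_notin[OF p q0 q qs xy gen] True qs(1) by blast
  ultimately show ?thesis using locally_regular_pair_aux[OF p q0 q qs xy(2,1)] by blast
qed

section \<open>Minimal primes of noetherian and reduced rings\<close>

lemma prime_disjoint_exists:
  assumes S: "\<one> \<in> S" "S \<subseteq> carrier R" "\<And>s t. s \<in> S \<Longrightarrow> t \<in> S \<Longrightarrow> s \<otimes> t \<in> S"
    and I: "ideal I R" "I \<inter> S = {}"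
  shows "\<exists>p. primeideal p R \<and> I \<subseteq> p \<and> p \<inter> S = {}"
proof -
  let ?F = "{J. ideal J R \<and> I \<subseteq> J \<and> J \<inter> S = {}}"
  have "I \<in> ?F" using I by simp
  then have ne: "?F \<noteq> {}" by blast
  have "\<exists>N\<in>?F. \<forall>L\<in>?F. N \<subseteq> L \<longrightarrow> L = N"
    by (rule M.noetherian_maximal[OF noetherian_ring_as_module ne]) (simp add: submodule_iff_ideal)
  then obtain p where pF: "p \<in> ?F" and max': "\<forall>L\<in>?F. p \<subseteq> L \<longrightarrow> L = p" by (rule bexE)
  from pF have p: "ideal p R" "I \<subseteq> p" "p \<inter> S = {}" by simp_all
  have max: "L = p" if "ideal L R" "I \<subseteq> L" "L \<inter> S = {}" "p \<subseteq> L" for L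
    using max' that by simp
  interpret p: ideal p R by fact
  \<comment> \<open>Enlarging \<open>p\<close> by an element outside it must meet \<open>S\<close>,
    by maximality. Two such elements with product in \<open>p\<close> would put a product of members
    of \<open>S\<close> into \<open>p\<close>.\<close>
  have big: "\<exists>r\<in>carrier R. \<exists>l\<in>p. r \<otimes> a \<oplus> l \<in> S" if a: "a \<in> carrier R" "a \<notin> p" for a
  proof -
    let ?L = "adjoin R (ring_as_module R) a p"
    have sub: "submodule p R (ring_as_module R)" by (simp add: submodule_iff_ideal p(1))
    have L: "ideal ?L R" using M.adjoin_submodule[OF sub] a(1) by (simp add: submodule_iff_ideal)
    have aL: "insert a p \<subseteq> ?L" using M.adjoin_superset[OF sub] a(1) by simp
    then have "?L \<inter> S \<noteq> {}" using max[OF L] p(2) a(2) by blast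
    then show ?thesis by (auto simp: adjoin_def)
  qed
  have "primeideal p R"
  proof (rule primeidealI[OF p(1) is_cring])
    show "carrier R \<noteq> p" using S(1,2) p(3) by blast
    fix a b assume ab: "a \<in> carrier R" "b \<in> carrier R" "a \<otimes> b \<in> p"
    show "a \<in> p \<or> b \<in> p"
    proof (rule ccontr)
      assume "\<not> ?thesis"
      then obtain r l s k where r: "r \<in> carrier R" "l \<in> p" "r \<otimes> a \<oplus> l \<in> S" and s: "s \<in> carrier R" "k \<in> p" "s \<otimes> b \<oplus> k \<in> S"
        using big[OF ab(1)] big[OF ab(2)] by blast
      have c: "l \<in> carrier R" "k \<in> carrier R" using r s by auto
      have "(r \<otimes> a \<oplus> l) \<otimes> (s \<otimes> b \<oplus> k) = (r \<otimes> s) \<otimes> (a \<otimes> b) \<oplus> (r \<otimes> a) \<otimes> k \<oplus> (s \<otimes> b \<oplus> k) \<otimes> l"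
        using r(1) s(1) c ab(1,2) by algebra
      also have "\<dots> \<in> p" using r(1) s(1) ab(1,2) c
        by (intro p.a_closed p.I_l_closed[OF ab(3)] p.I_l_closed[OF s(2)] p.I_l_closed[OF r(2)]) auto
      finally show False using S(3)[OF r(3) s(3)] p(3) by blast
    qed
  qed
  then show ?thesis using p by blast
qed

text \<open>A maximal counterexample \<open>I\<close> is not prime, so it contains some
  \<open>a \<otimes> b\<close> with neither factor in \<open>I\<close>. A minimal prime over
  \<open>I\<close> contains \<open>a\<close> or \<open>b\<close> and is then minimal over
  \<open>I + (a)\<close> or \<open>I + (b)\<close>, and both of these have only finitely
  many.\<close>

lemma finite_minimal_primes:
  assumes "ideal I R"
  shows "finite {p. primeideal p R \<and> I \<subseteq> p \<and> (\<forall>q. primeideal q R \<and> I \<subseteq> q \<and> q \<subseteq> p \<longrightarrow> q = p)}"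
proof (rule ccontr)
  define A where "A I = {p. primeideal p R \<and> I \<subseteq> p \<and> (\<forall>q. primeideal q R \<and> I \<subseteq> q \<and> q \<subseteq> p \<longrightarrow> q = p)}" for I
  assume "\<not> ?thesis"
  then have ne: "{I. ideal I R \<and> infinite (A I)} \<noteq> {}" using assms by (auto simp: A_def)
  have "\<exists>N\<in>{I. ideal I R \<and> infinite (A I)}. \<forall>L\<in>{I. ideal I R \<and> infinite (A I)}. N \<subseteq> L \<longrightarrow> L = N"
    by (rule M.noetherian_maximal[OF noetherian_ring_as_module ne]) (simp add: submodule_iff_ideal)
  then obtain I where IF: "I \<in> {I. ideal I R \<and> infinite (A I)}"
    and max': "\<forall>L\<in>{I. ideal I R \<and> infinite (A I)}. I \<subseteq> L \<longrightarrow> L = I" by (rule bexE)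
  from IF have I: "ideal I R" "infinite (A I)" by simp_all
  have max: "L = I" if "ideal L R" "infinite (A L)" "I \<subseteq> L" for L
    using max' that by simp
  interpret I: ideal I R by fact
  obtain P where P: "primeideal P R" "I \<subseteq> P" using infinite_imp_nonempty[OF I(2)] unfolding A_def by blast
  have "\<one> \<notin> I" using primeideal_compl_one[OF P(1)] P(2) by blast
  then have proper: "carrier R \<noteq> I" by auto
  have "\<not> primeideal I R"
  proof
    assume "primeideal I R"
    then have "A I \<subseteq> {I}" by (auto simp: A_def)
    then show False using I(2) finite_subset by blast
  qed
  then obtain a b where ab: "a \<in> carrier R" "b \<in> carrier R" "a \<otimes> b \<in> I" "a \<notin> I" "b \<notin> I"
    using primeidealI[OF I(1) is_cring proper] by blast
  have sub: "submodule I R (ring_as_module R)" by (simp add: submodule_iff_ideal I(1))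
  define J where "J c = adjoin R (ring_as_module R) c I" for c
  have J: "ideal (J c) R" "insert c I \<subseteq> J c" if "c \<in> carrier R" for c
    using M.adjoin_submodule[OF sub, of c] M.adjoin_superset[OF sub, of c] that
    by (simp_all add: submodule_iff_ideal J_def)
  have J_le: "J c \<subseteq> q" if "primeideal q R" "I \<subseteq> q" "c \<in> q" for q c
  proof -
    interpret q: primeideal q R by fact
    show ?thesis using that by (auto simp: J_def adjoin_def q.I_l_closed)
  qed
  have fin: "finite (A (J c))" if "c \<in> carrier R" "c \<notin> I" for c
    using max[OF J(1)[OF that(1)]] J(2)[OF that(1)] that(2) by blast
  have "A I \<subseteq> A (J a) \<union> A (J b)"
  proof
    fix p assume "p \<in> A I"
    then have p: "primeideal p R" "I \<subseteq> p" "\<And>q. primeideal q R \<Longrightarrow> I \<subseteq> q \<Longrightarrow> q \<subseteq> p \<Longrightarrow> q = p" by (auto simp: A_def)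
    have in_A: "p \<in> A (J c)" if "c \<in> carrier R" "c \<in> p" for c
    proof -
      have "q = p" if "primeideal q R" "J c \<subseteq> q" "q \<subseteq> p" for q
        using p(3)[OF that(1) _ that(3)] that(2) J(2)[OF \<open>c \<in> carrier R\<close>] by blast
      then show ?thesis using p(1) J_le[OF p(1,2) that(2)] by (simp add: A_def)
    qed
    have "a \<in> p \<or> b \<in> p" using primeideal.I_prime[OF p(1) ab(1,2)] ab(3) p(2) by blast
    then show "p \<in> A (J a) \<union> A (J b)" using in_A ab by blast
  qed
  then show False using I(2) fin ab finite_subset by (metis finite_UnI)
qed

text \<open>In \<open>R_p\<close> there is no prime but the maximal ideal, so \<open>z\<close> is
  nilpotent there. Concretely, if no \<open>u z^n\<close> were zero, a prime avoiding all of them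
  would sit inside \<open>p\<close>, hence be \<open>p\<close>, although it misses \<open>z\<close>.
  From \<open>u z^n = 0\<close> reducedness gives \<open>u z = 0\<close>.\<close>

lemma reduced_minimal_prime:
  assumes red: "reduced_ring R" and p: "primeideal p R" and min: "\<And>q. primeideal q R \<Longrightarrow> q \<subseteq> p \<Longrightarrow> q = p"
    and z: "z \<in> p"
  shows "\<exists>u\<in>carrier R - p. u \<otimes> z = \<zero>"
proof -
  interpret p: primeideal p R by fact
  have zR: "z \<in> carrier R" using z by simp
  define S where "S = {u \<otimes> z [^] (n::nat) | u n. u \<in> carrier R - p}"
  have pS: "u \<in> S" if "u \<in> carrier R - p" for u
    using that unfolding S_def by (intro CollectI exI[of _ u] exI[of _ "0::nat"]) auto
  have "\<zero> \<in> S"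
  proof (rule ccontr)
    assume "\<zero> \<notin> S"
    have "\<exists>q. primeideal q R \<and> {\<zero>} \<subseteq> q \<and> q \<inter> S = {}"
    proof (rule prime_disjoint_exists[OF _ _ _ zeroideal])
      show "\<one> \<in> S" using pS primeideal_compl_one[OF p] by blast
      show "S \<subseteq> carrier R" using zR by (auto simp: S_def)
      show "{\<zero>} \<inter> S = {}" using \<open>\<zero> \<notin> S\<close> by simp
      fix s t assume "s \<in> S" "t \<in> S"
      then obtain u n v m where s: "s = u \<otimes> z [^] (n::nat)" "u \<in> carrier R - p" and t: "t = v \<otimes> z [^] (m::nat)" "v \<in> carrier R - p"
        unfolding S_def by blast
      have "s \<otimes> t = (u \<otimes> v) \<otimes> (z [^] n \<otimes> z [^] m)" using s t zR by (simp add: m_ac)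
      also have "\<dots> = (u \<otimes> v) \<otimes> z [^] (n + m)" using zR by (simp add: nat_pow_mult)
      finally show "s \<otimes> t \<in> S" using primeideal_compl_mult[OF p s(2) t(2)] unfolding S_def by blast
    qed
    then obtain q where q: "primeideal q R" "q \<inter> S = {}" by blast
    interpret q: primeideal q R by (rule q(1))
    have "q \<subseteq> p" using pS q(2) q.Icarr by blast
    then have "q = p" by (rule min[OF q(1)])
    moreover have "\<one> \<otimes> z [^] (1::nat) \<in> S" unfolding S_def using primeideal_compl_one[OF p] by blast
    ultimately show False using q(2) z zR by auto
  qed
  then obtain u n where u: "u \<in> carrier R - p" "u \<otimes> z [^] (n::nat) = \<zero>" unfolding S_def by force
  have uR: "u \<in> carrier R" using u by simp
  have "(u \<otimes> z) [^] Suc n = \<zero>"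
  proof -
    have "(u \<otimes> z) [^] Suc n = (u [^] n \<otimes> z) \<otimes> (u \<otimes> z [^] n)"
      using uR zR by (simp add: nat_pow_distrib m_ac)
    then show ?thesis using u uR zR by simp
  qed
  then have "u \<otimes> z = \<zero>" using red uR zR unfolding reduced_ring_def by blast
  then show ?thesis using u(1) by blast
qed

section \<open>The regular locus\<close>

text \<open>\<open>J2_ring\<close> speaks of quotients of polynomial rings. The ring
  \<open>R\<close> itself occurs there, up to isomorphism, as the polynomial ring in no variables
  modulo the zero ideal, and constants give the first half of this isomorphism.\<close>

definition const0 :: "'a \<Rightarrow> (nat \<Rightarrow> nat) \<Rightarrow> 'a"
  where "const0 r = (\<lambda>e. if e = (\<lambda>_. 0) then r else \<zero>)"

lemma const0_iso: "const0 \<in> ring_iso R (mpoly_ring R 0)"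
proof -
  have ex: "carrier (exponent_monoid 0) = {\<lambda>_. 0}" "\<one>\<^bsub>exponent_monoid 0\<^esub> = (\<lambda>_. 0)"
    "\<And>y z. y \<otimes>\<^bsub>exponent_monoid 0\<^esub> z = (\<lambda>i. y i + z i)"
    by (auto simp: exponent_monoid_def)
  have car: "carrier (mpoly_ring R 0) = const0 ` carrier R"
  proof (intro equalityI subsetI)
    fix f assume "f \<in> carrier (mpoly_ring R 0)"
    then have f: "range f \<subseteq> carrier R" "{e. f e \<noteq> \<zero>} \<subseteq> {\<lambda>_. 0}"
      by (auto simp: mpoly_ring_def monoid_ring_def ex)
    have "f = const0 (f (\<lambda>_. 0))"
    proof
      fix e
      show "f e = const0 (f (\<lambda>_. 0)) e"
        using f(2) by (cases "e = (\<lambda>_. 0)") (auto simp: const0_def)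
    qed
    then show "f \<in> const0 ` carrier R" using f(1) by blast
  next
    fix f assume "f \<in> const0 ` carrier R"
    then obtain r where r: "r \<in> carrier R" "f = const0 r" by blast
    have sub: "{e. f e \<noteq> \<zero>} \<subseteq> {\<lambda>_. 0}" by (auto simp: r const0_def)
    then have "finite {e. f e \<noteq> \<zero>}" by (rule finite_subset) simp
    then show "f \<in> carrier (mpoly_ring R 0)" using sub r
      by (auto simp: mpoly_ring_def monoid_ring_def ex const0_def)
  qed
  have inj: "inj_on const0 (carrier R)"
    by (auto simp: inj_on_def const0_def dest: fun_cong[of _ _ "\<lambda>_. 0"])
  have "const0 \<in> ring_hom R (mpoly_ring R 0)"
  proof (rule ring_hom_memI)
    fix a b assume a: "a \<in> carrier R" and b: "b \<in> carrier R"
    show "const0 (a \<oplus> b) = const0 a \<oplus>\<^bsub>mpoly_ring R 0\<^esub> const0 b"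
      using a b by (auto simp: const0_def mpoly_ring_def monoid_ring_def fun_eq_iff)
    show "const0 (a \<otimes> b) = const0 a \<otimes>\<^bsub>mpoly_ring R 0\<^esub> const0 b"
    proof
      fix e
      let ?P = "{(y, z). const0 a y \<noteq> \<zero> \<and> const0 b z \<noteq> \<zero> \<and> y \<otimes>\<^bsub>exponent_monoid 0\<^esub> z = e}"
      have eq: "(const0 a \<otimes>\<^bsub>mpoly_ring R 0\<^esub> const0 b) e = (\<Oplus>yz\<in>?P. const0 a (fst yz) \<otimes> const0 b (snd yz))"
        by (simp add: mpoly_ring_def monoid_ring_def)
      show "const0 (a \<otimes> b) e = (const0 a \<otimes>\<^bsub>mpoly_ring R 0\<^esub> const0 b) e"
      proof (cases "e = (\<lambda>_. 0) \<and> a \<noteq> \<zero> \<and> b \<noteq> \<zero>")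
        case True
        then have P: "?P = {(\<lambda>_. 0, \<lambda>_. 0)}" by (auto simp: const0_def ex split: if_splits)
        show ?thesis unfolding eq P using True a b by (simp add: const0_def)
      next
        case False
        then have P: "?P = {}" by (auto simp: const0_def ex split: if_splits)
        show ?thesis unfolding eq P using False a b by (auto simp: const0_def)
      qed
    qed
  qed (auto simp: car, simp add: const0_def mpoly_ring_def monoid_ring_def ex)
  then show ?thesis using inj car by (simp add: ring_iso_def bij_betw_def)
qed

lemma mpoly_ring_0_cring: "cring (mpoly_ring R 0)"
proof -
  \<comment> \<open>Transport along the isomorphism replaces the zero of the record by the image of
    \<open>\<zero>\<close>, which is the zero it already has.\<close>
  have "cring ((mpoly_ring R 0) \<lparr> zero := const0 \<zero> \<rparr>)"
    by (rule ring_iso_imp_img_cring[OF const0_iso])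
  moreover have "const0 \<zero> = \<zero>\<^bsub>mpoly_ring R 0\<^esub>" by (auto simp: const0_def mpoly_ring_def monoid_ring_def)
  ultimately show ?thesis by simp
qed

text \<open>Closedness of the singular locus, already translated to \<open>R\<close>. Outside the
  closed set of \<open>I\<close>, \<open>p\<close> has no more local generators than the length of a
  chain below it. On it, a prime with at most one local generator and a chain of matching length has
  a longer chain too, since otherwise it would be regular.\<close>

lemma regular_locus_open:
  assumes J2: "J2_ring R"
  shows "\<exists>I. ideal I R \<and>
    (\<forall>p. primeideal p R \<longrightarrow> \<not> I \<subseteq> p \<longrightarrow>
      (\<exists>n S P. finite S \<and> S \<subseteq> p \<and> card S \<le> n \<and> prime_chain R n P p \<and>
        (\<forall>z\<in>p. \<exists>u\<in>carrier R - p. u \<otimes> z \<in> Idl S))) \<and>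
    (\<forall>p S P. primeideal p R \<longrightarrow> I \<subseteq> p \<longrightarrow> S \<subseteq> p \<longrightarrow> finite S \<longrightarrow> card S \<le> 1 \<longrightarrow>
      (\<forall>z\<in>p. \<exists>u\<in>carrier R - p. u \<otimes> z \<in> Idl S) \<longrightarrow> prime_chain R (card S) P p \<longrightarrow>
      (\<exists>P. prime_chain R (Suc (card S)) P p))"
proof -
  interpret M0: cring "mpoly_ring R 0" by (rule mpoly_ring_0_cring)
  let ?Z = "{\<zero>\<^bsub>mpoly_ring R 0\<^esub>}"
  interpret Z: ideal ?Z "mpoly_ring R 0" by (rule M0.zeroideal)
  define R' where "R' = mpoly_ring R 0 Quot ?Z"
  interpret R': cring R' unfolding R'_def by (rule Z.quotient_is_cring) (rule M0.is_cring)
  define h where "h r = ?Z +>\<^bsub>mpoly_ring R 0\<^esub> const0 r" for r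
  have c: "const0 \<in> ring_hom R (mpoly_ring R 0)" "bij_betw const0 (carrier R) (carrier (mpoly_ring R 0))"
    using const0_iso by (auto simp: ring_iso_def)
  have hom: "h \<in> ring_hom R R'"
    using ring_hom_trans[OF c(1) Z.rcos_ring_hom] by (simp add: h_def[abs_def] R'_def comp_def)
  \<comment> \<open>Cosets of the zero ideal are singletons, so the quotient map is a bijection and
    \<open>R'\<close> is a copy of \<open>R\<close>.\<close>
  have coset: "?Z +>\<^bsub>mpoly_ring R 0\<^esub> f = {f}" if "f \<in> carrier (mpoly_ring R 0)" for f
    using that by (auto simp: a_r_coset_def r_coset_def)
  have bij: "bij_betw h (carrier R) (carrier R')"
  proof -
    have hr: "h r = {const0 r}" if "r \<in> carrier R" for r
      using coset[of "const0 r"] c(2) that by (auto simp: h_def bij_betw_def)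
    have "carrier R' = (\<lambda>f. {f}) ` carrier (mpoly_ring R 0)"
      using coset by (auto simp: R'_def FactRing_def A_RCOSETS_def RCOSETS_def a_r_coset_def)
    then show ?thesis using c(2) hr by (auto simp: bij_betw_def inj_on_def image_iff)
  qed
  obtain I' where I': "ideal I' R'" and reg: "regular_locus R' = {p \<in> Spec R'. \<not> I' \<subseteq> p}"
    using J2 M0.zeroideal unfolding J2_ring_def zariski_open_def R'_def by blast
  interpret h: ring_hom_cring R R' h
    by (intro ring_hom_cringI hom) unfold_locales
  interpret I': ideal I' R' by fact
  define I where "I = {r \<in> carrier R. h r \<in> I'}"
  have "submodule I R (ring_as_module R)"
    by (rule M.submoduleI) (auto simp: I_def I'.I_l_closed)
  then have I: "ideal I R" by (simp add: submodule_iff_ideal)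
  have surj: "\<exists>r\<in>carrier R. h r = y" if y: "y \<in> carrier R'" for y
  proof -
    have "y \<in> h ` carrier R" using bij_betw_imp_surj_on[OF bij] y by simp
    then show ?thesis by (rule imageE) (intro bexI, simp_all)
  qed
  have inj: "r = s" if "h r = h s" "r \<in> carrier R" "s \<in> carrier R" for r s
    using bij that by (auto simp: bij_betw_def inj_on_def)
  have transfer: "\<exists>p'. p' \<in> Spec R' \<and> (I' \<subseteq> p' \<longleftrightarrow> I \<subseteq> p) \<and>
      prime_localization R (loc_at_prime R' p') p (\<lambda>r. loc_frac R' (carrier R' - p') (h r) \<one>\<^bsub>R'\<^esub>)"
    if p: "primeideal p R" for p
  proof -
    interpret p: primeideal p R by fact
    let ?p' = "h ` p"
    have mem: "h r \<in> ?p' \<longleftrightarrow> r \<in> p" if r: "r \<in> carrier R" for r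
    proof
      assume "h r \<in> ?p'"
      then obtain s where "s \<in> p" "h r = h s" by blast
      then show "r \<in> p" using inj[OF _ r] by simp
    qed simp
    have "submodule ?p' R' (ring_as_module R')"
    proof (rule module.submoduleI[OF R'.ring_as_module_is_module])
      show "?p' \<subseteq> carrier (ring_as_module R')" by auto
      show "\<zero>\<^bsub>ring_as_module R'\<^esub> \<in> ?p'" using mem[of \<zero>] by simp
      fix a assume "a \<in> ?p'"
      then obtain r where r: "r \<in> p" "a = h r" by blast
      then show "\<ominus>\<^bsub>ring_as_module R'\<^esub> a \<in> ?p'" using mem[of "\<ominus> r"] by simp
      fix b assume "b \<in> ?p'"
      then obtain s where s: "s \<in> p" "b = h s" by blast
      then show "a \<oplus>\<^bsub>ring_as_module R'\<^esub> b \<in> ?p'" using mem[of "r \<oplus> s"] r by simp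
    next
      fix c a assume c: "c \<in> carrier R'" and "a \<in> ?p'"
      then obtain r where r: "r \<in> p" "a = h r" by blast
      obtain s where s: "s \<in> carrier R" "h s = c" using surj[OF c] by blast
      have "s \<otimes> r \<in> p" using r s by (simp add: p.I_l_closed)
      then show "c \<odot>\<^bsub>ring_as_module R'\<^esub> a \<in> ?p'" using mem[of "s \<otimes> r"] r s by simp
    qed
    then have id: "ideal ?p' R'" by (simp add: R'.submodule_iff_ideal)
    have prime': "primeideal ?p' R'"
    proof (rule primeidealI[OF id R'.is_cring])
      show "carrier R' \<noteq> ?p'"
        using mem[of \<one>] primeideal_compl_one[OF p] R'.one_closed by (auto simp del: R'.one_closed)
      fix a b assume a: "a \<in> carrier R'" and b: "b \<in> carrier R'" and ab: "a \<otimes>\<^bsub>R'\<^esub> b \<in> ?p'"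
      obtain r where r: "r \<in> carrier R" "h r = a" using surj[OF a] by blast
      obtain s where s: "s \<in> carrier R" "h s = b" using surj[OF b] by blast
      have "r \<otimes> s \<in> p" using ab mem[of "r \<otimes> s"] r s by simp
      then show "a \<in> ?p' \<or> b \<in> ?p'" using p.I_prime[OF r(1) s(1)] r s by blast
    qed
    have p_eq: "{r \<in> carrier R. h r \<in> ?p'} = p" using mem p.Icarr by blast
    have "I' \<subseteq> ?p' \<longleftrightarrow> I \<subseteq> p"
    proof
      assume "I' \<subseteq> ?p'"
      then show "I \<subseteq> p" using mem by (auto simp: I_def)
    next
      assume sub: "I \<subseteq> p"
      show "I' \<subseteq> ?p'"
      proof
        fix y assume y: "y \<in> I'"
        then obtain r where "r \<in> carrier R" "h r = y" using surj[of y] by auto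
        then show "y \<in> ?p'" using sub y by (auto simp: I_def)
      qed
    qed
    moreover have "prime_localization R (loc_at_prime R' ?p') p (\<lambda>r. loc_frac R' (carrier R' - ?p') (h r) \<one>\<^bsub>R'\<^esub>)"
      using prime_localization_iso[OF is_cring hom bij prime_localization_loc_at_prime[OF R'.is_cring prime']] p
      unfolding p_eq by blast
    ultimately show ?thesis using prime' by (intro exI[of _ ?p']) (simp add: Spec_def)
  qed
  show ?thesis
  proof (intro exI[of _ I] conjI allI impI I)
    fix p assume p: "primeideal p R" and Ip: "\<not> I \<subseteq> p"
    obtain p' where p': "p' \<in> Spec R'" "I' \<subseteq> p' \<longleftrightarrow> I \<subseteq> p"
      "prime_localization R (loc_at_prime R' p') p (\<lambda>r. loc_frac R' (carrier R' - p') (h r) \<one>\<^bsub>R'\<^esub>)"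
      using transfer[OF p] by blast
    then have "p' \<in> regular_locus R'" unfolding reg using Ip by blast
    then have "regular_local_ring (loc_at_prime R' p')" by (simp add: regular_locus_def)
    then show "\<exists>n S P. finite S \<and> S \<subseteq> p \<and> card S \<le> n \<and> prime_chain R n P p \<and>
        (\<forall>z\<in>p. \<exists>u\<in>carrier R - p. u \<otimes> z \<in> Idl S)"
      by (rule prime_localization.regular_local_generators[OF p'(3)])
  next
    fix p S P
    assume p: "primeideal p R" and Ip: "I \<subseteq> p" and S: "S \<subseteq> p" "finite S" "card S \<le> 1"
      "\<forall>z\<in>p. \<exists>u\<in>carrier R - p. u \<otimes> z \<in> Idl S" and ch: "prime_chain R (card S) P p"
    obtain p' where p': "p' \<in> Spec R'" "I' \<subseteq> p' \<longleftrightarrow> I \<subseteq> p"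
      "prime_localization R (loc_at_prime R' p') p (\<lambda>r. loc_frac R' (carrier R' - p') (h r) \<one>\<^bsub>R'\<^esub>)"
      using transfer[OF p] by blast
    show "\<exists>P. prime_chain R (Suc (card S)) P p"
    proof (rule ccontr)
      assume "\<not> ?thesis"
      then have "regular_local_ring (loc_at_prime R' p')"
        using S(4) by (intro prime_localization.regular_local_ringI[OF p'(3) _ S(1-3) _ ch]) (auto intro: noetherian_ring_axioms)
      then have "p' \<in> regular_locus R'" using p'(1) by (simp add: regular_locus_def)
      then show False using p'(2) Ip unfolding reg by blast
    qed
  qed
qed

end

section \<open>Primes of height one in normal domains\<close>

context noetherian_cring
begin

interpretation M: module R "ring_as_module R" by (rule ring_as_module_is_module)

lemma colon_ideal:
  assumes "ideal I R" "b \<in> carrier R"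
  shows "ideal {r \<in> carrier R. r \<otimes> b \<in> I} R"
proof -
  interpret I: ideal I R by fact
  have "submodule {r \<in> carrier R. r \<otimes> b \<in> I} R (ring_as_module R)"
    by (rule M.submoduleI) (use assms(2) in \<open>auto simp: l_minus l_distr m_assoc I.I_l_closed\<close>)
  then show ?thesis by (simp add: submodule_iff_ideal)
qed

text \<open>A prime of height one containing \<open>a\<close> is associated, locally, to \<open>R / aR\<close>.\<close>

lemma height_one_colon:
  assumes p: "primeideal p R" and a: "a \<in> p" "a \<noteq> \<zero>"
    and min: "\<And>q. primeideal q R \<Longrightarrow> q \<subseteq> p \<Longrightarrow> q \<noteq> {\<zero>} \<Longrightarrow> q = p"
  shows "\<exists>b\<in>carrier R. b \<notin> PIdl a \<and> (\<forall>y\<in>p. \<exists>v\<in>carrier R. b \<otimes> y = a \<otimes> v)"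
proof -
  interpret p: primeideal p R by fact
  have aR: "a \<in> carrier R" using a by simp
  define I where "I = PIdl a"
  have I: "ideal I R" unfolding I_def by (rule cgenideal_ideal[OF aR])
  interpret I: ideal I R by (rule I)
  have aI: "a \<in> I" unfolding I_def by (rule cgenideal_self[OF aR])
  \<comment> \<open>The contraction to \<open>R\<close> of the ideal generated by \<open>a\<close>
    in \<open>R_p\<close>.\<close>
  define T where "T = sat R (ring_as_module R) p I"
  have T_iff: "x \<in> T \<longleftrightarrow> x \<in> carrier R \<and> (\<exists>u\<in>carrier R - p. u \<otimes> x \<in> I)" for x
    unfolding T_def sat_def by simp
  have subI: "submodule I R (ring_as_module R)" by (simp add: submodule_iff_ideal I)
  have T: "ideal T R" unfolding T_def using M.sat_submodule[OF p subI] by (simp add: submodule_iff_ideal)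
  interpret T: ideal T R by (rule T)
  have IT: "I \<subseteq> T" unfolding T_def using I.Icarr by (intro M.sat_superset[OF p]) auto
  have T_I: "x \<in> T" if "u \<in> carrier R - p" "x \<in> carrier R" "u \<otimes> x \<in> T" for u x
  proof -
    have "x \<in> sat R (ring_as_module R) p T" by (rule M.satI[OF that(1)]) (simp_all add: that)
    then show ?thesis using M.sat_idem[OF p] unfolding T_def by blast
  qed
  have "I \<subseteq> p"
    unfolding I_def cgenideal_def using a(1) by (auto intro: p.I_l_closed)
  have oneT: "\<one> \<notin> T"
  proof
    assume "\<one> \<in> T"
    then obtain u where "u \<in> carrier R - p" "u \<otimes> \<one> \<in> I" unfolding T_iff by blast
    then show False using \<open>I \<subseteq> p\<close> by auto
  qed
  define J where "J b = {r \<in> carrier R. r \<otimes> b \<in> T}" for b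
  have J: "ideal (J b) R" if "b \<in> carrier R" for b
    unfolding J_def by (rule colon_ideal[OF T that])
  \<comment> \<open>Annihilators of nonzero elements of \<open>R / T\<close>. A maximal one is
    prime; it contains \<open>a\<close>, so it is nonzero, and it is contained in \<open>p\<close>
    because \<open>T\<close> is local at \<open>p\<close>. Height one then makes it equal to
    \<open>p\<close>.\<close>
  let ?F = "{J b | b. b \<in> carrier R \<and> b \<notin> T}"
  have ne: "?F \<noteq> {}" using oneT by blast
  have "\<exists>N\<in>?F. \<forall>L\<in>?F. N \<subseteq> L \<longrightarrow> L = N"
    by (rule M.noetherian_maximal[OF noetherian_ring_as_module ne]) (auto simp: submodule_iff_ideal J)
  then obtain N where N: "N \<in> ?F" "\<forall>L\<in>?F. N \<subseteq> L \<longrightarrow> L = N" by (rule bexE)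
  then obtain b where b: "b \<in> carrier R" "b \<notin> T" "N = J b" by blast
  have max: "J c = J b" if "c \<in> carrier R" "c \<notin> T" "J b \<subseteq> J c" for c
    using N(2) that b(3) by blast
  have prime: "primeideal (J b) R"
  proof (rule primeidealI[OF J[OF b(1)] is_cring])
    have "\<one> \<notin> J b" using b by (simp add: J_def)
    then show "carrier R \<noteq> J b" by auto
    fix r s assume rs: "r \<in> carrier R" "s \<in> carrier R" "r \<otimes> s \<in> J b"
    show "r \<in> J b \<or> s \<in> J b"
    proof (rule disjCI)
      assume "s \<notin> J b"
      then have s: "s \<otimes> b \<notin> T" "s \<otimes> b \<in> carrier R" using rs b by (auto simp: J_def)
      have "J b \<subseteq> J (s \<otimes> b)"
      proof
        fix t assume t: "t \<in> J b"
        then have "t \<otimes> (s \<otimes> b) = s \<otimes> (t \<otimes> b)" using rs b by (simp add: J_def m_lcomm)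
        then show "t \<in> J (s \<otimes> b)" using t rs(2) by (auto simp: J_def T.I_l_closed)
      qed
      then have "J (s \<otimes> b) = J b" by (rule max[OF s(2,1)])
      moreover have "r \<in> J (s \<otimes> b)" using rs b by (simp add: J_def m_assoc)
      ultimately show "r \<in> J b" by simp
    qed
  qed
  have "J b \<subseteq> p"
  proof
    fix r assume r: "r \<in> J b"
    then show "r \<in> p" using T_I[of r b] b by (auto simp: J_def)
  qed
  moreover have "a \<in> J b" using aR b aI IT by (auto simp: J_def T.I_r_closed)
  ultimately have Jp: "J b = p" using min[OF prime] a(2) by blast
  define L where "L = {y \<in> carrier R. y \<otimes> b \<in> I}"
  have L: "submodule L R (ring_as_module R)"
    unfolding L_def using colon_ideal[OF I b(1)] by (simp add: submodule_iff_ideal)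
  have "p \<subseteq> sat R (ring_as_module R) p L"
  proof
    fix y assume y: "y \<in> p"
    then have "y \<in> carrier R" "y \<otimes> b \<in> T" using Jp by (auto simp: J_def)
    then obtain u where u: "u \<in> carrier R - p" "u \<otimes> (y \<otimes> b) \<in> I" unfolding T_iff by blast
    have "(u \<otimes> y) \<otimes> b \<in> I" using u y b by (simp add: m_assoc)
    then show "y \<in> sat R (ring_as_module R) p L" using y u(1) by (intro M.satI[OF u(1)]) (auto simp: L_def)
  qed
  \<comment> \<open>So far \<open>p b\<close> lies in \<open>T\<close>, that is, in
    \<open>aR\<close> up to denominators. As \<open>p\<close> is finitely generated, one
    \<open>u\<close> clears them all, and \<open>u b\<close> takes the place of \<open>b\<close>; it
    is outside \<open>aR\<close> because \<open>b\<close> is outside \<open>T\<close>.\<close>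
  then obtain u where u: "u \<in> carrier R - p" "\<And>y. y \<in> p \<Longrightarrow> u \<otimes> y \<in> L"
    using M.sat_uniform[OF p ideal_fg[OF p.is_ideal] L] by auto
  have uR: "u \<in> carrier R" using u by simp
  have "u \<otimes> b \<notin> I"
  proof
    assume "u \<otimes> b \<in> I"
    then have "b \<in> T" using b(1) u(1) unfolding T_iff by blast
    then show False using b(2) by blast
  qed
  moreover have "\<exists>v\<in>carrier R. (u \<otimes> b) \<otimes> y = a \<otimes> v" if y: "y \<in> p" for y
  proof -
    have "(u \<otimes> y) \<otimes> b \<in> PIdl a" using u(2)[OF y] by (simp add: L_def I_def)
    then obtain v where v: "v \<in> carrier R" "(u \<otimes> y) \<otimes> b = v \<otimes> a" by (auto simp: cgenideal_def)
    then have "(u \<otimes> b) \<otimes> y = a \<otimes> v" using uR b(1) y aR by (simp add: m_ac)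
    then show ?thesis using v(1) by blast
  qed
  ultimately show ?thesis using uR b(1) unfolding I_def by (intro bexI[of _ "u \<otimes> b"]) auto
qed

text \<open>The ideals generated by the first \<open>n\<close> terms stabilize, so some term is a
  combination of its predecessors. The coefficient one of \<open>w n\<close> is what later makes the
  equation for \<open>b / a\<close> monic.\<close>

lemma noetherian_sequence_relation:
  fixes w :: "nat \<Rightarrow> 'a"
  assumes w: "\<And>i. w i \<in> carrier R"
  shows "\<exists>n c. (\<forall>i. c i \<in> carrier R) \<and> w n \<oplus> (\<Oplus>i\<in>{..<n}. c i \<otimes> w i) = \<zero>"
proof -
  define L where "L = rec_nat {\<zero>} (\<lambda>n. adjoin R (ring_as_module R) (w n))"
  have L0: "L 0 = {\<zero>}" and LS: "L (Suc n) = adjoin R (ring_as_module R) (w n) (L n)" for n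
    by (simp_all add: L_def)
  have L: "submodule (L n) R (ring_as_module R)" for n
  proof (induction n)
    case 0 then show ?case using M.zero_submodule by (simp add: L0)
  next
    case (Suc n) then show ?case unfolding LS using w by (intro M.adjoin_submodule) auto
  qed
  have comb: "\<exists>c. (\<forall>i. c i \<in> carrier R) \<and> x = (\<Oplus>i\<in>{..<n}. c i \<otimes> w i)" if "x \<in> L n" for n x
    using that
  proof (induction n arbitrary: x)
    case 0 then show ?case by (auto simp: L0 intro!: exI[of _ "\<lambda>_. \<zero>"])
  next
    case (Suc n)
    then obtain r l where r: "x = r \<otimes> w n \<oplus> l" "r \<in> carrier R" "l \<in> L n" unfolding LS adjoin_def by auto
    obtain c where c: "\<forall>i. c i \<in> carrier R" "l = (\<Oplus>i\<in>{..<n}. c i \<otimes> w i)" using Suc.IH[OF r(3)] by blast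
    have "(\<Oplus>i\<in>{..<Suc n}. (c(n := r)) i \<otimes> w i) = r \<otimes> w n \<oplus> (\<Oplus>i\<in>{..<n}. (c(n := r)) i \<otimes> w i)"
      using c(1) r(2) w by (subst lessThan_Suc, subst finsum_insert) auto
    also have "(\<Oplus>i\<in>{..<n}. (c(n := r)) i \<otimes> w i) = (\<Oplus>i\<in>{..<n}. c i \<otimes> w i)"
      using c(1) w by (intro finsum_cong') auto
    finally show ?case using c r by (intro exI[of _ "c(n := r)"]) auto
  qed
  have "\<exists>N\<in>range L. \<forall>K\<in>range L. N \<subseteq> K \<longrightarrow> K = N"
    by (rule M.noetherian_maximal[OF noetherian_ring_as_module]) (auto simp: L)
  then obtain n where n: "\<forall>K\<in>range L. L n \<subseteq> K \<longrightarrow> K = L n" by blast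
  have sup: "insert (w n) (L n) \<subseteq> L (Suc n)" unfolding LS using w by (intro M.adjoin_superset[OF L]) simp
  then have "L (Suc n) = L n" using n by blast
  then have "w n \<in> L n" using sup by blast
  then have "\<ominus> w n \<in> L n" using M.submoduleD(2)[OF L, of "w n" n] w by simp
  then obtain c where c: "\<forall>i. c i \<in> carrier R" "\<ominus> w n = (\<Oplus>i\<in>{..<n}. c i \<otimes> w i)" using comb by blast
  have "w n \<oplus> (\<Oplus>i\<in>{..<n}. c i \<otimes> w i) = \<zero>" unfolding c(2)[symmetric] using w by (simp add: r_neg)
  then show ?thesis using c(1) by blast
qed

text \<open>With \<open>b\<close> as in the colon lemma, either \<open>bx = au\<close> for some \<open>x\<close> in \<open>p\<close> and \<open>u\<close> outside \<open>p\<close>, and then \<open>x\<close>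
  generates \<open>p\<close> locally, or multiplication by \<open>b / a\<close> maps \<open>p\<close> to itself. In the second case \<open>b / a\<close> is
  integral: the ideal generated by the elements \<open>(b / a)\<^sup>i a\<close> is finitely generated.\<close>

lemma normal_height_one_principal:
  assumes norm: "normal_domain R" and p: "primeideal p R" "p \<noteq> {\<zero>}"
    and min: "\<And>q. primeideal q R \<Longrightarrow> q \<subseteq> p \<Longrightarrow> q \<noteq> {\<zero>} \<Longrightarrow> q = p"
  shows "\<exists>x\<in>p. \<exists>u\<in>carrier R - p. \<forall>y\<in>p. \<exists>r\<in>carrier R. u \<otimes> y = x \<otimes> r"
proof -
  interpret dom: domain R using norm by (simp add: normal_domain_def)
  interpret p: primeideal p R by (rule p(1))
  have "\<zero> \<in> p" by simp
  then obtain a where a: "a \<in> p" "a \<noteq> \<zero>" using p(2) by blast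
  have aR: "a \<in> carrier R" using a by simp
  obtain b where b: "b \<in> carrier R" "b \<notin> PIdl a" "\<And>y. y \<in> p \<Longrightarrow> \<exists>v\<in>carrier R. b \<otimes> y = a \<otimes> v"
    using height_one_colon[OF p(1) a min] by blast
  have cancel: "x = y" if "a \<otimes> x = a \<otimes> y" "x \<in> carrier R" "y \<in> carrier R" for x y
    using that dom.m_lcancel[OF a(2) aR] by blast
  show ?thesis
  proof (cases "\<exists>x\<in>p. \<exists>u\<in>carrier R - p. b \<otimes> x = a \<otimes> u")
    case True
    then obtain x u where x: "x \<in> p" "u \<in> carrier R - p" "b \<otimes> x = a \<otimes> u" by blast
    have R: "x \<in> carrier R" "u \<in> carrier R" using x by auto
    have "\<exists>r\<in>carrier R. u \<otimes> y = x \<otimes> r" if y: "y \<in> p" for y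
    proof -
      obtain v where v: "v \<in> carrier R" "b \<otimes> y = a \<otimes> v" using b(3)[OF y] by blast
      have yR: "y \<in> carrier R" using y by simp
      have "a \<otimes> (u \<otimes> y) = (b \<otimes> x) \<otimes> y" unfolding x(3) using aR R yR by (simp add: m_assoc)
      also have "\<dots> = (b \<otimes> y) \<otimes> x" using b(1) R yR by (simp add: m_ac)
      also have "\<dots> = a \<otimes> (x \<otimes> v)" unfolding v(2) using aR v(1) R by (simp add: m_ac)
      finally have "u \<otimes> y = x \<otimes> v" using cancel R yR v(1) by simp
      then show ?thesis using v(1) by blast
    qed
    then show ?thesis using x by blast
  next
    case False
    have "\<forall>y\<in>p. \<exists>v. v \<in> p \<and> b \<otimes> y = a \<otimes> v"
    proof
      fix y assume y: "y \<in> p"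
      obtain v where v: "v \<in> carrier R" "b \<otimes> y = a \<otimes> v" using b(3)[OF y] by blast
      then have "v \<in> p" using False y by blast
      then show "\<exists>v. v \<in> p \<and> b \<otimes> y = a \<otimes> v" using v(2) by blast
    qed
    \<comment> \<open>\<open>f\<close> is multiplication by \<open>b / a\<close> on
      \<open>p\<close>, which stays inside \<open>R\<close> although \<open>b / a\<close> itself is
      not yet known to. Iterating from \<open>a\<close> gives
      \<open>w n = (b / a)^n a\<close>.\<close>
    then obtain f where f: "\<And>y. y \<in> p \<Longrightarrow> f y \<in> p" "\<And>y. y \<in> p \<Longrightarrow> b \<otimes> y = a \<otimes> f y"
      using bchoice[of p "\<lambda>y v. v \<in> p \<and> b \<otimes> y = a \<otimes> v"] by blast
    define w where "w n = (f ^^ n) a" for n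
    have w: "w n \<in> p" for n by (induction n) (simp_all add: w_def a f)
    have w_Suc: "b \<otimes> w n = a \<otimes> w (Suc n)" for n using f(2)[OF w, of n] by (simp add: w_def)
    have wR: "w n \<in> carrier R" for n using w by simp
    obtain n c where c: "\<And>i. c i \<in> carrier R" "w n \<oplus> (\<Oplus>i\<in>{..<n}. c i \<otimes> w i) = \<zero>"
      using noetherian_sequence_relation[of w] wR by blast
    \<comment> \<open>A relation with \<open>n = 0\<close> would read \<open>a = \<zero>\<close>;
      \<open>integral_elem\<close> asks for a positive degree.\<close>
    have n0: "n > 0"
    proof (rule ccontr)
      assume "\<not> n > 0"
      then have "w 0 = \<zero>" using c(2) wR by simp
      then show False using a(2) by (simp add: w_def)
    qed
    interpret S: mult_subset R "carrier R - {\<zero>}"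
      by (rule mult_subset_compl[OF is_cring dom.zeroprimeideal])
    define K where "K = fraction_field R"
    define \<phi> where "\<phi> = to_fraction_field R"
    have K_eq: "K = localization R (carrier R - {\<zero>})" by (simp add: K_def fraction_field_def)
    have \<phi>_eq: "\<phi> = (\<lambda>r. loc_frac R (carrier R - {\<zero>}) r \<one>)" by (simp add: \<phi>_def to_fraction_field_def[abs_def])
    interpret K: cring K unfolding K_eq by (rule S.loc_cring)
    have hom: "\<phi> \<in> ring_hom R K" unfolding \<phi>_eq K_eq by (rule S.loc_frac_hom)
    interpret h: ring_hom_cring R K \<phi> by (intro ring_hom_cringI hom) unfold_locales
    have aS: "a \<in> carrier R - {\<zero>}" using aR a(2) by simp
    have ua: "\<phi> a \<in> Units K" unfolding \<phi>_eq K_eq by (rule S.loc_frac_unit[OF aS])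
    have cancelK: "x = y" if "\<phi> a \<otimes>\<^bsub>K\<^esub> x = \<phi> a \<otimes>\<^bsub>K\<^esub> y" "x \<in> carrier K" "y \<in> carrier K" for x y
      using that ua K.Units_l_cancel by blast
    have inj: "x = y" if "\<phi> x = \<phi> y" "x \<in> carrier R" "y \<in> carrier R" for x y
    proof -
      have "\<phi> (x \<ominus> y) = \<zero>\<^bsub>K\<^esub>" using that by (simp add: a_minus_def K.r_neg)
      then have "\<exists>s\<in>carrier R - {\<zero>}. s \<otimes> (x \<ominus> y) = \<zero>"
        unfolding \<phi>_eq K_eq by (intro S.loc_frac_eq_zero minus_closed that(2,3))
      then obtain s where "s \<in> carrier R - {\<zero>}" "s \<otimes> (x \<ominus> y) = \<zero>" by blast
      then have "x \<ominus> y = \<zero>" using dom.integral[of s "x \<ominus> y"] that(2,3) by auto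
      then show ?thesis using that(2,3) r_right_minus_eq by blast
    qed
    define \<kappa> where "\<kappa> = \<phi> b \<otimes>\<^bsub>K\<^esub> inv\<^bsub>K\<^esub> \<phi> a"
    have \<kappa>: "\<kappa> \<in> carrier K" using b(1) K.Units_inv_closed[OF ua] by (simp add: \<kappa>_def)
    have \<kappa>a: "\<phi> a \<otimes>\<^bsub>K\<^esub> \<kappa> = \<phi> b"
    proof -
      have "\<phi> a \<otimes>\<^bsub>K\<^esub> \<kappa> = \<phi> b \<otimes>\<^bsub>K\<^esub> (\<phi> a \<otimes>\<^bsub>K\<^esub> inv\<^bsub>K\<^esub> \<phi> a)"
        using aR b(1) K.Units_inv_closed[OF ua] by (simp add: \<kappa>_def K.m_lcomm)
      then show ?thesis using ua b(1) by simp
    qed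
    have \<phi>w: "\<phi> (w i) = \<phi> a \<otimes>\<^bsub>K\<^esub> \<kappa> [^]\<^bsub>K\<^esub> i" for i
    proof (induction i)
      case 0
      then show ?case using aR by (simp add: w_def)
    next
      case (Suc i)
      have "\<phi> a \<otimes>\<^bsub>K\<^esub> \<phi> (w (Suc i)) = \<phi> (b \<otimes> w i)" unfolding w_Suc using aR wR by simp
      also have "\<dots> = \<phi> b \<otimes>\<^bsub>K\<^esub> (\<phi> a \<otimes>\<^bsub>K\<^esub> \<kappa> [^]\<^bsub>K\<^esub> i)" using b(1) wR by (simp add: Suc)
      also have "\<dots> = \<phi> a \<otimes>\<^bsub>K\<^esub> (\<phi> a \<otimes>\<^bsub>K\<^esub> \<kappa> [^]\<^bsub>K\<^esub> Suc i)"
        unfolding \<kappa>a[symmetric] using aR \<kappa> by (simp add: K.m_ac)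
      finally show ?case by (rule cancelK) (use aR wR \<kappa> in simp_all)
    qed
    \<comment> \<open>The monic expression in \<open>\<kappa> = b / a\<close>, multiplied by
      \<open>a\<close>, is the image of the relation among the \<open>w i\<close>, that is, zero.
      Cancelling \<open>a\<close> in the fraction field leaves an integral equation, and normality
      puts \<open>b / a\<close> into \<open>R\<close>, against \<open>b \<notin> aR\<close>.\<close>
    have "\<phi> a \<otimes>\<^bsub>K\<^esub> (\<kappa> [^]\<^bsub>K\<^esub> n \<oplus>\<^bsub>K\<^esub> (\<Oplus>\<^bsub>K\<^esub>i\<in>{..<n}. \<phi> (c i) \<otimes>\<^bsub>K\<^esub> \<kappa> [^]\<^bsub>K\<^esub> i)) =
        \<phi> (w n) \<oplus>\<^bsub>K\<^esub> (\<Oplus>\<^bsub>K\<^esub>i\<in>{..<n}. \<phi> (c i \<otimes> w i))"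
    proof -
      have "\<phi> a \<otimes>\<^bsub>K\<^esub> (\<Oplus>\<^bsub>K\<^esub>i\<in>{..<n}. \<phi> (c i) \<otimes>\<^bsub>K\<^esub> \<kappa> [^]\<^bsub>K\<^esub> i) =
          (\<Oplus>\<^bsub>K\<^esub>i\<in>{..<n}. \<phi> a \<otimes>\<^bsub>K\<^esub> (\<phi> (c i) \<otimes>\<^bsub>K\<^esub> \<kappa> [^]\<^bsub>K\<^esub> i))"
        using aR c(1) \<kappa> by (intro K.finsum_rdistr) auto
      also have "\<dots> = (\<Oplus>\<^bsub>K\<^esub>i\<in>{..<n}. \<phi> (c i \<otimes> w i))"
        using aR c(1) \<kappa> wR by (intro K.finsum_cong') (auto simp: \<phi>w K.m_lcomm)
      finally show ?thesis using aR c(1) \<kappa> by (simp add: K.r_distr \<phi>w K.finsum_closed Pi_def)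
    qed
    also have "\<dots> = \<phi> (w n \<oplus> (\<Oplus>i\<in>{..<n}. c i \<otimes> w i))"
      using c(1) wR by (simp add: h.hom_finsum Pi_def comp_def)
    also have "\<dots> = \<zero>\<^bsub>K\<^esub>" by (simp add: c(2))
    also have "\<dots> = \<phi> a \<otimes>\<^bsub>K\<^esub> \<zero>\<^bsub>K\<^esub>" using aR by simp
    finally have "\<kappa> [^]\<^bsub>K\<^esub> n \<oplus>\<^bsub>K\<^esub> (\<Oplus>\<^bsub>K\<^esub>i\<in>{..<n}. \<phi> (c i) \<otimes>\<^bsub>K\<^esub> \<kappa> [^]\<^bsub>K\<^esub> i) = \<zero>\<^bsub>K\<^esub>"
      by (rule cancelK) (use c(1) \<kappa> in \<open>auto intro!: K.finsum_closed K.add.m_closed\<close>)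
    then have "integral_elem R K \<phi> \<kappa>" unfolding integral_elem_def using n0 c(1) by blast
    then obtain t where t: "t \<in> carrier R" "\<kappa> = \<phi> t"
      using norm \<kappa> unfolding normal_domain_def K_def \<phi>_def by blast
    have "\<phi> (t \<otimes> a) = \<phi> b" using \<kappa>a t aR by (simp add: K.m_comm)
    then have "t \<otimes> a = b" by (rule inj) (use t aR b(1) in auto)
    then have "b \<in> PIdl a" using t(1) unfolding cgenideal_def by blast
    then show ?thesis using b(2) by blast
  qed
qed

end

section \<open>Finiteness of the associated primes\<close>

lemma domain_reduced: "domain R \<Longrightarrow> reduced_ring R"
proof -
  assume "domain R"
  then interpret domain R .
  have "x = \<zero>\<^bsub>R\<^esub>" if "x \<in> carrier R" "x [^]\<^bsub>R\<^esub> (n::nat) = \<zero>\<^bsub>R\<^esub>" for x n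
    using that(2)
  proof (induction n)
    case (Suc n)
    then show ?case using integral[of "x [^]\<^bsub>R\<^esub> n" x] that(1) by auto
  qed simp
  then show ?thesis unfolding reduced_ring_def by blast
qed

context noetherian_cring
begin

interpretation M: module R "ring_as_module R" by (rule ring_as_module_is_module)

lemma genideal_pair:
  assumes x: "x \<in> carrier R" "y \<in> carrier R" and z: "z \<in> Idl {x, y}"
  shows "\<exists>r\<in>carrier R. \<exists>s\<in>carrier R. z = x \<otimes> r \<oplus> y \<otimes> s"
proof -
  let ?I = "adjoin R (ring_as_module R) x (PIdl y)"
  have sub: "submodule (PIdl y) R (ring_as_module R)" by (simp add: submodule_iff_ideal cgenideal_ideal x)
  have I: "ideal ?I R" using M.adjoin_submodule[OF sub] x by (simp add: submodule_iff_ideal)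
  have "insert x (PIdl y) \<subseteq> ?I" using M.adjoin_superset[OF sub] x by simp
  then have "{x, y} \<subseteq> ?I" using cgenideal_self[OF x(2)] by blast
  then have "z \<in> ?I" using genideal_minimal[OF I] z by blast
  then show ?thesis using x by (auto simp: adjoin_def cgenideal_def m_comm)
qed

text \<open>At most one generator is handled with the given prime \<open>q\<close> strictly below
  \<open>p\<close>. Two generators force \<open>n = 2\<close>, and then the chain itself provides
  the two smaller primes.\<close>

lemma locally_regularI:
  assumes p: "primeideal p R" and q: "primeideal q R" "q \<subset> p"
    and S: "finite S" "S \<subseteq> p" "card S \<le> n" "n \<le> 2" and chain: "prime_chain R n P p"
    and gen: "\<forall>z\<in>p. \<exists>u\<in>carrier R - p. u \<otimes> z \<in> Idl S"
  shows "locally_principal_regular R p \<or> locally_regular_pair R p"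
proof -
  interpret p: primeideal p R by fact
  have gen': "\<exists>u\<in>carrier R - p. \<exists>r\<in>carrier R. \<exists>s\<in>carrier R. u \<otimes> z = x \<otimes> r \<oplus> y \<otimes> s"
    if Sxy: "S \<subseteq> {x, y}" and xp: "x \<in> p" "y \<in> p" and zp: "z \<in> p" for x y z
  proof -
    have xy: "x \<in> carrier R" "y \<in> carrier R" using xp by auto
    obtain u where u: "u \<in> carrier R - p" "u \<otimes> z \<in> Idl S" using gen zp by blast
    have "Idl S \<subseteq> Idl {x, y}" by (rule subset_Idl_subset) (use xy Sxy in auto)
    then show ?thesis using genideal_pair[OF xy, of "u \<otimes> z"] u by blast
  qed
  show ?thesis
  proof (cases "card S \<le> 1")
    case True
    \<comment> \<open>An empty \<open>S\<close> is treated as the single generator zero.\<close>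
    have "\<exists>x\<in>p. S \<subseteq> {x}"
    proof (cases "S = {}")
      case True
      then show ?thesis using p.zero_closed by blast
    next
      case False
      then have "card S = 1" using \<open>card S \<le> 1\<close> S(1) by (simp add: le_Suc_eq)
      then show ?thesis using S(2) by (auto simp: card_1_singleton_iff)
    qed
    then obtain x where x: "x \<in> p" "S \<subseteq> {x}" by blast
    have "\<exists>u\<in>carrier R - p. \<exists>r\<in>carrier R. u \<otimes> z = x \<otimes> r" if z: "z \<in> p" for z
    proof -
      obtain u r s where u: "u \<in> carrier R - p" "r \<in> carrier R" "s \<in> carrier R" "u \<otimes> z = x \<otimes> r \<oplus> x \<otimes> s"
        using gen'[of x x z] x z by auto
      then have "u \<otimes> z = x \<otimes> (r \<oplus> s)" using x(1) by (simp add: r_distr)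
      then show ?thesis using u(1-3) by blast
    qed
    then show ?thesis using locally_principal_regularI[OF p q x(1)] by blast
  next
    case False
    then have n: "card S = 2" "n = 2" using S(3,4) by auto
    then obtain x y where xy: "S = {x, y}" by (auto simp: card_2_iff)
    \<comment> \<open>The first two members of the chain serve as \<open>q0 \<subset> q\<close>. The
      second is strictly inside \<open>p\<close> because the third lies between them.\<close>
    have P: "primeideal (P 0) R" "primeideal (P 1) R" "P 0 \<subset> P 1" "P 1 \<subset> P 2" "P 2 \<subseteq> p"
      using chain n(2) by (auto simp: prime_chain_def numeral_2_eq_2)
    have "locally_regular_pair R p"
      by (rule locally_regular_pairI[OF p P(1,2,3), of x y]) (use P(4,5) xy S(2) gen'[of x y] in auto)
    then show ?thesis by blast
  qed
qed

lemma prime_chain_krull_dim: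
  assumes "prime_chain R n P q"
  shows "enat n \<le> krull_dim R"
  unfolding krull_dim_def using assms
  by (intro Sup_upper) (auto simp: prime_chain_def Spec_def intro!: exI[of _ P])

lemma prime_chain_extend:
  assumes "prime_chain R n P p" "primeideal q R" "p \<subset> q"
  shows "prime_chain R (Suc n) (P(Suc n := q)) q"
  using assms unfolding prime_chain_def by (auto simp: le_Suc_eq less_Suc_eq)

text \<open>An ideal maximal among the proper ones above \<open>p\<close> exists by the ascending
  chain condition and must be the unique maximal ideal.\<close>

lemma local_prime_subset:
  assumes loc: "local_ring R" and p: "primeideal p R"
  shows "p \<subseteq> max_ideal R" "primeideal (max_ideal R) R"
proof -
  have ex1: "\<exists>!m. maximalideal m R" using loc by (simp add: local_ring_def)
  have m: "maximalideal (max_ideal R) R" unfolding max_ideal_def by (rule theI'[OF ex1])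
  then show "primeideal (max_ideal R) R" by (rule maximalideal_prime)
  have unit_free: "\<one> \<notin> p" using primeideal_compl_one[OF p] by blast
  let ?F = "{J. ideal J R \<and> p \<subseteq> J \<and> \<one> \<notin> J}"
  have "p \<in> ?F" using primeideal.axioms(1)[OF p] unit_free by simp
  then have ne: "?F \<noteq> {}" by blast
  have "\<exists>N\<in>?F. \<forall>L\<in>?F. N \<subseteq> L \<longrightarrow> L = N"
    by (rule M.noetherian_maximal[OF noetherian_ring_as_module ne]) (simp add: submodule_iff_ideal)
  then obtain N where N: "N \<in> ?F" "\<forall>L\<in>?F. N \<subseteq> L \<longrightarrow> L = N" by (rule bexE)
  have "maximalideal N R"
  proof (rule maximalidealI)
    show "ideal N R" "carrier R \<noteq> N" using N(1) by auto
    fix J assume J: "ideal J R" "N \<subseteq> J" "J \<subseteq> carrier R"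
    show "J = N \<or> J = carrier R"
    proof (cases "\<one> \<in> J")
      case True
      then show ?thesis using ideal.one_imp_carrier[OF J(1)] by blast
    next
      case False
      then have "J \<in> ?F" using J N(1) by blast
      then show ?thesis using N(2) J(2) by blast
    qed
  qed
  then have "N = max_ideal R" using ex1 m by blast
  then show "p \<subseteq> max_ideal R" using N(1) by blast
qed

section \<open>The finite exceptional set and its two cases\<close>

definition minimal_primes :: "'a set \<Rightarrow> 'a set set"
  where "minimal_primes I = {p. primeideal p R \<and> I \<subseteq> p \<and> (\<forall>q. primeideal q R \<and> I \<subseteq> q \<and> q \<subseteq> p \<longrightarrow> q = p)}"

lemma minimal_primes_zero:
  "p \<in> minimal_primes {\<zero>} \<longleftrightarrow> primeideal p R \<and> (\<forall>q. primeideal q R \<and> q \<subseteq> p \<longrightarrow> q = p)"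
proof -
  have "{\<zero>} \<subseteq> q" if "primeideal q R" for q
    using additive_subgroup.zero_closed[OF ideal.axioms(1)[OF primeideal.axioms(1)[OF that]]] by simp
  then show ?thesis unfolding minimal_primes_def by blast
qed

lemma finite_associated_primes_Ext:
  fixes M :: "('a, 'c, 'n) module_scheme"
  assumes M: "module R M" "finitely_generated_module R M" and red: "reduced_ring R"
    and Exc: "finite Exc" and reg: "\<And>p. primeideal p R \<Longrightarrow> p \<notin> Exc \<Longrightarrow> locally_principal_regular R p \<or> locally_regular_pair R p"
  shows "finite (\<Union>i. associated_primes R (Ext i R M (ring_as_module R)))"
proof -
  let ?A = "\<lambda>i. associated_primes R (Ext i R M (ring_as_module R))"
  have "(\<Union>i. ?A i) \<subseteq> minimal_primes {\<zero>} \<union> ?A (Suc 0) \<union> ?A (Suc (Suc 0)) \<union> Exc"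
  proof
    fix p assume "p \<in> (\<Union>i. ?A i)"
    then obtain i where i: "p \<in> ?A i" by blast
    then have p: "primeideal p R" by (simp add: associated_primes_def Spec_def)
    consider "i = 0" | "i = Suc 0" | "i = Suc (Suc 0)" | "i \<ge> 3" by linarith
    then show "p \<in> minimal_primes {\<zero>} \<union> ?A (Suc 0) \<union> ?A (Suc (Suc 0)) \<union> Exc"
    proof cases
      case 1
      then have "p \<in> minimal_primes {\<zero>}"
        unfolding minimal_primes_zero using associated_primes_Ext_0[OF red M(1)] i p by blast
      then show ?thesis by blast
    next
      case 4
      then show ?thesis using associated_prime_Ext_not_regular[OF M 4 i] reg[OF p] by blast
    qed (use i in auto)
  qed
  moreover have "finite (minimal_primes {\<zero>})"
    unfolding minimal_primes_def by (rule finite_minimal_primes[OF zeroideal])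
  ultimately show ?thesis
    using finite_associated_primes_Ext_Suc[OF M] Exc by (meson finite_Un finite_subset)
qed

text \<open>Away from the maximal ideal, the minimal primes of \<open>R\<close> and the minimal primes over the ideal
  of the singular locus, a singular prime \<open>p\<close> strictly contains another singular prime \<open>q\<close>.\<close>

lemma locally_regular_outside_finite:
  assumes loc: "local_ring R" and J2: "J2_ring R" and dim: "krull_dim R = enat d" "d \<le> 3"
    and codim: "\<And>p q. primeideal p R \<Longrightarrow> primeideal q R \<Longrightarrow> q \<subset> p \<Longrightarrow> p \<subset> max_ideal R \<Longrightarrow>
      \<exists>S P. S \<subseteq> q \<and> finite S \<and> card S \<le> 1 \<and> (\<forall>z\<in>q. \<exists>u\<in>carrier R - q. u \<otimes> z \<in> Idl S) \<and>
        prime_chain R (card S) P q \<and> (\<forall>P. \<not> prime_chain R (Suc (card S)) P q)"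
  shows "\<exists>Exc. finite Exc \<and> (\<forall>p. primeideal p R \<longrightarrow> p \<notin> Exc \<longrightarrow> locally_principal_regular R p \<or> locally_regular_pair R p)"
proof -
  obtain I where I: "ideal I R"
    and smooth: "\<forall>p. primeideal p R \<longrightarrow> \<not> I \<subseteq> p \<longrightarrow>
      (\<exists>n S P. finite S \<and> S \<subseteq> p \<and> card S \<le> n \<and> prime_chain R n P p \<and>
        (\<forall>z\<in>p. \<exists>u\<in>carrier R - p. u \<otimes> z \<in> Idl S))"
    and sing: "\<forall>p S P. primeideal p R \<longrightarrow> I \<subseteq> p \<longrightarrow> S \<subseteq> p \<longrightarrow> finite S \<longrightarrow> card S \<le> 1 \<longrightarrow>
      (\<forall>z\<in>p. \<exists>u\<in>carrier R - p. u \<otimes> z \<in> Idl S) \<longrightarrow> prime_chain R (card S) P p \<longrightarrow>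
      (\<exists>P. prime_chain R (Suc (card S)) P p)"
    using regular_locus_open[OF J2] by (elim exE conjE)
  let ?X = "{max_ideal R} \<union> minimal_primes {\<zero>} \<union> minimal_primes I"
  have "finite ?X"
    unfolding minimal_primes_def using finite_minimal_primes[OF zeroideal] finite_minimal_primes[OF I] by simp
  moreover have "locally_principal_regular R p \<or> locally_regular_pair R p"
    if p: "primeideal p R" "p \<notin> ?X" for p
  proof -
    have pm: "p \<subset> max_ideal R" using local_prime_subset[OF loc p(1)] p(2) by blast
    have "p \<notin> minimal_primes {\<zero>}" using p(2) by blast
    then obtain q where q: "primeideal q R" "q \<subset> p" using p(1) unfolding minimal_primes_zero by blast
    have "\<not> I \<subseteq> p"
    proof
      assume Ip: "I \<subseteq> p"
      have "p \<notin> minimal_primes I" using p(2) by blast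
      then obtain q where q: "primeideal q R" "I \<subseteq> q" "q \<subset> p"
        using p(1) Ip unfolding minimal_primes_def by blast
      obtain S P where S: "S \<subseteq> q" "finite S" "card S \<le> 1" "\<forall>z\<in>q. \<exists>u\<in>carrier R - q. u \<otimes> z \<in> Idl S"
        "prime_chain R (card S) P q" and max: "\<forall>P. \<not> prime_chain R (Suc (card S)) P q"
        using codim[OF p(1) q(1,3) pm] by (elim exE conjE)
      have "\<exists>P. prime_chain R (Suc (card S)) P q"
        by (rule sing[rule_format, OF q(1,2) S(1,2,3) _ S(5)]) (use S(4) in blast)
      then show False using max by blast
    qed
    then have "\<exists>n S P. finite S \<and> S \<subseteq> p \<and> card S \<le> n \<and> prime_chain R n P p \<and>
        (\<forall>z\<in>p. \<exists>u\<in>carrier R - p. u \<otimes> z \<in> Idl S)" by (rule smooth[rule_format, OF p(1)])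
    then obtain n S P where S: "finite S" "S \<subseteq> p" "card S \<le> n" and ch: "prime_chain R n P p"
      and gen: "\<forall>z\<in>p. \<exists>u\<in>carrier R - p. u \<otimes> z \<in> Idl S"
      by (elim exE conjE)
    \<comment> \<open>The chain below \<open>p\<close> can be extended by the maximal ideal, as
      \<open>p\<close> is strictly smaller. So \<open>n + 1 \<le> d \<le> 3\<close>, which leaves at
      most two local generators.\<close>
    have "enat (Suc n) \<le> enat d"
      using prime_chain_krull_dim[OF prime_chain_extend[OF ch local_prime_subset(2)[OF loc p(1)] pm]] dim(1) by simp
    then have "n \<le> 2" using dim(2) by simp
    then show ?thesis by (rule locally_regularI[OF p(1) q S _ ch gen])
  qed
  ultimately show ?thesis by (intro exI[of _ ?X]) blast
qed

lemma prime_chain_0: "primeideal q R \<Longrightarrow> prime_chain R 0 (\<lambda>_. q) q"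
  by (simp add: prime_chain_def)

lemma prime_chain_SucE:
  assumes "prime_chain R (Suc n) P q"
  shows "\<exists>q'. primeideal q' R \<and> q' \<subset> q \<and> prime_chain R n P q'"
  using assms unfolding prime_chain_def by (intro exI[of _ "P n"]) auto

text \<open>The localization of a reduced ring at a minimal prime is a field, so the empty set
  generates the prime locally and the constant chain of length 0 cannot be prolonged.\<close>

lemma regular_in_codim_0:
  assumes red: "reduced_ring R" and q: "primeideal q R" and min: "\<And>q'. primeideal q' R \<Longrightarrow> q' \<subseteq> q \<Longrightarrow> q' = q"
  shows "\<exists>S P. S \<subseteq> q \<and> finite S \<and> card S \<le> 1 \<and> (\<forall>z\<in>q. \<exists>u\<in>carrier R - q. u \<otimes> z \<in> Idl S) \<and>
        prime_chain R (card S) P q \<and> (\<forall>P. \<not> prime_chain R (Suc (card S)) P q)"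
proof -
  have "\<zero> \<in> Idl {}" using additive_subgroup.zero_closed[OF ideal.axioms(1)[OF genideal_ideal[of "{}"]]] by simp
  then have "\<forall>z\<in>q. \<exists>u\<in>carrier R - q. u \<otimes> z \<in> Idl {}"
    using reduced_minimal_prime[OF red q min] by metis
  moreover have "\<not> prime_chain R (Suc 0) P q" for P
    using prime_chain_SucE[of 0 P q] min by blast
  ultimately show ?thesis using prime_chain_0[OF q] by (intro exI[of _ "{}"] exI[of _ "\<lambda>_. q"]) simp
qed

text \<open>A prime below \<open>q\<close> would begin a chain
  \<open>q' \<subset> q \<subset> p \<subset> max_ideal R\<close> of length 3 in dimension 2. So
  \<open>q\<close> is minimal.\<close>

lemma reduced_dim_2_codim:
  assumes red: "reduced_ring R" and loc: "local_ring R" and dim: "krull_dim R = enat 2"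
    and p: "primeideal p R" and q: "primeideal q R" and qp: "q \<subset> p" and pm: "p \<subset> max_ideal R"
  shows "\<exists>S P. S \<subseteq> q \<and> finite S \<and> card S \<le> 1 \<and> (\<forall>z\<in>q. \<exists>u\<in>carrier R - q. u \<otimes> z \<in> Idl S) \<and>
        prime_chain R (card S) P q \<and> (\<forall>P. \<not> prime_chain R (Suc (card S)) P q)"
proof (rule regular_in_codim_0[OF red q])
  fix q' assume q': "primeideal q' R" "q' \<subseteq> q"
  show "q' = q"
  proof (rule ccontr)
    assume "q' \<noteq> q"
    then have s: "q' \<subset> q" using q'(2) by blast
    show False
      using prime_chain_krull_dim[OF prime_chain_extend[OF prime_chain_extend[OF prime_chain_extend[OF
            prime_chain_0[OF q'(1)] q s] p qp] local_prime_subset(2)[OF loc p] pm]] dim by simp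
  qed
qed

text \<open>Two further primes \<open>p\<close> and \<open>max_ideal R\<close> above
  \<open>q\<close> leave height at most one for \<open>q\<close> in dimension 3. Height zero is the
  zero ideal of a domain; in height one normality supplies a single local generator.\<close>

lemma normal_dim_3_codim:
  assumes norm: "normal_domain R" and loc: "local_ring R" and dim: "krull_dim R = enat 3"
    and p: "primeideal p R" and q: "primeideal q R" and qp: "q \<subset> p" and pm: "p \<subset> max_ideal R"
  shows "\<exists>S P. S \<subseteq> q \<and> finite S \<and> card S \<le> 1 \<and> (\<forall>z\<in>q. \<exists>u\<in>carrier R - q. u \<otimes> z \<in> Idl S) \<and>
        prime_chain R (card S) P q \<and> (\<forall>P. \<not> prime_chain R (Suc (card S)) P q)"
proof -
  interpret dom: domain R using norm by (simp add: normal_domain_def)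
  have zero_le: "{\<zero>} \<subseteq> q'" if "primeideal q' R" for q'
    using additive_subgroup.zero_closed[OF ideal.axioms(1)[OF primeideal.axioms(1)[OF that]]] by simp
  have no_chain: "\<not> prime_chain R 2 P q" for P
  proof
    assume "prime_chain R 2 P q"
    then show False
      using prime_chain_krull_dim[OF prime_chain_extend[OF prime_chain_extend[OF _ p qp]
            local_prime_subset(2)[OF loc p] pm]] dim by fastforce
  qed
  show ?thesis
  proof (cases "q = {\<zero>}")
    case True
    have red: "reduced_ring R" by (rule domain_reduced) unfold_locales
    show ?thesis
      by (rule regular_in_codim_0[OF red q]) (use zero_le True in blast)
  next
    case False
    have chain: "prime_chain R 1 (\<lambda>i. if i = 0 then {\<zero>} else q) q"
      using zero_le[OF q] False q dom.zeroprimeideal by (auto simp: prime_chain_def)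
    have "q' = q" if q': "primeideal q' R" "q' \<subseteq> q" "q' \<noteq> {\<zero>}" for q'
    proof (rule ccontr)
      assume "q' \<noteq> q"
      then have "q' \<subset> q" "{\<zero>} \<subset> q'" using q' zero_le[OF q'(1)] by auto
      then have "prime_chain R (Suc (Suc 0)) ((\<lambda>_. {\<zero>})(Suc 0 := q', Suc (Suc 0) := q)) q"
        by (intro prime_chain_extend[OF prime_chain_extend[OF prime_chain_0[OF dom.zeroprimeideal] q'(1)] q])
      then show False using no_chain by (simp add: numeral_2_eq_2)
    qed
    then obtain x u where x: "x \<in> q" "u \<in> carrier R - q" "\<forall>y\<in>q. \<exists>r\<in>carrier R. u \<otimes> y = x \<otimes> r"
      using normal_height_one_principal[OF norm q False] by blast
    have xR: "x \<in> carrier R" using x(1) ideal.Icarr[OF primeideal.axioms(1)[OF q]] by blast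
    have "u \<otimes> z \<in> Idl {x}" if z: "z \<in> q" for z
    proof -
      obtain r where "r \<in> carrier R" "u \<otimes> z = x \<otimes> r" using x(3) z by blast
      then show ?thesis
        using ideal.I_r_closed[OF genideal_ideal genideal_self'[OF xR]] xR by simp
    qed
    then show ?thesis
      using x(1,2) chain no_chain by (intro exI[of _ "{x}"] exI[of _ "\<lambda>i. if i = 0 then {\<zero>} else q"])
        (auto simp: numeral_2_eq_2)
  qed
qed

end

theorem proposition5p10:
  fixes R :: "('a, 'm) ring_scheme" and M :: "('a, 'b, 'n) module_scheme"
  assumes "cring R" and "noetherian_ring R" and "local_ring R"
    and "(krull_dim R = 3 \<and> excellent_ring R \<and> normal_domain R) \<or>
         (krull_dim R = 2 \<and> reduced_ring R \<and> excellent_ring R)"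
    and "module R M" and "finitely_generated_module R M"
  shows "finite (\<Union>i. associated_primes R (Ext i R M (ring_as_module R)))"
proof -
  interpret noetherian_cring R using assms(1,2) by (rule noetherian_cring.intro)
  have J2: "J2_ring R" using assms(4) by (auto simp: excellent_ring_def)
  have red: "reduced_ring R" using assms(4) domain_reduced by (auto simp: normal_domain_def)
  have "\<exists>Exc. finite Exc \<and> (\<forall>p. primeideal p R \<longrightarrow> p \<notin> Exc \<longrightarrow> locally_principal_regular R p \<or> locally_regular_pair R p)"
    using assms(4)
  proof
    assume *: "krull_dim R = 3 \<and> excellent_ring R \<and> normal_domain R"
    then have dim: "krull_dim R = enat 3" by (simp add: numeral_eq_enat)
    show ?thesis
      by (rule locally_regular_outside_finite[OF assms(3) J2 dim order_refl])
        (rule normal_dim_3_codim[OF _ assms(3) dim], use * in auto)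
  next
    assume *: "krull_dim R = 2 \<and> reduced_ring R \<and> excellent_ring R"
    then have dim: "krull_dim R = enat 2" by (simp add: numeral_eq_enat)
    show ?thesis
      by (rule locally_regular_outside_finite[OF assms(3) J2 dim])
        (simp, rule reduced_dim_2_codim[OF red assms(3) dim])
  qed
  then show ?thesis using finite_associated_primes_Ext[OF assms(5,6) red] by blast
qed

end
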